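(* Let $G$ be a finite group acting linearly on a complex vector space $V$ with basis $v_1,\ldots,v_n$, let $\mathbf{q}=(q_{ij})$ be nonzero complex scalars with $q_{ii}=1$ and $q_{ji}=q_{ij}^{-1}$ for all $i,j$, and assume that the action of $G$ on $V$ induces an action on $S_{\mathbf{q}}(V)$ by algebra automorphisms. Then the quantum Drinfeld Hecke algebras over $\mathbb{C}[t]$ are precisely the deformations of $S_{\mathbf{q}}(V)\rtimes G$ over $\mathbb{C}[t]$ for which $\deg \mu_i=-2i$ for all $i\geq 1$. That is, up to isomorphism of $\mathbb{C}[t]$-algebras: every quantum Drinfeld Hecke algebra $\mathcal{H}_{\mathbf{q},\kappa,t}$ over $\mathbb{C}[t]$ is a deformation of $S_{\mathbf{q}}(V)\rtimes G$ over $\mathbb{C}[t]$ with $\deg\mu_i=-2i$ for all $i\ge 1$; and conversely every deformation of $S_{\mathbf{q}}(V)\rtimes G$ over $\mathbb{C}[t]$ with $\deg\mu_i=-2i$ for all $i\geq 1$ is a quantum Drinfeld Hecke algebra $\mathcal{H}_{\mathbf{q},\kappa,t}$ over $\mathbb{C}[t]$ for some $\kappa$.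
   Context: All tensor products are over $\mathbb{C}$. $S_{\mathbf{q}}(V)=\mathbb{C}\langle v_1,\ldots,v_n\mid v_iv_j=q_{ij}v_jv_i \text{ for all } i,j\rangle$ is the quantum symmetric algebra, and $T(V)$ is the tensor algebra. For an algebra $A$ with an action of $G$ by automorphisms $a\mapsto {}^g a$, the skew group algebra $A\rtimes G$ is the free left $A$-module with basis $G$ and multiplication $(ag)(bh)=a({}^g b)\,gh$. The algebra $S_{\mathbf{q}}(V)\rtimes G$ is graded with $\deg v_i=1$ and $\deg g=0$ for $g\in G$. A deformation of a $\mathbb{C}$-algebra $R$ over $\mathbb{C}[t]$ is an associative $\mathbb{C}[t]$-algebra whose underlying vector space is $R[t]=\mathbb{C}[t]\otimes R$ and whose multiplication is $r*s=rs+\mu_1(r\otimes s)t+\mu_2(r\otimes s)t^2+\cdots$ for $r,s\in R$, where $rs$ is the product in $R$, the $\mu_i:R\otimes R\to R$ are $\mathbb{C}$-linear maps extended to be linear over $\mathbb{C}[t]$, and for each $r,s$ the sum is finite. For $R=S_{\mathbf{q}}(V)\rtimes G$, $\deg\mu_i=-2i$ means that $\mu_i$ is homogeneous of degree $-2i$ as a map from the graded space $R\otimes R$ to $R$ (the zero map being allowed). Let $\kappa:V\times V\to\mathbb{C}G$ be a bilinear map with $\kappa(v_i,v_j)=-q_{ij}\kappa(v_j,v_i)$ for all $i,j$, and write $\kappa(v,w)=\sum_{g\in G}\kappa_g(v,w)g$ with $\kappa_g(v,w)\in\mathbb{C}$. Put $$\mathcal{H}_{\mathbf{q},\kappa,t}=(T(V)\rtimes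 G)[t]\Big/\Big(v_iv_j-q_{ij}v_jv_i-\sum_{g\in G}\kappa_g(v_i,v_j)\,t\,g \;\Big|\; 1\le i,j\le n\Big),$$ a filtered algebra with each $v_i$ in degree $1$ and $t$ and each $g\in G$ in degree $0$. It is called a quantum Drinfeld Hecke algebra over $\mathbb{C}[t]$ if its associated graded algebra is isomorphic (as a graded $\mathbb{C}[t]$-algebra) to $(S_{\mathbf{q}}(V)\rtimes G)[t]$. *)

theory Defs
  imports "HOL-Algebra.Algebra" "HOL-Algebra.Algebraic_Closure_Type"
begin

section \<open>Associative algebras\<close>

text \<open>
  Algebras are carried by the \<^type>\<open>module\<close> record of HOL-Algebra, which has both a
  multiplication and a scalar multiplication. The library locale \<^locale>\<open>algebra\<close> demands a
  commutative algebra, so the non-commutative notion is introduced here.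
\<close>

definition assoc_algebra :: "('k, 'm) ring_scheme \<Rightarrow> ('k, 'a) module \<Rightarrow> bool" where
  "assoc_algebra K A \<longleftrightarrow> module K A \<and> ring A \<and>
     (\<forall>c\<in>carrier K. \<forall>x\<in>carrier A. \<forall>y\<in>carrier A.
        (c \<odot>\<^bsub>A\<^esub> x) \<otimes>\<^bsub>A\<^esub> y = c \<odot>\<^bsub>A\<^esub> (x \<otimes>\<^bsub>A\<^esub> y) \<and>
        x \<otimes>\<^bsub>A\<^esub> (c \<odot>\<^bsub>A\<^esub> y) = c \<odot>\<^bsub>A\<^esub> (x \<otimes>\<^bsub>A\<^esub> y))"

definition algebra_iso :: "('k, 'm) ring_scheme \<Rightarrow> ('k, 'a) module \<Rightarrow> ('k, 'b) module \<Rightarrow> ('a \<Rightarrow> 'b) set" where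
  "algebra_iso K A B = {\<phi> \<in> ring_iso A B.
     \<forall>c\<in>carrier K. \<forall>x\<in>carrier A. \<phi> (c \<odot>\<^bsub>A\<^esub> x) = c \<odot>\<^bsub>B\<^esub> \<phi> x}"

definition algebra_isomorphic :: "('k, 'm) ring_scheme \<Rightarrow> ('k, 'a) module \<Rightarrow> ('k, 'b) module \<Rightarrow> bool" where
  "algebra_isomorphic K A B \<longleftrightarrow> algebra_iso K A B \<noteq> {}"

definition graded_algebra_isomorphic ::
    "('k, 'm) ring_scheme \<Rightarrow> ('k, 'a) module \<Rightarrow> (int \<Rightarrow> 'a set) \<Rightarrow> ('k, 'b) module \<Rightarrow> (int \<Rightarrow> 'b set) \<Rightarrow> bool" where
  "graded_algebra_isomorphic K A U B W \<longleftrightarrow>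
     (\<exists>\<phi>\<in>algebra_iso K A B. \<forall>d. \<phi> ` U d = W d)"

text \<open>The quotient of an algebra by a two-sided ideal: \<^const>\<open>FactRing\<close> with its scalar multiplication.\<close>

definition quotient_algebra :: "('k, 'a) module \<Rightarrow> 'a set \<Rightarrow> ('k, 'a set) module" where
  "quotient_algebra A I = \<lparr>carrier = carrier (A Quot I), monoid.mult = monoid.mult (A Quot I), monoid.one = monoid.one (A Quot I),
     ring.zero = ring.zero (A Quot I), ring.add = ring.add (A Quot I),
     module.smult = (\<lambda>c U. \<Union>x\<in>U. I +>\<^bsub>A\<^esub> (c \<odot>\<^bsub>A\<^esub> x))\<rparr>"

abbreviation Cring :: "complex ring" where
  "Cring \<equiv> ring_of_type_algebra"

abbreviation Ct :: "(complex, nat \<Rightarrow> complex) up_ring" where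
  "Ct \<equiv> UP Cring"

text \<open>\<open>A[t]\<close> as an algebra over \<open>K[t]\<close>, for an algebra \<open>A\<close> over \<open>K\<close>. The field \<^const>\<open>smult\<close> of
  \<^term>\<open>UP A\<close> only multiplies by elements of \<open>A\<close>, hence is replaced.\<close>

definition poly_algebra :: "('k, 'a) module \<Rightarrow> (nat \<Rightarrow> 'k, nat \<Rightarrow> 'a) module" where
  "poly_algebra A = \<lparr>carrier = carrier (UP A), monoid.mult = monoid.mult (UP A), monoid.one = monoid.one (UP A),
     ring.zero = ring.zero (UP A), ring.add = ring.add (UP A),
     module.smult = (\<lambda>p f k. \<Oplus>\<^bsub>A\<^esub>i\<in>{..k}. p i \<odot>\<^bsub>A\<^esub> f (k - i))\<rparr>"

definition poly_part :: "('k, 'a) module \<Rightarrow> 'a set \<Rightarrow> (nat \<Rightarrow> 'a) set" where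
  "poly_part A U = {f \<in> carrier (poly_algebra A). \<forall>k. f k \<in> U}"


section \<open>Skew group algebras\<close>

text \<open>The family \<open>f\<close> stands for the sum of the \<open>f g \<cdot> g\<close>, over \<open>g\<close> in the finite group \<open>G\<close>.\<close>

definition skew_group_algebra ::
    "('k, 'a) module \<Rightarrow> ('g, 'm) monoid_scheme \<Rightarrow> ('g \<Rightarrow> 'a \<Rightarrow> 'a) \<Rightarrow> ('k, 'g \<Rightarrow> 'a) module" where
  "skew_group_algebra A G act = \<lparr>carrier = carrier G \<rightarrow>\<^sub>E carrier A,
     monoid.mult = (\<lambda>f h. \<lambda>k\<in>carrier G. \<Oplus>\<^bsub>A\<^esub>g\<in>carrier G. f g \<otimes>\<^bsub>A\<^esub> act g (h (inv\<^bsub>G\<^esub> g \<otimes>\<^bsub>G\<^esub> k))),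
     monoid.one = (\<lambda>k\<in>carrier G. if k = \<one>\<^bsub>G\<^esub> then \<one>\<^bsub>A\<^esub> else \<zero>\<^bsub>A\<^esub>),
     ring.zero = (\<lambda>k\<in>carrier G. \<zero>\<^bsub>A\<^esub>),
     ring.add = (\<lambda>f h. \<lambda>k\<in>carrier G. f k \<oplus>\<^bsub>A\<^esub> h k),
     module.smult = (\<lambda>c f. \<lambda>k\<in>carrier G. c \<odot>\<^bsub>A\<^esub> f k)\<rparr>"

definition skew_part :: "('g, 'm) monoid_scheme \<Rightarrow> 'a set \<Rightarrow> ('g \<Rightarrow> 'a) set" where
  "skew_part G U = carrier G \<rightarrow>\<^sub>E U"

definition skew_of_base :: "('k, 'a) module \<Rightarrow> ('g, 'm) monoid_scheme \<Rightarrow> 'a \<Rightarrow> 'g \<Rightarrow> 'a" where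
  "skew_of_base A G a = (\<lambda>k\<in>carrier G. if k = \<one>\<^bsub>G\<^esub> then a else \<zero>\<^bsub>A\<^esub>)"

definition skew_of_group_algebra ::
    "('k, 'a) module \<Rightarrow> ('g, 'm) monoid_scheme \<Rightarrow> ('g \<Rightarrow> 'k) \<Rightarrow> 'g \<Rightarrow> 'a" where
  "skew_of_group_algebra A G c = (\<lambda>k\<in>carrier G. c k \<odot>\<^bsub>A\<^esub> \<one>\<^bsub>A\<^esub>)"


section \<open>Associated graded algebras\<close>

text \<open>
  \<open>F d\<close> is the part of filtration degree at most \<open>d\<close> of \<open>A\<close>. Filtrations and gradings are indexed by
  the integers and vanish in negative degrees (for a filtration, \<open>F d\<close> is the zero subspace if
  \<open>d < 0\<close>), so that only the degrees \<open>0..k\<close> contribute to component \<open>k\<close> of a product.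
  An element of the associated graded algebra is a finitely supported family whose \<open>d\<close>-th member
  is a coset in \<open>F d / F (d - 1)\<close>. Operations are given on representatives, as for \<^const>\<open>FactRing\<close>.
\<close>

definition assoc_graded :: "('k, 'a) module \<Rightarrow> (int \<Rightarrow> 'a set) \<Rightarrow> ('k, int \<Rightarrow> 'a set) module" where
  "assoc_graded A F = \<lparr>
     carrier = {f. (\<forall>d. \<exists>x\<in>F d. f d = F (d - 1) +>\<^bsub>A\<^esub> x) \<and> finite {d. f d \<noteq> F (d - 1)}},
     monoid.mult = (\<lambda>f h k. \<Union>{F (k - 1) +>\<^bsub>A\<^esub> (\<Oplus>\<^bsub>A\<^esub>i\<in>{0..k}. x i \<otimes>\<^bsub>A\<^esub> y (k - i)) | x y.
               (\<forall>i. x i \<in> f i) \<and> (\<forall>i. y i \<in> h i)}),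
     monoid.one = (\<lambda>k. if k = 0 then F (- 1) +>\<^bsub>A\<^esub> \<one>\<^bsub>A\<^esub> else F (k - 1)),
     ring.zero = (\<lambda>k. F (k - 1)),
     ring.add = (\<lambda>f h k. f k <+>\<^bsub>A\<^esub> h k),
     module.smult = (\<lambda>c f k. \<Union>x\<in>f k. F (k - 1) +>\<^bsub>A\<^esub> (c \<odot>\<^bsub>A\<^esub> x))\<rparr>"

definition assoc_graded_part :: "('k, 'a) module \<Rightarrow> (int \<Rightarrow> 'a set) \<Rightarrow> int \<Rightarrow> (int \<Rightarrow> 'a set) set" where
  "assoc_graded_part A F d = {f \<in> carrier (assoc_graded A F). \<forall>k. k \<noteq> d \<longrightarrow> f k = F (k - 1)}"


section \<open>The tensor algebra and the quantum symmetric algebra\<close>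

text \<open>
  \<open>T(V)\<close> for \<open>V\<close> with basis \<open>v 0, \<dots>, v (n - 1)\<close> has as basis the words in the letters \<open>0, \<dots>, n - 1\<close>,
  the word \<open>[i\<^sub>1, \<dots>, i\<^sub>d]\<close> standing for the tensor of \<open>v i\<^sub>1, \<dots>, v i\<^sub>d\<close>.
\<close>

definition tensor_algebra :: "nat \<Rightarrow> (complex, nat list \<Rightarrow> complex) module" where
  "tensor_algebra n = \<lparr>
     carrier = {x. finite {w. x w \<noteq> 0} \<and> (\<forall>w. x w \<noteq> 0 \<longrightarrow> set w \<subseteq> {..<n})},
     monoid.mult = (\<lambda>x y w. \<Sum>k\<le>length w. x (take k w) * y (drop k w)),
     monoid.one = (\<lambda>w. if w = [] then 1 else 0),
     ring.zero = (\<lambda>w. 0),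
     ring.add = (\<lambda>x y w. x w + y w),
     module.smult = (\<lambda>c x w. c * x w)\<rparr>"

definition tensor_degree :: "nat \<Rightarrow> int \<Rightarrow> (nat list \<Rightarrow> complex) set" where
  "tensor_degree n d = {x \<in> carrier (tensor_algebra n). \<forall>w. x w \<noteq> 0 \<longrightarrow> int (length w) = d}"

definition tensor_filtration :: "nat \<Rightarrow> int \<Rightarrow> (nat list \<Rightarrow> complex) set" where
  "tensor_filtration n d = {x \<in> carrier (tensor_algebra n). \<forall>w. x w \<noteq> 0 \<longrightarrow> int (length w) \<le> d}"

definition is_basis :: "(complex \<Rightarrow> 'v \<Rightarrow> 'v) \<Rightarrow> (nat \<Rightarrow> 'v :: ab_group_add) \<Rightarrow> nat \<Rightarrow> bool" where
  "is_basis scale v n \<longleftrightarrow> inj_on v {..<n} \<and> \<not> module.dependent scale (v ` {..<n}) \<and>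
     module.span scale (v ` {..<n}) = UNIV"

definition coord ::
    "(complex \<Rightarrow> 'v \<Rightarrow> 'v) \<Rightarrow> (nat \<Rightarrow> 'v :: ab_group_add) \<Rightarrow> nat \<Rightarrow> 'v \<Rightarrow> nat \<Rightarrow> complex" where
  "coord scale v n x i = (if i < n then module.representation scale (v ` {..<n}) x (v i) else 0)"

text \<open>The inclusion of \<open>V\<close> in \<open>T(V)\<close>.\<close>

definition tensor_of_vec ::
    "(complex \<Rightarrow> 'v \<Rightarrow> 'v) \<Rightarrow> (nat \<Rightarrow> 'v :: ab_group_add) \<Rightarrow> nat \<Rightarrow> 'v \<Rightarrow> nat list \<Rightarrow> complex" where
  "tensor_of_vec scale v n x = (\<lambda>w. if length w = 1 then coord scale v n x (hd w) else 0)"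

text \<open>
  The algebra endomorphism of \<open>T(V)\<close> induced by a linear endomorphism \<open>f\<close> of \<open>V\<close>: it maps the word
  \<open>w = [j\<^sub>1, \<dots>, j\<^sub>d]\<close> to the tensor of \<open>f (v j\<^sub>1), \<dots>, f (v j\<^sub>d)\<close>, whose coefficient at the word
  \<open>u = [i\<^sub>1, \<dots>, i\<^sub>d]\<close> is the product over \<open>k\<close> of the \<open>i\<^sub>k\<close>-th coordinate of \<open>f (v j\<^sub>k)\<close>.
\<close>

definition tensor_map ::
    "(complex \<Rightarrow> 'v \<Rightarrow> 'v) \<Rightarrow> (nat \<Rightarrow> 'v :: ab_group_add) \<Rightarrow> nat \<Rightarrow> ('v \<Rightarrow> 'v) \<Rightarrow>
     (nat list \<Rightarrow> complex) \<Rightarrow> nat list \<Rightarrow> complex" where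
  "tensor_map scale v n f x = (\<lambda>u. \<Sum>w | set w \<subseteq> {..<n} \<and> length w = length u.
     x w * (\<Prod>k<length u. coord scale v n (f (v (w ! k))) (u ! k)))"

definition gen :: "nat \<Rightarrow> nat list \<Rightarrow> complex" where
  "gen i = (\<lambda>w. if w = [i] then 1 else 0)"

definition quantum_commutator :: "nat \<Rightarrow> (nat \<Rightarrow> nat \<Rightarrow> complex) \<Rightarrow> nat \<Rightarrow> nat \<Rightarrow> nat list \<Rightarrow> complex" where
  "quantum_commutator n q i j =
     (gen i \<otimes>\<^bsub>tensor_algebra n\<^esub> gen j) \<ominus>\<^bsub>tensor_algebra n\<^esub>
     q i j \<odot>\<^bsub>tensor_algebra n\<^esub> (gen j \<otimes>\<^bsub>tensor_algebra n\<^esub> gen i)"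

definition quantum_ideal :: "nat \<Rightarrow> (nat \<Rightarrow> nat \<Rightarrow> complex) \<Rightarrow> (nat list \<Rightarrow> complex) set" where
  "quantum_ideal n q =
     genideal (tensor_algebra n) {quantum_commutator n q i j | i j. i < n \<and> j < n}"

definition quantum_sym :: "nat \<Rightarrow> (nat \<Rightarrow> nat \<Rightarrow> complex) \<Rightarrow> (complex, (nat list \<Rightarrow> complex) set) module" where
  "quantum_sym n q = quotient_algebra (tensor_algebra n) (quantum_ideal n q)"

definition quantum_class ::
    "nat \<Rightarrow> (nat \<Rightarrow> nat \<Rightarrow> complex) \<Rightarrow> (nat list \<Rightarrow> complex) \<Rightarrow> (nat list \<Rightarrow> complex) set" where
  "quantum_class n q x = quantum_ideal n q +>\<^bsub>tensor_algebra n\<^esub> x"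

definition quantum_degree ::
    "nat \<Rightarrow> (nat \<Rightarrow> nat \<Rightarrow> complex) \<Rightarrow> int \<Rightarrow> (nat list \<Rightarrow> complex) set set" where
  "quantum_degree n q d = quantum_class n q ` tensor_degree n d"

text \<open>\<open>act\<close> is an action of \<open>G\<close> on \<open>V\<close>, and \<open>\<alpha>\<close> is the action on \<open>S\<^sub>q(V)\<close> by automorphisms it induces.\<close>

definition linear_action ::
    "('g, 'm) monoid_scheme \<Rightarrow> (complex \<Rightarrow> 'v \<Rightarrow> 'v :: ab_group_add) \<Rightarrow> ('g \<Rightarrow> 'v \<Rightarrow> 'v) \<Rightarrow> bool" where
  "linear_action G scale act \<longleftrightarrow> group_action G UNIV act \<and>
     (\<forall>g\<in>carrier G. Vector_Spaces.linear scale scale (act g))"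

definition induced_action ::
    "('g, 'm) monoid_scheme \<Rightarrow> (complex \<Rightarrow> 'v \<Rightarrow> 'v) \<Rightarrow> (nat \<Rightarrow> 'v :: ab_group_add) \<Rightarrow> nat \<Rightarrow>
     ('g \<Rightarrow> 'v \<Rightarrow> 'v) \<Rightarrow> (nat \<Rightarrow> nat \<Rightarrow> complex) \<Rightarrow>
     ('g \<Rightarrow> (nat list \<Rightarrow> complex) set \<Rightarrow> (nat list \<Rightarrow> complex) set) \<Rightarrow> bool" where
  "induced_action G scale v n act q \<alpha> \<longleftrightarrow>
     group_action G (carrier (quantum_sym n q)) \<alpha> \<and>
     (\<forall>g\<in>carrier G. \<alpha> g \<in> algebra_iso Cring (quantum_sym n q) (quantum_sym n q) \<and>
        (\<forall>x. \<alpha> g (quantum_class n q (tensor_of_vec scale v n x)) =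
             quantum_class n q (tensor_of_vec scale v n (act g x))))"

text \<open>\<open>S\<^sub>q(V) \<rtimes> G\<close> and its homogeneous components.\<close>

definition quantum_skew ::
    "('g, 'm) monoid_scheme \<Rightarrow> nat \<Rightarrow> (nat \<Rightarrow> nat \<Rightarrow> complex) \<Rightarrow>
     ('g \<Rightarrow> (nat list \<Rightarrow> complex) set \<Rightarrow> (nat list \<Rightarrow> complex) set) \<Rightarrow>
     (complex, 'g \<Rightarrow> (nat list \<Rightarrow> complex) set) module" where
  "quantum_skew G n q \<alpha> = skew_group_algebra (quantum_sym n q) G \<alpha>"

definition quantum_skew_degree ::
    "('g, 'm) monoid_scheme \<Rightarrow> nat \<Rightarrow> (nat \<Rightarrow> nat \<Rightarrow> complex) \<Rightarrow> int \<Rightarrow>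
     ('g \<Rightarrow> (nat list \<Rightarrow> complex) set) set" where
  "quantum_skew_degree G n q d = skew_part G (quantum_degree n q d)"


section \<open>Deformations\<close>

definition bilinear_map :: "('k, 'm) ring_scheme \<Rightarrow> ('k, 'a) module \<Rightarrow> ('a \<Rightarrow> 'a \<Rightarrow> 'a) \<Rightarrow> bool" where
  "bilinear_map K R m \<longleftrightarrow>
     (\<forall>x\<in>carrier R. \<forall>y\<in>carrier R. m x y \<in> carrier R \<and>
        (\<forall>z\<in>carrier R. m (x \<oplus>\<^bsub>R\<^esub> z) y = m x y \<oplus>\<^bsub>R\<^esub> m z y \<and> m x (y \<oplus>\<^bsub>R\<^esub> z) = m x y \<oplus>\<^bsub>R\<^esub> m x z) \<and>
        (\<forall>c\<in>carrier K. m (c \<odot>\<^bsub>R\<^esub> x) y = c \<odot>\<^bsub>R\<^esub> m x y \<and> m x (c \<odot>\<^bsub>R\<^esub> y) = c \<odot>\<^bsub>R\<^esub> m x y))"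

text \<open>
  \<open>D\<close> is a deformation of \<open>R\<close> over \<open>\<complex>[t]\<close> with structure maps \<open>\<mu> 1, \<mu> 2, \<dots>\<close>. Since products of \<open>D\<close> lie in
  \<open>R[t]\<close>, the family of the \<open>\<mu> i r s\<close> is finitely supported in \<open>i\<close> for all \<open>r\<close> and \<open>s\<close>. The value \<open>\<mu> 0\<close>
  is irrelevant.
\<close>

definition deformation ::
    "(complex, 'a) module \<Rightarrow> (nat \<Rightarrow> 'a \<Rightarrow> 'a \<Rightarrow> 'a) \<Rightarrow> (nat \<Rightarrow> complex, nat \<Rightarrow> 'a) module \<Rightarrow> bool" where
  "deformation R \<mu> D \<longleftrightarrow> assoc_algebra Ct D \<and>
     carrier D = carrier (poly_algebra R) \<and> \<zero>\<^bsub>D\<^esub> = \<zero>\<^bsub>poly_algebra R\<^esub> \<and>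
     (\<forall>x\<in>carrier D. \<forall>y\<in>carrier D. x \<oplus>\<^bsub>D\<^esub> y = x \<oplus>\<^bsub>poly_algebra R\<^esub> y) \<and>
     (\<forall>p\<in>carrier Ct. \<forall>x\<in>carrier D. p \<odot>\<^bsub>D\<^esub> x = p \<odot>\<^bsub>poly_algebra R\<^esub> x) \<and>
     (\<forall>i\<ge>1. bilinear_map Cring R (\<mu> i)) \<and>
     (\<forall>r\<in>carrier R. \<forall>s\<in>carrier R.
        up_ring.monom (UP R) r 0 \<otimes>\<^bsub>D\<^esub> up_ring.monom (UP R) s 0 = (\<lambda>i. if i = 0 then r \<otimes>\<^bsub>R\<^esub> s else \<mu> i r s))"

text \<open>A map homogeneous of degree \<open>e\<close> on the tensor square of a graded algebra with components \<open>U d\<close>.\<close>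

definition homogeneous_of_degree :: "(int \<Rightarrow> 'a set) \<Rightarrow> int \<Rightarrow> ('a \<Rightarrow> 'a \<Rightarrow> 'a) \<Rightarrow> bool" where
  "homogeneous_of_degree U e m \<longleftrightarrow> (\<forall>a b. \<forall>r\<in>U a. \<forall>s\<in>U b. m r s \<in> U (a + b + e))"


section \<open>Quantum Drinfeld Hecke algebras\<close>

text \<open>\<open>\<kappa> x y g\<close> is the coefficient of \<open>g\<close> in the element \<open>\<kappa> x y\<close> of the group algebra.\<close>

definition quantum_skew_form ::
    "('g, 'm) monoid_scheme \<Rightarrow> (complex \<Rightarrow> 'v \<Rightarrow> 'v) \<Rightarrow> (nat \<Rightarrow> 'v :: ab_group_add) \<Rightarrow> nat \<Rightarrow>
     (nat \<Rightarrow> nat \<Rightarrow> complex) \<Rightarrow> ('v \<Rightarrow> 'v \<Rightarrow> 'g \<Rightarrow> complex) \<Rightarrow> bool" where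
  "quantum_skew_form G scale v n q \<kappa> \<longleftrightarrow> (\<forall>g\<in>carrier G.
     (\<forall>y. Vector_Spaces.linear scale (*) (\<lambda>x. \<kappa> x y g)) \<and>
     (\<forall>x. Vector_Spaces.linear scale (*) (\<lambda>y. \<kappa> x y g)) \<and>
     (\<forall>i<n. \<forall>j<n. \<kappa> (v i) (v j) g = - q i j * \<kappa> (v j) (v i) g))"

definition tensor_skew ::
    "('g, 'm) monoid_scheme \<Rightarrow> (complex \<Rightarrow> 'v \<Rightarrow> 'v) \<Rightarrow> (nat \<Rightarrow> 'v :: ab_group_add) \<Rightarrow> nat \<Rightarrow>
     ('g \<Rightarrow> 'v \<Rightarrow> 'v) \<Rightarrow> (complex, 'g \<Rightarrow> nat list \<Rightarrow> complex) module" where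
  "tensor_skew G scale v n act =
     skew_group_algebra (tensor_algebra n) G (\<lambda>g. tensor_map scale v n (act g))"

definition hecke_relation ::
    "('g, 'm) monoid_scheme \<Rightarrow> (complex \<Rightarrow> 'v \<Rightarrow> 'v) \<Rightarrow> (nat \<Rightarrow> 'v :: ab_group_add) \<Rightarrow> nat \<Rightarrow>
     ('g \<Rightarrow> 'v \<Rightarrow> 'v) \<Rightarrow> (nat \<Rightarrow> nat \<Rightarrow> complex) \<Rightarrow> ('v \<Rightarrow> 'v \<Rightarrow> 'g \<Rightarrow> complex) \<Rightarrow>
     nat \<Rightarrow> nat \<Rightarrow> nat \<Rightarrow> 'g \<Rightarrow> nat list \<Rightarrow> complex" where
  "hecke_relation G scale v n act q \<kappa> i j =
     up_ring.monom (UP (tensor_skew G scale v n act))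
       (skew_of_base (tensor_algebra n) G (quantum_commutator n q i j)) 0
     \<ominus>\<^bsub>poly_algebra (tensor_skew G scale v n act)\<^esub>
     up_ring.monom (UP (tensor_skew G scale v n act))
       (skew_of_group_algebra (tensor_algebra n) G (\<kappa> (v i) (v j))) 1"

definition hecke_ideal ::
    "('g, 'm) monoid_scheme \<Rightarrow> (complex \<Rightarrow> 'v \<Rightarrow> 'v) \<Rightarrow> (nat \<Rightarrow> 'v :: ab_group_add) \<Rightarrow> nat \<Rightarrow>
     ('g \<Rightarrow> 'v \<Rightarrow> 'v) \<Rightarrow> (nat \<Rightarrow> nat \<Rightarrow> complex) \<Rightarrow> ('v \<Rightarrow> 'v \<Rightarrow> 'g \<Rightarrow> complex) \<Rightarrow>
     (nat \<Rightarrow> 'g \<Rightarrow> nat list \<Rightarrow> complex) set" where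
  "hecke_ideal G scale v n act q \<kappa> =
     genideal (poly_algebra (tensor_skew G scale v n act))
       {hecke_relation G scale v n act q \<kappa> i j | i j. i < n \<and> j < n}"

definition hecke_algebra ::
    "('g, 'm) monoid_scheme \<Rightarrow> (complex \<Rightarrow> 'v \<Rightarrow> 'v) \<Rightarrow> (nat \<Rightarrow> 'v :: ab_group_add) \<Rightarrow> nat \<Rightarrow>
     ('g \<Rightarrow> 'v \<Rightarrow> 'v) \<Rightarrow> (nat \<Rightarrow> nat \<Rightarrow> complex) \<Rightarrow> ('v \<Rightarrow> 'v \<Rightarrow> 'g \<Rightarrow> complex) \<Rightarrow>
     (nat \<Rightarrow> complex, (nat \<Rightarrow> 'g \<Rightarrow> nat list \<Rightarrow> complex) set) module" where
  "hecke_algebra G scale v n act q \<kappa> =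
     quotient_algebra (poly_algebra (tensor_skew G scale v n act)) (hecke_ideal G scale v n act q \<kappa>)"

definition hecke_filtration ::
    "('g, 'm) monoid_scheme \<Rightarrow> (complex \<Rightarrow> 'v \<Rightarrow> 'v) \<Rightarrow> (nat \<Rightarrow> 'v :: ab_group_add) \<Rightarrow> nat \<Rightarrow>
     ('g \<Rightarrow> 'v \<Rightarrow> 'v) \<Rightarrow> (nat \<Rightarrow> nat \<Rightarrow> complex) \<Rightarrow> ('v \<Rightarrow> 'v \<Rightarrow> 'g \<Rightarrow> complex) \<Rightarrow>
     int \<Rightarrow> (nat \<Rightarrow> 'g \<Rightarrow> nat list \<Rightarrow> complex) set set" where
  "hecke_filtration G scale v n act q \<kappa> d =
     (\<lambda>x. hecke_ideal G scale v n act q \<kappa> +>\<^bsub>poly_algebra (tensor_skew G scale v n act)\<^esub> x) `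
       poly_part (tensor_skew G scale v n act) (skew_part G (tensor_filtration n d))"

definition quantum_Drinfeld_Hecke ::
    "('g, 'm) monoid_scheme \<Rightarrow> (complex \<Rightarrow> 'v \<Rightarrow> 'v) \<Rightarrow> (nat \<Rightarrow> 'v :: ab_group_add) \<Rightarrow> nat \<Rightarrow>
     ('g \<Rightarrow> 'v \<Rightarrow> 'v) \<Rightarrow> (nat \<Rightarrow> nat \<Rightarrow> complex) \<Rightarrow>
     ('g \<Rightarrow> (nat list \<Rightarrow> complex) set \<Rightarrow> (nat list \<Rightarrow> complex) set) \<Rightarrow>
     ('v \<Rightarrow> 'v \<Rightarrow> 'g \<Rightarrow> complex) \<Rightarrow> bool" where
  "quantum_Drinfeld_Hecke G scale v n act q \<alpha> \<kappa> \<longleftrightarrow>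
     quantum_skew_form G scale v n q \<kappa> \<and>
     graded_algebra_isomorphic Ct
       (assoc_graded (hecke_algebra G scale v n act q \<kappa>) (hecke_filtration G scale v n act q \<kappa>))
       (assoc_graded_part (hecke_algebra G scale v n act q \<kappa>) (hecke_filtration G scale v n act q \<kappa>))
       (poly_algebra (quantum_skew G n q \<alpha>))
       (\<lambda>d. poly_part (quantum_skew G n q \<alpha>) (quantum_skew_degree G n q d))"

end

theory Submission
  imports Defs "HOL-Library.Function_Algebras"
begin

text \<open>
  Put \<open>R = S\<^sub>q(V) \<rtimes> G\<close> and \<open>B = T(V) \<rtimes> G\<close>. The projection \<open>\<pi>\<close> from \<open>B\<close> to \<open>R\<close> is graded, and its kernel is generated
  by the quadratic elements \<open>\<rho>\<^sub>i\<^sub>j = v\<^sub>i v\<^sub>j - q\<^sub>i\<^sub>j v\<^sub>j v\<^sub>i\<close>. A form \<open>\<kappa>\<close> deforms the relations to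
  \<open>\<rho>\<^sub>i\<^sub>j = t \<kappa>(v\<^sub>i, v\<^sub>j)\<close> and defines the Hecke algebra \<open>H\<close> as a quotient of \<open>B[t]\<close>. A graded linear section of \<open>\<pi>\<close>,
  followed by the projection to \<open>H\<close>, gives a \<open>\<complex>[t]\<close>-linear map \<open>sec\<close> from \<open>R[t]\<close> to \<open>H\<close>. It is always onto:
  whatever \<open>\<pi>\<close> kills is in \<open>H\<close> a multiple of \<open>t\<close> of degree smaller by two, so rewriting terminates. The theorem is a
  matter of the injectivity of \<open>sec\<close>.

  Two gradings of \<open>t\<close> have to be kept apart. In degree zero it belongs to the filtration of \<open>H\<close> in the definition of a
  quantum Drinfeld Hecke algebra. In degree two it makes the deformed relations homogeneous, and a deformation
  with \<open>deg \<mu>\<^sub>i = - 2i\<close> is the same as one whose multiplication is homogeneous for this grading.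

  If \<open>sec\<close> is injective, the natural map from \<open>R[t]\<close> to the associated graded algebra is an isomorphism
  (\<open>PBW_if_sec_inj\<close>), and transporting the multiplication of \<open>H\<close> to \<open>R[t]\<close> along \<open>sec\<close> gives a deformation of the
  required degrees (\<open>deformation_if_sec_inj\<close>).

  Let \<open>H\<close> be a quantum Drinfeld Hecke algebra. The isomorphism of its associated graded algebra with \<open>R[t]\<close> is only
  known to be graded. Composed with the natural surjection, it is a surjective endomorphism of \<open>R\<^sub>d[t]\<close> in each degree
  \<open>d\<close>, and modulo \<open>t\<close> one of \<open>R\<^sub>d\<close>, which is finite-dimensional because \<open>G\<close> is finite and \<open>V\<close> is finite-dimensional.
  It is therefore injective (\<open>PBW_imp_leading_term_inj\<close>, \<open>surjective_endomorphism_injective\<close>), and so is \<open>sec\<close>.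

  Let conversely \<open>D\<close> be a deformation with \<open>deg \<mu>\<^sub>i = - 2i\<close>. With \<open>t\<close> in degree two, products in \<open>D\<close> of total degree
  below two agree with those in \<open>R\<close> (\<open>const_mult_low\<close>). So the relations of \<open>G\<close> and those between \<open>G\<close> and \<open>V\<close> hold in
  \<open>D\<close>, and there is a graded homomorphism \<open>\<psi>\<close> from \<open>B\<close> to \<open>D\<close> which is \<open>\<pi>\<close> modulo \<open>t\<close>. It sends \<open>\<rho>\<^sub>i\<^sub>j\<close> to an element of
  degree two without constant term, hence to \<open>t\<close> times an element of degree zero, which lies in the group algebra and
  is the value \<open>\<kappa>(v\<^sub>i, v\<^sub>j)\<close> (\<open>\<psi>_\<rho>_exists\<close>). By construction \<open>\<psi>\<close> factors through \<open>H\<close>. Its composite with \<open>sec\<close> is the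
  identity modulo \<open>t\<close>, so \<open>sec\<close> is injective and \<open>H\<close> is isomorphic to \<open>D\<close> (\<open>sec_inj_if_hom_to_deformation\<close>).

  The locale \<open>presentation\<close> carries the parts of the argument that only involve \<open>\<pi>\<close>, the section and the relations;
  \<open>quantum_data\<close> provides its instance for \<open>S\<^sub>q(V) \<rtimes> G\<close>.
\<close>


section \<open>Associative algebras\<close>

locale assoc_alg = module K A + ring A
  for K :: "('k, 'm) ring_scheme" (structure) and A :: "('k, 'a) module" (structure) +
  assumes smult_mult_left: "\<lbrakk>c \<in> carrier K; x \<in> carrier A; y \<in> carrier A\<rbrakk> \<Longrightarrow> (c \<odot>\<^bsub>A\<^esub> x) \<otimes>\<^bsub>A\<^esub> y = c \<odot>\<^bsub>A\<^esub> (x \<otimes>\<^bsub>A\<^esub> y)"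
    and smult_mult_right: "\<lbrakk>c \<in> carrier K; x \<in> carrier A; y \<in> carrier A\<rbrakk> \<Longrightarrow> x \<otimes>\<^bsub>A\<^esub> (c \<odot>\<^bsub>A\<^esub> y) = c \<odot>\<^bsub>A\<^esub> (x \<otimes>\<^bsub>A\<^esub> y)"

lemma assoc_algebra_iff: "assoc_algebra K A \<longleftrightarrow> assoc_alg K A"
  unfolding assoc_algebra_def assoc_alg_def assoc_alg_axioms_def by blast

lemma (in assoc_alg) smult_eq_mult:
  assumes "c \<in> carrier K" "x \<in> carrier A"
  shows "c \<odot>\<^bsub>A\<^esub> x = (c \<odot>\<^bsub>A\<^esub> \<one>\<^bsub>A\<^esub>) \<otimes>\<^bsub>A\<^esub> x"
  using assms by (simp add: smult_mult_left)

text \<open>A scalar acts as multiplication by a multiple of the unit, so two-sided ideals of the ring are subspaces.\<close>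

lemma (in assoc_alg) ideal_smult_closed:
  assumes "ideal I A" "c \<in> carrier K" "x \<in> I"
  shows "c \<odot>\<^bsub>A\<^esub> x \<in> I"
proof -
  interpret I: ideal I A by fact
  show ?thesis
    using assms by (subst smult_eq_mult) (auto intro!: I.I_l_closed)
qed

definition alg_hom :: "('k, 'm) ring_scheme \<Rightarrow> ('k, 'a) module \<Rightarrow> ('k, 'b) module \<Rightarrow> ('a \<Rightarrow> 'b) set" where
  "alg_hom K A B = {\<phi> \<in> ring_hom A B. \<forall>c\<in>carrier K. \<forall>x\<in>carrier A. \<phi> (c \<odot>\<^bsub>A\<^esub> x) = c \<odot>\<^bsub>B\<^esub> \<phi> x}"

lemma alg_homI:
  assumes "\<And>x. x \<in> carrier A \<Longrightarrow> \<phi> x \<in> carrier B"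
    and "\<And>x y. \<lbrakk>x \<in> carrier A; y \<in> carrier A\<rbrakk> \<Longrightarrow> \<phi> (x \<otimes>\<^bsub>A\<^esub> y) = \<phi> x \<otimes>\<^bsub>B\<^esub> \<phi> y"
    and "\<And>x y. \<lbrakk>x \<in> carrier A; y \<in> carrier A\<rbrakk> \<Longrightarrow> \<phi> (x \<oplus>\<^bsub>A\<^esub> y) = \<phi> x \<oplus>\<^bsub>B\<^esub> \<phi> y"
    and "\<phi> \<one>\<^bsub>A\<^esub> = \<one>\<^bsub>B\<^esub>"
    and "\<And>c x. \<lbrakk>c \<in> carrier K; x \<in> carrier A\<rbrakk> \<Longrightarrow> \<phi> (c \<odot>\<^bsub>A\<^esub> x) = c \<odot>\<^bsub>B\<^esub> \<phi> x"
  shows "\<phi> \<in> alg_hom K A B"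
  using assms unfolding alg_hom_def by (simp add: ring_hom_memI)

lemma alg_homD:
  assumes "\<phi> \<in> alg_hom K A B"
  shows "\<phi> \<in> ring_hom A B"
    and "x \<in> carrier A \<Longrightarrow> \<phi> x \<in> carrier B"
    and "\<lbrakk>x \<in> carrier A; y \<in> carrier A\<rbrakk> \<Longrightarrow> \<phi> (x \<otimes>\<^bsub>A\<^esub> y) = \<phi> x \<otimes>\<^bsub>B\<^esub> \<phi> y"
    and "\<lbrakk>x \<in> carrier A; y \<in> carrier A\<rbrakk> \<Longrightarrow> \<phi> (x \<oplus>\<^bsub>A\<^esub> y) = \<phi> x \<oplus>\<^bsub>B\<^esub> \<phi> y"
    and "\<phi> \<one>\<^bsub>A\<^esub> = \<one>\<^bsub>B\<^esub>"
    and "\<lbrakk>c \<in> carrier K; x \<in> carrier A\<rbrakk> \<Longrightarrow> \<phi> (c \<odot>\<^bsub>A\<^esub> x) = c \<odot>\<^bsub>B\<^esub> \<phi> x"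
  using assms unfolding alg_hom_def
  by (auto simp: ring_hom_closed ring_hom_mult ring_hom_add ring_hom_one)

lemma algebra_iso_eq: "algebra_iso K A B = {\<phi> \<in> alg_hom K A B. bij_betw \<phi> (carrier A) (carrier B)}"
  unfolding algebra_iso_def alg_hom_def ring_iso_def by auto

lemma additive_map_zero_minus_sum:
  assumes "abelian_group A" "abelian_group B"
    and closed: "\<And>x. x \<in> carrier A \<Longrightarrow> \<phi> x \<in> carrier B"
    and add: "\<And>x y. \<lbrakk>x \<in> carrier A; y \<in> carrier A\<rbrakk> \<Longrightarrow> \<phi> (x \<oplus>\<^bsub>A\<^esub> y) = \<phi> x \<oplus>\<^bsub>B\<^esub> \<phi> y"
  shows additive_map_zero: "\<phi> \<zero>\<^bsub>A\<^esub> = \<zero>\<^bsub>B\<^esub>"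
    and additive_map_a_inv: "x \<in> carrier A \<Longrightarrow> \<phi> (\<ominus>\<^bsub>A\<^esub> x) = \<ominus>\<^bsub>B\<^esub> \<phi> x"
    and additive_map_minus: "\<lbrakk>x \<in> carrier A; y \<in> carrier A\<rbrakk> \<Longrightarrow> \<phi> (x \<ominus>\<^bsub>A\<^esub> y) = \<phi> x \<ominus>\<^bsub>B\<^esub> \<phi> y"
    and additive_map_finsum: "f \<in> S \<rightarrow> carrier A \<Longrightarrow> \<phi> (finsum A f S) = finsum B (\<lambda>i. \<phi> (f i)) S"
proof -
  interpret A: abelian_group A by fact
  interpret B: abelian_group B by fact
  interpret h: abelian_group_hom A B \<phi>
    by (rule abelian_group_homI[OF assms(1,2) group_hom.intro[OF A.a_group B.a_group]])
       (simp add: group_hom_axioms_def hom_def closed add)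
  show z: "\<phi> \<zero>\<^bsub>A\<^esub> = \<zero>\<^bsub>B\<^esub>" by simp
  show i: "\<phi> (\<ominus>\<^bsub>A\<^esub> x) = \<ominus>\<^bsub>B\<^esub> \<phi> x" if "x \<in> carrier A" for x using that by simp
  show "\<phi> (x \<ominus>\<^bsub>A\<^esub> y) = \<phi> x \<ominus>\<^bsub>B\<^esub> \<phi> y" if "x \<in> carrier A" "y \<in> carrier A"
    using that by (simp add: a_minus_def)
  show "\<phi> (finsum A f S) = finsum B (\<lambda>i. \<phi> (f i)) S" if "f \<in> S \<rightarrow> carrier A"
    using that
  proof (induction S rule: infinite_finite_induct)
    case (insert x F)
    then have "f \<in> F \<rightarrow> carrier A" "f x \<in> carrier A" by auto
    with insert show ?case by (simp add: A.finsum_insert B.finsum_insert closed Pi_iff)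
  qed simp_all
qed

text \<open>The laws of an algebra are equations and existence of additive inverses, so they pull back along a
  bijection that respects the operations. The deformation attached to a Hecke algebra is obtained in this way.\<close>

lemma assoc_alg_transport:
  assumes "assoc_alg K A" and inj: "inj_on h (carrier A')" and im: "h ` carrier A' = carrier A"
    and mult: "\<And>x y. \<lbrakk>x \<in> carrier A'; y \<in> carrier A'\<rbrakk> \<Longrightarrow> x \<otimes>\<^bsub>A'\<^esub> y \<in> carrier A' \<and> h (x \<otimes>\<^bsub>A'\<^esub> y) = h x \<otimes>\<^bsub>A\<^esub> h y"
    and add: "\<And>x y. \<lbrakk>x \<in> carrier A'; y \<in> carrier A'\<rbrakk> \<Longrightarrow> x \<oplus>\<^bsub>A'\<^esub> y \<in> carrier A' \<and> h (x \<oplus>\<^bsub>A'\<^esub> y) = h x \<oplus>\<^bsub>A\<^esub> h y"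
    and one: "\<one>\<^bsub>A'\<^esub> \<in> carrier A' \<and> h \<one>\<^bsub>A'\<^esub> = \<one>\<^bsub>A\<^esub>"
    and zero: "\<zero>\<^bsub>A'\<^esub> \<in> carrier A' \<and> h \<zero>\<^bsub>A'\<^esub> = \<zero>\<^bsub>A\<^esub>"
    and smult: "\<And>c x. \<lbrakk>c \<in> carrier K; x \<in> carrier A'\<rbrakk> \<Longrightarrow> c \<odot>\<^bsub>A'\<^esub> x \<in> carrier A' \<and> h (c \<odot>\<^bsub>A'\<^esub> x) = c \<odot>\<^bsub>A\<^esub> h x"
  shows "assoc_alg K A'"
proof -
  interpret A: assoc_alg K A by fact
  have hc: "h x \<in> carrier A" if "x \<in> carrier A'" for x using that im by blast
  have eqI: "x = y" if "x \<in> carrier A'" "y \<in> carrier A'" "h x = h y" for x y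
    using inj that by (simp add: inj_on_def)
  have neg: "\<exists>y\<in>carrier A'. y \<oplus>\<^bsub>A'\<^esub> x = \<zero>\<^bsub>A'\<^esub>" if x: "x \<in> carrier A'" for x
  proof -
    obtain y where y: "y \<in> carrier A'" "h y = \<ominus>\<^bsub>A\<^esub> h x"
      using hc[OF x] im by (metis A.M.a_inv_closed imageE)
    have "y \<oplus>\<^bsub>A'\<^esub> x = \<zero>\<^bsub>A'\<^esub>"
      using x y hc by (intro eqI) (simp_all add: add zero A.M.l_neg)
    with y show ?thesis by blast
  qed
  have ab: "abelian_group A'"
    by (rule abelian_groupI)
       (auto simp: add zero hc neg intro!: eqI A.M.a_assoc A.M.a_comm)
  have mo: "Group.monoid A'"
    by (rule monoidI) (auto simp: mult one hc intro!: eqI A.m_assoc)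
  have ri: "ring A'"
    by (rule ringI[OF ab mo]) (auto simp: add mult hc A.l_distr A.r_distr intro!: eqI)
  have mod: "module K A'"
    by (rule moduleI[OF A.R.is_cring ab])
       (auto simp: add mult smult hc A.smult_l_distr A.smult_r_distr A.smult_assoc1 intro!: eqI)
  show ?thesis
    by (rule assoc_alg.intro[OF mod ri], unfold_locales)
       (auto simp: mult smult hc A.smult_mult_left A.smult_mult_right intro!: eqI)
qed

lemma algebra_iso_inv:
  assumes "assoc_alg K A" and \<phi>: "\<phi> \<in> algebra_iso K A B"
  shows "inv_into (carrier A) \<phi> \<in> algebra_iso K B A"
proof -
  interpret A: assoc_alg K A by fact
  have r: "\<phi> \<in> ring_iso A B" and sm: "\<And>c x. c \<in> carrier K \<Longrightarrow> x \<in> carrier A \<Longrightarrow> \<phi> (c \<odot>\<^bsub>A\<^esub> x) = c \<odot>\<^bsub>B\<^esub> \<phi> x"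
    using \<phi> unfolding algebra_iso_def by auto
  let ?\<psi> = "inv_into (carrier A) \<phi>"
  have inj: "inj_on \<phi> (carrier A)" and im: "\<phi> ` carrier A = carrier B"
    using r unfolding ring_iso_def bij_betw_def by auto
  have "?\<psi> \<in> ring_iso B A" by (rule ring_iso_set_sym[OF A.ring_axioms r])
  moreover have "?\<psi> (c \<odot>\<^bsub>B\<^esub> y) = c \<odot>\<^bsub>A\<^esub> ?\<psi> y" if c: "c \<in> carrier K" and y: "y \<in> carrier B" for c y
  proof -
    have x: "?\<psi> y \<in> carrier A" "\<phi> (?\<psi> y) = y" using y im inv_into_into f_inv_into_f by (metis, metis)
    have "c \<odot>\<^bsub>B\<^esub> y = \<phi> (c \<odot>\<^bsub>A\<^esub> ?\<psi> y)" using sm[OF c x(1)] x(2) by simp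
    then show ?thesis using inj c x(1) by (simp add: inv_into_f_f)
  qed
  ultimately show ?thesis unfolding algebra_iso_def by blast
qed

lemma algebra_isomorphic_sym:
  "\<lbrakk>assoc_alg K A; algebra_isomorphic K A B\<rbrakk> \<Longrightarrow> algebra_isomorphic K B A"
  unfolding algebra_isomorphic_def using algebra_iso_inv by blast

lemma ring_same_operations:
  assumes "ring A" "carrier B = carrier A" "(\<otimes>\<^bsub>B\<^esub>) = (\<otimes>\<^bsub>A\<^esub>)" "(\<oplus>\<^bsub>B\<^esub>) = (\<oplus>\<^bsub>A\<^esub>)" "\<one>\<^bsub>B\<^esub> = \<one>\<^bsub>A\<^esub>" "\<zero>\<^bsub>B\<^esub> = \<zero>\<^bsub>A\<^esub>"
  shows "ring B"
proof -
  interpret ring A by fact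
  have "\<exists>y\<in>carrier A. y \<oplus>\<^bsub>A\<^esub> x = \<zero>\<^bsub>A\<^esub>" if "x \<in> carrier A" for x
    using that l_neg by blast
  then have "abelian_group B"
    by (intro abelian_groupI) (simp_all add: assms a_ac)
  moreover have "Group.monoid B"
    by (rule monoidI) (simp_all add: assms m_assoc)
  ultimately show ?thesis
    by (rule ringI) (simp_all add: assms l_distr r_distr)
qed

subsection \<open>Cosets and quotients\<close>

lemma a_coset_eq_iff:
  assumes "additive_subgroup F H" "abelian_group H" "x \<in> carrier H" "y \<in> carrier H"
  shows "F +>\<^bsub>H\<^esub> x = F +>\<^bsub>H\<^esub> y \<longleftrightarrow> x \<ominus>\<^bsub>H\<^esub> y \<in> F"
proof -
  interpret abelian_subgroup F H
    using assms by (metis abelian_subgroupI3)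
  show ?thesis
    using assms a_rcos_module[of y x] a_repr_independence[of x F y] a_rcos_self[of x] a_subgroup
    unfolding a_minus_def by metis
qed

lemma quotient_algebra_simps:
  "carrier (quotient_algebra A I) = a_rcosets\<^bsub>A\<^esub> I"
  "\<one>\<^bsub>quotient_algebra A I\<^esub> = I +>\<^bsub>A\<^esub> \<one>\<^bsub>A\<^esub>"
  "\<zero>\<^bsub>quotient_algebra A I\<^esub> = I"
  "(\<otimes>\<^bsub>quotient_algebra A I\<^esub>) = rcoset_mult A I"
  "(\<oplus>\<^bsub>quotient_algebra A I\<^esub>) = (<+>\<^bsub>A\<^esub>)"
  by (simp_all add: quotient_algebra_def FactRing_def)

locale alg_ideal = assoc_alg K A + ideal I A
  for K :: "('k, 'm) ring_scheme" (structure) and A :: "('k, 'a) module" (structure) and I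
begin

abbreviation cls where "cls x \<equiv> I +>\<^bsub>A\<^esub> x"

lemma cls_closed: "x \<in> carrier A \<Longrightarrow> cls x \<in> carrier (quotient_algebra A I)"
  by (simp add: quotient_algebra_simps a_rcosetsI[OF a_subset])

lemma cls_surj: "U \<in> carrier (quotient_algebra A I) \<Longrightarrow> \<exists>x\<in>carrier A. U = cls x"
  by (auto simp: quotient_algebra_simps A_RCOSETS_defs a_r_coset_def)

lemma cls_eq_iff: "\<lbrakk>x \<in> carrier A; y \<in> carrier A\<rbrakk> \<Longrightarrow> cls x = cls y \<longleftrightarrow> x \<ominus>\<^bsub>A\<^esub> y \<in> I"
  by (rule a_coset_eq_iff) (auto simp: is_additive_subgroup is_abelian_group)

lemma cls_mult: "\<lbrakk>x \<in> carrier A; y \<in> carrier A\<rbrakk> \<Longrightarrow> cls x \<otimes>\<^bsub>quotient_algebra A I\<^esub> cls y = cls (x \<otimes>\<^bsub>A\<^esub> y)"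
  by (simp add: quotient_algebra_simps rcoset_mult_add)

lemma cls_add: "\<lbrakk>x \<in> carrier A; y \<in> carrier A\<rbrakk> \<Longrightarrow> cls x \<oplus>\<^bsub>quotient_algebra A I\<^esub> cls y = cls (x \<oplus>\<^bsub>A\<^esub> y)"
  by (simp add: quotient_algebra_simps a_rcos_sum)

lemma cls_zero: "cls \<zero>\<^bsub>A\<^esub> = \<zero>\<^bsub>quotient_algebra A I\<^esub>"
  by (simp add: quotient_algebra_simps a_subset)

lemma cls_one: "cls \<one>\<^bsub>A\<^esub> = \<one>\<^bsub>quotient_algebra A I\<^esub>"
  by (simp add: quotient_algebra_simps)

lemma cls_smult:
  assumes c: "c \<in> carrier K" and x: "x \<in> carrier A"
  shows "c \<odot>\<^bsub>quotient_algebra A I\<^esub> cls x = cls (c \<odot>\<^bsub>A\<^esub> x)"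
proof -
  have "cls (c \<odot>\<^bsub>A\<^esub> y) = cls (c \<odot>\<^bsub>A\<^esub> x)" if y: "y \<in> cls x" for y
  proof -
    have yA: "y \<in> carrier A" using y x a_elemrcos_carrier by blast
    have "y \<ominus>\<^bsub>A\<^esub> x \<in> I" using y x yA a_rcos_module by (simp add: a_minus_def)
    then have "c \<odot>\<^bsub>A\<^esub> (y \<ominus>\<^bsub>A\<^esub> x) \<in> I" using c by (simp add: ideal_smult_closed ideal_axioms)
    moreover have "c \<odot>\<^bsub>A\<^esub> (y \<ominus>\<^bsub>A\<^esub> x) = c \<odot>\<^bsub>A\<^esub> y \<ominus>\<^bsub>A\<^esub> c \<odot>\<^bsub>A\<^esub> x"
      using c x yA by (simp add: a_minus_def smult_r_distr smult_r_minus)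
    ultimately show ?thesis using c x yA by (simp add: cls_eq_iff)
  qed
  then have "(\<Union>y\<in>cls x. cls (c \<odot>\<^bsub>A\<^esub> y)) = cls (c \<odot>\<^bsub>A\<^esub> x)"
    using a_rcos_self[OF x] by blast
  then show ?thesis by (simp add: quotient_algebra_def)
qed

lemma quotient_assoc_alg: "assoc_alg K (quotient_algebra A I)"
proof -
  let ?Q = "quotient_algebra A I"
  interpret Q: ring "A Quot I" by (rule quotient_is_ring)
  have ri: "ring ?Q"
    by (rule ring_same_operations[OF Q.ring_axioms]) (simp_all add: quotient_algebra_def)
  interpret QA: ring ?Q by fact
  have "module K ?Q"
  proof (rule moduleI[OF R.is_cring QA.is_abelian_group])
  qed (auto dest!: cls_surj simp: cls_smult cls_add cls_closed smult_l_distr smult_r_distr smult_assoc1)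
  then show ?thesis
  proof (rule assoc_alg.intro[OF _ ri], unfold_locales)
    fix c U W assume c: "c \<in> carrier K" and "U \<in> carrier ?Q" "W \<in> carrier ?Q"
    then obtain x y where xy: "x \<in> carrier A" "y \<in> carrier A" and U: "U = cls x" and W: "W = cls y"
      using cls_surj by metis
    show "c \<odot>\<^bsub>?Q\<^esub> U \<otimes>\<^bsub>?Q\<^esub> W = c \<odot>\<^bsub>?Q\<^esub> (U \<otimes>\<^bsub>?Q\<^esub> W)"
      and "U \<otimes>\<^bsub>?Q\<^esub> (c \<odot>\<^bsub>?Q\<^esub> W) = c \<odot>\<^bsub>?Q\<^esub> (U \<otimes>\<^bsub>?Q\<^esub> W)"
      using c xy unfolding U W by (simp_all add: cls_smult cls_mult smult_mult_left smult_mult_right)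
  qed
qed

lemma cls_alg_hom: "cls \<in> alg_hom K A (quotient_algebra A I)"
  by (rule alg_homI) (simp_all add: cls_closed cls_mult cls_add cls_one cls_smult)

end

text \<open>The first isomorphism theorem.\<close>

lemma surjective_alg_hom_quotient:
  assumes "assoc_alg K A" "assoc_alg K D" and \<psi>: "\<psi> \<in> alg_hom K A D"
    and surj: "\<psi> ` carrier A = carrier D" and I: "ideal I A"
    and ker: "\<And>x. x \<in> carrier A \<Longrightarrow> \<psi> x = \<zero>\<^bsub>D\<^esub> \<longleftrightarrow> x \<in> I"
  shows "algebra_isomorphic K D (quotient_algebra A I)"
proof -
  interpret D: assoc_alg K D by fact
  interpret A: assoc_alg K A by fact
  interpret alg_ideal K A I using I by (simp add: alg_ideal_def A.assoc_alg_axioms)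
  note \<psi>D = alg_homD[OF \<psi>]
  have eq: "cls x = cls y \<longleftrightarrow> \<psi> x = \<psi> y" if "x \<in> carrier A" "y \<in> carrier A" for x y
  proof -
    have "\<psi> (x \<ominus>\<^bsub>A\<^esub> y) = \<psi> x \<ominus>\<^bsub>D\<^esub> \<psi> y"
      using that by (intro additive_map_minus) (auto simp: \<psi>D A.is_abelian_group D.is_abelian_group)
    then show ?thesis
      using that ker[of "x \<ominus>\<^bsub>A\<^esub> y"] \<psi>D(2) by (simp add: cls_eq_iff)
  qed
  define s where "s d = (SOME x. x \<in> carrier A \<and> \<psi> x = d)" for d
  have s: "s d \<in> carrier A" "\<psi> (s d) = d" if "d \<in> carrier D" for d
  proof -
    from that obtain x where "x \<in> carrier A \<and> \<psi> x = d" unfolding surj[symmetric] by auto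
    then have "s d \<in> carrier A \<and> \<psi> (s d) = d" unfolding s_def by (rule someI)
    then show "s d \<in> carrier A" "\<psi> (s d) = d" by auto
  qed
  have cs: "cls (s d) = cls x" if "x \<in> carrier A" "\<psi> x = d" for x d
    using that s[of d] \<psi>D(2) eq by blast
  have "(\<lambda>d. cls (s d)) \<in> alg_hom K D (quotient_algebra A I)"
  proof (rule alg_homI)
    fix x y assume xy: "x \<in> carrier D" "y \<in> carrier D"
    show "cls (s (x \<otimes>\<^bsub>D\<^esub> y)) = cls (s x) \<otimes>\<^bsub>quotient_algebra A I\<^esub> cls (s y)"
      using xy by (subst cls_mult) (auto simp: s \<psi>D intro!: cs)
    show "cls (s (x \<oplus>\<^bsub>D\<^esub> y)) = cls (s x) \<oplus>\<^bsub>quotient_algebra A I\<^esub> cls (s y)"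
      using xy by (subst cls_add) (auto simp: s \<psi>D intro!: cs)
  next
    fix c x assume "c \<in> carrier K" "x \<in> carrier D"
    then show "cls (s (c \<odot>\<^bsub>D\<^esub> x)) = c \<odot>\<^bsub>quotient_algebra A I\<^esub> cls (s x)"
      by (subst cls_smult) (auto simp: s \<psi>D intro!: cs)
  next
    show "cls (s \<one>\<^bsub>D\<^esub>) = \<one>\<^bsub>quotient_algebra A I\<^esub>"
      unfolding cls_one[symmetric] by (rule cs) (simp_all add: \<psi>D)
  qed (simp add: s cls_closed)
  moreover have "bij_betw (\<lambda>d. cls (s d)) (carrier D) (carrier (quotient_algebra A I))"
    unfolding bij_betw_def
  proof
    show "inj_on (\<lambda>d. cls (s d)) (carrier D)"
      by (rule inj_onI) (metis eq s)
    show "(\<lambda>d. cls (s d)) ` carrier D = carrier (quotient_algebra A I)"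
    proof (intro equalityI subsetI)
      fix U assume "U \<in> carrier (quotient_algebra A I)"
      then obtain x where x: "x \<in> carrier A" "U = cls x" using cls_surj by blast
      then have "U = cls (s (\<psi> x))" by (simp add: cs)
      with x \<psi>D(2) show "U \<in> (\<lambda>d. cls (s d)) ` carrier D" by blast
    qed (use s cls_closed in blast)
  qed
  ultimately show ?thesis unfolding algebra_isomorphic_def algebra_iso_eq by blast
qed

section \<open>Polynomials over an algebra\<close>

text \<open>The monomial \<open>a t\<^sup>i\<close>. It agrees with \<open>up_ring.monom\<close> for coefficients in the carrier.\<close>

definition mon :: "('a, 'm) ring_scheme \<Rightarrow> nat \<Rightarrow> 'a \<Rightarrow> nat \<Rightarrow> 'a" where
  "mon A i a = (\<lambda>k. if k = i then a else \<zero>\<^bsub>A\<^esub>)"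

lemma monom_eq_mon: "a \<in> carrier A \<Longrightarrow> up_ring.monom (UP A) a i = mon A i a"
  by (auto simp: UP_def mon_def)

lemma mon_in_up: "\<lbrakk>a \<in> carrier A; \<zero>\<^bsub>A\<^esub> \<in> carrier A\<rbrakk> \<Longrightarrow> mon A i a \<in> up A"
  unfolding up_def mon_def by (auto intro!: exI[of _ i])

lemma poly_algebra_simps:
  "carrier (poly_algebra A) = up A"
  "\<zero>\<^bsub>poly_algebra A\<^esub> = (\<lambda>i. \<zero>\<^bsub>A\<^esub>)"
  "\<one>\<^bsub>poly_algebra A\<^esub> = mon A 0 \<one>\<^bsub>A\<^esub>"
  "\<lbrakk>x \<in> up A; y \<in> up A\<rbrakk> \<Longrightarrow> x \<oplus>\<^bsub>poly_algebra A\<^esub> y = (\<lambda>i. x i \<oplus>\<^bsub>A\<^esub> y i)"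
  "\<lbrakk>x \<in> up A; y \<in> up A\<rbrakk> \<Longrightarrow> x \<otimes>\<^bsub>poly_algebra A\<^esub> y = (\<lambda>k. \<Oplus>\<^bsub>A\<^esub>i\<in>{..k}. x i \<otimes>\<^bsub>A\<^esub> y (k - i))"
  "p \<odot>\<^bsub>poly_algebra A\<^esub> x = (\<lambda>k. \<Oplus>\<^bsub>A\<^esub>i\<in>{..k}. p i \<odot>\<^bsub>A\<^esub> x (k - i))"
  by (simp_all add: poly_algebra_def UP_def mon_def fun_eq_iff)

lemma UP_simps:
  "carrier (UP A) = up A"
  "\<zero>\<^bsub>UP A\<^esub> = (\<lambda>i. \<zero>\<^bsub>A\<^esub>)"
  "\<one>\<^bsub>UP A\<^esub> = mon A 0 \<one>\<^bsub>A\<^esub>"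
  "\<lbrakk>x \<in> up A; y \<in> up A\<rbrakk> \<Longrightarrow> x \<oplus>\<^bsub>UP A\<^esub> y = (\<lambda>i. x i \<oplus>\<^bsub>A\<^esub> y i)"
  "\<lbrakk>x \<in> up A; y \<in> up A\<rbrakk> \<Longrightarrow> x \<otimes>\<^bsub>UP A\<^esub> y = (\<lambda>k. \<Oplus>\<^bsub>A\<^esub>i\<in>{..k}. x i \<otimes>\<^bsub>A\<^esub> y (k - i))"
  by (simp_all add: UP_def mon_def fun_eq_iff)

lemma upD: "x \<in> up A \<Longrightarrow> x i \<in> carrier A"
  by (rule mem_upD)

lemma up_bound: "x \<in> up A \<Longrightarrow> \<exists>N. \<forall>i>N. x i = \<zero>\<^bsub>A\<^esub>"
  unfolding up_def by (auto simp: bound_def)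

lemma up_iff: "x \<in> up A \<longleftrightarrow> (\<forall>i. x i \<in> carrier A) \<and> (\<exists>N. \<forall>i>N. x i = \<zero>\<^bsub>A\<^esub>)"
  unfolding up_def by (auto simp: bound_def)

lemma up_map:
  assumes "x \<in> up A" "\<And>a. a \<in> carrier A \<Longrightarrow> f a \<in> carrier B" "f \<zero>\<^bsub>A\<^esub> = \<zero>\<^bsub>B\<^esub>"
  shows "(\<lambda>i. f (x i)) \<in> up B"
  using assms unfolding up_iff by metis

lemma up_shift: "\<lbrakk>x \<in> up A\<rbrakk> \<Longrightarrow> (\<lambda>i. x (Suc i)) \<in> up A"
  unfolding up_iff by (metis less_SucI)

lemma up_induct [consumes 2, case_names zero mon add]:
  assumes "abelian_group A" "f \<in> up A"
    and zero: "P (\<lambda>i. \<zero>\<^bsub>A\<^esub>)"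
    and mon: "\<And>i. P (mon A i (f i))"
    and add: "\<And>x y. \<lbrakk>x \<in> up A; y \<in> up A; P x; P y\<rbrakk> \<Longrightarrow> P (\<lambda>i. x i \<oplus>\<^bsub>A\<^esub> y i)"
  shows "P f"
proof -
  interpret A: abelian_group A by fact
  obtain N where N: "\<And>i. i > N \<Longrightarrow> f i = \<zero>\<^bsub>A\<^esub>" using up_bound[OF assms(2)] by blast
  have fc: "f i \<in> carrier A" for i using assms(2) by (rule upD)
  have "P (\<lambda>i. if i < n then f i else \<zero>\<^bsub>A\<^esub>)" for n
  proof (induction n)
    case (Suc n)
    have "(\<lambda>i. if i < n then f i else \<zero>\<^bsub>A\<^esub>) \<in> up A" using fc unfolding up_iff by (auto intro!: exI[of _ n])
    moreover have "mon A n (f n) \<in> up A" using fc by (simp add: mon_in_up)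
    ultimately have "P (\<lambda>i. (if i < n then f i else \<zero>\<^bsub>A\<^esub>) \<oplus>\<^bsub>A\<^esub> mon A n (f n) i)"
      using Suc mon by (rule add)
    also have "(\<lambda>i. (if i < n then f i else \<zero>\<^bsub>A\<^esub>) \<oplus>\<^bsub>A\<^esub> mon A n (f n) i) = (\<lambda>i. if i < Suc n then f i else \<zero>\<^bsub>A\<^esub>)"
      using fc by (auto simp: fun_eq_iff mon_def less_Suc_eq)
    finally show ?case .
  qed (simp add: zero)
  moreover have "(\<lambda>i. if i < Suc N then f i else \<zero>\<^bsub>A\<^esub>) = f" using N by (force simp: fun_eq_iff)
  ultimately show ?thesis by metis
qed

lemma (in ring) UP_ring_ring: "ring (UP R)"
  by (rule UP_ring.UP_ring) (rule UP_ring.intro, rule ring_axioms)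

context assoc_alg
begin

lemma poly_ring: "ring (poly_algebra A)"
  by (rule ring_same_operations[OF UP_ring_ring]) (simp_all add: poly_algebra_def)

lemma UP_K_cring: "cring (UP K)"
  by (rule UP_cring.UP_cring) (rule UP_cring.intro, rule R.is_cring)

lemma poly_a_inv: "x \<in> up A \<Longrightarrow> \<ominus>\<^bsub>poly_algebra A\<^esub> x = (\<lambda>i. \<ominus>\<^bsub>A\<^esub> x i)"
proof -
  assume x: "x \<in> up A"
  interpret P: ring "poly_algebra A" by (rule poly_ring)
  have "(\<lambda>i. \<ominus>\<^bsub>A\<^esub> x i) \<in> up A" using x by (rule up_a_inv_closed)
  then show ?thesis
    using x by (intro P.minus_equality) (auto simp: poly_algebra_simps upD M.l_neg)
qed

lemma poly_minus: "\<lbrakk>x \<in> up A; y \<in> up A\<rbrakk> \<Longrightarrow> x \<ominus>\<^bsub>poly_algebra A\<^esub> y = (\<lambda>i. x i \<ominus>\<^bsub>A\<^esub> y i)"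
  by (simp add: a_minus_def poly_a_inv poly_algebra_simps up_a_inv_closed)

lemma mon_closed: "a \<in> carrier A \<Longrightarrow> mon A i a \<in> up A"
  by (simp add: mon_in_up)

lemma mon_add: "\<lbrakk>a \<in> carrier A; b \<in> carrier A\<rbrakk> \<Longrightarrow> mon A i a \<oplus>\<^bsub>poly_algebra A\<^esub> mon A i b = mon A i (a \<oplus>\<^bsub>A\<^esub> b)"
  by (auto simp: poly_algebra_simps mon_closed) (simp add: mon_def fun_eq_iff)

lemma mon_mult:
  assumes "a \<in> carrier A" "b \<in> carrier A"
  shows "mon A i a \<otimes>\<^bsub>poly_algebra A\<^esub> mon A j b = mon A (i + j) (a \<otimes>\<^bsub>A\<^esub> b)"
proof -
  have "(\<Oplus>\<^bsub>A\<^esub>l\<in>{..k}. mon A i a l \<otimes>\<^bsub>A\<^esub> mon A j b (k - l)) = mon A (i + j) (a \<otimes>\<^bsub>A\<^esub> b) k" for k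
  proof (cases "i \<le> k")
    case True
    have "(\<Oplus>\<^bsub>A\<^esub>l\<in>{..k}. mon A i a l \<otimes>\<^bsub>A\<^esub> mon A j b (k - l))
        = (\<Oplus>\<^bsub>A\<^esub>l\<in>{..k}. if i = l then a \<otimes>\<^bsub>A\<^esub> mon A j b (k - l) else \<zero>\<^bsub>A\<^esub>)"
      using assms by (intro M.finsum_cong') (auto simp: mon_def)
    also have "\<dots> = a \<otimes>\<^bsub>A\<^esub> mon A j b (k - i)"
      using True assms by (subst M.finsum_singleton) (auto simp: mon_def)
    finally show ?thesis using True assms by (auto simp: mon_def)
  next
    case False
    have "(\<Oplus>\<^bsub>A\<^esub>l\<in>{..k}. mon A i a l \<otimes>\<^bsub>A\<^esub> mon A j b (k - l)) = (\<Oplus>\<^bsub>A\<^esub>l\<in>{..k}. \<zero>\<^bsub>A\<^esub>)"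
      using False assms by (intro M.finsum_cong') (auto simp: mon_def)
    then show ?thesis using False by (simp add: mon_def)
  qed
  then show ?thesis using assms by (simp add: poly_algebra_simps mon_closed)
qed

lemma smult_poly_mon:
  assumes "c \<in> carrier K" "f \<in> up A"
  shows "mon K i c \<odot>\<^bsub>poly_algebra A\<^esub> f = (\<lambda>k. if i \<le> k then c \<odot>\<^bsub>A\<^esub> f (k - i) else \<zero>\<^bsub>A\<^esub>)"
proof
  fix k
  have fc: "f j \<in> carrier A" for j using assms(2) by (rule upD)
  show "(mon K i c \<odot>\<^bsub>poly_algebra A\<^esub> f) k = (if i \<le> k then c \<odot>\<^bsub>A\<^esub> f (k - i) else \<zero>\<^bsub>A\<^esub>)"
  proof (cases "i \<le> k")
    case True
    have "(\<Oplus>\<^bsub>A\<^esub>l\<in>{..k}. mon K i c l \<odot>\<^bsub>A\<^esub> f (k - l)) = (\<Oplus>\<^bsub>A\<^esub>l\<in>{..k}. if i = l then c \<odot>\<^bsub>A\<^esub> f (k - l) else \<zero>\<^bsub>A\<^esub>)"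
      using assms fc by (intro M.finsum_cong') (auto simp: mon_def)
    also have "\<dots> = c \<odot>\<^bsub>A\<^esub> f (k - i)"
      using True assms fc by (subst M.finsum_singleton) auto
    finally show ?thesis using True by (simp add: poly_algebra_simps)
  next
    case False
    have "(\<Oplus>\<^bsub>A\<^esub>l\<in>{..k}. mon K i c l \<odot>\<^bsub>A\<^esub> f (k - l)) = (\<Oplus>\<^bsub>A\<^esub>l\<in>{..k}. \<zero>\<^bsub>A\<^esub>)"
      using False assms fc by (intro M.finsum_cong') (auto simp: mon_def)
    then show ?thesis using False by (simp add: poly_algebra_simps)
  qed
qed

lemma smult_mon_mon:
  assumes "c \<in> carrier K" "a \<in> carrier A"
  shows "mon K i c \<odot>\<^bsub>poly_algebra A\<^esub> mon A j a = mon A (i + j) (c \<odot>\<^bsub>A\<^esub> a)"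
  using assms by (auto simp: smult_poly_mon mon_closed) (auto simp: mon_def fun_eq_iff)

lemma poly_assoc_alg: "assoc_alg (UP K) (poly_algebra A)"
proof -
  let ?P = "poly_algebra A"
  interpret P: ring ?P by (rule poly_ring)
  interpret UK: cring "UP K" by (rule UP_K_cring)
  \<comment> \<open>The polynomials with scalar coefficients are central elements of \<open>A[t]\<close>, and scalar multiplication
    is multiplication by them: the module axioms become ring axioms.\<close>
  define s where "s p = (\<lambda>i. p i \<odot>\<^bsub>A\<^esub> \<one>\<^bsub>A\<^esub>)" for p :: "nat \<Rightarrow> 'k"
  have sc: "s p \<in> up A" if "p \<in> up K" for p
    unfolding s_def by (rule up_map[OF that]) auto
  have sm: "p \<odot>\<^bsub>?P\<^esub> f = s p \<otimes>\<^bsub>?P\<^esub> f" if "p \<in> up K" "f \<in> up A" for p f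
    using that sc[OF that(1)] upD[OF that(1)] upD[OF that(2)]
    by (auto simp: poly_algebra_simps s_def fun_eq_iff smult_mult_left intro!: M.finsum_cong')
  have central: "f \<otimes>\<^bsub>?P\<^esub> s p = s p \<otimes>\<^bsub>?P\<^esub> f" if p: "p \<in> up K" and f: "f \<in> up A" for p f
  proof -
    have "(\<Oplus>\<^bsub>A\<^esub>i\<in>{..k}. f i \<otimes>\<^bsub>A\<^esub> s p (k - i)) = (\<Oplus>\<^bsub>A\<^esub>i\<in>{..k}. s p i \<otimes>\<^bsub>A\<^esub> f (k - i))" for k
    proof -
      have c: "p i \<in> carrier K" "f i \<in> carrier A" for i using upD p f by (blast, blast)
      have "(\<Oplus>\<^bsub>A\<^esub>i\<in>{..k}. f i \<otimes>\<^bsub>A\<^esub> s p (k - i)) = (\<Oplus>\<^bsub>A\<^esub>i\<in>(\<lambda>i. k - i) ` {..k}. f i \<otimes>\<^bsub>A\<^esub> s p (k - i))"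
      proof -
        have "(\<lambda>i. k - i) ` {..k} = {..k}"
          by (auto simp: image_iff) (metis atMost_iff diff_diff_cancel diff_le_self)
        then show ?thesis by simp
      qed
      also have "\<dots> = (\<Oplus>\<^bsub>A\<^esub>i\<in>{..k}. f (k - i) \<otimes>\<^bsub>A\<^esub> s p (k - (k - i)))"
        using c by (intro M.finsum_reindex) (auto simp: s_def inj_on_def)
      also have "\<dots> = (\<Oplus>\<^bsub>A\<^esub>i\<in>{..k}. s p i \<otimes>\<^bsub>A\<^esub> f (k - i))"
        using c by (intro M.finsum_cong') (auto simp: s_def smult_mult_left smult_mult_right)
      finally show ?thesis .
    qed
    then show ?thesis using p f sc by (simp add: poly_algebra_simps)
  qed
  have s_add: "s (p \<oplus>\<^bsub>UP K\<^esub> r) = s p \<oplus>\<^bsub>?P\<^esub> s r" if "p \<in> up K" "r \<in> up K" for p r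
    using that upD[OF that(1)] upD[OF that(2)] sc[OF that(1)] sc[OF that(2)]
    by (simp add: poly_algebra_simps UP_simps) (simp add: s_def smult_l_distr)
  have s_mult: "s (p \<otimes>\<^bsub>UP K\<^esub> r) = s p \<otimes>\<^bsub>?P\<^esub> s r" if pr: "p \<in> up K" "r \<in> up K" for p r
  proof -
    have c: "p i \<in> carrier K" "r i \<in> carrier K" for i using upD pr by (blast, blast)
    have "(\<Oplus>\<^bsub>K\<^esub>i\<in>{..k}. p i \<otimes>\<^bsub>K\<^esub> r (k - i)) \<odot>\<^bsub>A\<^esub> \<one>\<^bsub>A\<^esub> = (\<Oplus>\<^bsub>A\<^esub>i\<in>{..k}. s p i \<otimes>\<^bsub>A\<^esub> s r (k - i))" for k
    proof -
      have "(\<Oplus>\<^bsub>K\<^esub>i\<in>{..k}. p i \<otimes>\<^bsub>K\<^esub> r (k - i)) \<odot>\<^bsub>A\<^esub> \<one>\<^bsub>A\<^esub> = (\<Oplus>\<^bsub>A\<^esub>i\<in>{..k}. (p i \<otimes>\<^bsub>K\<^esub> r (k - i)) \<odot>\<^bsub>A\<^esub> \<one>\<^bsub>A\<^esub>)"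
        using c by (intro additive_map_finsum) (auto simp: R.is_abelian_group is_abelian_group smult_l_distr)
      also have "\<dots> = (\<Oplus>\<^bsub>A\<^esub>i\<in>{..k}. s p i \<otimes>\<^bsub>A\<^esub> s r (k - i))"
        using c by (intro M.finsum_cong') (auto simp: s_def smult_mult_left smult_assoc1)
      finally show ?thesis .
    qed
    then show ?thesis using pr sc by (simp add: poly_algebra_simps UP_simps) (simp add: s_def)
  qed
  have s_one: "s \<one>\<^bsub>UP K\<^esub> = \<one>\<^bsub>?P\<^esub>" by (auto simp: s_def UP_simps poly_algebra_simps mon_def fun_eq_iff)
  have PC: "carrier ?P = up A" "carrier (UP K) = up K" by (simp_all add: poly_algebra_simps UP_simps)
  note [simp] = PC
  note cl = P.m_closed[unfolded PC] P.a_closed[unfolded PC] UK.m_closed[unfolded PC] UK.a_closed[unfolded PC]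
  have "module (UP K) ?P"
  proof (rule moduleI[OF UK.is_cring P.is_abelian_group])
    fix p f assume "p \<in> carrier (UP K)" "f \<in> carrier ?P"
    then show "p \<odot>\<^bsub>?P\<^esub> f \<in> carrier ?P" using cl by (simp add: sm sc)
  next
    fix p r f assume "p \<in> carrier (UP K)" "r \<in> carrier (UP K)" "f \<in> carrier ?P"
    then show "(p \<oplus>\<^bsub>UP K\<^esub> r) \<odot>\<^bsub>?P\<^esub> f = p \<odot>\<^bsub>?P\<^esub> f \<oplus>\<^bsub>?P\<^esub> r \<odot>\<^bsub>?P\<^esub> f"
      and "(p \<otimes>\<^bsub>UP K\<^esub> r) \<odot>\<^bsub>?P\<^esub> f = p \<odot>\<^bsub>?P\<^esub> (r \<odot>\<^bsub>?P\<^esub> f)"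
      using cl P.l_distr[of "s p" "s r" f] P.m_assoc[of "s p" "s r" f] by (simp_all add: sm sc s_add s_mult)
  next
    fix p f h assume "p \<in> carrier (UP K)" "f \<in> carrier ?P" "h \<in> carrier ?P"
    then show "p \<odot>\<^bsub>?P\<^esub> (f \<oplus>\<^bsub>?P\<^esub> h) = p \<odot>\<^bsub>?P\<^esub> f \<oplus>\<^bsub>?P\<^esub> p \<odot>\<^bsub>?P\<^esub> h"
      using cl P.r_distr[of f h "s p"] by (simp add: sm sc)
  next
    fix f assume "f \<in> carrier ?P"
    then show "\<one>\<^bsub>UP K\<^esub> \<odot>\<^bsub>?P\<^esub> f = f" using UK.one_closed P.l_one[of f] by (simp add: sm s_one)
  qed
  then show ?thesis
  proof (rule assoc_alg.intro[OF _ P.ring_axioms], unfold_locales)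
    fix p f h assume a: "p \<in> carrier (UP K)" "f \<in> carrier ?P" "h \<in> carrier ?P"
    then show "p \<odot>\<^bsub>?P\<^esub> f \<otimes>\<^bsub>?P\<^esub> h = p \<odot>\<^bsub>?P\<^esub> (f \<otimes>\<^bsub>?P\<^esub> h)"
      using cl P.m_assoc[of "s p" f h] by (simp add: sm sc)
    show "f \<otimes>\<^bsub>?P\<^esub> (p \<odot>\<^bsub>?P\<^esub> h) = p \<odot>\<^bsub>?P\<^esub> (f \<otimes>\<^bsub>?P\<^esub> h)"
      using a cl P.m_assoc[of "s p" f h] P.m_assoc[of f "s p" h] by (simp add: sm sc central)
  qed
qed

end

text \<open>Extension of scalars: an algebra over \<open>K[t]\<close> that receives a \<open>K\<close>-linear homomorphism from \<open>A\<close>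
  receives a \<open>K[t]\<close>-linear one from \<open>A[t]\<close>.\<close>

definition poly_ext :: "('k, 'm) ring_scheme \<Rightarrow> ('k, 'a) module \<Rightarrow> (nat \<Rightarrow> 'k, 'd) module \<Rightarrow> ('a \<Rightarrow> 'd) \<Rightarrow> (nat \<Rightarrow> 'a) \<Rightarrow> 'd" where
  "poly_ext K A D \<phi> f = (\<Oplus>\<^bsub>D\<^esub>i\<in>{i. f i \<noteq> \<zero>\<^bsub>A\<^esub>}. mon K i \<one>\<^bsub>K\<^esub> \<odot>\<^bsub>D\<^esub> \<phi> (f i))"

locale poly_extension = A: assoc_alg K A + D: assoc_alg "UP K" D
  for K :: "('k, 'm) ring_scheme" and A :: "('k, 'a) module" and D :: "(nat \<Rightarrow> 'k, 'd) module" +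
  fixes \<phi> :: "'a \<Rightarrow> 'd"
  assumes hom: "\<phi> \<in> ring_hom A D"
    and lin: "\<lbrakk>c \<in> carrier K; a \<in> carrier A\<rbrakk> \<Longrightarrow> \<phi> (c \<odot>\<^bsub>A\<^esub> a) = mon K 0 c \<odot>\<^bsub>D\<^esub> \<phi> a"
begin

abbreviation "ext \<equiv> poly_ext K A D \<phi>"

lemma \<phi>_simps [simp]:
  "a \<in> carrier A \<Longrightarrow> \<phi> a \<in> carrier D"
  "\<phi> \<one>\<^bsub>A\<^esub> = \<one>\<^bsub>D\<^esub>"
  "\<phi> \<zero>\<^bsub>A\<^esub> = \<zero>\<^bsub>D\<^esub>"
  "\<lbrakk>a \<in> carrier A; b \<in> carrier A\<rbrakk> \<Longrightarrow> \<phi> (a \<oplus>\<^bsub>A\<^esub> b) = \<phi> a \<oplus>\<^bsub>D\<^esub> \<phi> b"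
  "\<lbrakk>a \<in> carrier A; b \<in> carrier A\<rbrakk> \<Longrightarrow> \<phi> (a \<otimes>\<^bsub>A\<^esub> b) = \<phi> a \<otimes>\<^bsub>D\<^esub> \<phi> b"
  using hom ring_hom_closed[OF hom] ring_hom_add[OF hom]
    additive_map_zero[OF A.is_abelian_group D.is_abelian_group, of \<phi>]
  by (simp_all add: ring_hom_one ring_hom_mult)

lemma mon_mult_UP:
  "\<lbrakk>c \<in> carrier K; c' \<in> carrier K\<rbrakk> \<Longrightarrow> mon K i c \<otimes>\<^bsub>UP K\<^esub> mon K j c' = mon K (i + j) (c \<otimes>\<^bsub>K\<^esub> c')"
  using UP_ring.monom_mult[OF UP_ring.intro[OF A.R.ring_axioms], of c c' i j] by (simp add: monom_eq_mon)

lemma t_power_closed [simp]: "c \<in> carrier K \<Longrightarrow> mon K i c \<in> carrier (UP K)"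
  by (simp add: UP_simps mon_in_up)

lemma ext_eq:
  assumes "f \<in> up A" "finite S" "{i. f i \<noteq> \<zero>\<^bsub>A\<^esub>} \<subseteq> S"
  shows "ext f = (\<Oplus>\<^bsub>D\<^esub>i\<in>S. mon K i \<one>\<^bsub>K\<^esub> \<odot>\<^bsub>D\<^esub> \<phi> (f i))"
  unfolding poly_ext_def using assms upD[OF assms(1)]
  by (intro D.M.add.finprod_mono_neutral_cong_left) auto

lemma support_finite: "f \<in> up A \<Longrightarrow> finite {i. f i \<noteq> \<zero>\<^bsub>A\<^esub>}"
proof -
  assume "f \<in> up A"
  then obtain N where "\<forall>i>N. f i = \<zero>\<^bsub>A\<^esub>" using up_bound by blast
  then have "{i. f i \<noteq> \<zero>\<^bsub>A\<^esub>} \<subseteq> {..N}" by (metis (mono_tags, lifting) atMost_iff leI mem_Collect_eq subsetI)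
  then show ?thesis by (rule finite_subset) simp
qed

lemma ext_closed: "f \<in> up A \<Longrightarrow> ext f \<in> carrier D"
  unfolding poly_ext_def by (intro D.M.finsum_closed) (auto simp: upD)

lemma ext_mon: "a \<in> carrier A \<Longrightarrow> ext (mon A i a) = mon K i \<one>\<^bsub>K\<^esub> \<odot>\<^bsub>D\<^esub> \<phi> a"
proof -
  assume a: "a \<in> carrier A"
  have "ext (mon A i a) = (\<Oplus>\<^bsub>D\<^esub>j\<in>{i}. mon K j \<one>\<^bsub>K\<^esub> \<odot>\<^bsub>D\<^esub> \<phi> (mon A i a j))"
    using a by (intro ext_eq A.mon_closed) (auto simp: mon_def split: if_splits)
  also have "\<dots> = mon K i \<one>\<^bsub>K\<^esub> \<odot>\<^bsub>D\<^esub> \<phi> (mon A i a i)"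
    using a by (simp add: A.mon_closed upD del: insert_iff)
  finally show ?thesis by (simp add: mon_def)
qed

lemma ext_add:
  assumes "f \<in> up A" "h \<in> up A"
  shows "ext (f \<oplus>\<^bsub>poly_algebra A\<^esub> h) = ext f \<oplus>\<^bsub>D\<^esub> ext h"
proof -
  let ?S = "{i. f i \<noteq> \<zero>\<^bsub>A\<^esub>} \<union> {i. h i \<noteq> \<zero>\<^bsub>A\<^esub>}"
  have fin: "finite ?S" using assms support_finite by blast
  have c: "f i \<in> carrier A" "h i \<in> carrier A" for i using assms upD by (blast, blast)
  interpret P: ring "poly_algebra A" by (rule A.poly_ring)
  have "f \<oplus>\<^bsub>poly_algebra A\<^esub> h \<in> up A" using assms P.a_closed by (simp add: poly_algebra_simps)
  then show ?thesis
    using assms fin c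
    by (subst (1 2 3) ext_eq[where S = ?S])
       (auto simp: poly_algebra_simps D.smult_r_distr intro!: D.M.finsum_addf[symmetric])
qed

lemma ext_hom: "ext \<in> alg_hom (UP K) (poly_algebra A) D"
proof -
  interpret P: assoc_alg "UP K" "poly_algebra A" by (rule A.poly_assoc_alg)
  have PC: "carrier (poly_algebra A) = up A" "carrier (UP K) = up K" by (simp_all add: poly_algebra_simps UP_simps)
  have ext_zero: "ext (\<lambda>i. \<zero>\<^bsub>A\<^esub>) = \<zero>\<^bsub>D\<^esub>" unfolding poly_ext_def by simp
  note cl = P.m_closed[unfolded PC] P.M.a_closed[unfolded PC] P.smult_closed[unfolded PC]
  have t: "mon K i c \<odot>\<^bsub>D\<^esub> (mon K j c' \<odot>\<^bsub>D\<^esub> d) = mon K (i + j) (c \<otimes>\<^bsub>K\<^esub> c') \<odot>\<^bsub>D\<^esub> d"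
    if "d \<in> carrier D" "c \<in> carrier K" "c' \<in> carrier K" for i j c c' d
    using that by (simp add: D.smult_assoc1[symmetric] mon_mult_UP)
  have mult_mon: "ext (mon A i a \<otimes>\<^bsub>poly_algebra A\<^esub> f) = ext (mon A i a) \<otimes>\<^bsub>D\<^esub> ext f"
    if a: "a \<in> carrier A" and f: "f \<in> up A" for i a f
    using A.is_abelian_group f
  proof (induction f rule: up_induct)
    case zero
    show ?case using a ext_zero P.r_null[of "mon A i a"] by (simp add: PC A.mon_closed poly_algebra_simps(2) ext_closed)
  next
    case (mon j)
    have "f j \<in> carrier A" using f by (rule upD)
    then show ?case using a
      by (simp add: A.mon_mult ext_mon D.smult_mult_left D.smult_mult_right t add.commute)
  next
    case (add x y)
    then show ?case
      using a P.r_distr[of x y "mon A i a"]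
      by (simp add: PC A.mon_closed poly_algebra_simps(4)[symmetric] ext_add ext_closed cl D.r_distr)
  qed
  have mult: "ext (f \<otimes>\<^bsub>poly_algebra A\<^esub> h) = ext f \<otimes>\<^bsub>D\<^esub> ext h" if f: "f \<in> up A" and h: "h \<in> up A" for f h
    using A.is_abelian_group f
  proof (induction f rule: up_induct)
    case zero
    show ?case using h ext_zero P.l_null[of h] by (simp add: PC poly_algebra_simps(2) ext_closed)
  next
    case (mon i)
    show ?case using upD[OF f] h by (rule mult_mon)
  next
    case (add x y)
    then show ?case
      using h P.l_distr[of x y h]
      by (simp add: PC poly_algebra_simps(4)[symmetric] ext_add ext_closed cl D.l_distr)
  qed
  have smult_mon: "ext (mon K i c \<odot>\<^bsub>poly_algebra A\<^esub> f) = mon K i c \<odot>\<^bsub>D\<^esub> ext f"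
    if c: "c \<in> carrier K" and f: "f \<in> up A" for i c f
    using A.is_abelian_group f
  proof (induction f rule: up_induct)
    case zero
    show ?case using c ext_zero P.smult_r_null[of "mon K i c"] by (simp add: poly_algebra_simps(2))
  next
    case (mon j)
    have "f j \<in> carrier A" using f by (rule upD)
    then show ?case using c by (simp add: A.smult_mon_mon ext_mon lin t)
  next
    case (add x y)
    then show ?case
      using c P.smult_r_distr[of "mon K i c" x y]
      by (simp add: PC mon_in_up poly_algebra_simps(4)[symmetric] ext_add ext_closed cl D.smult_r_distr)
  qed
  have smult: "ext (p \<odot>\<^bsub>poly_algebra A\<^esub> f) = p \<odot>\<^bsub>D\<^esub> ext f" if p: "p \<in> up K" and f: "f \<in> up A" for p f
    using A.R.is_abelian_group p
  proof (induction p rule: up_induct)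
    case zero
    show ?case using f ext_zero P.smult_l_null[of f] D.smult_l_null[of "ext f"]
      by (simp add: PC poly_algebra_simps(2) UP_simps(2) ext_closed)
  next
    case (mon i)
    show ?case using upD[OF p] f by (rule smult_mon)
  next
    case (add x y)
    then show ?case
      using f P.smult_l_distr[of x y f] D.smult_l_distr[of x y "ext f"]
      by (simp add: PC UP_simps(4)[symmetric] ext_add ext_closed cl)
  qed
  have one: "ext \<one>\<^bsub>poly_algebra A\<^esub> = \<one>\<^bsub>D\<^esub>"
    using D.smult_one[of "\<one>\<^bsub>D\<^esub>"] by (simp add: poly_algebra_simps(3) ext_mon UP_simps(3))
  show ?thesis
    by (rule alg_homI) (simp_all add: PC ext_closed mult ext_add one smult)
qed

end

section \<open>Skew group algebras\<close>

text \<open>The element \<open>a g\<close> of the skew group algebra.\<close>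

definition sgl :: "('k, 'a) module \<Rightarrow> ('g, 'n) monoid_scheme \<Rightarrow> 'g \<Rightarrow> 'a \<Rightarrow> 'g \<Rightarrow> 'a" where
  "sgl A G g a = (\<lambda>k\<in>carrier G. if k = g then a else \<zero>\<^bsub>A\<^esub>)"

lemma skew_simps:
  "carrier (skew_group_algebra A G act) = carrier G \<rightarrow>\<^sub>E carrier A"
  "f \<otimes>\<^bsub>skew_group_algebra A G act\<^esub> h = (\<lambda>k\<in>carrier G. \<Oplus>\<^bsub>A\<^esub>g\<in>carrier G. f g \<otimes>\<^bsub>A\<^esub> act g (h (inv\<^bsub>G\<^esub> g \<otimes>\<^bsub>G\<^esub> k)))"
  "\<one>\<^bsub>skew_group_algebra A G act\<^esub> = sgl A G \<one>\<^bsub>G\<^esub> \<one>\<^bsub>A\<^esub>"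
  "\<zero>\<^bsub>skew_group_algebra A G act\<^esub> = (\<lambda>k\<in>carrier G. \<zero>\<^bsub>A\<^esub>)"
  "f \<oplus>\<^bsub>skew_group_algebra A G act\<^esub> h = (\<lambda>k\<in>carrier G. f k \<oplus>\<^bsub>A\<^esub> h k)"
  "c \<odot>\<^bsub>skew_group_algebra A G act\<^esub> f = (\<lambda>k\<in>carrier G. c \<odot>\<^bsub>A\<^esub> f k)"
  by (simp_all add: skew_group_algebra_def sgl_def)

locale skew_algebra = A: assoc_alg K A + G: group G
  for K :: "('k, 'm) ring_scheme" and A :: "('k, 'a) module" and G :: "('g, 'n) monoid_scheme" +
  fixes act :: "'g \<Rightarrow> 'a \<Rightarrow> 'a"
  assumes finite_G: "finite (carrier G)"
    and act_hom: "g \<in> carrier G \<Longrightarrow> act g \<in> alg_hom K A A"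
    and act_one: "a \<in> carrier A \<Longrightarrow> act \<one>\<^bsub>G\<^esub> a = a"
    and act_mult: "\<lbrakk>g \<in> carrier G; h \<in> carrier G; a \<in> carrier A\<rbrakk> \<Longrightarrow> act (g \<otimes>\<^bsub>G\<^esub> h) a = act g (act h a)"
begin

abbreviation "S \<equiv> skew_group_algebra A G act"
abbreviation "\<delta> \<equiv> sgl A G"

lemma act_simps [simp]:
  assumes "g \<in> carrier G"
  shows "a \<in> carrier A \<Longrightarrow> act g a \<in> carrier A"
    and "act g \<one>\<^bsub>A\<^esub> = \<one>\<^bsub>A\<^esub>"
    and "act g \<zero>\<^bsub>A\<^esub> = \<zero>\<^bsub>A\<^esub>"
    and "\<lbrakk>a \<in> carrier A; b \<in> carrier A\<rbrakk> \<Longrightarrow> act g (a \<otimes>\<^bsub>A\<^esub> b) = act g a \<otimes>\<^bsub>A\<^esub> act g b"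
    and "\<lbrakk>a \<in> carrier A; b \<in> carrier A\<rbrakk> \<Longrightarrow> act g (a \<oplus>\<^bsub>A\<^esub> b) = act g a \<oplus>\<^bsub>A\<^esub> act g b"
    and "\<lbrakk>c \<in> carrier K; a \<in> carrier A\<rbrakk> \<Longrightarrow> act g (c \<odot>\<^bsub>A\<^esub> a) = c \<odot>\<^bsub>A\<^esub> act g a"
  using alg_homD[OF act_hom[OF assms]] additive_map_zero[OF A.is_abelian_group A.is_abelian_group, of "act g"]
  by simp_all

lemma S_carrier_iff: "f \<in> carrier S \<longleftrightarrow> f \<in> extensional (carrier G) \<and> (\<forall>g\<in>carrier G. f g \<in> carrier A)"
  by (auto simp: skew_simps PiE_iff)

lemma S_app:
  assumes "k \<in> carrier G"
  shows "(f \<otimes>\<^bsub>S\<^esub> h) k = (\<Oplus>\<^bsub>A\<^esub>g\<in>carrier G. f g \<otimes>\<^bsub>A\<^esub> act g (h (inv\<^bsub>G\<^esub> g \<otimes>\<^bsub>G\<^esub> k)))"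
    and "(f \<oplus>\<^bsub>S\<^esub> h) k = f k \<oplus>\<^bsub>A\<^esub> h k"
    and "(c \<odot>\<^bsub>S\<^esub> f) k = c \<odot>\<^bsub>A\<^esub> f k"
    and "\<zero>\<^bsub>S\<^esub> k = \<zero>\<^bsub>A\<^esub>"
  using assms by (simp_all add: skew_simps)

lemma S_closed [simp]: "\<lbrakk>f \<in> carrier S; g \<in> carrier G\<rbrakk> \<Longrightarrow> f g \<in> carrier A"
  by (simp add: S_carrier_iff)

lemma S_eqI: "\<lbrakk>f \<in> carrier S; h \<in> carrier S; \<And>g. g \<in> carrier G \<Longrightarrow> f g = h g\<rbrakk> \<Longrightarrow> f = h"
  by (auto simp: S_carrier_iff intro: extensionalityI)

lemma \<delta>_closed [simp]: "a \<in> carrier A \<Longrightarrow> \<delta> g a \<in> carrier S"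
  by (simp add: S_carrier_iff sgl_def)

lemma S_add_closed [simp]: "\<lbrakk>f \<in> carrier S; h \<in> carrier S\<rbrakk> \<Longrightarrow> f \<oplus>\<^bsub>S\<^esub> h \<in> carrier S"
  by (auto simp: S_carrier_iff skew_simps)

lemma S_mult_closed [simp]: "\<lbrakk>f \<in> carrier S; h \<in> carrier S\<rbrakk> \<Longrightarrow> f \<otimes>\<^bsub>S\<^esub> h \<in> carrier S"
  by (auto simp: S_carrier_iff skew_simps(2-) intro!: A.M.finsum_closed)

lemma S_smult_closed [simp]: "\<lbrakk>c \<in> carrier K; f \<in> carrier S\<rbrakk> \<Longrightarrow> c \<odot>\<^bsub>S\<^esub> f \<in> carrier S"
  by (auto simp: S_carrier_iff skew_simps)

lemma S_zero_one_closed [simp]: "\<zero>\<^bsub>S\<^esub> \<in> carrier S" "\<one>\<^bsub>S\<^esub> \<in> carrier S"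
  by (auto simp: S_carrier_iff skew_simps sgl_def)

lemma skew_induct [consumes 1, case_names zero single add]:
  assumes f: "f \<in> carrier S" and zero: "P \<zero>\<^bsub>S\<^esub>"
    and single: "\<And>g. g \<in> carrier G \<Longrightarrow> P (\<delta> g (f g))"
    and add: "\<And>x y. \<lbrakk>x \<in> carrier S; y \<in> carrier S; P x; P y\<rbrakk> \<Longrightarrow> P (x \<oplus>\<^bsub>S\<^esub> y)"
  shows "P f"
proof -
  have "P (\<lambda>k\<in>carrier G. if k \<in> F then f k else \<zero>\<^bsub>A\<^esub>)" if "finite F" "F \<subseteq> carrier G" for F
    using that
  proof (induction F)
    case empty
    have "(\<lambda>k\<in>carrier G. if k \<in> {} then f k else \<zero>\<^bsub>A\<^esub>) = \<zero>\<^bsub>S\<^esub>" by (simp add: skew_simps)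
    then show ?case using zero by argo
  next
    case (insert g F)
    let ?r = "\<lambda>F. \<lambda>k\<in>carrier G. if k \<in> F then f k else \<zero>\<^bsub>A\<^esub>"
    have "?r F \<in> carrier S" "\<delta> g (f g) \<in> carrier S" using f insert.prems by (auto simp: S_carrier_iff sgl_def)
    then have "P (?r F \<oplus>\<^bsub>S\<^esub> \<delta> g (f g))" using insert by (intro add single) (simp_all add: restrict_def)
    also have "?r F \<oplus>\<^bsub>S\<^esub> \<delta> g (f g) = ?r (insert g F)"
      using f insert by (auto simp: skew_simps sgl_def fun_eq_iff PiE_iff)
    finally show ?case .
  qed
  from this[OF finite_G] have "P (\<lambda>k\<in>carrier G. f k)" by (simp cong: restrict_cong)
  then show ?thesis using f by (simp add: S_carrier_iff extensional_restrict)
qed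

lemma S_a_comm_group: "abelian_group S"
proof (rule abelian_groupI)
  fix f assume f: "f \<in> carrier S"
  show "\<exists>h\<in>carrier S. h \<oplus>\<^bsub>S\<^esub> f = \<zero>\<^bsub>S\<^esub>"
    using f by (intro bexI[of _ "\<lambda>k\<in>carrier G. \<ominus>\<^bsub>A\<^esub> f k"]) (auto simp: S_carrier_iff skew_simps(4,5) A.M.l_neg)
qed (auto intro!: S_eqI simp: S_app A.M.a_ac)

lemma S_l_distr:
  assumes "f \<in> carrier S" "f' \<in> carrier S" "h \<in> carrier S"
  shows "(f \<oplus>\<^bsub>S\<^esub> f') \<otimes>\<^bsub>S\<^esub> h = (f \<otimes>\<^bsub>S\<^esub> h) \<oplus>\<^bsub>S\<^esub> (f' \<otimes>\<^bsub>S\<^esub> h)"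
  using assms
proof (intro S_eqI)
  fix k assume k: "k \<in> carrier G"
  have "((f \<oplus>\<^bsub>S\<^esub> f') \<otimes>\<^bsub>S\<^esub> h) k = (\<Oplus>\<^bsub>A\<^esub>g\<in>carrier G. f g \<otimes>\<^bsub>A\<^esub> act g (h (inv\<^bsub>G\<^esub> g \<otimes>\<^bsub>G\<^esub> k)) \<oplus>\<^bsub>A\<^esub> f' g \<otimes>\<^bsub>A\<^esub> act g (h (inv\<^bsub>G\<^esub> g \<otimes>\<^bsub>G\<^esub> k)))"
    using assms k unfolding S_app(1)[OF k] by (intro A.M.finsum_cong') (simp_all add: A.l_distr S_app Pi_iff)
  also have "\<dots> = (\<Oplus>\<^bsub>A\<^esub>g\<in>carrier G. f g \<otimes>\<^bsub>A\<^esub> act g (h (inv\<^bsub>G\<^esub> g \<otimes>\<^bsub>G\<^esub> k))) \<oplus>\<^bsub>A\<^esub> (\<Oplus>\<^bsub>A\<^esub>g\<in>carrier G. f' g \<otimes>\<^bsub>A\<^esub> act g (h (inv\<^bsub>G\<^esub> g \<otimes>\<^bsub>G\<^esub> k)))"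
    using assms k by (intro A.M.finsum_addf) (simp_all add: Pi_iff)
  finally show "((f \<oplus>\<^bsub>S\<^esub> f') \<otimes>\<^bsub>S\<^esub> h) k = ((f \<otimes>\<^bsub>S\<^esub> h) \<oplus>\<^bsub>S\<^esub> (f' \<otimes>\<^bsub>S\<^esub> h)) k" using k by (simp add: S_app)
qed simp_all

lemma S_r_distr:
  assumes "f \<in> carrier S" "f' \<in> carrier S" "h \<in> carrier S"
  shows "h \<otimes>\<^bsub>S\<^esub> (f \<oplus>\<^bsub>S\<^esub> f') = (h \<otimes>\<^bsub>S\<^esub> f) \<oplus>\<^bsub>S\<^esub> (h \<otimes>\<^bsub>S\<^esub> f')"
  using assms
proof (intro S_eqI)
  fix k assume k: "k \<in> carrier G"
  have "(h \<otimes>\<^bsub>S\<^esub> (f \<oplus>\<^bsub>S\<^esub> f')) k = (\<Oplus>\<^bsub>A\<^esub>g\<in>carrier G. h g \<otimes>\<^bsub>A\<^esub> act g (f (inv\<^bsub>G\<^esub> g \<otimes>\<^bsub>G\<^esub> k)) \<oplus>\<^bsub>A\<^esub> h g \<otimes>\<^bsub>A\<^esub> act g (f' (inv\<^bsub>G\<^esub> g \<otimes>\<^bsub>G\<^esub> k)))"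
    using assms k unfolding S_app(1)[OF k] by (intro A.M.finsum_cong') (simp_all add: A.r_distr S_app Pi_iff)
  also have "\<dots> = (\<Oplus>\<^bsub>A\<^esub>g\<in>carrier G. h g \<otimes>\<^bsub>A\<^esub> act g (f (inv\<^bsub>G\<^esub> g \<otimes>\<^bsub>G\<^esub> k))) \<oplus>\<^bsub>A\<^esub> (\<Oplus>\<^bsub>A\<^esub>g\<in>carrier G. h g \<otimes>\<^bsub>A\<^esub> act g (f' (inv\<^bsub>G\<^esub> g \<otimes>\<^bsub>G\<^esub> k)))"
    using assms k by (intro A.M.finsum_addf) (simp_all add: Pi_iff)
  finally show "(h \<otimes>\<^bsub>S\<^esub> (f \<oplus>\<^bsub>S\<^esub> f')) k = ((h \<otimes>\<^bsub>S\<^esub> f) \<oplus>\<^bsub>S\<^esub> (h \<otimes>\<^bsub>S\<^esub> f')) k" using k by (simp add: S_app)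
qed simp_all

lemma S_zero_mult: "f \<in> carrier S \<Longrightarrow> \<zero>\<^bsub>S\<^esub> \<otimes>\<^bsub>S\<^esub> f = \<zero>\<^bsub>S\<^esub>" "f \<in> carrier S \<Longrightarrow> f \<otimes>\<^bsub>S\<^esub> \<zero>\<^bsub>S\<^esub> = \<zero>\<^bsub>S\<^esub>"
  by (auto intro!: S_eqI A.M.add.finprod_one_eqI simp: S_app)

lemma \<delta>_mult:
  assumes g: "g \<in> carrier G" and h: "h \<in> carrier G" and a: "a \<in> carrier A" and b: "b \<in> carrier A"
  shows "\<delta> g a \<otimes>\<^bsub>S\<^esub> \<delta> h b = \<delta> (g \<otimes>\<^bsub>G\<^esub> h) (a \<otimes>\<^bsub>A\<^esub> act g b)"
proof (rule S_eqI)
  fix k assume k: "k \<in> carrier G"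
  have "(\<Oplus>\<^bsub>A\<^esub>g'\<in>carrier G. \<delta> g a g' \<otimes>\<^bsub>A\<^esub> act g' (\<delta> h b (inv\<^bsub>G\<^esub> g' \<otimes>\<^bsub>G\<^esub> k)))
      = (\<Oplus>\<^bsub>A\<^esub>g'\<in>carrier G. if g = g' then a \<otimes>\<^bsub>A\<^esub> act g' (\<delta> h b (inv\<^bsub>G\<^esub> g' \<otimes>\<^bsub>G\<^esub> k)) else \<zero>\<^bsub>A\<^esub>)"
    using assms k by (intro A.M.finsum_cong') (auto simp: sgl_def)
  also have "\<dots> = a \<otimes>\<^bsub>A\<^esub> act g (\<delta> h b (inv\<^bsub>G\<^esub> g \<otimes>\<^bsub>G\<^esub> k))"
    using assms k finite_G by (subst A.M.finsum_singleton) (auto simp: sgl_def)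
  also have "\<dots> = \<delta> (g \<otimes>\<^bsub>G\<^esub> h) (a \<otimes>\<^bsub>A\<^esub> act g b) k"
    using assms k by (auto simp: sgl_def G.inv_solve_left G.inv_solve_left' G.m_assoc[symmetric])
  finally show "(\<delta> g a \<otimes>\<^bsub>S\<^esub> \<delta> h b) k = \<delta> (g \<otimes>\<^bsub>G\<^esub> h) (a \<otimes>\<^bsub>A\<^esub> act g b) k"
    using k by (simp add: skew_simps(2))
qed (use assms in simp_all)

lemma \<delta>_add: "\<lbrakk>a \<in> carrier A; b \<in> carrier A\<rbrakk> \<Longrightarrow> \<delta> g a \<oplus>\<^bsub>S\<^esub> \<delta> g b = \<delta> g (a \<oplus>\<^bsub>A\<^esub> b)"
  by (auto simp: skew_simps(5) sgl_def fun_eq_iff)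

lemma \<delta>_smult: "\<lbrakk>c \<in> carrier K; a \<in> carrier A\<rbrakk> \<Longrightarrow> c \<odot>\<^bsub>S\<^esub> \<delta> g a = \<delta> g (c \<odot>\<^bsub>A\<^esub> a)"
  by (auto simp: skew_simps(6) sgl_def fun_eq_iff)

text \<open>The product is biadditive, so associativity reduces to that of the products of elements \<open>a g\<close>.\<close>

lemma S_assoc:
  assumes x: "x \<in> carrier S" and y: "y \<in> carrier S" and z: "z \<in> carrier S"
  shows "(x \<otimes>\<^bsub>S\<^esub> y) \<otimes>\<^bsub>S\<^esub> z = x \<otimes>\<^bsub>S\<^esub> (y \<otimes>\<^bsub>S\<^esub> z)"
proof -
  have 1: "(\<delta> g a \<otimes>\<^bsub>S\<^esub> \<delta> h b) \<otimes>\<^bsub>S\<^esub> z = \<delta> g a \<otimes>\<^bsub>S\<^esub> (\<delta> h b \<otimes>\<^bsub>S\<^esub> z)"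
    if "g \<in> carrier G" "h \<in> carrier G" "a \<in> carrier A" "b \<in> carrier A" for g h a b
    using z
  proof (induction z rule: skew_induct)
    case (single k)
    then show ?case using z that by (simp add: \<delta>_mult A.m_assoc act_mult G.m_assoc)
  qed (simp_all add: that S_zero_mult S_r_distr)
  have 2: "(\<delta> g a \<otimes>\<^bsub>S\<^esub> y) \<otimes>\<^bsub>S\<^esub> z = \<delta> g a \<otimes>\<^bsub>S\<^esub> (y \<otimes>\<^bsub>S\<^esub> z)"
    if "g \<in> carrier G" "a \<in> carrier A" for g a
    using y that
  proof (induction y rule: skew_induct)
    case (single h)
    then show ?case using 1 y by simp
  qed (simp_all add: z S_zero_mult S_r_distr S_l_distr)
  show ?thesis
    using x
  proof (induction x rule: skew_induct)
    case (single g)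
    then show ?case using 2 x by simp
  qed (simp_all add: y z S_zero_mult S_l_distr)
qed

lemma S_one: "x \<in> carrier S \<Longrightarrow> \<one>\<^bsub>S\<^esub> \<otimes>\<^bsub>S\<^esub> x = x" "x \<in> carrier S \<Longrightarrow> x \<otimes>\<^bsub>S\<^esub> \<one>\<^bsub>S\<^esub> = x"
proof -
  assume x: "x \<in> carrier S"
  note [simp] = skew_simps(3)
  show "\<one>\<^bsub>S\<^esub> \<otimes>\<^bsub>S\<^esub> x = x" using x
  proof (induction x rule: skew_induct)
    case (single g)
    then show ?case using x by (simp add: \<delta>_mult act_one)
  qed (simp_all add: S_zero_mult S_r_distr)
  show "x \<otimes>\<^bsub>S\<^esub> \<one>\<^bsub>S\<^esub> = x" using x
  proof (induction x rule: skew_induct)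
    case (single g)
    then show ?case using x by (simp add: \<delta>_mult)
  qed (simp_all add: S_zero_mult S_l_distr)
qed

lemma S_smult_mult:
  assumes c: "c \<in> carrier K" and x: "x \<in> carrier S" and y: "y \<in> carrier S"
  shows "(c \<odot>\<^bsub>S\<^esub> x) \<otimes>\<^bsub>S\<^esub> y = c \<odot>\<^bsub>S\<^esub> (x \<otimes>\<^bsub>S\<^esub> y)" "x \<otimes>\<^bsub>S\<^esub> (c \<odot>\<^bsub>S\<^esub> y) = c \<odot>\<^bsub>S\<^esub> (x \<otimes>\<^bsub>S\<^esub> y)"
proof -
  have "c \<odot>\<^bsub>A\<^esub> (\<Oplus>\<^bsub>A\<^esub>g\<in>carrier G. x g \<otimes>\<^bsub>A\<^esub> act g (y (inv\<^bsub>G\<^esub> g \<otimes>\<^bsub>G\<^esub> k)))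
     = (\<Oplus>\<^bsub>A\<^esub>g\<in>carrier G. c \<odot>\<^bsub>A\<^esub> (x g \<otimes>\<^bsub>A\<^esub> act g (y (inv\<^bsub>G\<^esub> g \<otimes>\<^bsub>G\<^esub> k))))" if "k \<in> carrier G" for k
    using that c x y finite_G by (intro A.finsum_smult_ldistr) auto
  then show "(c \<odot>\<^bsub>S\<^esub> x) \<otimes>\<^bsub>S\<^esub> y = c \<odot>\<^bsub>S\<^esub> (x \<otimes>\<^bsub>S\<^esub> y)" "x \<otimes>\<^bsub>S\<^esub> (c \<odot>\<^bsub>S\<^esub> y) = c \<odot>\<^bsub>S\<^esub> (x \<otimes>\<^bsub>S\<^esub> y)"
    using c x y
    by (auto intro!: S_eqI A.M.finsum_cong' simp: S_app A.smult_mult_left A.smult_mult_right)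
qed

lemma skew_assoc_alg: "assoc_alg K S"
proof (rule assoc_alg.intro)
  have "Group.monoid S" by (rule monoidI) (simp_all add: S_assoc S_one)
  then show ri: "ring S" by (rule ringI[OF S_a_comm_group]) (simp_all add: S_l_distr S_r_distr)
  show "module K S"
    by (rule moduleI[OF A.R.is_cring S_a_comm_group])
       (auto intro!: S_eqI simp: S_app A.smult_l_distr A.smult_r_distr A.smult_assoc1)
  show "assoc_alg_axioms K S" by unfold_locales (simp_all add: S_smult_mult)
qed

end

text \<open>An algebra homomorphism from \<open>A\<close> and a homomorphism from \<open>G\<close> to the units of \<open>D\<close> that intertwine
  the action with conjugation combine to one from \<open>A \<rtimes> G\<close>.\<close>

locale skew_extension = skew_algebra K A G act + D: assoc_alg K D
  for K :: "('k, 'm) ring_scheme" and A :: "('k, 'a) module" and G :: "('g, 'n) monoid_scheme" and act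
    and D :: "('k, 'd) module" +
  fixes \<phi> :: "'a \<Rightarrow> 'd" and u :: "'g \<Rightarrow> 'd"
  assumes hom: "\<phi> \<in> alg_hom K A D"
    and u_closed [simp]: "g \<in> carrier G \<Longrightarrow> u g \<in> carrier D"
    and u_one: "u \<one>\<^bsub>G\<^esub> = \<one>\<^bsub>D\<^esub>"
    and u_mult: "\<lbrakk>g \<in> carrier G; h \<in> carrier G\<rbrakk> \<Longrightarrow> u (g \<otimes>\<^bsub>G\<^esub> h) = u g \<otimes>\<^bsub>D\<^esub> u h"
    and intertwine: "\<lbrakk>g \<in> carrier G; a \<in> carrier A\<rbrakk> \<Longrightarrow> u g \<otimes>\<^bsub>D\<^esub> \<phi> a = \<phi> (act g a) \<otimes>\<^bsub>D\<^esub> u g"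
begin

definition ext :: "('g \<Rightarrow> 'a) \<Rightarrow> 'd" where
  "ext f = (\<Oplus>\<^bsub>D\<^esub>g\<in>carrier G. \<phi> (f g) \<otimes>\<^bsub>D\<^esub> u g)"

lemma \<phi>_simps [simp]:
  "a \<in> carrier A \<Longrightarrow> \<phi> a \<in> carrier D"
  "\<phi> \<one>\<^bsub>A\<^esub> = \<one>\<^bsub>D\<^esub>"
  "\<phi> \<zero>\<^bsub>A\<^esub> = \<zero>\<^bsub>D\<^esub>"
  "\<lbrakk>a \<in> carrier A; b \<in> carrier A\<rbrakk> \<Longrightarrow> \<phi> (a \<oplus>\<^bsub>A\<^esub> b) = \<phi> a \<oplus>\<^bsub>D\<^esub> \<phi> b"
  "\<lbrakk>a \<in> carrier A; b \<in> carrier A\<rbrakk> \<Longrightarrow> \<phi> (a \<otimes>\<^bsub>A\<^esub> b) = \<phi> a \<otimes>\<^bsub>D\<^esub> \<phi> b"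
  "\<lbrakk>c \<in> carrier K; a \<in> carrier A\<rbrakk> \<Longrightarrow> \<phi> (c \<odot>\<^bsub>A\<^esub> a) = c \<odot>\<^bsub>D\<^esub> \<phi> a"
  using alg_homD[OF hom] additive_map_zero[OF A.is_abelian_group D.is_abelian_group, of \<phi>] by simp_all

lemma ext_closed: "f \<in> carrier S \<Longrightarrow> ext f \<in> carrier D"
  unfolding ext_def by (intro D.M.finsum_closed) auto

lemma ext_single:
  assumes "g \<in> carrier G" "a \<in> carrier A"
  shows "ext (\<delta> g a) = \<phi> a \<otimes>\<^bsub>D\<^esub> u g"
proof -
  have "ext (\<delta> g a) = (\<Oplus>\<^bsub>D\<^esub>k\<in>carrier G. if g = k then \<phi> a \<otimes>\<^bsub>D\<^esub> u k else \<zero>\<^bsub>D\<^esub>)"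
    unfolding ext_def using assms by (intro D.M.finsum_cong') (auto simp: sgl_def)
  also have "\<dots> = \<phi> a \<otimes>\<^bsub>D\<^esub> u g" using assms finite_G by (subst D.M.finsum_singleton) auto
  finally show ?thesis .
qed

lemma ext_add: "\<lbrakk>f \<in> carrier S; h \<in> carrier S\<rbrakk> \<Longrightarrow> ext (f \<oplus>\<^bsub>S\<^esub> h) = ext f \<oplus>\<^bsub>D\<^esub> ext h"
proof -
  assume fh: "f \<in> carrier S" "h \<in> carrier S"
  have "ext (f \<oplus>\<^bsub>S\<^esub> h) = (\<Oplus>\<^bsub>D\<^esub>g\<in>carrier G. \<phi> (f g) \<otimes>\<^bsub>D\<^esub> u g \<oplus>\<^bsub>D\<^esub> \<phi> (h g) \<otimes>\<^bsub>D\<^esub> u g)"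
    unfolding ext_def using fh by (intro D.M.finsum_cong') (simp_all add: S_app D.l_distr Pi_iff)
  also have "\<dots> = ext f \<oplus>\<^bsub>D\<^esub> ext h"
    unfolding ext_def using fh by (intro D.M.finsum_addf) (simp_all add: Pi_iff)
  finally show ?thesis .
qed

lemma ext_zero: "ext \<zero>\<^bsub>S\<^esub> = \<zero>\<^bsub>D\<^esub>"
  unfolding ext_def by (auto intro!: D.M.add.finprod_one_eqI simp: S_app)

lemma ext_hom: "ext \<in> alg_hom K S D"
proof -
  interpret S: assoc_alg K S by (rule skew_assoc_alg)
  have 1: "ext (\<delta> g a \<otimes>\<^bsub>S\<^esub> y) = ext (\<delta> g a) \<otimes>\<^bsub>D\<^esub> ext y"
    if ga: "g \<in> carrier G" "a \<in> carrier A" and y: "y \<in> carrier S" for g a y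
    using y
  proof (induction y rule: skew_induct)
    case (single h)
    let ?b = "y h"
    have b: "?b \<in> carrier A" using single y by simp
    have "u g \<otimes>\<^bsub>D\<^esub> (\<phi> ?b \<otimes>\<^bsub>D\<^esub> u h) = \<phi> (act g ?b) \<otimes>\<^bsub>D\<^esub> (u g \<otimes>\<^bsub>D\<^esub> u h)"
      using ga single b by (simp add: D.m_assoc[symmetric] intertwine)
    then show ?case using ga single b
      by (simp add: \<delta>_mult ext_single u_mult D.m_assoc)
  qed (simp_all add: ga S_r_distr ext_add ext_closed D.r_distr ext_zero)
  have 2: "ext (x \<otimes>\<^bsub>S\<^esub> y) = ext x \<otimes>\<^bsub>D\<^esub> ext y" if x: "x \<in> carrier S" and y: "y \<in> carrier S" for x y
    using x
  proof (induction x rule: skew_induct)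
    case (single g)
    then show ?case using x y 1 by simp
  qed (simp_all add: y S_l_distr ext_add ext_closed D.l_distr ext_zero)
  have 3: "ext (c \<odot>\<^bsub>S\<^esub> x) = c \<odot>\<^bsub>D\<^esub> ext x" if c: "c \<in> carrier K" and x: "x \<in> carrier S" for c x
    using x
  proof (induction x rule: skew_induct)
    case (single g)
    then show ?case using x c by (simp add: \<delta>_smult ext_single D.smult_mult_left)
  qed (simp_all add: c S.smult_r_distr ext_add ext_closed D.smult_r_distr ext_zero)
  show ?thesis
    by (rule alg_homI) (simp_all add: 2 3 ext_add ext_closed skew_simps(3) ext_single u_one)
qed

end

lemma skew_map_hom:
  assumes "skew_algebra K A G act" "skew_algebra K A' G act'" and \<phi>: "\<phi> \<in> alg_hom K A A'"
    and equivariant: "\<And>g a. \<lbrakk>g \<in> carrier G; a \<in> carrier A\<rbrakk> \<Longrightarrow> \<phi> (act g a) = act' g (\<phi> a)"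
  shows "(\<lambda>f. \<lambda>k\<in>carrier G. \<phi> (f k)) \<in> alg_hom K (skew_group_algebra A G act) (skew_group_algebra A' G act')"
proof -
  interpret S: skew_algebra K A G act by fact
  interpret S': skew_algebra K A' G act' by fact
  note \<phi>D = alg_homD[OF \<phi>]
  have z: "\<phi> \<zero>\<^bsub>A\<^esub> = \<zero>\<^bsub>A'\<^esub>"
    using \<phi>D by (intro additive_map_zero[OF S.A.is_abelian_group S'.A.is_abelian_group])
  have s: "\<phi> (finsum A f T) = finsum A' (\<lambda>i. \<phi> (f i)) T" if "f \<in> T \<rightarrow> carrier A" for f and T :: "'d set"
    using that \<phi>D by (intro additive_map_finsum[OF S.A.is_abelian_group S'.A.is_abelian_group])
  show ?thesis
  proof (rule alg_homI)
    fix x y assume x: "x \<in> carrier S.S" and y: "y \<in> carrier S.S"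
    show "(\<lambda>k\<in>carrier G. \<phi> ((x \<otimes>\<^bsub>S.S\<^esub> y) k)) = (\<lambda>k\<in>carrier G. \<phi> (x k)) \<otimes>\<^bsub>S'.S\<^esub> (\<lambda>k\<in>carrier G. \<phi> (y k))"
      using x y \<phi>D(2)
      by (auto simp: skew_simps(2) s Pi_iff \<phi>D(3) equivariant fun_eq_iff intro!: S'.A.M.finsum_cong')
  qed (auto simp: S.S_carrier_iff S'.S_carrier_iff skew_simps(3,5,6) sgl_def z \<phi>D fun_eq_iff)
qed

section \<open>Graded algebras\<close>

text \<open>A grading is given by its projections \<open>cmp d\<close> onto the components. Since these vanish in negative degrees,
  component \<open>k\<close> of a product only involves the degrees \<open>0..k\<close> of the factors.\<close>

locale graded_alg = assoc_alg K B for K :: "('k, 'm) ring_scheme" and B :: "('k, 'b) module" +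
  fixes cmp :: "int \<Rightarrow> 'b \<Rightarrow> 'b"
  assumes cmp_closed [simp]: "x \<in> carrier B \<Longrightarrow> cmp d x \<in> carrier B"
    and cmp_add: "\<lbrakk>x \<in> carrier B; y \<in> carrier B\<rbrakk> \<Longrightarrow> cmp d (x \<oplus>\<^bsub>B\<^esub> y) = cmp d x \<oplus>\<^bsub>B\<^esub> cmp d y"
    and cmp_smult: "\<lbrakk>c \<in> carrier K; x \<in> carrier B\<rbrakk> \<Longrightarrow> cmp d (c \<odot>\<^bsub>B\<^esub> x) = c \<odot>\<^bsub>B\<^esub> cmp d x"
    and cmp_cmp: "x \<in> carrier B \<Longrightarrow> cmp d (cmp e x) = (if d = e then cmp d x else \<zero>\<^bsub>B\<^esub>)"
    and cmp_neg: "\<lbrakk>x \<in> carrier B; d < 0\<rbrakk> \<Longrightarrow> cmp d x = \<zero>\<^bsub>B\<^esub>"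
    and cmp_bound: "x \<in> carrier B \<Longrightarrow> \<exists>N. \<forall>d>N. cmp d x = \<zero>\<^bsub>B\<^esub>"
    and cmp_separated: "\<lbrakk>x \<in> carrier B; \<And>d. cmp d x = \<zero>\<^bsub>B\<^esub>\<rbrakk> \<Longrightarrow> x = \<zero>\<^bsub>B\<^esub>"
    and cmp_mult: "\<lbrakk>x \<in> carrier B; y \<in> carrier B\<rbrakk> \<Longrightarrow>
      cmp k (x \<otimes>\<^bsub>B\<^esub> y) = (\<Oplus>\<^bsub>B\<^esub>i\<in>{0..k}. cmp i x \<otimes>\<^bsub>B\<^esub> cmp (k - i) y)"
    and cmp_one: "cmp 0 \<one>\<^bsub>B\<^esub> = \<one>\<^bsub>B\<^esub>"
begin

definition "homog d = {x \<in> carrier B. cmp d x = x}"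
definition "below d = {x \<in> carrier B. \<forall>e>d. cmp e x = \<zero>\<^bsub>B\<^esub>}"

lemma cmp_zero [simp]: "cmp d \<zero>\<^bsub>B\<^esub> = \<zero>\<^bsub>B\<^esub>"
  using additive_map_zero[OF is_abelian_group is_abelian_group, of "cmp d"] cmp_add by simp

lemma cmp_minus: "\<lbrakk>x \<in> carrier B; y \<in> carrier B\<rbrakk> \<Longrightarrow> cmp d (x \<ominus>\<^bsub>B\<^esub> y) = cmp d x \<ominus>\<^bsub>B\<^esub> cmp d y"
  using additive_map_minus[OF is_abelian_group is_abelian_group, of "cmp d"] cmp_add by simp

lemma cmp_a_inv: "x \<in> carrier B \<Longrightarrow> cmp d (\<ominus>\<^bsub>B\<^esub> x) = \<ominus>\<^bsub>B\<^esub> cmp d x"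
  using additive_map_a_inv[OF is_abelian_group is_abelian_group, of "cmp d"] cmp_add by simp

lemma homog_carrier: "x \<in> homog d \<Longrightarrow> x \<in> carrier B" by (simp add: homog_def)
lemma below_carrier: "x \<in> below d \<Longrightarrow> x \<in> carrier B" by (simp add: below_def)

lemma cmp_homog: "x \<in> homog d \<Longrightarrow> cmp e x = (if e = d then x else \<zero>\<^bsub>B\<^esub>)"
  unfolding homog_def using cmp_cmp[of x e d] by auto

lemma cmp_in_homog [simp]: "x \<in> carrier B \<Longrightarrow> cmp d x \<in> homog d" by (simp add: homog_def cmp_cmp)

lemma eq_if_cmp_eq:
  assumes "x \<in> carrier B" "y \<in> carrier B" "\<And>d. cmp d x = cmp d y"
  shows "x = y"
proof -
  have "x \<ominus>\<^bsub>B\<^esub> y = \<zero>\<^bsub>B\<^esub>"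
  proof (rule cmp_separated)
    show "cmp d (x \<ominus>\<^bsub>B\<^esub> y) = \<zero>\<^bsub>B\<^esub>" for d
      using assms(1,2) assms(3)[of d] by (simp add: cmp_minus)
  qed (use assms in simp)
  then show ?thesis using assms by simp
qed

lemma homog_zero [simp]: "\<zero>\<^bsub>B\<^esub> \<in> homog d" by (simp add: homog_def)
lemma homog_add [simp]: "\<lbrakk>x \<in> homog d; y \<in> homog d\<rbrakk> \<Longrightarrow> x \<oplus>\<^bsub>B\<^esub> y \<in> homog d" by (simp add: homog_def cmp_add)
lemma homog_minus [simp]: "\<lbrakk>x \<in> homog d; y \<in> homog d\<rbrakk> \<Longrightarrow> x \<ominus>\<^bsub>B\<^esub> y \<in> homog d" by (simp add: homog_def cmp_minus)
lemma homog_smult [simp]: "\<lbrakk>c \<in> carrier K; x \<in> homog d\<rbrakk> \<Longrightarrow> c \<odot>\<^bsub>B\<^esub> x \<in> homog d" by (simp add: homog_def cmp_smult)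

lemma homog_neg: "\<lbrakk>x \<in> homog d; d < 0\<rbrakk> \<Longrightarrow> x = \<zero>\<^bsub>B\<^esub>" using cmp_neg[of x d] by (auto simp: homog_def)

lemma below_zero [simp]: "\<zero>\<^bsub>B\<^esub> \<in> below d" by (simp add: below_def)
lemma below_add [simp]: "\<lbrakk>x \<in> below d; y \<in> below d\<rbrakk> \<Longrightarrow> x \<oplus>\<^bsub>B\<^esub> y \<in> below d" by (simp add: below_def cmp_add)
lemma below_a_inv [simp]: "x \<in> below d \<Longrightarrow> \<ominus>\<^bsub>B\<^esub> x \<in> below d" by (simp add: below_def cmp_a_inv)
lemma below_smult [simp]: "\<lbrakk>c \<in> carrier K; x \<in> below d\<rbrakk> \<Longrightarrow> c \<odot>\<^bsub>B\<^esub> x \<in> below d" by (simp add: below_def cmp_smult)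
lemma below_mono: "\<lbrakk>x \<in> below d; d \<le> e\<rbrakk> \<Longrightarrow> x \<in> below e" by (simp add: below_def)
lemma homog_below: "\<lbrakk>x \<in> homog d; d \<le> e\<rbrakk> \<Longrightarrow> x \<in> below e" by (auto simp: below_def cmp_homog homog_carrier)
lemma below_exists: "x \<in> carrier B \<Longrightarrow> \<exists>d. x \<in> below d" using cmp_bound by (auto simp: below_def)

lemma below_neg: "\<lbrakk>x \<in> below d; d < 0\<rbrakk> \<Longrightarrow> x = \<zero>\<^bsub>B\<^esub>"
proof (rule cmp_separated)
  assume "x \<in> below d" "d < 0"
  then show "cmp e x = \<zero>\<^bsub>B\<^esub>" for e
    by (cases "e < 0") (auto simp: below_def cmp_neg)
qed (simp add: below_def)

lemma below_split:
  assumes "x \<in> below d"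
  shows "x \<ominus>\<^bsub>B\<^esub> cmp d x \<in> below (d - 1)"
proof -
  have x: "x \<in> carrier B" using assms by (rule below_carrier)
  have "cmp e (x \<ominus>\<^bsub>B\<^esub> cmp d x) = \<zero>\<^bsub>B\<^esub>" if "e > d - 1" for e
    using that assms x by (cases "e = d") (auto simp: cmp_minus cmp_cmp below_def)
  then show ?thesis using x by (simp add: below_def)
qed

lemma split_top: "x \<in> carrier B \<Longrightarrow> x = cmp d x \<oplus>\<^bsub>B\<^esub> (x \<ominus>\<^bsub>B\<^esub> cmp d x)"
  by (simp add: a_minus_def M.a_ac M.r_neg M.r_neg1)

lemma below_induct [consumes 1, case_names zero hom add]:
  assumes "x \<in> below d" and zero: "P \<zero>\<^bsub>B\<^esub>"
    and hom: "\<And>e y. \<lbrakk>e \<le> d; y \<in> homog e\<rbrakk> \<Longrightarrow> P y"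
    and add: "\<And>y z. \<lbrakk>y \<in> carrier B; z \<in> carrier B; P y; P z\<rbrakk> \<Longrightarrow> P (y \<oplus>\<^bsub>B\<^esub> z)"
  shows "P x"
proof -
  have "x \<in> below e \<Longrightarrow> e \<le> d \<Longrightarrow> P x" for e x
  proof (induction "nat (e + 1)" arbitrary: e x)
    case 0
    then show ?case using below_neg[of x e] zero by simp
  next
    case (Suc n)
    have x: "x \<in> carrier B" using Suc.prems(1) by (rule below_carrier)
    have "P (x \<ominus>\<^bsub>B\<^esub> cmp e x)"
      using Suc below_split[of x e] by (intro Suc.hyps(1)[of "e - 1"]) auto
    moreover have "P (cmp e x)" using x Suc.prems by (intro hom[of e]) auto
    ultimately show ?case using x split_top[OF x, of e] add[of "cmp e x" "x \<ominus>\<^bsub>B\<^esub> cmp e x"] by simp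
  qed
  then show ?thesis using assms(1) by blast
qed

lemma graded_induct [consumes 1, case_names zero hom add]:
  assumes "x \<in> carrier B" and "P \<zero>\<^bsub>B\<^esub>" and "\<And>e y. y \<in> homog e \<Longrightarrow> P y"
    and "\<And>y z. \<lbrakk>y \<in> carrier B; z \<in> carrier B; P y; P z\<rbrakk> \<Longrightarrow> P (y \<oplus>\<^bsub>B\<^esub> z)"
  shows "P x"
proof -
  obtain d where "x \<in> below d" using below_exists assms(1) by blast
  then show ?thesis by (induction rule: below_induct) (auto intro: assms)
qed

lemma below_mult:
  assumes x: "x \<in> below a" and y: "y \<in> below b"
  shows "x \<otimes>\<^bsub>B\<^esub> y \<in> below (a + b)"
proof -
  have c: "x \<in> carrier B" "y \<in> carrier B" using x y by (auto dest: below_carrier)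
  have "cmp k (x \<otimes>\<^bsub>B\<^esub> y) = \<zero>\<^bsub>B\<^esub>" if k: "k > a + b" for k
  proof -
    have "cmp i x \<otimes>\<^bsub>B\<^esub> cmp (k - i) y = \<zero>\<^bsub>B\<^esub>" for i
      using x y c k by (cases "i > a") (auto simp: below_def)
    then show ?thesis using c by (simp add: cmp_mult)
  qed
  then show ?thesis using c by (simp add: below_def)
qed

lemma homog_mult:
  assumes x: "x \<in> homog a" and y: "y \<in> homog b"
  shows "x \<otimes>\<^bsub>B\<^esub> y \<in> homog (a + b)"
proof -
  have c: "x \<in> carrier B" "y \<in> carrier B" using x y by (auto dest: homog_carrier)
  have "cmp k (x \<otimes>\<^bsub>B\<^esub> y) = \<zero>\<^bsub>B\<^esub>" if k: "k \<noteq> a + b" for k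
  proof -
    have "cmp i x \<otimes>\<^bsub>B\<^esub> cmp (k - i) y = \<zero>\<^bsub>B\<^esub>" for i
      using x y c k by (cases "i = a") (auto simp: cmp_homog)
    then show ?thesis using c by (simp add: cmp_mult)
  qed
  then have "cmp k (cmp (a + b) (x \<otimes>\<^bsub>B\<^esub> y)) = cmp k (x \<otimes>\<^bsub>B\<^esub> y)" for k
    using c by (simp add: cmp_cmp)
  then have "cmp (a + b) (x \<otimes>\<^bsub>B\<^esub> y) = x \<otimes>\<^bsub>B\<^esub> y" by (rule eq_if_cmp_eq[rotated 2]) (simp_all add: c)
  then show ?thesis using c by (simp add: homog_def)
qed

lemma one_homog: "\<one>\<^bsub>B\<^esub> \<in> homog 0" by (simp add: homog_def cmp_one)

end

lemma (in abelian_monoid) finsum_swap: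
  assumes "finite S" "finite T" "\<And>i j. \<lbrakk>i \<in> S; j \<in> T\<rbrakk> \<Longrightarrow> f i j \<in> carrier G"
  shows "(\<Oplus>i\<in>S. \<Oplus>j\<in>T. f i j) = (\<Oplus>j\<in>T. \<Oplus>i\<in>S. f i j)"
  using assms(1,3)
proof (induction S)
  case (insert s S)
  have "(\<Oplus>i\<in>insert s S. \<Oplus>j\<in>T. f i j) = (\<Oplus>j\<in>T. f s j) \<oplus> (\<Oplus>i\<in>S. \<Oplus>j\<in>T. f i j)"
    using insert by (intro finsum_insert) (auto intro!: finsum_closed)
  also have "\<dots> = (\<Oplus>j\<in>T. f s j) \<oplus> (\<Oplus>j\<in>T. \<Oplus>i\<in>S. f i j)" using insert by simp
  also have "\<dots> = (\<Oplus>j\<in>T. f s j \<oplus> (\<Oplus>i\<in>S. f i j))"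
    using insert by (intro finsum_addf[symmetric]) (auto intro!: finsum_closed)
  also have "\<dots> = (\<Oplus>j\<in>T. \<Oplus>i\<in>insert s S. f i j)"
    using insert by (intro finsum_cong') (auto intro!: finsum_closed finsum_insert[symmetric])
  finally show ?case .
qed simp

text \<open>The grading of \<open>B[t]\<close> with \<open>t\<close> in degree zero.\<close>

lemma (in graded_alg) poly_graded: "graded_alg (UP K) (poly_algebra B) (\<lambda>d z i. cmp d (z i))"
proof -
  let ?P = "poly_algebra B"
  interpret P: assoc_alg "UP K" ?P by (rule poly_assoc_alg)
  have PC: "carrier ?P = up B" "carrier (UP K) = up K" by (simp_all add: poly_algebra_simps UP_simps)
  have cl: "(\<lambda>i. cmp d (z i)) \<in> up B" if "z \<in> up B" for d z
    using that by (rule up_map) auto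
  have up_c: "z i \<in> carrier B" if "z \<in> up B" for z i using that by (rule upD)
  show ?thesis
  proof (unfold_locales, unfold PC)
    fix z d assume z: "z \<in> up B"
    then show "(\<lambda>i. cmp d (z i)) \<in> up B" by (rule cl)
    fix e
    show "(\<lambda>i. cmp d (cmp e (z i))) = (if d = e then \<lambda>i. cmp d (z i) else \<zero>\<^bsub>?P\<^esub>)"
      using z by (auto simp: poly_algebra_simps cmp_cmp up_c)
    show "d < 0 \<Longrightarrow> (\<lambda>i. cmp d (z i)) = \<zero>\<^bsub>?P\<^esub>"
      using z by (auto simp: poly_algebra_simps cmp_neg up_c)
    show "(\<And>d. (\<lambda>i. cmp d (z i)) = \<zero>\<^bsub>?P\<^esub>) \<Longrightarrow> z = \<zero>\<^bsub>?P\<^esub>"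
    proof -
      assume "\<And>d. (\<lambda>i. cmp d (z i)) = \<zero>\<^bsub>?P\<^esub>"
      then have "cmp d (z i) = \<zero>\<^bsub>B\<^esub>" for d i by (simp add: poly_algebra_simps fun_eq_iff)
      then have "z i = \<zero>\<^bsub>B\<^esub>" for i using up_c[OF z] by (rule cmp_separated[rotated])
      then show ?thesis by (simp add: poly_algebra_simps fun_eq_iff)
    qed
    show "\<exists>N. \<forall>d>N. (\<lambda>i. cmp d (z i)) = \<zero>\<^bsub>?P\<^esub>"
    proof -
      obtain M where M: "\<And>i. i > M \<Longrightarrow> z i = \<zero>\<^bsub>B\<^esub>" using up_bound[OF z] by blast
      have "\<forall>i. \<exists>N. \<forall>d>N. cmp d (z i) = \<zero>\<^bsub>B\<^esub>" using cmp_bound up_c[OF z] by blast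
      then obtain N where N: "\<And>i d. d > N i \<Longrightarrow> cmp d (z i) = \<zero>\<^bsub>B\<^esub>" by metis
      have "cmp d (z i) = \<zero>\<^bsub>B\<^esub>" if "d > Max (N ` {..M})" for d i
      proof (cases "i \<le> M")
        case True
        then have "N i \<le> Max (N ` {..M})" by simp
        then have "N i < d" using that by linarith
        then show ?thesis by (rule N)
      qed (use M in simp)
      then show ?thesis by (intro exI[of _ "Max (N ` {..M})"]) (simp add: poly_algebra_simps)
    qed
  next
    fix x y d assume x: "x \<in> up B" and y: "y \<in> up B"
    then show "(\<lambda>i. cmp d ((x \<oplus>\<^bsub>?P\<^esub> y) i)) = (\<lambda>i. cmp d (x i)) \<oplus>\<^bsub>?P\<^esub> (\<lambda>i. cmp d (y i))"
      by (auto simp: poly_algebra_simps cl cmp_add up_c)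
    let ?t = "\<lambda>n i j. cmp j (x i) \<otimes>\<^bsub>B\<^esub> cmp (d - j) (y (n - i))"
    have "cmp d (\<Oplus>\<^bsub>B\<^esub>i\<in>{..n}. x i \<otimes>\<^bsub>B\<^esub> y (n - i)) = (\<Oplus>\<^bsub>B\<^esub>j\<in>{0..d}. \<Oplus>\<^bsub>B\<^esub>i\<in>{..n}. ?t n i j)" for n
    proof -
      have "cmp d (\<Oplus>\<^bsub>B\<^esub>i\<in>{..n}. x i \<otimes>\<^bsub>B\<^esub> y (n - i)) = (\<Oplus>\<^bsub>B\<^esub>i\<in>{..n}. cmp d (x i \<otimes>\<^bsub>B\<^esub> y (n - i)))"
        using x y by (intro additive_map_finsum) (auto simp: cmp_add is_abelian_group up_c)
      also have "\<dots> = (\<Oplus>\<^bsub>B\<^esub>i\<in>{..n}. \<Oplus>\<^bsub>B\<^esub>j\<in>{0..d}. ?t n i j)"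
        using x y by (intro M.finsum_cong') (auto simp: cmp_mult up_c intro!: M.finsum_closed)
      also have "\<dots> = (\<Oplus>\<^bsub>B\<^esub>j\<in>{0..d}. \<Oplus>\<^bsub>B\<^esub>i\<in>{..n}. ?t n i j)"
        using x y by (intro M.finsum_swap) (auto simp: up_c)
      finally show ?thesis .
    qed
    moreover have "(\<Oplus>\<^bsub>?P\<^esub>j\<in>{0..d}. (\<lambda>i. cmp j (x i)) \<otimes>\<^bsub>?P\<^esub> (\<lambda>i. cmp (d - j) (y i))) n
        = (\<Oplus>\<^bsub>B\<^esub>j\<in>{0..d}. ((\<lambda>i. cmp j (x i)) \<otimes>\<^bsub>?P\<^esub> (\<lambda>i. cmp (d - j) (y i))) n)" for n
      using x y P.m_closed cl
      by (intro additive_map_finsum[where \<phi> = "\<lambda>z. z n"])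
         (auto simp: PC poly_algebra_simps(4) P.is_abelian_group is_abelian_group up_c)
    ultimately show "(\<lambda>i. cmp d ((x \<otimes>\<^bsub>?P\<^esub> y) i)) =
      (\<Oplus>\<^bsub>?P\<^esub>j\<in>{0..d}. (\<lambda>i. cmp j (x i)) \<otimes>\<^bsub>?P\<^esub> (\<lambda>i. cmp (d - j) (y i)))"
      using x y cl by (simp add: fun_eq_iff poly_algebra_simps(5))
  next
    fix p x d assume p: "p \<in> up K" and x: "x \<in> up B"
    have pc: "p i \<in> carrier K" for i using p by (rule upD)
    show "(\<lambda>i. cmp d ((p \<odot>\<^bsub>?P\<^esub> x) i)) = p \<odot>\<^bsub>?P\<^esub> (\<lambda>i. cmp d (x i))"
    proof
      fix k
      have "cmp d (\<Oplus>\<^bsub>B\<^esub>i\<in>{..k}. p i \<odot>\<^bsub>B\<^esub> x (k - i)) = (\<Oplus>\<^bsub>B\<^esub>i\<in>{..k}. cmp d (p i \<odot>\<^bsub>B\<^esub> x (k - i)))"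
        using x pc by (intro additive_map_finsum) (auto simp: cmp_add is_abelian_group up_c)
      also have "\<dots> = (\<Oplus>\<^bsub>B\<^esub>i\<in>{..k}. p i \<odot>\<^bsub>B\<^esub> cmp d (x (k - i)))"
        using x pc by (intro M.finsum_cong') (auto simp: cmp_smult up_c)
      finally show "cmp d ((p \<odot>\<^bsub>?P\<^esub> x) k) = (p \<odot>\<^bsub>?P\<^esub> (\<lambda>i. cmp d (x i))) k"
        by (simp add: poly_algebra_simps)
    qed
  next
    show "(\<lambda>i. cmp 0 (\<one>\<^bsub>?P\<^esub> i)) = \<one>\<^bsub>?P\<^esub>"
      by (auto simp: poly_algebra_simps mon_def cmp_one)
  qed
qed

section \<open>Graded presentations and their one-parameter families\<close>

lemma Cring_simps [simp]:
  "carrier Cring = UNIV" "\<one>\<^bsub>Cring\<^esub> = 1" "\<zero>\<^bsub>Cring\<^esub> = 0" "x \<otimes>\<^bsub>Cring\<^esub> y = x * y" "x \<oplus>\<^bsub>Cring\<^esub> y = x + y"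
  by (simp_all add: ring_of_type_algebra_def)

abbreviation tt :: "nat \<Rightarrow> complex" where "tt \<equiv> mon Cring 1 1"

lemma tt_closed [simp]: "mon Cring i c \<in> carrier (UP Cring)"
  by (simp add: UP_simps mon_in_up)

lemma (in abelian_group) add_minus_cancel: "\<lbrakk>a \<in> carrier G; b \<in> carrier G\<rbrakk> \<Longrightarrow> b \<oplus> (a \<ominus> b) = a"
  by (metis a_minus_def a_inv_closed a_lcomm r_neg r_zero)

lemma (in assoc_alg) poly_cons:
  assumes "a \<in> carrier A" "z \<in> up A" 
  shows poly_cons_closed: "case_nat a z \<in> up A"
    and poly_cons_eq: "case_nat a z = mon A 0 a \<oplus>\<^bsub>poly_algebra A\<^esub> mon K 1 \<one>\<^bsub>K\<^esub> \<odot>\<^bsub>poly_algebra A\<^esub> z"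
proof -
  have zc: "z i \<in> carrier A" for i using assms(2) by (rule upD)
  obtain N where "\<And>i. i > N \<Longrightarrow> z i = \<zero>\<^bsub>A\<^esub>" using up_bound[OF assms(2)] by blast
  then show "case_nat a z \<in> up A"
    using assms zc unfolding up_iff by (auto simp: split: nat.split intro!: exI[of _ "Suc N"])
  interpret P: assoc_alg "UP K" "poly_algebra A" by (rule poly_assoc_alg)
  have "mon K 1 \<one>\<^bsub>K\<^esub> \<odot>\<^bsub>poly_algebra A\<^esub> z \<in> up A"
    using P.smult_closed[of "mon K 1 \<one>\<^bsub>K\<^esub>" z] assms by (simp add: poly_algebra_simps(1) UP_simps mon_in_up)
  then show "case_nat a z = mon A 0 a \<oplus>\<^bsub>poly_algebra A\<^esub> mon K 1 \<one>\<^bsub>K\<^esub> \<odot>\<^bsub>poly_algebra A\<^esub> z"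
    using assms zc by (auto simp: poly_algebra_simps(4) mon_closed smult_poly_mon fun_eq_iff split: nat.split)
       (simp_all add: mon_def)
qed

lemma case_nat_split: "case_nat (z 0) (\<lambda>i. z (Suc i)) = z"
  by (auto simp: fun_eq_iff split: nat.split)

lemma poly_map_linear:
  assumes "assoc_alg K A" "assoc_alg K A'"
    and closed: "\<And>x. x \<in> carrier A \<Longrightarrow> f x \<in> carrier A'"
    and add: "\<And>x y. \<lbrakk>x \<in> carrier A; y \<in> carrier A\<rbrakk> \<Longrightarrow> f (x \<oplus>\<^bsub>A\<^esub> y) = f x \<oplus>\<^bsub>A'\<^esub> f y"
    and smult: "\<And>c x. \<lbrakk>c \<in> carrier K; x \<in> carrier A\<rbrakk> \<Longrightarrow> f (c \<odot>\<^bsub>A\<^esub> x) = c \<odot>\<^bsub>A'\<^esub> f x"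
  shows poly_map_closed: "z \<in> up A \<Longrightarrow> (\<lambda>i. f (z i)) \<in> up A'"
    and poly_map_add: "\<lbrakk>z \<in> up A; w \<in> up A\<rbrakk> \<Longrightarrow>
      (\<lambda>i. f ((z \<oplus>\<^bsub>poly_algebra A\<^esub> w) i)) = (\<lambda>i. f (z i)) \<oplus>\<^bsub>poly_algebra A'\<^esub> (\<lambda>i. f (w i))"
    and poly_map_smult: "\<lbrakk>p \<in> up K; z \<in> up A\<rbrakk> \<Longrightarrow>
      (\<lambda>i. f ((p \<odot>\<^bsub>poly_algebra A\<^esub> z) i)) = p \<odot>\<^bsub>poly_algebra A'\<^esub> (\<lambda>i. f (z i))"
    and poly_map_mon: "(\<lambda>k. f (mon A i a k)) = mon A' i (f a)"
proof -
  interpret A: assoc_alg K A by fact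
  interpret A': assoc_alg K A' by fact
  have z: "f \<zero>\<^bsub>A\<^esub> = \<zero>\<^bsub>A'\<^esub>" using closed add by (intro additive_map_zero) (auto simp: A.is_abelian_group A'.is_abelian_group)
  show c: "(\<lambda>i. f (z i)) \<in> up A'" if "z \<in> up A" for z using that closed z by (rule up_map)
  show "(\<lambda>i. f ((z \<oplus>\<^bsub>poly_algebra A\<^esub> w) i)) = (\<lambda>i. f (z i)) \<oplus>\<^bsub>poly_algebra A'\<^esub> (\<lambda>i. f (w i))"
    if "z \<in> up A" "w \<in> up A"
    using that c upD[OF that(1)] upD[OF that(2)] by (simp add: poly_algebra_simps(4) add)
  show "(\<lambda>i. f ((p \<odot>\<^bsub>poly_algebra A\<^esub> z) i)) = p \<odot>\<^bsub>poly_algebra A'\<^esub> (\<lambda>i. f (z i))"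
    if p: "p \<in> up K" and zz: "z \<in> up A"
  proof
    fix k
    have pc: "p i \<in> carrier K" "z i \<in> carrier A" for i using upD[OF p] upD[OF zz] by auto
    have "f (\<Oplus>\<^bsub>A\<^esub>i\<in>{..k}. p i \<odot>\<^bsub>A\<^esub> z (k - i)) = (\<Oplus>\<^bsub>A'\<^esub>i\<in>{..k}. f (p i \<odot>\<^bsub>A\<^esub> z (k - i)))"
      using pc closed add by (intro additive_map_finsum) (auto simp: A.is_abelian_group A'.is_abelian_group)
    also have "\<dots> = (\<Oplus>\<^bsub>A'\<^esub>i\<in>{..k}. p i \<odot>\<^bsub>A'\<^esub> f (z (k - i)))"
      using pc closed by (intro A'.M.finsum_cong') (auto simp: smult)
    finally show "f ((p \<odot>\<^bsub>poly_algebra A\<^esub> z) k) = (p \<odot>\<^bsub>poly_algebra A'\<^esub> (\<lambda>i. f (z i))) k"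
      by (simp add: poly_algebra_simps)
  qed
  show "(\<lambda>k. f (mon A i a k)) = mon A' i (f a)" by (auto simp: mon_def z)
qed

text \<open>
  \<open>B\<close> is a graded algebra, \<open>R\<close> the quotient of \<open>B\<close> by quadratic relations \<open>\<rho>\<close>, and each relation has a
  companion \<open>\<kappa>\<close> of degree zero. The linear section \<open>\<sigma>\<close> of the projection \<open>\<pi>\<close> plays the role of a choice of
  normal forms: \<open>\<sigma> (\<pi> x)\<close> is the normal form of \<open>x\<close>. The last assumption says, as an induction rule, that in
  each degree the kernel of \<open>\<pi>\<close> consists of sums of products \<open>a \<rho> b\<close>.
\<close>

locale presentation = B: graded_alg Cring B cmp + R: assoc_alg Cring R
  for B :: "(complex, 'b) module" and cmp and R :: "(complex, 'r) module" +
  fixes \<pi> :: "'b \<Rightarrow> 'r" and \<sigma> :: "'r \<Rightarrow> 'b" and rels :: "('b \<times> 'b) set"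
  assumes \<pi>_hom: "\<pi> \<in> alg_hom Cring B R"
    and \<sigma>_closed [simp]: "r \<in> carrier R \<Longrightarrow> \<sigma> r \<in> carrier B"
    and \<sigma>_add: "\<lbrakk>r \<in> carrier R; s \<in> carrier R\<rbrakk> \<Longrightarrow> \<sigma> (r \<oplus>\<^bsub>R\<^esub> s) = \<sigma> r \<oplus>\<^bsub>B\<^esub> \<sigma> s"
    and \<sigma>_smult: "r \<in> carrier R \<Longrightarrow> \<sigma> (c \<odot>\<^bsub>R\<^esub> r) = c \<odot>\<^bsub>B\<^esub> \<sigma> r"
    and \<pi>_\<sigma> [simp]: "r \<in> carrier R \<Longrightarrow> \<pi> (\<sigma> r) = r"
    and kernel_cmp: "\<lbrakk>x \<in> carrier B; \<pi> x = \<zero>\<^bsub>R\<^esub>\<rbrakk> \<Longrightarrow> \<pi> (cmp d x) = \<zero>\<^bsub>R\<^esub>"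
    and \<sigma>_homog: "x \<in> B.homog d \<Longrightarrow> \<sigma> (\<pi> x) \<in> B.homog d"
    and relsD: "(\<rho>, \<kappa>) \<in> rels \<Longrightarrow> \<rho> \<in> B.homog 2 \<and> \<kappa> \<in> B.homog 0 \<and> \<pi> \<rho> = \<zero>\<^bsub>R\<^esub>"
    and kernel_induct: "\<lbrakk>x \<in> B.homog m; \<pi> x = \<zero>\<^bsub>R\<^esub>; P \<zero>\<^bsub>B\<^esub>;
      \<And>u w. \<lbrakk>u \<in> carrier B; w \<in> carrier B; P u; P w\<rbrakk> \<Longrightarrow> P (u \<oplus>\<^bsub>B\<^esub> w);
      \<And>a \<rho> \<kappa> b p q. \<lbrakk>(\<rho>, \<kappa>) \<in> rels; a \<in> B.homog p; b \<in> B.homog q; p + q + 2 = m\<rbrakk> \<Longrightarrow> P (a \<otimes>\<^bsub>B\<^esub> \<rho> \<otimes>\<^bsub>B\<^esub> b)\<rbrakk> \<Longrightarrow> P x"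
begin

abbreviation "Bt \<equiv> poly_algebra B"
abbreviation "Rt \<equiv> poly_algebra R"
text \<open>
  The deformed relations read \<open>\<rho> = t \<kappa>\<close>, and \<open>H\<close> is the algebra that they define. The section \<open>\<sigma>\<close>, applied to
  coefficients, gives the linear map \<open>sec\<close> from \<open>R[t]\<close> to \<open>H\<close> on which everything hinges; \<open>Fil\<close> is the
  filtration of \<open>H\<close> by the degree in \<open>B\<close>, with \<open>t\<close> in degree zero.
\<close>

definition "J = genideal Bt {mon B 0 \<rho> \<ominus>\<^bsub>Bt\<^esub> mon B 1 \<kappa> | \<rho> \<kappa>. (\<rho>, \<kappa>) \<in> rels}"
abbreviation "H \<equiv> quotient_algebra Bt J"

sublocale Bt: graded_alg "UP Cring" Bt "\<lambda>d z i. cmp d (z i)" by (rule B.poly_graded)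
sublocale Rt: assoc_alg "UP Cring" Rt by (rule R.poly_assoc_alg)

lemma Bt_carrier: "carrier Bt = up B" by (simp add: poly_algebra_simps)
lemma Rt_carrier: "carrier Rt = up R" by (simp add: poly_algebra_simps)

lemma one_smult [simp]: "x \<in> carrier B \<Longrightarrow> 1 \<odot>\<^bsub>B\<^esub> x = x" "r \<in> carrier R \<Longrightarrow> 1 \<odot>\<^bsub>R\<^esub> r = r"
  using B.smult_one[of x] R.smult_one[of r] by simp_all

lemma relation_closed: "(\<rho>, \<kappa>) \<in> rels \<Longrightarrow> mon B i \<rho> \<in> carrier Bt \<and> mon B i \<kappa> \<in> carrier Bt"
  using relsD[of \<rho> \<kappa>] B.homog_carrier[of \<rho>] B.homog_carrier[of \<kappa>] by (auto simp: Bt_carrier intro!: B.mon_closed)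

sublocale J: alg_ideal "UP Cring" Bt J
proof (unfold alg_ideal_def, intro conjI)
  show "assoc_alg (UP Cring) Bt" by (rule B.poly_assoc_alg)
  show "ideal J Bt" unfolding J_def using relation_closed by (intro Bt.genideal_ideal) auto
qed

sublocale H: assoc_alg "UP Cring" H by (rule J.quotient_assoc_alg)

abbreviation cl where "cl \<equiv> J.cls"
abbreviation \<pi>t where "\<pi>t z \<equiv> (\<lambda>i. \<pi> (z i))"
abbreviation \<sigma>t where "\<sigma>t x \<equiv> (\<lambda>i. \<sigma> (x i))"
definition "sec x = cl (\<sigma>t x)"
definition "Rdeg d = \<pi> ` B.homog d"
definition "Fil d = cl ` Bt.below d"

lemma relation: "(\<rho>, \<kappa>) \<in> rels \<Longrightarrow> cl (mon B 0 \<rho>) = cl (mon B 1 \<kappa>)"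
proof -
  assume r: "(\<rho>, \<kappa>) \<in> rels"
  have "{mon B 0 \<rho> \<ominus>\<^bsub>Bt\<^esub> mon B 1 \<kappa> | \<rho> \<kappa>. (\<rho>, \<kappa>) \<in> rels} \<subseteq> J"
    unfolding J_def using relation_closed by (intro Bt.genideal_self) auto
  with r have "mon B 0 \<rho> \<ominus>\<^bsub>Bt\<^esub> mon B 1 \<kappa> \<in> J" by blast
  then show ?thesis using relation_closed[OF r] by (simp add: J.cls_eq_iff)
qed

lemma \<pi>_simps [simp]:
  "x \<in> carrier B \<Longrightarrow> \<pi> x \<in> carrier R"
  "\<lbrakk>x \<in> carrier B; y \<in> carrier B\<rbrakk> \<Longrightarrow> \<pi> (x \<oplus>\<^bsub>B\<^esub> y) = \<pi> x \<oplus>\<^bsub>R\<^esub> \<pi> y"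
  "\<lbrakk>x \<in> carrier B; y \<in> carrier B\<rbrakk> \<Longrightarrow> \<pi> (x \<otimes>\<^bsub>B\<^esub> y) = \<pi> x \<otimes>\<^bsub>R\<^esub> \<pi> y"
  "\<lbrakk>x \<in> carrier B; y \<in> carrier B\<rbrakk> \<Longrightarrow> \<pi> (x \<ominus>\<^bsub>B\<^esub> y) = \<pi> x \<ominus>\<^bsub>R\<^esub> \<pi> y"
  "x \<in> carrier B \<Longrightarrow> \<pi> (c \<odot>\<^bsub>B\<^esub> x) = c \<odot>\<^bsub>R\<^esub> \<pi> x"
  "\<pi> \<zero>\<^bsub>B\<^esub> = \<zero>\<^bsub>R\<^esub>" "\<pi> \<one>\<^bsub>B\<^esub> = \<one>\<^bsub>R\<^esub>"
  using alg_homD[OF \<pi>_hom] additive_map_zero[OF B.is_abelian_group R.is_abelian_group, of \<pi>]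
    additive_map_minus[OF B.is_abelian_group R.is_abelian_group, of \<pi>] by simp_all

lemma \<sigma>_zero [simp]: "\<sigma> \<zero>\<^bsub>R\<^esub> = \<zero>\<^bsub>B\<^esub>"
  using additive_map_zero[OF R.is_abelian_group B.is_abelian_group, of \<sigma>] \<sigma>_add by simp

lemma \<pi>t_closed [simp]: "z \<in> carrier Bt \<Longrightarrow> \<pi>t z \<in> carrier Rt"
  and \<pi>t_add: "\<lbrakk>z \<in> carrier Bt; w \<in> carrier Bt\<rbrakk> \<Longrightarrow> \<pi>t (z \<oplus>\<^bsub>Bt\<^esub> w) = \<pi>t z \<oplus>\<^bsub>Rt\<^esub> \<pi>t w"
  and \<pi>t_smult: "\<lbrakk>p \<in> carrier (UP Cring); z \<in> carrier Bt\<rbrakk> \<Longrightarrow> \<pi>t (p \<odot>\<^bsub>Bt\<^esub> z) = p \<odot>\<^bsub>Rt\<^esub> \<pi>t z"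
  unfolding Bt_carrier Rt_carrier UP_simps
  by (intro poly_map_linear[OF B.assoc_alg_axioms R.assoc_alg_axioms, of \<pi>]; simp)+

lemma \<sigma>t_closed [simp]: "x \<in> carrier Rt \<Longrightarrow> \<sigma>t x \<in> carrier Bt"
  and \<sigma>t_add: "\<lbrakk>x \<in> carrier Rt; y \<in> carrier Rt\<rbrakk> \<Longrightarrow> \<sigma>t (x \<oplus>\<^bsub>Rt\<^esub> y) = \<sigma>t x \<oplus>\<^bsub>Bt\<^esub> \<sigma>t y"
  and \<sigma>t_smult: "\<lbrakk>p \<in> carrier (UP Cring); x \<in> carrier Rt\<rbrakk> \<Longrightarrow> \<sigma>t (p \<odot>\<^bsub>Rt\<^esub> x) = p \<odot>\<^bsub>Bt\<^esub> \<sigma>t x"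
  unfolding Bt_carrier Rt_carrier UP_simps
  by (intro poly_map_linear[OF R.assoc_alg_axioms B.assoc_alg_axioms, of \<sigma>]; simp add: \<sigma>_add \<sigma>_smult)+

lemma \<pi>t_minus: "\<lbrakk>z \<in> carrier Bt; w \<in> carrier Bt\<rbrakk> \<Longrightarrow> \<pi>t (z \<ominus>\<^bsub>Bt\<^esub> w) = \<pi>t z \<ominus>\<^bsub>Rt\<^esub> \<pi>t w"
  using additive_map_minus[OF Bt.is_abelian_group Rt.is_abelian_group, of \<pi>t] \<pi>t_add by simp

lemma \<pi>t_mult:
  assumes "z \<in> carrier Bt" "w \<in> carrier Bt"
  shows "\<pi>t (z \<otimes>\<^bsub>Bt\<^esub> w) = \<pi>t z \<otimes>\<^bsub>Rt\<^esub> \<pi>t w"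
proof
  fix k
  have c: "z i \<in> carrier B" "w i \<in> carrier B" for i using assms upD unfolding Bt_carrier by (blast, blast)
  have "\<pi> (\<Oplus>\<^bsub>B\<^esub>i\<in>{..k}. z i \<otimes>\<^bsub>B\<^esub> w (k - i)) = (\<Oplus>\<^bsub>R\<^esub>i\<in>{..k}. \<pi> (z i \<otimes>\<^bsub>B\<^esub> w (k - i)))"
    using c by (intro additive_map_finsum) (auto simp: B.is_abelian_group R.is_abelian_group)
  also have "\<dots> = (\<Oplus>\<^bsub>R\<^esub>i\<in>{..k}. \<pi> (z i) \<otimes>\<^bsub>R\<^esub> \<pi> (w (k - i)))"
    using c by (intro R.M.finsum_cong') auto
  finally show "\<pi> ((z \<otimes>\<^bsub>Bt\<^esub> w) k) = (\<pi>t z \<otimes>\<^bsub>Rt\<^esub> \<pi>t w) k"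
    using assms \<pi>t_closed[OF assms(1)] \<pi>t_closed[OF assms(2)] by (simp add: poly_algebra_simps)
qed

lemma \<pi>t_\<sigma>t [simp]: "x \<in> carrier Rt \<Longrightarrow> \<pi>t (\<sigma>t x) = x"
  by (auto simp: Rt_carrier fun_eq_iff upD)

lemma Rdeg_iff: "r \<in> Rdeg d \<longleftrightarrow> r \<in> carrier R \<and> \<sigma> r \<in> B.homog d"
  unfolding Rdeg_def using \<sigma>_homog B.homog_carrier by (auto intro!: image_eqI[of r \<pi> "\<sigma> r"])

lemma Bt_homog_iff: "z \<in> Bt.homog d \<longleftrightarrow> z \<in> carrier Bt \<and> (\<forall>i. z i \<in> B.homog d)"
  unfolding Bt.homog_def B.homog_def by (auto simp: Bt_carrier upD fun_eq_iff)

lemma Bt_below_iff: "z \<in> Bt.below d \<longleftrightarrow> z \<in> carrier Bt \<and> (\<forall>i. z i \<in> B.below d)"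
  unfolding Bt.below_def B.below_def by (auto simp: Bt_carrier upD fun_eq_iff poly_algebra_simps)

lemma poly_part_Rdeg: "poly_part R (Rdeg d) = {x \<in> carrier Rt. \<sigma>t x \<in> Bt.homog d}"
  unfolding poly_part_def by (auto simp: Rdeg_iff Bt_homog_iff Rt_carrier upD)

lemma poly_part_below: "poly_part B (B.below d) = Bt.below d"
  unfolding poly_part_def by (auto simp: Bt_below_iff)

lemma cl_simps:
  "z \<in> carrier Bt \<Longrightarrow> cl z \<in> carrier H"
  "\<lbrakk>z \<in> carrier Bt; w \<in> carrier Bt\<rbrakk> \<Longrightarrow> cl (z \<oplus>\<^bsub>Bt\<^esub> w) = cl z \<oplus>\<^bsub>H\<^esub> cl w"
  "\<lbrakk>z \<in> carrier Bt; w \<in> carrier Bt\<rbrakk> \<Longrightarrow> cl (z \<otimes>\<^bsub>Bt\<^esub> w) = cl z \<otimes>\<^bsub>H\<^esub> cl w"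
  "\<lbrakk>z \<in> carrier Bt; w \<in> carrier Bt\<rbrakk> \<Longrightarrow> cl (z \<ominus>\<^bsub>Bt\<^esub> w) = cl z \<ominus>\<^bsub>H\<^esub> cl w"
  "\<lbrakk>p \<in> carrier (UP Cring); z \<in> carrier Bt\<rbrakk> \<Longrightarrow> cl (p \<odot>\<^bsub>Bt\<^esub> z) = p \<odot>\<^bsub>H\<^esub> cl z"
  "cl \<zero>\<^bsub>Bt\<^esub> = \<zero>\<^bsub>H\<^esub>" "cl \<one>\<^bsub>Bt\<^esub> = \<one>\<^bsub>H\<^esub>"
  using alg_homD[OF J.cls_alg_hom] additive_map_zero[OF Bt.is_abelian_group H.is_abelian_group, of cl]
    additive_map_minus[OF Bt.is_abelian_group H.is_abelian_group, of cl] by simp_all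

lemma sec_simps:
  "x \<in> carrier Rt \<Longrightarrow> sec x \<in> carrier H"
  "\<lbrakk>x \<in> carrier Rt; y \<in> carrier Rt\<rbrakk> \<Longrightarrow> sec (x \<oplus>\<^bsub>Rt\<^esub> y) = sec x \<oplus>\<^bsub>H\<^esub> sec y"
  "\<lbrakk>p \<in> carrier (UP Cring); x \<in> carrier Rt\<rbrakk> \<Longrightarrow> sec (p \<odot>\<^bsub>Rt\<^esub> x) = p \<odot>\<^bsub>H\<^esub> sec x"
  by (simp_all add: sec_def \<sigma>t_add \<sigma>t_smult cl_simps)

lemma sec_zero: "sec \<zero>\<^bsub>Rt\<^esub> = \<zero>\<^bsub>H\<^esub>" and sec_minus: "\<lbrakk>x \<in> carrier Rt; y \<in> carrier Rt\<rbrakk> \<Longrightarrow> sec (x \<ominus>\<^bsub>Rt\<^esub> y) = sec x \<ominus>\<^bsub>H\<^esub> sec y"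
  using additive_map_zero[OF Rt.is_abelian_group H.is_abelian_group, of sec]
    additive_map_minus[OF Rt.is_abelian_group H.is_abelian_group, of sec] sec_simps by simp_all

subsection \<open>Normal forms\<close>

lemma nf_cmp: "x \<in> carrier B \<Longrightarrow> \<sigma> (\<pi> (cmp d x)) = cmp d (\<sigma> (\<pi> x))"
proof (induction x rule: B.graded_induct)
  case (hom e y)
  then show ?case using \<sigma>_homog[OF hom] by (simp add: B.cmp_homog)
next
  case (add y z)
  then show ?case by (simp add: B.cmp_add \<sigma>_add)
qed simp

lemma nft_cmp: "z \<in> carrier Bt \<Longrightarrow> \<sigma>t (\<pi>t (\<lambda>i. cmp d (z i))) = (\<lambda>i. cmp d (\<sigma> (\<pi> (z i))))"
  by (auto simp: Bt_carrier nf_cmp upD)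

text \<open>A relation \<open>\<rho>\<close> equals \<open>t \<kappa>\<close> in \<open>H\<close>, so what \<open>\<pi>\<close> kills is divisible by \<open>t\<close> there, and the quotient
  has degree smaller by two.\<close>

lemma kernel_const:
  assumes "x \<in> B.homog m" "\<pi> x = \<zero>\<^bsub>R\<^esub>"
  shows "\<exists>y\<in>B.homog (m - 2). cl (mon B 0 x) = tt \<odot>\<^bsub>H\<^esub> cl (mon B 0 y)"
proof (rule kernel_induct[OF assms], goal_cases)
  case 1
  have "mon B 0 \<zero>\<^bsub>B\<^esub> = \<zero>\<^bsub>Bt\<^esub>" by (auto simp: mon_def poly_algebra_simps)
  then show ?case by (intro bexI[of _ "\<zero>\<^bsub>B\<^esub>"]) (simp_all add: cl_simps)
next
  case (2 u w)
  then obtain y y' where y: "y \<in> B.homog (m - 2)" "cl (mon B 0 u) = tt \<odot>\<^bsub>H\<^esub> cl (mon B 0 y)"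
    and y': "y' \<in> B.homog (m - 2)" "cl (mon B 0 w) = tt \<odot>\<^bsub>H\<^esub> cl (mon B 0 y')" by blast
  have c: "y \<in> carrier B" "y' \<in> carrier B" using y y' B.homog_carrier by auto
  show ?case
    using 2(1,2) c y y'
    by (intro bexI[of _ "y \<oplus>\<^bsub>B\<^esub> y'"])
       (simp_all add: B.mon_add[symmetric] Bt_carrier B.mon_closed cl_simps H.smult_r_distr)
next
  case (3 a \<rho> \<kappa> b p q)
  have \<rho>\<kappa>: "\<rho> \<in> carrier B" "\<kappa> \<in> B.homog 0" "\<kappa> \<in> carrier B" "a \<in> carrier B" "b \<in> carrier B"
    using relsD[OF 3(1)] 3 B.homog_carrier by auto
  have "cl (mon B 0 (a \<otimes>\<^bsub>B\<^esub> \<rho> \<otimes>\<^bsub>B\<^esub> b)) = cl (mon B 0 a) \<otimes>\<^bsub>H\<^esub> cl (mon B 0 \<rho>) \<otimes>\<^bsub>H\<^esub> cl (mon B 0 b)"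
    using \<rho>\<kappa> B.mon_mult[of a \<rho> 0 0] B.mon_mult[of "a \<otimes>\<^bsub>B\<^esub> \<rho>" b 0 0]
    by (simp add: cl_simps(3)[symmetric] Bt_carrier B.mon_closed)
  also have "\<dots> = cl (mon B 0 a) \<otimes>\<^bsub>H\<^esub> cl (mon B 1 \<kappa>) \<otimes>\<^bsub>H\<^esub> cl (mon B 0 b)"
    using relation[OF 3(1)] by simp
  also have "\<dots> = cl (mon B 1 (a \<otimes>\<^bsub>B\<^esub> \<kappa> \<otimes>\<^bsub>B\<^esub> b))"
    using \<rho>\<kappa> B.mon_mult[of a \<kappa> 0 1] B.mon_mult[of "a \<otimes>\<^bsub>B\<^esub> \<kappa>" b 1 0]
    by (simp add: cl_simps(3)[symmetric] Bt_carrier B.mon_closed)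
  also have "\<dots> = tt \<odot>\<^bsub>H\<^esub> cl (mon B 0 (a \<otimes>\<^bsub>B\<^esub> \<kappa> \<otimes>\<^bsub>B\<^esub> b))"
    using \<rho>\<kappa> one_smult B.smult_mon_mon[of 1 "a \<otimes>\<^bsub>B\<^esub> \<kappa> \<otimes>\<^bsub>B\<^esub> b" 1 0]
    by (simp add: cl_simps(5)[symmetric] Bt_carrier B.mon_closed)
  finally show ?case
    using B.homog_mult[OF B.homog_mult[OF 3(2) \<rho>\<kappa>(2)] 3(3)] 3(4)
    by (intro bexI[of _ "a \<otimes>\<^bsub>B\<^esub> \<kappa> \<otimes>\<^bsub>B\<^esub> b"]) (auto simp: algebra_simps)
qed

lemma mon_in_Bt [simp]: "a \<in> carrier B \<Longrightarrow> mon B i a \<in> carrier Bt"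
  by (simp add: Bt_carrier B.mon_closed)

lemma Bt_coeff [simp]: "z \<in> carrier Bt \<Longrightarrow> z i \<in> carrier B"
  by (simp add: Bt_carrier upD)

lemma Rt_coeff [simp]: "x \<in> carrier Rt \<Longrightarrow> x i \<in> carrier R"
  by (simp add: Rt_carrier upD)

lemma mon_homog: "a \<in> B.homog d \<Longrightarrow> mon B i a \<in> Bt.homog d"
  by (auto simp: Bt_homog_iff B.homog_carrier) (simp add: mon_def)

lemma kernel_poly:
  assumes z: "z \<in> Bt.homog m" and ker: "\<pi>t z = \<zero>\<^bsub>Rt\<^esub>"
  shows "\<exists>y\<in>Bt.homog (m - 2). cl z = tt \<odot>\<^bsub>H\<^esub> cl y"
proof -
  have zB: "z \<in> up B" using z by (simp add: Bt_homog_iff Bt_carrier)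
  show ?thesis
    using B.is_abelian_group zB
  proof (induction z rule: up_induct)
    case zero
    then show ?case
      by (intro bexI[of _ "\<zero>\<^bsub>Bt\<^esub>"]) (simp_all only: cl_simps poly_algebra_simps(2)[symmetric], simp_all)
  next
    case (mon i)
    have zi: "z i \<in> B.homog m" "\<pi> (z i) = \<zero>\<^bsub>R\<^esub>"
      using z ker by (auto simp: Bt_homog_iff fun_eq_iff poly_algebra_simps)
    obtain y where y: "y \<in> B.homog (m - 2)" "cl (mon B 0 (z i)) = tt \<odot>\<^bsub>H\<^esub> cl (mon B 0 y)"
      using kernel_const[OF zi] by blast
    have c: "y \<in> carrier B" "z i \<in> carrier B" using y zi B.homog_carrier by auto
    have s: "cl (mon B i a) = mon Cring i 1 \<odot>\<^bsub>H\<^esub> cl (mon B 0 a)" if "a \<in> carrier B" for a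
      using that one_smult B.smult_mon_mon[of 1 a i 0] by (simp add: cl_simps(5)[symmetric])
    have "mon Cring i 1 \<odot>\<^bsub>H\<^esub> (tt \<odot>\<^bsub>H\<^esub> h) = tt \<odot>\<^bsub>H\<^esub> (mon Cring i 1 \<odot>\<^bsub>H\<^esub> h)" if "h \<in> carrier H" for h
      using that comm_monoid.m_comm[OF cring.axioms(2)[OF B.UP_K_cring], of "mon Cring i 1" tt] by (simp add: H.smult_assoc1[symmetric])
    then have "cl (mon B i (z i)) = tt \<odot>\<^bsub>H\<^esub> cl (mon B i y)"
      using c by (simp add: s y cl_simps)
    then show ?case using mon_homog[OF y(1)] by blast
  next
    case (add u w)
    then obtain y y' where y: "y \<in> Bt.homog (m - 2)" "cl u = tt \<odot>\<^bsub>H\<^esub> cl y"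
      and y': "y' \<in> Bt.homog (m - 2)" "cl w = tt \<odot>\<^bsub>H\<^esub> cl y'" by blast
    have "cl (u \<oplus>\<^bsub>Bt\<^esub> w) = tt \<odot>\<^bsub>H\<^esub> cl (y \<oplus>\<^bsub>Bt\<^esub> y')"
      using add y y' Bt.homog_carrier[OF y(1)] Bt.homog_carrier[OF y'(1)]
      by (simp add: Bt_carrier cl_simps H.smult_r_distr)
    then show ?case
      using add y y' by (intro bexI[of _ "y \<oplus>\<^bsub>Bt\<^esub> y'"]) (simp_all add: poly_algebra_simps(4)[symmetric])
  qed
qed

lemma Fil_subgroup: "additive_subgroup (Fil d) H"
proof (rule additive_subgroupI, rule subgroup.intro)
  show "Fil d \<subseteq> carrier (add_monoid H)" unfolding Fil_def using Bt.below_carrier by (auto simp: cl_simps)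
  show "\<one>\<^bsub>add_monoid H\<^esub> \<in> Fil d"
    unfolding Fil_def using Bt.below_zero cl_simps(6) by (metis imageI monoid.simps(2))
  fix h assume "h \<in> Fil d"
  then obtain x where x: "x \<in> Bt.below d" "h = cl x" unfolding Fil_def by blast
  show "inv\<^bsub>add_monoid H\<^esub> h \<in> Fil d"
  proof -
    have "\<ominus>\<^bsub>H\<^esub> cl x = cl (\<ominus>\<^bsub>Bt\<^esub> x)"
      using additive_map_a_inv[OF Bt.is_abelian_group H.is_abelian_group, of cl x] cl_simps(1,2) Bt.below_carrier[OF x(1)] by simp
    moreover have "\<ominus>\<^bsub>Bt\<^esub> x \<in> Bt.below d" using x(1) by (rule Bt.below_a_inv)
    ultimately show ?thesis unfolding Fil_def x(2) a_inv_def[symmetric] by simp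
  qed
  fix h' assume "h' \<in> Fil d"
  then obtain y where y: "y \<in> Bt.below d" "h' = cl y" unfolding Fil_def by blast
  have "h \<oplus>\<^bsub>H\<^esub> h' = cl (x \<oplus>\<^bsub>Bt\<^esub> y)" using x y Bt.below_carrier by (simp add: cl_simps)
  then show "h \<otimes>\<^bsub>add_monoid H\<^esub> h' \<in> Fil d" using x y unfolding Fil_def by auto
qed

lemma Fil_abelian_subgroup: "abelian_subgroup (Fil d) H"
  by (rule abelian_subgroupI3[OF Fil_subgroup H.is_abelian_group])

lemma Fil_mono: "\<lbrakk>x \<in> Fil d; d \<le> e\<rbrakk> \<Longrightarrow> x \<in> Fil e"
  unfolding Fil_def using Bt.below_mono by blast

lemma Fil_mult: "\<lbrakk>x \<in> Fil a; y \<in> Fil b\<rbrakk> \<Longrightarrow> x \<otimes>\<^bsub>H\<^esub> y \<in> Fil (a + b)"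
  unfolding Fil_def using Bt.below_mult Bt.below_carrier by (force simp: cl_simps(3)[symmetric])

lemma Fil_smult: "\<lbrakk>p \<in> carrier (UP Cring); x \<in> Fil d\<rbrakk> \<Longrightarrow> p \<odot>\<^bsub>H\<^esub> x \<in> Fil d"
  unfolding Fil_def using Bt.below_smult Bt.below_carrier by (force simp: cl_simps(5)[symmetric])

lemma Fil_cl: "z \<in> Bt.below d \<Longrightarrow> cl z \<in> Fil d" unfolding Fil_def by blast

lemma Fil_coset_iff: "\<lbrakk>x \<in> carrier H; y \<in> carrier H\<rbrakk> \<Longrightarrow> Fil d +>\<^bsub>H\<^esub> x = Fil d +>\<^bsub>H\<^esub> y \<longleftrightarrow> x \<ominus>\<^bsub>H\<^esub> y \<in> Fil d"
  by (rule a_coset_eq_iff[OF Fil_subgroup H.is_abelian_group])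

text \<open>Modulo lower filtration degree, the class of a homogeneous element depends only on its image in \<open>R[t]\<close>.\<close>

lemma kernel_below:
  assumes "z \<in> Bt.homog d" "\<pi>t z = \<zero>\<^bsub>Rt\<^esub>"
  shows "cl z \<in> Fil (d - 1)"
proof -
  obtain y where "y \<in> Bt.homog (d - 2)" "cl z = tt \<odot>\<^bsub>H\<^esub> cl y" using kernel_poly[OF assms] by blast
  then show ?thesis using Bt.homog_below[of y "d - 2" "d - 1"] by (simp add: Fil_smult Fil_cl)
qed

lemma nft_homog: "z \<in> Bt.homog d \<Longrightarrow> \<sigma>t (\<pi>t z) \<in> Bt.homog d"
  by (auto simp: Bt_homog_iff \<sigma>_homog)

lemma sec_eq_mod_below:
  assumes "z \<in> Bt.homog d"
  shows "cl z \<ominus>\<^bsub>H\<^esub> sec (\<pi>t z) \<in> Fil (d - 1)"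
proof -
  have c: "z \<in> carrier Bt" using assms by (rule Bt.homog_carrier)
  have "cl (z \<ominus>\<^bsub>Bt\<^esub> \<sigma>t (\<pi>t z)) \<in> Fil (d - 1)"
    using c by (intro kernel_below Bt.homog_minus nft_homog assms) (simp add: \<pi>t_minus)
  then show ?thesis using c by (simp add: sec_def cl_simps)
qed

text \<open>Replacing the component of top degree \<open>d\<close> by its normal form changes the class by something of smaller
  filtration degree, so induction on \<open>d\<close> gives a normal form of no larger filtration degree.\<close>

lemma normal_form_below:
  assumes "z \<in> Bt.below d"
  shows "\<exists>x\<in>carrier Rt. \<sigma>t x \<in> Bt.below d \<and> cl z = sec x"
  using assms
proof (induction "nat (d + 1)" arbitrary: d z)
  case 0
  then have "z = \<zero>\<^bsub>Bt\<^esub>" using Bt.below_neg by simp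
  moreover have "\<sigma>t \<zero>\<^bsub>Rt\<^esub> = \<zero>\<^bsub>Bt\<^esub>" by (simp add: poly_algebra_simps)
  ultimately show ?case by (intro bexI[of _ "\<zero>\<^bsub>Rt\<^esub>"]) (simp_all add: sec_zero cl_simps)
next
  case (Suc n)
  let ?z = "\<lambda>i. cmp d (z i)"
  have c: "z \<in> carrier Bt" using Suc.prems by (rule Bt.below_carrier)
  have zd: "?z \<in> Bt.homog d" using c by simp
  then have zc: "?z \<in> carrier Bt" by (rule Bt.homog_carrier)
  have "cl ?z \<ominus>\<^bsub>H\<^esub> sec (\<pi>t ?z) \<in> Fil (d - 1)" by (rule sec_eq_mod_below[OF zd])
  then obtain w where w: "w \<in> Bt.below (d - 1)" "cl ?z \<ominus>\<^bsub>H\<^esub> sec (\<pi>t ?z) = cl w" unfolding Fil_def by blast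
  have wz: "w \<oplus>\<^bsub>Bt\<^esub> (z \<ominus>\<^bsub>Bt\<^esub> ?z) \<in> Bt.below (d - 1)" using w Bt.below_split[OF Suc.prems] by simp
  have "n = nat (d - 1 + 1)" using Suc.hyps(2) by simp
  then obtain x where x: "x \<in> carrier Rt" "\<sigma>t x \<in> Bt.below (d - 1)" "cl (w \<oplus>\<^bsub>Bt\<^esub> (z \<ominus>\<^bsub>Bt\<^esub> ?z)) = sec x"
    using Suc.hyps(1)[OF _ wz] by blast
  have wc: "w \<in> carrier Bt" using w Bt.below_carrier by blast
  have zz: "z = ?z \<oplus>\<^bsub>Bt\<^esub> (z \<ominus>\<^bsub>Bt\<^esub> ?z)" by (rule Bt.split_top[OF c])
  have "cl z = cl ?z \<oplus>\<^bsub>H\<^esub> cl (z \<ominus>\<^bsub>Bt\<^esub> ?z)"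
    using cl_simps(2)[OF zc Bt.minus_closed[OF c zc]] zz by metis
  also have "cl ?z = sec (\<pi>t ?z) \<oplus>\<^bsub>H\<^esub> cl w"
  proof -
    have "cl ?z \<in> carrier H" "sec (\<pi>t ?z) \<in> carrier H" using zc by (simp_all add: cl_simps sec_simps)
    then show ?thesis unfolding w(2)[symmetric] by (simp add: H.M.add_minus_cancel)
  qed
  also have "\<dots> \<oplus>\<^bsub>H\<^esub> cl (z \<ominus>\<^bsub>Bt\<^esub> ?z) = sec (\<pi>t ?z) \<oplus>\<^bsub>H\<^esub> (cl w \<oplus>\<^bsub>H\<^esub> cl (z \<ominus>\<^bsub>Bt\<^esub> ?z))"
    using sec_simps(1)[OF \<pi>t_closed[OF zc]] cl_simps(1)[OF wc] cl_simps(1)[OF Bt.minus_closed[OF c zc]]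
    by (rule H.M.a_assoc)
  also have "cl w \<oplus>\<^bsub>H\<^esub> cl (z \<ominus>\<^bsub>Bt\<^esub> ?z) = sec x"
    unfolding x(3)[symmetric] using wc c zc by (intro cl_simps(2)[symmetric] Bt.minus_closed)
  finally have "cl z = sec (\<pi>t ?z) \<oplus>\<^bsub>H\<^esub> sec x" .
  then have "cl z = sec (\<pi>t ?z \<oplus>\<^bsub>Rt\<^esub> x)" using zc x by (simp add: sec_simps)
  moreover have "\<sigma>t (\<pi>t ?z) \<in> Bt.below d" using nft_homog[OF zd] Bt.homog_below by blast
  moreover have "\<sigma>t x \<in> Bt.below d" using x(2) Bt.below_mono by fastforce
  ultimately show ?case
    using zc x by (intro bexI[of _ "\<pi>t ?z \<oplus>\<^bsub>Rt\<^esub> x"]) (simp_all add: \<sigma>t_add)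
qed

text \<open>So \<open>sec\<close> is onto for any choice of the \<open>\<kappa>\<close>; only its injectivity is a condition.\<close>

lemma sec_surj: "h \<in> carrier H \<Longrightarrow> \<exists>x\<in>carrier Rt. h = sec x"
  using J.cls_surj Bt.below_exists normal_form_below by metis

end

lemma (in abelian_group) add_diff_add:
  "\<lbrakk>a \<in> carrier G; b \<in> carrier G; c \<in> carrier G; d \<in> carrier G\<rbrakk> \<Longrightarrow>
    (a \<oplus> b) \<ominus> (c \<oplus> d) = (a \<ominus> c) \<oplus> (b \<ominus> d)"
  by (simp add: a_minus_def a_ac minus_add)

lemma (in ring) mult_diff_mult:
  assumes "a \<in> carrier R" "b \<in> carrier R" "c \<in> carrier R" "d \<in> carrier R"
  shows "a \<otimes> b \<ominus> c \<otimes> d = (a \<ominus> c) \<otimes> b \<oplus> c \<otimes> (b \<ominus> d)"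
proof -
  have "(a \<ominus> c) \<otimes> b \<oplus> c \<otimes> (b \<ominus> d) = a \<otimes> b \<oplus> (\<ominus> (c \<otimes> b) \<oplus> (c \<otimes> b \<oplus> \<ominus> (c \<otimes> d)))"
    using assms by (simp add: a_minus_def l_distr r_distr l_minus r_minus a_assoc)
  also have "\<dots> = a \<otimes> b \<ominus> c \<otimes> d" using assms by (simp add: a_minus_def r_neg1 r_neg2)
  finally show ?thesis ..
qed

context presentation
begin

lemma UP_zero_closed: "\<zero>\<^bsub>UP Cring\<^esub> \<in> carrier (UP Cring)"
  by (simp add: UP_simps up_iff)

lemma Rt_cons:
  assumes "r \<in> carrier R" "x \<in> carrier Rt"
  shows "case_nat r x \<in> carrier Rt" and "case_nat r x = mon R 0 r \<oplus>\<^bsub>Rt\<^esub> tt \<odot>\<^bsub>Rt\<^esub> x"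
  using R.poly_cons_closed[of r x] R.poly_cons_eq[of r x] assms by (simp_all add: Rt_carrier)

lemma mon_in_Rt [simp]: "r \<in> carrier R \<Longrightarrow> mon R i r \<in> carrier Rt"
  by (simp add: Rt_carrier R.mon_closed)

lemma \<sigma>t_mon: "\<sigma>t (mon R i r) = mon B i (\<sigma> r)"
  by (auto simp: mon_def)

lemma Rt_shift: "x \<in> carrier Rt \<Longrightarrow> (\<lambda>i. x (Suc i)) \<in> carrier Rt"
  unfolding Rt_carrier by (rule up_shift)

lemma Rt_uncons: "x \<in> carrier Rt \<Longrightarrow> x = mon R 0 (x 0) \<oplus>\<^bsub>Rt\<^esub> tt \<odot>\<^bsub>Rt\<^esub> (\<lambda>i. x (Suc i))"
  using Rt_cons(2)[of "x 0" "\<lambda>i. x (Suc i)"] by (simp add: case_nat_split Rt_shift)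

text \<open>The normal form of a homogeneous element of \<open>B\<close>: its coefficient at \<open>t\<^sup>i\<close> has degree \<open>m - 2i\<close>.
  This is the grading of \<open>H\<close> with \<open>t\<close> in degree two, for which the relations \<open>\<rho> = t \<kappa>\<close> are homogeneous. In
  \<open>H\<close> the difference of \<open>z\<close> and \<open>\<sigma> (\<pi> z)\<close> is \<open>t\<close> times an element of degree \<open>m - 2\<close>, and below degree zero nothing is left.\<close>

lemma normal_form_homog:
  assumes "z \<in> B.homog m"
  shows "\<exists>x\<in>carrier Rt. x 0 = \<pi> z \<and> (\<forall>i. x i \<in> Rdeg (m - 2 * int i)) \<and> cl (mon B 0 z) = sec x"
  using assms
proof (induction "nat (m + 2)" arbitrary: m z rule: less_induct)
  case less
  show ?case
  proof (cases "m < 0")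
    case True
    then have "z = \<zero>\<^bsub>B\<^esub>" using B.homog_neg less.prems by blast
    moreover have "mon B 0 \<zero>\<^bsub>B\<^esub> = \<zero>\<^bsub>Bt\<^esub>" "\<And>i. \<zero>\<^bsub>Rt\<^esub> i = \<zero>\<^bsub>R\<^esub>" by (auto simp: mon_def poly_algebra_simps)
    ultimately show ?thesis by (intro bexI[of _ "\<zero>\<^bsub>Rt\<^esub>"]) (simp_all add: sec_zero cl_simps Rdeg_iff)
  next
    case False
    have zc: "z \<in> carrier B" using less.prems by (rule B.homog_carrier)
    have nf: "\<sigma> (\<pi> z) \<in> B.homog m" "\<sigma> (\<pi> z) \<in> carrier B" using \<sigma>_homog[OF less.prems] zc by auto
    have "\<pi> (z \<ominus>\<^bsub>B\<^esub> \<sigma> (\<pi> z)) = \<zero>\<^bsub>R\<^esub>" using zc by simp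
    then obtain y where y: "y \<in> B.homog (m - 2)" "cl (mon B 0 (z \<ominus>\<^bsub>B\<^esub> \<sigma> (\<pi> z))) = tt \<odot>\<^bsub>H\<^esub> cl (mon B 0 y)"
      using kernel_const[OF B.homog_minus[OF less.prems nf(1)]] by blast
    have "nat (m - 2 + 2) < nat (m + 2)" using False by simp
    then obtain x where x: "x \<in> carrier Rt" "\<And>i. x i \<in> Rdeg (m - 2 - 2 * int i)" "cl (mon B 0 y) = sec x"
      using less.hyps[OF _ y(1)] by metis
    have "cl (mon B 0 z) = cl (mon B 0 (\<sigma> (\<pi> z)) \<oplus>\<^bsub>Bt\<^esub> mon B 0 (z \<ominus>\<^bsub>B\<^esub> \<sigma> (\<pi> z)))"
      using zc nf by (simp add: B.mon_add B.add_minus_cancel)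
    also have "\<dots> = sec (mon R 0 (\<pi> z)) \<oplus>\<^bsub>H\<^esub> tt \<odot>\<^bsub>H\<^esub> sec x"
      using zc nf y by (simp add: cl_simps x(3)) (simp add: sec_def \<sigma>t_mon)
    also have "\<dots> = sec (case_nat (\<pi> z) x)"
      using zc x by (simp add: Rt_cons(2) sec_simps)
    finally have "cl (mon B 0 z) = sec (case_nat (\<pi> z) x)" .
    moreover have "case_nat (\<pi> z) x i \<in> Rdeg (m - 2 * int i)" for i
      using zc nf x(2)[of "i - 1"] by (cases i) (auto simp: Rdeg_iff algebra_simps)
    ultimately show ?thesis using zc x by (intro bexI[of _ "case_nat (\<pi> z) x"]) (simp_all add: Rt_cons(1))
  qed
qed

lemma normal_form_const:
  assumes "z \<in> carrier B"
  shows "\<exists>x\<in>carrier Rt. x 0 = \<pi> z \<and> cl (mon B 0 z) = sec x"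
  using assms
proof (induction z rule: B.graded_induct)
  case zero
  then show ?case using normal_form_homog[of "\<zero>\<^bsub>B\<^esub>" 0] by auto
next
  case (hom e y)
  then show ?case using normal_form_homog[of y e] by auto
next
  case (add y z)
  then obtain x x' where x: "x \<in> carrier Rt" "x 0 = \<pi> y" "cl (mon B 0 y) = sec x"
    and x': "x' \<in> carrier Rt" "x' 0 = \<pi> z" "cl (mon B 0 z) = sec x'" by blast
  then have "(x \<oplus>\<^bsub>Rt\<^esub> x') 0 = \<pi> (y \<oplus>\<^bsub>B\<^esub> z)" using add by (simp add: Rt_carrier poly_algebra_simps(4))
  then show ?case using add x x' by (intro bexI[of _ "x \<oplus>\<^bsub>Rt\<^esub> x'"]) (simp_all add: B.mon_add[symmetric] cl_simps sec_simps)
qed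

subsection \<open>The associated graded algebra\<close>

abbreviation "gr \<equiv> assoc_graded H Fil"
abbreviation "gr_part \<equiv> assoc_graded_part H Fil"

text \<open>The isomorphism in \<open>PBW\<close> is an arbitrary graded one; nothing relates it to \<open>sec\<close>.\<close>

definition "PBW \<longleftrightarrow> graded_algebra_isomorphic (UP Cring) gr gr_part Rt (\<lambda>d. poly_part R (Rdeg d))"
definition "sec_inj \<longleftrightarrow> (\<forall>x\<in>carrier Rt. sec x = \<zero>\<^bsub>H\<^esub> \<longrightarrow> x = \<zero>\<^bsub>Rt\<^esub>)"

lemma Fil_carrier: "h \<in> Fil d \<Longrightarrow> h \<in> carrier H"
  unfolding Fil_def using Bt.below_carrier by (auto simp: cl_simps)

lemma coset_add:
  "\<lbrakk>h \<in> carrier H; h' \<in> carrier H\<rbrakk> \<Longrightarrow> (Fil d +>\<^bsub>H\<^esub> h) <+>\<^bsub>H\<^esub> (Fil d +>\<^bsub>H\<^esub> h') = Fil d +>\<^bsub>H\<^esub> (h \<oplus>\<^bsub>H\<^esub> h')"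
  by (rule abelian_subgroup.a_rcos_sum[OF Fil_abelian_subgroup])

lemma coset_zero: "Fil d +>\<^bsub>H\<^esub> \<zero>\<^bsub>H\<^esub> = Fil d"
  using Fil_carrier by (intro H.a_coset_add_zero) auto

lemma coset_elem: 
  assumes "h \<in> carrier H" "h' \<in> Fil d +>\<^bsub>H\<^esub> h"
  shows "h' \<in> carrier H" "h' \<ominus>\<^bsub>H\<^esub> h \<in> Fil d"
proof -
  interpret F: abelian_subgroup "Fil d" H by (rule Fil_abelian_subgroup)
  show "h' \<in> carrier H" using assms F.a_elemrcos_carrier by blast
  then show "h' \<ominus>\<^bsub>H\<^esub> h \<in> Fil d" using assms F.a_rcos_module[of h h'] by (simp add: a_minus_def)
qed

lemma coset_self: "h \<in> carrier H \<Longrightarrow> h \<in> Fil d +>\<^bsub>H\<^esub> h"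
  by (rule abelian_subgroup.a_rcos_self[OF Fil_abelian_subgroup])

lemma coset_smult:
  assumes p: "p \<in> carrier (UP Cring)" and h: "h \<in> carrier H"
  shows "(\<Union>x\<in>Fil d +>\<^bsub>H\<^esub> h. Fil d +>\<^bsub>H\<^esub> (p \<odot>\<^bsub>H\<^esub> x)) = Fil d +>\<^bsub>H\<^esub> (p \<odot>\<^bsub>H\<^esub> h)"
proof -
  have "Fil d +>\<^bsub>H\<^esub> (p \<odot>\<^bsub>H\<^esub> x) = Fil d +>\<^bsub>H\<^esub> (p \<odot>\<^bsub>H\<^esub> h)" if x: "x \<in> Fil d +>\<^bsub>H\<^esub> h" for x
  proof -
    note xx = coset_elem[OF h x]
    have "p \<odot>\<^bsub>H\<^esub> x \<ominus>\<^bsub>H\<^esub> p \<odot>\<^bsub>H\<^esub> h = p \<odot>\<^bsub>H\<^esub> (x \<ominus>\<^bsub>H\<^esub> h)"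
      using p h xx(1) by (simp add: a_minus_def H.smult_r_distr H.smult_r_minus)
    then show ?thesis using p h xx Fil_smult[OF p xx(2)] by (simp add: Fil_coset_iff)
  qed
  then show ?thesis using coset_self[OF h] by blast
qed

text \<open>The element of \<open>gr\<close> concentrated in degree \<open>d\<close> with leading term \<open>h\<close>.\<close>

definition lead :: "int \<Rightarrow> _ \<Rightarrow> int \<Rightarrow> _" where
  "lead d h = (\<lambda>k. if k = d then Fil (d - 1) +>\<^bsub>H\<^esub> h else Fil (k - 1))"

lemma gr_simps:
  "carrier gr = {f. (\<forall>d. \<exists>x\<in>Fil d. f d = Fil (d - 1) +>\<^bsub>H\<^esub> x) \<and> finite {d. f d \<noteq> Fil (d - 1)}}"
  "f \<oplus>\<^bsub>gr\<^esub> g = (\<lambda>k. f k <+>\<^bsub>H\<^esub> g k)"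
  "p \<odot>\<^bsub>gr\<^esub> f = (\<lambda>k. \<Union>x\<in>f k. Fil (k - 1) +>\<^bsub>H\<^esub> (p \<odot>\<^bsub>H\<^esub> x))"
  "\<one>\<^bsub>gr\<^esub> = (\<lambda>k. if k = 0 then Fil (- 1) +>\<^bsub>H\<^esub> \<one>\<^bsub>H\<^esub> else Fil (k - 1))"
  "\<zero>\<^bsub>gr\<^esub> = (\<lambda>k. Fil (k - 1))"
  "f \<otimes>\<^bsub>gr\<^esub> g = (\<lambda>k. \<Union>{Fil (k - 1) +>\<^bsub>H\<^esub> (\<Oplus>\<^bsub>H\<^esub>i\<in>{0..k}. x i \<otimes>\<^bsub>H\<^esub> y (k - i)) | x y.
               (\<forall>i. x i \<in> f i) \<and> (\<forall>i. y i \<in> g i)})"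
  by (simp_all add: assoc_graded_def)

lemma lead_in_part: "h \<in> Fil d \<Longrightarrow> lead d h \<in> gr_part d"
proof -
  assume h: "h \<in> Fil d"
  have "\<exists>x\<in>Fil k. lead d h k = Fil (k - 1) +>\<^bsub>H\<^esub> x" for k
  proof (cases "k = d")
    case False
    then show ?thesis
      using additive_subgroup.zero_closed[OF Fil_subgroup] by (intro bexI[of _ "\<zero>\<^bsub>H\<^esub>"]) (simp_all add: lead_def coset_zero)
  qed (use h in \<open>auto simp: lead_def\<close>)
  moreover have "finite {k. lead d h k \<noteq> Fil (k - 1)}"
    by (rule finite_subset[of _ "{d}"]) (auto simp: lead_def)
  ultimately show ?thesis unfolding assoc_graded_part_def gr_simps by (auto simp: lead_def)
qed

lemma part_lead: "f \<in> gr_part d \<Longrightarrow> \<exists>h\<in>Fil d. f = lead d h"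
proof -
  assume f: "f \<in> gr_part d"
  then obtain h where "h \<in> Fil d" "f d = Fil (d - 1) +>\<^bsub>H\<^esub> h" unfolding assoc_graded_part_def gr_simps by blast
  moreover have "\<And>k. k \<noteq> d \<Longrightarrow> f k = Fil (k - 1)" using f unfolding assoc_graded_part_def by blast
  ultimately show ?thesis by (intro bexI[of _ h]) (auto simp: lead_def fun_eq_iff)
qed

lemma lead_add: "\<lbrakk>h \<in> carrier H; h' \<in> carrier H\<rbrakk> \<Longrightarrow> lead d h \<oplus>\<^bsub>gr\<^esub> lead d h' = lead d (h \<oplus>\<^bsub>H\<^esub> h')"
  using coset_add[of "\<zero>\<^bsub>H\<^esub>" "\<zero>\<^bsub>H\<^esub>"] by (auto simp: gr_simps lead_def coset_add coset_zero fun_eq_iff)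

lemma lead_smult: "\<lbrakk>p \<in> carrier (UP Cring); h \<in> carrier H\<rbrakk> \<Longrightarrow> p \<odot>\<^bsub>gr\<^esub> lead d h = lead d (p \<odot>\<^bsub>H\<^esub> h)"
  using coset_smult[of p "\<zero>\<^bsub>H\<^esub>"] coset_smult[of p h "d - 1"] by (auto simp: gr_simps lead_def coset_zero fun_eq_iff)

lemma lead_eq_iff: "\<lbrakk>h \<in> carrier H; h' \<in> carrier H\<rbrakk> \<Longrightarrow> lead d h = lead d h' \<longleftrightarrow> h \<ominus>\<^bsub>H\<^esub> h' \<in> Fil (d - 1)"
  unfolding lead_def fun_eq_iff using Fil_coset_iff[of h h' "d - 1"] by auto

lemma sec_in_Fil: "\<lbrakk>x \<in> carrier Rt; \<sigma>t x \<in> Bt.below d\<rbrakk> \<Longrightarrow> sec x \<in> Fil d"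
  unfolding sec_def by (rule Fil_cl)

lemma lead_sec:
  assumes "h \<in> Fil d"
  shows "\<exists>x\<in>{x \<in> carrier Rt. \<sigma>t x \<in> Bt.homog d}. lead d h = lead d (sec x)"
proof -
  obtain z where z: "z \<in> Bt.below d" "h = cl z" using assms unfolding Fil_def by blast
  let ?z = "\<lambda>i. cmp d (z i)"
  have zc: "z \<in> carrier Bt" "?z \<in> carrier Bt" using z(1) Bt.below_carrier Bt.cmp_closed by auto
  have zh: "?z \<in> Bt.homog d" by (rule Bt.cmp_in_homog[OF zc(1)])
  have "h \<ominus>\<^bsub>H\<^esub> cl ?z \<in> Fil (d - 1)"
    using Fil_cl[OF Bt.below_split[OF z(1)]] zc by (simp add: z(2) cl_simps)
  then have "lead d h = lead d (cl ?z)" using zc z by (simp add: lead_eq_iff cl_simps)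
  also have "\<dots> = lead d (sec (\<pi>t ?z))"
    using sec_eq_mod_below[OF zh] zc by (simp add: lead_eq_iff cl_simps sec_simps)
  finally have "lead d h = lead d (sec (\<pi>t ?z))" .
  moreover have "\<pi>t ?z \<in> {x \<in> carrier Rt. \<sigma>t x \<in> Bt.homog d}" using nft_homog[OF zh] \<pi>t_closed[OF zc(2)] by simp
  ultimately show ?thesis by blast
qed

text \<open>An abstract graded isomorphism of \<open>gr\<close> with \<open>R[t]\<close>, composed with the natural surjection from \<open>R[t]\<close>,
  is a surjective endomorphism of each \<open>R\<^sub>d[t]\<close>. Modulo \<open>t\<close> it is a surjective endomorphism of the
  finite-dimensional \<open>R\<^sub>d\<close>, hence injective; by descent on the power of \<open>t\<close> it is injective itself.\<close>

lemma PBW_imp_leading_term_inj: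
  assumes "PBW" 
    and findim: "\<And>g. \<lbrakk>\<And>r. r \<in> Rdeg d \<Longrightarrow> g r \<in> Rdeg d;
       \<And>r s. \<lbrakk>r \<in> Rdeg d; s \<in> Rdeg d\<rbrakk> \<Longrightarrow> g (r \<oplus>\<^bsub>R\<^esub> s) = g r \<oplus>\<^bsub>R\<^esub> g s;
       \<And>c r. r \<in> Rdeg d \<Longrightarrow> g (c \<odot>\<^bsub>R\<^esub> r) = c \<odot>\<^bsub>R\<^esub> g r; Rdeg d \<subseteq> g ` Rdeg d\<rbrakk> \<Longrightarrow>
       \<forall>r\<in>Rdeg d. g r = \<zero>\<^bsub>R\<^esub> \<longrightarrow> r = \<zero>\<^bsub>R\<^esub>"
    and x: "x \<in> carrier Rt" "\<sigma>t x \<in> Bt.homog d" "sec x \<in> Fil (d - 1)"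
  shows "x = \<zero>\<^bsub>Rt\<^esub>"
proof -
  let ?Q = "{x \<in> carrier Rt. \<sigma>t x \<in> Bt.homog d}"
  obtain \<phi> where \<phi>: "\<phi> \<in> algebra_iso (UP Cring) gr Rt" and im: "\<phi> ` gr_part d = poly_part R (Rdeg d)"
    using assms(1) unfolding PBW_def graded_algebra_isomorphic_def by blast
  note \<phi>D = alg_homD[of \<phi> "UP Cring" gr Rt]
  have \<phi>h: "\<phi> \<in> alg_hom (UP Cring) gr Rt" using \<phi> by (simp add: algebra_iso_eq)
  define f where "f x = \<phi> (lead d (sec x))" for x
  have secF: "sec x \<in> Fil d" if "x \<in> ?Q" for x using that Bt.homog_below by (intro sec_in_Fil) auto
  have lead_gr: "lead d h \<in> carrier gr" if "h \<in> Fil d" for h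
    using lead_in_part[OF that] unfolding assoc_graded_part_def by blast
  have fQ: "f x \<in> ?Q" if "x \<in> ?Q" for x
    using im lead_in_part[OF secF[OF that]] unfolding poly_part_Rdeg f_def by blast
  have f_add: "f (x \<oplus>\<^bsub>Rt\<^esub> y) = f x \<oplus>\<^bsub>Rt\<^esub> f y" if "x \<in> ?Q" "y \<in> ?Q" for x y
    using that secF[OF that(1)] secF[OF that(2)]
    by (simp add: f_def sec_simps lead_add[symmetric] Fil_carrier \<phi>D(4)[OF \<phi>h] lead_gr)
  have f_smult: "f (p \<odot>\<^bsub>Rt\<^esub> x) = p \<odot>\<^bsub>Rt\<^esub> f x" if "p \<in> carrier (UP Cring)" "x \<in> ?Q" for x p
    using that secF[OF that(2)]
    by (simp add: f_def sec_simps lead_smult[symmetric] Fil_carrier \<phi>D(6)[OF \<phi>h] lead_gr)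
  have Q_add: "x \<oplus>\<^bsub>Rt\<^esub> y \<in> ?Q" if "x \<in> ?Q" "y \<in> ?Q" for x y using that by (simp add: \<sigma>t_add)
  have Q_smult: "p \<odot>\<^bsub>Rt\<^esub> x \<in> ?Q" if "p \<in> carrier (UP Cring)" "x \<in> ?Q" for p x using that by (simp add: \<sigma>t_smult)
  have Q_mon: "mon R 0 r \<in> ?Q" if "r \<in> Rdeg d" for r
    using that by (simp add: Rdeg_iff \<sigma>t_mon mon_homog)
  have Q_coeff: "x i \<in> Rdeg d" if "x \<in> ?Q" for x i using that by (auto simp: Rdeg_iff Bt_homog_iff)
  have Q_shift: "(\<lambda>i. x (Suc i)) \<in> ?Q" if "x \<in> ?Q" for x
    using that Rt_shift by (auto simp: Bt_homog_iff) 
  have f_cons: "f x = f (mon R 0 (x 0)) \<oplus>\<^bsub>Rt\<^esub> tt \<odot>\<^bsub>Rt\<^esub> f (\<lambda>i. x (Suc i))" if "x \<in> ?Q" for x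
  proof -
    have "f x = f (mon R 0 (x 0) \<oplus>\<^bsub>Rt\<^esub> tt \<odot>\<^bsub>Rt\<^esub> (\<lambda>i. x (Suc i)))" using Rt_uncons[of x] that by simp
    also have "\<dots> = f (mon R 0 (x 0)) \<oplus>\<^bsub>Rt\<^esub> tt \<odot>\<^bsub>Rt\<^esub> f (\<lambda>i. x (Suc i))"
      using f_add[OF Q_mon[OF Q_coeff[OF that]] Q_smult[OF tt_closed Q_shift[OF that]]] f_smult[OF tt_closed Q_shift[OF that]] by simp
    finally show ?thesis .
  qed
  have t0: "(y \<oplus>\<^bsub>Rt\<^esub> tt \<odot>\<^bsub>Rt\<^esub> z) 0 = y 0" if "y \<in> carrier Rt" "z \<in> carrier Rt" for y z
    using that Rt.smult_closed[of tt z]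
    by (simp add: poly_algebra_simps(4) Rt_carrier) (simp add: R.smult_poly_mon[of 1 z 1, simplified] upD)
  define g where "g r = f (mon R 0 r) 0" for r
  have f0: "f x 0 = g (x 0)" if "x \<in> ?Q" for x
    using f_cons[OF that] fQ[OF Q_mon[OF Q_coeff[OF that]]] fQ[OF Q_shift[OF that]] t0 by (simp add: g_def)
  have g_inj: "\<forall>r\<in>Rdeg d. g r = \<zero>\<^bsub>R\<^esub> \<longrightarrow> r = \<zero>\<^bsub>R\<^esub>"
  proof (rule findim)
    fix r s assume r: "r \<in> Rdeg d" and s: "s \<in> Rdeg d"
    show "g r \<in> Rdeg d" unfolding g_def by (rule Q_coeff[OF fQ[OF Q_mon[OF r]]])
    have "mon R 0 (r \<oplus>\<^bsub>R\<^esub> s) = mon R 0 r \<oplus>\<^bsub>Rt\<^esub> mon R 0 s" using r s by (simp add: R.mon_add Rdeg_iff)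
    then show "g (r \<oplus>\<^bsub>R\<^esub> s) = g r \<oplus>\<^bsub>R\<^esub> g s"
      using fQ[OF Q_mon[OF r]] fQ[OF Q_mon[OF s]]
      by (simp add: g_def f_add[OF Q_mon[OF r] Q_mon[OF s]] poly_algebra_simps(4) Rt_carrier)
  next
    fix c r assume r: "r \<in> Rdeg d"
    have "mon R 0 (c \<odot>\<^bsub>R\<^esub> r) = mon Cring 0 c \<odot>\<^bsub>Rt\<^esub> mon R 0 r" using r by (simp add: R.smult_mon_mon Rdeg_iff)
    then have "g (c \<odot>\<^bsub>R\<^esub> r) = (mon Cring 0 c \<odot>\<^bsub>Rt\<^esub> f (mon R 0 r)) 0"
      by (simp add: g_def f_smult[OF tt_closed Q_mon[OF r]])
    also have "\<dots> = c \<odot>\<^bsub>R\<^esub> g r"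
      using fQ[OF Q_mon[OF r]] R.smult_poly_mon[of c "f (mon R 0 r)" 0] by (simp add: g_def Rt_carrier)
    finally show "g (c \<odot>\<^bsub>R\<^esub> r) = c \<odot>\<^bsub>R\<^esub> g r" .
  next
    show "Rdeg d \<subseteq> g ` Rdeg d"
    proof
      fix s assume s: "s \<in> Rdeg d"
      then have "mon R 0 s \<in> \<phi> ` gr_part d" using im Q_mon unfolding poly_part_Rdeg by simp
      then obtain h where h: "h \<in> Fil d" "mon R 0 s = \<phi> (lead d h)" using part_lead by blast
      then obtain x where xQ: "x \<in> ?Q" "lead d h = lead d (sec x)" using lead_sec by blast
      then have "f x = mon R 0 s" using h by (simp add: f_def)
      then have "g (x 0) = s" using f0[OF xQ(1)] by (simp add: mon_def)
      then show "s \<in> g ` Rdeg d" using Q_coeff[OF xQ(1)] by blast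
    qed
  qed
  have tfree: "y = \<zero>\<^bsub>Rt\<^esub>" if "tt \<odot>\<^bsub>Rt\<^esub> y = \<zero>\<^bsub>Rt\<^esub>" "y \<in> carrier Rt" for y
  proof -
    have "(tt \<odot>\<^bsub>Rt\<^esub> y) (Suc i) = y i" for i
      using that(2) R.smult_poly_mon[of 1 y 1] by (simp add: Rt_carrier upD)
    then show ?thesis using that(1) by (simp add: poly_algebra_simps fun_eq_iff)
  qed
  have inj: "x = \<zero>\<^bsub>Rt\<^esub>" if "x \<in> ?Q" "f x = \<zero>\<^bsub>Rt\<^esub>" "\<And>i. i \<ge> N \<Longrightarrow> x i = \<zero>\<^bsub>R\<^esub>" for x N
    using that
  proof (induction N arbitrary: x)
    case 0
    then show ?case by (simp add: poly_algebra_simps fun_eq_iff)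
  next
    case (Suc N)
    have x0: "x 0 = \<zero>\<^bsub>R\<^esub>" using f0[OF Suc.prems(1)] Suc.prems(2) g_inj Q_coeff[OF Suc.prems(1)] by (simp add: poly_algebra_simps)
    have m0: "mon R 0 \<zero>\<^bsub>R\<^esub> = \<zero>\<^bsub>Rt\<^esub>" by (auto simp: mon_def poly_algebra_simps)
    have Q0: "\<zero>\<^bsub>Rt\<^esub> \<in> ?Q" using Q_mon[of "\<zero>\<^bsub>R\<^esub>"] m0 by (simp add: Rdeg_iff)
    have fz: "f \<zero>\<^bsub>Rt\<^esub> = \<zero>\<^bsub>Rt\<^esub>"
      using f_smult[OF UP_zero_closed Q0] fQ[OF Q0] by simp
    have fs: "f (\<lambda>i. x (Suc i)) \<in> carrier Rt" using fQ[OF Q_shift[OF Suc.prems(1)]] by simp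
    then have "tt \<odot>\<^bsub>Rt\<^esub> f (\<lambda>i. x (Suc i)) = \<zero>\<^bsub>Rt\<^esub>"
      using f_cons[OF Suc.prems(1)] Suc.prems(2) by (simp add: x0 m0 fz)
    then have "f (\<lambda>i. x (Suc i)) = \<zero>\<^bsub>Rt\<^esub>" using fs by (rule tfree)
    moreover have "x (Suc i) = \<zero>\<^bsub>R\<^esub>" if "i \<ge> N" for i using that by (intro Suc.prems(3)) simp
    ultimately have "(\<lambda>i. x (Suc i)) = \<zero>\<^bsub>Rt\<^esub>"
      by (rule Suc.IH[OF Q_shift[OF Suc.prems(1)]])
    then have "x i = \<zero>\<^bsub>R\<^esub>" for i using x0 by (cases i) (auto simp: poly_algebra_simps fun_eq_iff)
    then show ?case by (simp add: poly_algebra_simps fun_eq_iff)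
  qed
  have xQ: "x \<in> ?Q" using x by simp
  have "lead d (sec x) = lead d \<zero>\<^bsub>H\<^esub>" using x by (simp add: lead_eq_iff sec_simps a_minus_def)
  moreover have Q0: "\<zero>\<^bsub>Rt\<^esub> \<in> ?Q" by (simp add: poly_algebra_simps) (simp add: Bt_homog_iff Bt_carrier up_iff)
  ultimately have "f x = f \<zero>\<^bsub>Rt\<^esub>" by (simp add: f_def sec_zero)
  also have "\<dots> = \<zero>\<^bsub>Rt\<^esub>" using f_smult[OF UP_zero_closed Q0] fQ[OF Q0] by simp
  finally have "f x = \<zero>\<^bsub>Rt\<^esub>" .
  moreover obtain N where "\<forall>i>N. x i = \<zero>\<^bsub>R\<^esub>" using x(1) up_bound unfolding Rt_carrier by blast
  ultimately show ?thesis using inj[OF xQ, of "Suc N"] by (simp add: Suc_le_eq)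
qed

lemma \<sigma>t_zero: "\<sigma>t \<zero>\<^bsub>Rt\<^esub> = \<zero>\<^bsub>Bt\<^esub>" by (simp add: poly_algebra_simps)

lemma \<sigma>t_eq_zero: "\<lbrakk>x \<in> carrier Rt; \<sigma>t x = \<zero>\<^bsub>Bt\<^esub>\<rbrakk> \<Longrightarrow> x = \<zero>\<^bsub>Rt\<^esub>"
  using \<pi>t_\<sigma>t[of x] by (auto simp: poly_algebra_simps fun_eq_iff)

lemma section_cmp:
  assumes "x \<in> carrier Rt"
  shows "\<sigma>t (\<pi>t (\<lambda>i. cmp d (\<sigma> (x i)))) = (\<lambda>i. cmp d (\<sigma> (x i)))"
  using nft_cmp[OF \<sigma>t_closed[OF assms], of d] assms by simp

text \<open>If \<open>sec\<close> kills an element of top degree \<open>d\<close>, then it sends the component of degree \<open>d\<close> to filtration degree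
  \<open>d - 1\<close>; so this component vanishes, and the degree drops until nothing is left.\<close>

lemma sec_inj_if_leading_term_inj:
  assumes "\<And>d x. \<lbrakk>x \<in> carrier Rt; \<sigma>t x \<in> Bt.homog d; sec x \<in> Fil (d - 1)\<rbrakk> \<Longrightarrow> x = \<zero>\<^bsub>Rt\<^esub>"
  shows "sec_inj"
proof -
  have "x = \<zero>\<^bsub>Rt\<^esub>" if "x \<in> carrier Rt" "\<sigma>t x \<in> Bt.below d" "sec x = \<zero>\<^bsub>H\<^esub>" for x d
    using that(2)
  proof (induction "nat (d + 1)" arbitrary: d)
    case 0
    then show ?case using Bt.below_neg[OF 0(2)] \<sigma>t_eq_zero[OF that(1)] by simp
  next
    case (Suc n)
    let ?w = "\<lambda>i. cmp d (\<sigma> (x i))" 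
    have c: "\<sigma>t x \<in> carrier Bt" "?w \<in> carrier Bt" using that(1) Bt.cmp_closed[of "\<sigma>t x"] by simp_all
    have v: "\<sigma>t x \<ominus>\<^bsub>Bt\<^esub> ?w \<in> Bt.below (d - 1)" using Bt.below_split[OF Suc.prems] by simp
    have "cl (\<sigma>t x \<ominus>\<^bsub>Bt\<^esub> ?w) = \<ominus>\<^bsub>H\<^esub> cl ?w"
      using c that(3) cl_simps(1)[OF c(2)] cl_simps(4)[OF c] by (simp add: sec_def a_minus_def)
    then have "\<ominus>\<^bsub>H\<^esub> cl ?w \<in> Fil (d - 1)" using Fil_cl[OF v] by simp
    then have "cl ?w \<in> Fil (d - 1)"
      using additive_subgroup.a_inv_closed[OF Fil_subgroup, of "\<ominus>\<^bsub>H\<^esub> cl ?w" "d - 1"] cl_simps(1)[OF c(2)] by simp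
    then have "sec (\<pi>t ?w) \<in> Fil (d - 1)" by (simp add: sec_def section_cmp[OF that(1)])
    moreover have "\<sigma>t (\<pi>t ?w) \<in> Bt.homog d"
      using Bt.cmp_in_homog[OF c(1), of d] by (simp add: section_cmp[OF that(1)])
    ultimately have "\<pi>t ?w = \<zero>\<^bsub>Rt\<^esub>" by (intro assms[OF \<pi>t_closed[OF c(2)]])
    then have w0: "?w = \<zero>\<^bsub>Bt\<^esub>" using section_cmp[OF that(1), of d] \<sigma>t_zero by metis
    have "\<sigma>t x \<in> Bt.below (d - 1)" using v c(1) unfolding w0 by (simp add: a_minus_def)
    then show ?case using Suc.hyps by (intro Suc.hyps(1)[of "d - 1"]) simp_all
  qed
  then show ?thesis unfolding sec_inj_def using Bt.below_exists[OF \<sigma>t_closed] by metis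
qed

lemma sec_eq_iff:
  assumes "sec_inj" "x \<in> carrier Rt" "y \<in> carrier Rt" "sec x = sec y"
  shows "x = y"
proof -
  have "sec (x \<ominus>\<^bsub>Rt\<^esub> y) = \<zero>\<^bsub>H\<^esub>" using assms sec_simps(1) by (simp add: sec_minus)
  then have "x \<ominus>\<^bsub>Rt\<^esub> y = \<zero>\<^bsub>Rt\<^esub>" using assms unfolding sec_inj_def by simp
  then show ?thesis using assms by simp
qed

text \<open>Conversely, an element of filtration degree \<open>d - 1\<close> has a normal form of that degree, and by injectivity this
  is its only one.\<close>

lemma leading_term_inj:
  assumes "sec_inj" and x: "x \<in> carrier Rt" "\<sigma>t x \<in> Bt.homog d" "sec x \<in> Fil (d - 1)"
  shows "x = \<zero>\<^bsub>Rt\<^esub>"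
proof -
  obtain z where "z \<in> Bt.below (d - 1)" "sec x = cl z" using x(3) unfolding Fil_def by blast
  then obtain y where y: "y \<in> carrier Rt" "\<sigma>t y \<in> Bt.below (d - 1)" "sec x = sec y" using normal_form_below by metis
  then have "x = y" using sec_eq_iff assms by blast
  then have "(\<lambda>i. cmp d (\<sigma> (x i))) = \<zero>\<^bsub>Bt\<^esub>" using y(2) unfolding Bt.below_def by simp
  then have "\<sigma>t x = \<zero>\<^bsub>Bt\<^esub>" using x(2) unfolding Bt.homog_def by simp
  then show ?thesis using \<sigma>t_eq_zero x(1) by blast
qed

text \<open>The map taking \<open>z\<close> to the family of classes of its components is an algebra homomorphism to \<open>gr\<close>.
  It only depends on the image of \<open>z\<close> in \<open>R[t]\<close>.\<close>

definition sym :: "(nat \<Rightarrow> 'b) \<Rightarrow> int \<Rightarrow> (nat \<Rightarrow> 'b) set set" where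
  "sym z = (\<lambda>d. Fil (d - 1) +>\<^bsub>H\<^esub> cl (\<lambda>i. cmp d (z i)))"

lemma cmpt_closed [simp]: "z \<in> carrier Bt \<Longrightarrow> (\<lambda>i. cmp d (z i)) \<in> carrier Bt"
  by (rule Bt.cmp_closed)

lemma sym_closed: "z \<in> carrier Bt \<Longrightarrow> sym z \<in> carrier gr"
proof -
  assume z: "z \<in> carrier Bt"
  have "\<exists>x\<in>Fil d. sym z d = Fil (d - 1) +>\<^bsub>H\<^esub> x" for d
    unfolding sym_def using Fil_cl[OF Bt.homog_below[OF Bt.cmp_in_homog[OF z] order_refl]] by blast
  moreover obtain N where N: "\<And>d. d > N \<Longrightarrow> (\<lambda>i. cmp d (z i)) = \<zero>\<^bsub>Bt\<^esub>" using Bt.cmp_bound[OF z] by blast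
  have zero: "sym z d = Fil (d - 1)" if "(\<lambda>i. cmp d (z i)) = \<zero>\<^bsub>Bt\<^esub>" for d
    unfolding sym_def that cl_simps(6) by (rule coset_zero)
  have "d \<in> {0..N}" if "sym z d \<noteq> Fil (d - 1)" for d
    using that zero[of d] N[of d] Bt.cmp_neg[OF z, of d] by force
  then have "{d. sym z d \<noteq> Fil (d - 1)} \<subseteq> {0..N}" by blast
  then have "finite {d. sym z d \<noteq> Fil (d - 1)}" by (rule finite_subset) simp
  ultimately show ?thesis unfolding gr_simps by blast
qed

lemma sym_add: "\<lbrakk>z \<in> carrier Bt; w \<in> carrier Bt\<rbrakk> \<Longrightarrow> sym (z \<oplus>\<^bsub>Bt\<^esub> w) = sym z \<oplus>\<^bsub>gr\<^esub> sym w"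
  unfolding sym_def gr_simps by (simp add: Bt.cmp_add cl_simps coset_add)

lemma sym_smult: "\<lbrakk>p \<in> carrier (UP Cring); z \<in> carrier Bt\<rbrakk> \<Longrightarrow> sym (p \<odot>\<^bsub>Bt\<^esub> z) = p \<odot>\<^bsub>gr\<^esub> sym z"
  unfolding sym_def gr_simps by (simp add: Bt.cmp_smult cl_simps coset_smult)

lemma sym_one: "sym \<one>\<^bsub>Bt\<^esub> = \<one>\<^bsub>gr\<^esub>"
  unfolding sym_def gr_simps using Bt.cmp_homog[OF Bt.one_homog] by (auto simp: cl_simps coset_zero fun_eq_iff)

text \<open>A product in \<open>gr\<close> is a union over all families of representatives. Replacing a representative changes it by an
  element of smaller filtration degree, hence the products too, so all families give the same coset.\<close>

lemma sym_mult:
  assumes z: "z \<in> carrier Bt" and w: "w \<in> carrier Bt"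
  shows "sym (z \<otimes>\<^bsub>Bt\<^esub> w) = sym z \<otimes>\<^bsub>gr\<^esub> sym w"
proof
  fix k
  let ?z = "\<lambda>d. cl (\<lambda>i. cmp d (z i))" and ?w = "\<lambda>d. cl (\<lambda>i. cmp d (w i))"
  have zF: "?z d \<in> Fil d" "?w d \<in> Fil d" for d
    using Fil_cl[OF Bt.homog_below[OF Bt.cmp_in_homog order_refl]] z w by auto
  have zH: "?z d \<in> carrier H" "?w d \<in> carrier H" for d using z w by (simp_all add: cl_simps)
  have prod: "cl (\<lambda>i. cmp k ((z \<otimes>\<^bsub>Bt\<^esub> w) i)) = (\<Oplus>\<^bsub>H\<^esub>i\<in>{0..k}. ?z i \<otimes>\<^bsub>H\<^esub> ?w (k - i))"
  proof -
    have "cl (\<lambda>i. cmp k ((z \<otimes>\<^bsub>Bt\<^esub> w) i)) = (\<Oplus>\<^bsub>H\<^esub>i\<in>{0..k}. cl ((\<lambda>j. cmp i (z j)) \<otimes>\<^bsub>Bt\<^esub> (\<lambda>j. cmp (k - i) (w j))))"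
      using z w unfolding Bt.cmp_mult[OF z w]
      by (intro additive_map_finsum[where \<phi> = cl]) (auto simp: Bt.is_abelian_group H.is_abelian_group cl_simps)
    also have "\<dots> = (\<Oplus>\<^bsub>H\<^esub>i\<in>{0..k}. ?z i \<otimes>\<^bsub>H\<^esub> ?w (k - i))"
      using z w by (intro H.M.finsum_cong') (auto simp: cl_simps)
    finally show ?thesis .
  qed
  have wd: "Fil (k - 1) +>\<^bsub>H\<^esub> (\<Oplus>\<^bsub>H\<^esub>i\<in>{0..k}. x i \<otimes>\<^bsub>H\<^esub> y (k - i)) = sym (z \<otimes>\<^bsub>Bt\<^esub> w) k"
    if x: "\<And>i. x i \<in> sym z i" and y: "\<And>i. y i \<in> sym w i" for x y
  proof -
    note xx = coset_elem[OF zH(1) x[unfolded sym_def]] and yy = coset_elem[OF zH(2) y[unfolded sym_def]]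
    have yF: "y i \<in> Fil i" for i
    proof -
      have "y i = ?w i \<oplus>\<^bsub>H\<^esub> (y i \<ominus>\<^bsub>H\<^esub> ?w i)" using yy(1) zH by (simp add: H.M.add_minus_cancel)
      then show ?thesis
        using additive_subgroup.a_closed[OF Fil_subgroup zF(2)[of i] Fil_mono[OF yy(2)[of i]]] by simp
    qed
    have diff: "x i \<otimes>\<^bsub>H\<^esub> y (k - i) \<ominus>\<^bsub>H\<^esub> ?z i \<otimes>\<^bsub>H\<^esub> ?w (k - i) \<in> Fil (k - 1)" for i
    proof -
      have "x i \<otimes>\<^bsub>H\<^esub> y (k - i) \<ominus>\<^bsub>H\<^esub> ?z i \<otimes>\<^bsub>H\<^esub> ?w (k - i)
          = (x i \<ominus>\<^bsub>H\<^esub> ?z i) \<otimes>\<^bsub>H\<^esub> y (k - i) \<oplus>\<^bsub>H\<^esub> ?z i \<otimes>\<^bsub>H\<^esub> (y (k - i) \<ominus>\<^bsub>H\<^esub> ?w (k - i))"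
        by (rule H.mult_diff_mult[OF xx(1)[of i] yy(1)[of "k - i"] zH(1)[of i] zH(2)[of "k - i"]])
      moreover have "(x i \<ominus>\<^bsub>H\<^esub> ?z i) \<otimes>\<^bsub>H\<^esub> y (k - i) \<in> Fil (k - 1)"
        using Fil_mult[OF xx(2)[of i] yF[of "k - i"]] by simp
      moreover have "?z i \<otimes>\<^bsub>H\<^esub> (y (k - i) \<ominus>\<^bsub>H\<^esub> ?w (k - i)) \<in> Fil (k - 1)"
        using Fil_mult[OF zF(1)[of i] yy(2)[of "k - i"]] by (simp add: algebra_simps)
      ultimately show ?thesis by (simp add: additive_subgroup.a_closed[OF Fil_subgroup])
    qed
    have c1: "(\<lambda>i. x i \<otimes>\<^bsub>H\<^esub> y (k - i)) \<in> T \<rightarrow> carrier H" and c2: "(\<lambda>i. ?z i \<otimes>\<^bsub>H\<^esub> ?w (k - i)) \<in> T \<rightarrow> carrier H" for T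
      by (rule funcsetI, rule H.m_closed[OF xx(1) yy(1)], rule funcsetI, rule H.m_closed[OF zH])
    have "(\<Oplus>\<^bsub>H\<^esub>i\<in>T. x i \<otimes>\<^bsub>H\<^esub> y (k - i)) \<ominus>\<^bsub>H\<^esub> (\<Oplus>\<^bsub>H\<^esub>i\<in>T. ?z i \<otimes>\<^bsub>H\<^esub> ?w (k - i)) \<in> Fil (k - 1)" if "finite T" for T
      using that
    proof (induction T)
      case empty
      then show ?case using additive_subgroup.zero_closed[OF Fil_subgroup] by (simp add: a_minus_def)
    next
      case (insert j T)
      let ?a = "x j \<otimes>\<^bsub>H\<^esub> y (k - j)" and ?b = "\<Oplus>\<^bsub>H\<^esub>i\<in>T. x i \<otimes>\<^bsub>H\<^esub> y (k - i)"
      let ?c = "?z j \<otimes>\<^bsub>H\<^esub> ?w (k - j)" and ?d = "\<Oplus>\<^bsub>H\<^esub>i\<in>T. ?z i \<otimes>\<^bsub>H\<^esub> ?w (k - i)"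
      have cl: "?a \<in> carrier H" "?b \<in> carrier H" "?c \<in> carrier H" "?d \<in> carrier H"
        using H.M.finsum_closed[OF c1] H.M.finsum_closed[OF c2] H.m_closed[OF xx(1) yy(1)] H.m_closed[OF zH]
        by blast+
      have "(?a \<oplus>\<^bsub>H\<^esub> ?b) \<ominus>\<^bsub>H\<^esub> (?c \<oplus>\<^bsub>H\<^esub> ?d) = (?a \<ominus>\<^bsub>H\<^esub> ?c) \<oplus>\<^bsub>H\<^esub> (?b \<ominus>\<^bsub>H\<^esub> ?d)"
        by (rule H.M.add_diff_add[OF cl])
      then have "(?a \<oplus>\<^bsub>H\<^esub> ?b) \<ominus>\<^bsub>H\<^esub> (?c \<oplus>\<^bsub>H\<^esub> ?d) \<in> Fil (k - 1)"
        using additive_subgroup.a_closed[OF Fil_subgroup diff[of j] insert.IH] by simp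
      moreover have "(\<Oplus>\<^bsub>H\<^esub>i\<in>insert j T. x i \<otimes>\<^bsub>H\<^esub> y (k - i)) = ?a \<oplus>\<^bsub>H\<^esub> ?b"
        and "(\<Oplus>\<^bsub>H\<^esub>i\<in>insert j T. ?z i \<otimes>\<^bsub>H\<^esub> ?w (k - i)) = ?c \<oplus>\<^bsub>H\<^esub> ?d"
        by (rule H.M.finsum_insert[OF insert.hyps c1 cl(1)], rule H.M.finsum_insert[OF insert.hyps c2 cl(3)])
      ultimately show ?case by (simp only:)
    qed
    from this[of "{0..k}"] show ?thesis
      unfolding sym_def prod by (subst Fil_coset_iff) (simp_all add: H.M.finsum_closed c1 c2)
  qed
  have reps: "?z i \<in> sym z i" "?w i \<in> sym w i" for i
    unfolding sym_def using coset_self[OF zH(1)] coset_self[OF zH(2)] by auto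
  have "{Fil (k - 1) +>\<^bsub>H\<^esub> (\<Oplus>\<^bsub>H\<^esub>i\<in>{0..k}. x i \<otimes>\<^bsub>H\<^esub> y (k - i)) | x y.
      (\<forall>i. x i \<in> sym z i) \<and> (\<forall>i. y i \<in> sym w i)} = {sym (z \<otimes>\<^bsub>Bt\<^esub> w) k}" (is "?S = _")
  proof (intro equalityI subsetI)
    fix u assume "u \<in> ?S"
    then obtain x y where "\<And>i. x i \<in> sym z i" "\<And>i. y i \<in> sym w i"
      "u = Fil (k - 1) +>\<^bsub>H\<^esub> (\<Oplus>\<^bsub>H\<^esub>i\<in>{0..k}. x i \<otimes>\<^bsub>H\<^esub> y (k - i))" by blast
    then show "u \<in> {sym (z \<otimes>\<^bsub>Bt\<^esub> w) k}" using wd[of x y] by simp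
  next
    fix u assume "u \<in> {sym (z \<otimes>\<^bsub>Bt\<^esub> w) k}"
    then have "u = Fil (k - 1) +>\<^bsub>H\<^esub> (\<Oplus>\<^bsub>H\<^esub>i\<in>{0..k}. ?z i \<otimes>\<^bsub>H\<^esub> ?w (k - i))" using wd[of ?z ?w, OF reps] by simp
    then show "u \<in> ?S" using reps by (intro CollectI exI[of _ ?z] exI[of _ ?w]) simp
  qed
  then show "sym (z \<otimes>\<^bsub>Bt\<^esub> w) k = (sym z \<otimes>\<^bsub>gr\<^esub> sym w) k"
    unfolding gr_simps by simp
qed

lemma sym_nf:
  assumes "z \<in> carrier Bt"
  shows "sym (\<sigma>t (\<pi>t z)) = sym z"
proof
  fix d
  have "cl (\<lambda>i. cmp d (z i)) \<ominus>\<^bsub>H\<^esub> sec (\<pi>t (\<lambda>i. cmp d (z i))) \<in> Fil (d - 1)"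
    by (rule sec_eq_mod_below[OF Bt.cmp_in_homog[OF assms]])
  then show "sym (\<sigma>t (\<pi>t z)) d = sym z d"
    unfolding sym_def using assms nft_cmp[OF assms, of d]
    by (subst eq_commute, subst Fil_coset_iff) (simp_all add: sec_def cl_simps)
qed

end

context presentation
begin

text \<open>The natural map from \<open>R[t]\<close> to \<open>gr\<close>. It is always a surjective algebra homomorphism, because \<open>sym\<close> is one and
  does not distinguish an element from its normal form.\<close>

definition gr_map :: "(nat \<Rightarrow> 'r) \<Rightarrow> int \<Rightarrow> (nat \<Rightarrow> 'b) set set" where
  "gr_map x = sym (\<sigma>t x)"

lemma gr_map_hom: "gr_map \<in> alg_hom (UP Cring) Rt gr"
proof (rule alg_homI)
  fix x y assume x: "x \<in> carrier Rt" and y: "y \<in> carrier Rt"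
  have c: "\<sigma>t x \<in> carrier Bt" "\<sigma>t y \<in> carrier Bt" using x y by simp_all
  show "gr_map x \<in> carrier gr" unfolding gr_map_def by (rule sym_closed[OF c(1)])
  show "gr_map (x \<oplus>\<^bsub>Rt\<^esub> y) = gr_map x \<oplus>\<^bsub>gr\<^esub> gr_map y"
    unfolding gr_map_def \<sigma>t_add[OF x y] by (rule sym_add[OF c])
  have "\<pi>t (\<sigma>t x \<otimes>\<^bsub>Bt\<^esub> \<sigma>t y) = x \<otimes>\<^bsub>Rt\<^esub> y" using c x y by (simp add: \<pi>t_mult)
  then have "\<pi> ((\<sigma>t x \<otimes>\<^bsub>Bt\<^esub> \<sigma>t y) i) = (x \<otimes>\<^bsub>Rt\<^esub> y) i" for i by (rule fun_cong)
  then have "sym (\<sigma>t (x \<otimes>\<^bsub>Rt\<^esub> y)) = sym (\<sigma>t x \<otimes>\<^bsub>Bt\<^esub> \<sigma>t y)"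
    using sym_nf[OF Bt.m_closed[OF c]] by simp
  then show "gr_map (x \<otimes>\<^bsub>Rt\<^esub> y) = gr_map x \<otimes>\<^bsub>gr\<^esub> gr_map y"
    unfolding gr_map_def using sym_mult[OF c] by simp
next
  have "\<pi>t \<one>\<^bsub>Bt\<^esub> = \<one>\<^bsub>Rt\<^esub>" by (auto simp: poly_algebra_simps mon_def)
  then have "\<pi> (\<one>\<^bsub>Bt\<^esub> i) = \<one>\<^bsub>Rt\<^esub> i" for i by (rule fun_cong)
  then show "gr_map \<one>\<^bsub>Rt\<^esub> = \<one>\<^bsub>gr\<^esub>"
    unfolding gr_map_def using sym_nf[OF Bt.one_closed] sym_one by simp
next
  fix p x assume "p \<in> carrier (UP Cring)" "x \<in> carrier Rt"
  then show "gr_map (p \<odot>\<^bsub>Rt\<^esub> x) = p \<odot>\<^bsub>gr\<^esub> gr_map x"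
    unfolding gr_map_def by (simp add: \<sigma>t_smult sym_smult)
qed

lemma gr_map_homog:
  assumes "x \<in> carrier Rt" "\<sigma>t x \<in> Bt.homog d"
  shows "gr_map x = lead d (sec x)"
proof
  fix k
  show "gr_map x k = lead d (sec x) k"
    unfolding gr_map_def sym_def lead_def Bt.cmp_homog[OF assms(2)]
    by (simp add: sec_def cl_simps coset_zero)
qed

lemma gr_map_inj: "sec_inj \<Longrightarrow> inj_on gr_map (carrier Rt)"
proof (rule inj_onI)
  fix x y assume inj: sec_inj and x: "x \<in> carrier Rt" and y: "y \<in> carrier Rt" and eq: "gr_map x = gr_map y"
  define u where "u = x \<ominus>\<^bsub>Rt\<^esub> y"
  have u: "u \<in> carrier Rt" using x y by (simp add: u_def)
  have su: "\<sigma>t u = \<sigma>t x \<ominus>\<^bsub>Bt\<^esub> \<sigma>t y"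
    unfolding u_def
    using additive_map_minus[OF Rt.is_abelian_group Bt.is_abelian_group, of \<sigma>t x y] x y \<sigma>t_add by simp
  have "(\<lambda>i. cmp d (\<sigma> (u i))) = \<zero>\<^bsub>Bt\<^esub>" for d
  proof -
    let ?u = "\<lambda>i. cmp d (\<sigma> (u i))"
    have uc: "\<sigma>t u \<in> carrier Bt" "?u \<in> carrier Bt" using u cmpt_closed[of "\<sigma>t u"] by simp_all
    have "Fil (d - 1) +>\<^bsub>H\<^esub> cl (\<lambda>i. cmp d (\<sigma> (x i))) = Fil (d - 1) +>\<^bsub>H\<^esub> cl (\<lambda>i. cmp d (\<sigma> (y i)))"
      using eq unfolding gr_map_def sym_def by metis
    then have "cl (\<lambda>i. cmp d (\<sigma> (x i))) \<ominus>\<^bsub>H\<^esub> cl (\<lambda>i. cmp d (\<sigma> (y i))) \<in> Fil (d - 1)"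
      using cmpt_closed[of "\<sigma>t x"] cmpt_closed[of "\<sigma>t y"] x y by (simp add: Fil_coset_iff cl_simps)
    moreover have "?u = (\<lambda>i. cmp d (\<sigma> (x i))) \<ominus>\<^bsub>Bt\<^esub> (\<lambda>i. cmp d (\<sigma> (y i)))"
      using Bt.cmp_minus[of "\<sigma>t x" "\<sigma>t y" d] x y su by (simp add: fun_eq_iff)
    ultimately have "sec (\<pi>t ?u) \<in> Fil (d - 1)"
      using cmpt_closed[of "\<sigma>t x"] cmpt_closed[of "\<sigma>t y"] x y
      by (simp add: sec_def section_cmp[OF u] cl_simps)
    moreover have "\<sigma>t (\<pi>t ?u) \<in> Bt.homog d"
      using Bt.cmp_in_homog[OF uc(1), of d] by (simp add: section_cmp[OF u])
    ultimately have "\<pi>t ?u = \<zero>\<^bsub>Rt\<^esub>" by (intro leading_term_inj[OF inj \<pi>t_closed[OF uc(2)]])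
    then show ?thesis using section_cmp[OF u, of d] \<sigma>t_zero by metis
  qed
  then have "\<sigma>t u = \<zero>\<^bsub>Bt\<^esub>" by (rule Bt.cmp_separated[OF \<sigma>t_closed[OF u]])
  then have "u = \<zero>\<^bsub>Rt\<^esub>" using \<sigma>t_eq_zero u by blast
  then show "x = y" using x y unfolding u_def by simp
qed

lemma gr_map_surj:
  assumes "f \<in> carrier gr"
  shows "\<exists>x\<in>carrier Rt. gr_map x = f"
proof -
  note add = alg_homD(4)[OF gr_map_hom]
  have coset: "gr_map x d <+>\<^bsub>H\<^esub> Fil (d - 1) = gr_map x d" "Fil (d - 1) <+>\<^bsub>H\<^esub> gr_map x d = gr_map x d"
    if x: "x \<in> carrier Rt" for x d
  proof -
    have "gr_map x d = Fil (d - 1) +>\<^bsub>H\<^esub> cl (\<lambda>i. cmp d (\<sigma> (x i)))" unfolding gr_map_def sym_def ..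
    moreover have "cl (\<lambda>i. cmp d (\<sigma> (x i))) \<in> carrier H" using cmpt_closed[of "\<sigma>t x"] x by (simp add: cl_simps)
    ultimately show "gr_map x d <+>\<^bsub>H\<^esub> Fil (d - 1) = gr_map x d" "Fil (d - 1) <+>\<^bsub>H\<^esub> gr_map x d = gr_map x d"
      using coset_add[of "cl (\<lambda>i. cmp d (\<sigma> (x i)))" "\<zero>\<^bsub>H\<^esub>" "d - 1"] coset_add[of "\<zero>\<^bsub>H\<^esub>" "cl (\<lambda>i. cmp d (\<sigma> (x i)))" "d - 1"]
      by (simp_all add: coset_zero)
  qed
  have f: "\<exists>h\<in>Fil d. f d = Fil (d - 1) +>\<^bsub>H\<^esub> h" for d using assms unfolding gr_simps by blast
  have "\<exists>x\<in>carrier Rt. \<forall>d. gr_map x d = (if d < int n then f d else Fil (d - 1))" for n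
  proof (induction n)
    case 0
    have "f d = Fil (d - 1)" if "d < 0" for d
    proof -
      obtain h where h: "h \<in> Fil d" "f d = Fil (d - 1) +>\<^bsub>H\<^esub> h" using f by blast
      then obtain z where "z \<in> Bt.below d" "h = cl z" unfolding Fil_def by blast
      then have "h = \<zero>\<^bsub>H\<^esub>" using Bt.below_neg[OF _ that] cl_simps(6) by metis
      then show ?thesis using h by (simp add: coset_zero)
    qed
    moreover have "gr_map \<zero>\<^bsub>Rt\<^esub> d = Fil (d - 1)" for d
      unfolding gr_map_def \<sigma>t_zero sym_def using Bt.cmp_zero[of d] by (simp add: cl_simps coset_zero)
    ultimately show ?case by (intro bexI[of _ "\<zero>\<^bsub>Rt\<^esub>"]) auto
  next
    case (Suc n)
    then obtain x where x: "x \<in> carrier Rt" "\<And>d. gr_map x d = (if d < int n then f d else Fil (d - 1))" by blast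
    obtain h where h: "h \<in> Fil (int n)" "f (int n) = Fil (int n - 1) +>\<^bsub>H\<^esub> h" using f by blast
    obtain y where y: "y \<in> carrier Rt" "\<sigma>t y \<in> Bt.homog (int n)" "lead (int n) h = lead (int n) (sec y)"
      using lead_sec[OF h(1)] by blast
    have gy: "gr_map y d = (if d = int n then f d else Fil (d - 1))" for d
      using gr_map_homog[OF y(1,2)] y(3) h(2) by (simp add: lead_def fun_eq_iff split: if_splits)
    have "gr_map (x \<oplus>\<^bsub>Rt\<^esub> y) d = (if d < int (Suc n) then f d else Fil (d - 1))" for d
    proof -
      have "gr_map (x \<oplus>\<^bsub>Rt\<^esub> y) d = gr_map x d <+>\<^bsub>H\<^esub> gr_map y d"
        using add[OF x(1) y(1)] by (simp add: gr_simps)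
      also have "\<dots> = (if d = int n then gr_map y d else gr_map x d)"
        using coset(1)[OF x(1), of d] coset(2)[OF y(1), of d] x(2)[of d] gy[of d] by auto
      also have "\<dots> = (if d < int (Suc n) then f d else Fil (d - 1))" using x(2)[of d] gy[of d] by auto
      finally show ?thesis .
    qed
    then show ?case using x(1) y(1) by (intro bexI[of _ "x \<oplus>\<^bsub>Rt\<^esub> y"]) auto
  qed
  note all = this
  have "finite {d. f d \<noteq> Fil (d - 1)}" using assms unfolding gr_simps by blast
  then obtain N where N: "\<And>d. f d \<noteq> Fil (d - 1) \<Longrightarrow> d \<le> N" using Max_ge by (metis (mono_tags, lifting) mem_Collect_eq)
  obtain x where x: "x \<in> carrier Rt" "\<And>d. gr_map x d = (if d < int (nat (N + 1)) then f d else Fil (d - 1))"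
    using all by blast
  have "gr_map x d = f d" for d
  proof (cases "d < int (nat (N + 1))")
    case False
    then have "\<not> d \<le> N" by arith
    then show ?thesis using x(2)[of d] N[of d] False by metis
  qed (simp add: x(2))
  then show ?thesis using x(1) by blast
qed

lemma PBW_if_sec_inj:
  assumes sec_inj
  shows PBW
proof -
  have inj: "inj_on gr_map (carrier Rt)" by (rule gr_map_inj[OF assms])
  have "bij_betw gr_map (carrier Rt) (carrier gr)"
    unfolding bij_betw_def using inj alg_homD(2)[OF gr_map_hom] gr_map_surj by (auto simp: image_iff)
  then have iso: "inv_into (carrier Rt) gr_map \<in> algebra_iso (UP Cring) gr Rt"
    using gr_map_hom by (intro algebra_iso_inv[OF Rt.assoc_alg_axioms]) (simp add: algebra_iso_eq)
  have "inv_into (carrier Rt) gr_map ` gr_part d = poly_part R (Rdeg d)" for d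
  proof -
    have "gr_map ` poly_part R (Rdeg d) = gr_part d"
    proof (intro equalityI subsetI)
      fix f assume "f \<in> gr_map ` poly_part R (Rdeg d)"
      then obtain x where x: "x \<in> carrier Rt" "\<sigma>t x \<in> Bt.homog d" "f = gr_map x" unfolding poly_part_Rdeg by blast
      then show "f \<in> gr_part d"
        using lead_in_part[OF sec_in_Fil[OF x(1) Bt.homog_below[OF x(2) order_refl]]] gr_map_homog by simp
    next
      fix f assume "f \<in> gr_part d"
      then obtain h where h: "h \<in> Fil d" "f = lead d h" using part_lead by blast
      then obtain x where "x \<in> carrier Rt" "\<sigma>t x \<in> Bt.homog d" "lead d h = lead d (sec x)" using lead_sec by blast
      then have "x \<in> poly_part R (Rdeg d)" "f = gr_map x" using h gr_map_homog unfolding poly_part_Rdeg by simp_all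
      then show "f \<in> gr_map ` poly_part R (Rdeg d)" by blast
    qed
    moreover have "poly_part R (Rdeg d) \<subseteq> carrier Rt" unfolding poly_part_Rdeg by blast
    ultimately show ?thesis using inv_into_image_cancel[OF inj] by metis
  qed
  then show ?thesis unfolding PBW_def graded_algebra_isomorphic_def using iso by blast
qed

subsection \<open>From the filtered algebra to a deformation\<close>

text \<open>The multiplication of \<open>H\<close> is transported to \<open>R[t]\<close> along the bijection \<open>sec\<close>. Its degrees come from
  the grading of \<open>H\<close> with \<open>t\<close> in degree two: the coefficient of \<open>t\<^sup>i\<close> in a product of elements of degrees \<open>a\<close>
  and \<open>b\<close> has degree \<open>a + b - 2i\<close>.\<close>

lemma deformation_if_sec_inj:
  assumes inj: sec_inj
  shows "\<exists>\<mu> D. deformation R \<mu> D \<and> (\<forall>i\<ge>1. homogeneous_of_degree Rdeg (- 2 * int i) (\<mu> i)) \<and>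
     algebra_isomorphic (UP Cring) H D"
proof -
  define rec where "rec h = (SOME x. x \<in> carrier Rt \<and> h = sec x)" for h
  have rec: "rec h \<in> carrier Rt" "sec (rec h) = h" if h: "h \<in> carrier H" for h
  proof -
    obtain x where "x \<in> carrier Rt \<and> h = sec x" using sec_surj[OF h] by blast
    then have "rec h \<in> carrier Rt \<and> h = sec (rec h)"
      unfolding rec_def by (rule someI[of "\<lambda>x. x \<in> carrier Rt \<and> h = sec x"])
    then show "rec h \<in> carrier Rt" "sec (rec h) = h" by auto
  qed
  have rec_eq: "rec (sec x) = x" if "x \<in> carrier Rt" for x
    using rec[OF sec_simps(1)[OF that]] sec_eq_iff[OF inj _ that] by blast
  define D where "D = \<lparr>carrier = carrier Rt, monoid.mult = (\<lambda>x y. rec (sec x \<otimes>\<^bsub>H\<^esub> sec y)), monoid.one = rec \<one>\<^bsub>H\<^esub>,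
     ring.zero = \<zero>\<^bsub>Rt\<^esub>, ring.add = (\<lambda>x y. x \<oplus>\<^bsub>Rt\<^esub> y), module.smult = (\<lambda>p x. p \<odot>\<^bsub>Rt\<^esub> x)\<rparr>"
  have DS: "carrier D = carrier Rt" "\<zero>\<^bsub>D\<^esub> = \<zero>\<^bsub>Rt\<^esub>" "\<one>\<^bsub>D\<^esub> = rec \<one>\<^bsub>H\<^esub>" "\<And>x y. x \<otimes>\<^bsub>D\<^esub> y = rec (sec x \<otimes>\<^bsub>H\<^esub> sec y)"
     "\<And>x y. x \<oplus>\<^bsub>D\<^esub> y = x \<oplus>\<^bsub>Rt\<^esub> y" "\<And>p x. p \<odot>\<^bsub>D\<^esub> x = p \<odot>\<^bsub>Rt\<^esub> x"
    by (simp_all add: D_def)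
  have secI: "inj_on sec (carrier D)" using sec_eq_iff[OF inj] by (auto intro!: inj_onI simp: DS)
  have secS: "sec ` carrier D = carrier H"
    using sec_simps(1) sec_surj by (auto simp: DS image_iff)
  interpret D: assoc_alg "UP Cring" D
    by (rule assoc_alg_transport[OF H.assoc_alg_axioms secI secS])
       (simp_all add: DS rec sec_simps sec_zero)
  define \<mu> where "\<mu> i r s = (mon R 0 r \<otimes>\<^bsub>D\<^esub> mon R 0 s) i" for i :: nat and r s
  have coeff: "x i \<in> carrier R" if "x \<in> carrier D" for x i using that by (simp add: DS)
  have prod_closed: "mon R 0 r \<otimes>\<^bsub>D\<^esub> mon R 0 s \<in> carrier D" if "r \<in> carrier R" "s \<in> carrier R" for r s
    using that by (intro D.m_closed) (simp_all add: DS)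
  have c_add: "(x \<oplus>\<^bsub>D\<^esub> y) i = x i \<oplus>\<^bsub>R\<^esub> y i" if "x \<in> carrier D" "y \<in> carrier D" for x y i
    using that by (simp add: DS Rt_carrier poly_algebra_simps(4))
  have c_smult: "(mon Cring 0 c \<odot>\<^bsub>D\<^esub> x) i = c \<odot>\<^bsub>R\<^esub> x i" if "x \<in> carrier D" for c x i
    using that by (simp add: DS Rt_carrier R.smult_poly_mon)
  have m_add: "mon R 0 (r \<oplus>\<^bsub>R\<^esub> s) = mon R 0 r \<oplus>\<^bsub>D\<^esub> mon R 0 s" if "r \<in> carrier R" "s \<in> carrier R" for r s
    using that by (simp add: DS R.mon_add)
  have m_smult: "mon R 0 (c \<odot>\<^bsub>R\<^esub> r) = mon Cring 0 c \<odot>\<^bsub>D\<^esub> mon R 0 r" if "r \<in> carrier R" for c r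
    using that by (simp add: DS R.smult_mon_mon)
  have mD: "mon R 0 r \<in> carrier D" if "r \<in> carrier R" for r using that by (simp add: DS)
  have bil: "bilinear_map Cring R (\<mu> i)" for i
    unfolding bilinear_map_def
  proof (intro ballI conjI)
    fix x y z assume xyz: "x \<in> carrier R" "y \<in> carrier R" "z \<in> carrier R"
    show "\<mu> i (x \<oplus>\<^bsub>R\<^esub> z) y = \<mu> i x y \<oplus>\<^bsub>R\<^esub> \<mu> i z y" "\<mu> i x (y \<oplus>\<^bsub>R\<^esub> z) = \<mu> i x y \<oplus>\<^bsub>R\<^esub> \<mu> i x z"
      unfolding \<mu>_def using xyz by (simp_all add: m_add mD D.l_distr D.r_distr c_add)
  next
    fix x y c assume xy: "x \<in> carrier R" "y \<in> carrier R"
    show "\<mu> i x y \<in> carrier R" unfolding \<mu>_def by (rule coeff[OF prod_closed[OF xy]])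
    show "\<mu> i (c \<odot>\<^bsub>R\<^esub> x) y = c \<odot>\<^bsub>R\<^esub> \<mu> i x y" "\<mu> i x (c \<odot>\<^bsub>R\<^esub> y) = c \<odot>\<^bsub>R\<^esub> \<mu> i x y"
      unfolding \<mu>_def using xy by (simp_all add: m_smult mD D.smult_mult_left D.smult_mult_right c_smult)
  qed
  have prod: "mon R 0 r \<otimes>\<^bsub>D\<^esub> mon R 0 s = x"
    if "r \<in> carrier R" "s \<in> carrier R" "x \<in> carrier Rt" "cl (mon B 0 (\<sigma> r \<otimes>\<^bsub>B\<^esub> \<sigma> s)) = sec x" for r s x
  proof -
    have "sec (mon R 0 r) \<otimes>\<^bsub>H\<^esub> sec (mon R 0 s) = cl (mon B 0 (\<sigma> r \<otimes>\<^bsub>B\<^esub> \<sigma> s))"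
      using that B.mon_mult[of "\<sigma> r" "\<sigma> s" 0 0] by (simp add: sec_def \<sigma>t_mon cl_simps(3)[symmetric])
    then show ?thesis using that rec_eq by (simp add: DS)
  qed
  have prod0: "mon R 0 r \<otimes>\<^bsub>D\<^esub> mon R 0 s = (\<lambda>i. if i = 0 then r \<otimes>\<^bsub>R\<^esub> s else \<mu> i r s)" if rs: "r \<in> carrier R" "s \<in> carrier R" for r s
  proof -
    obtain x where x: "x \<in> carrier Rt" "x 0 = \<pi> (\<sigma> r \<otimes>\<^bsub>B\<^esub> \<sigma> s)" "cl (mon B 0 (\<sigma> r \<otimes>\<^bsub>B\<^esub> \<sigma> s)) = sec x"
      using normal_form_const[of "\<sigma> r \<otimes>\<^bsub>B\<^esub> \<sigma> s"] rs by auto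
    then show ?thesis using prod[OF rs x(1) x(3)] rs by (auto simp: \<mu>_def)
  qed
  have homog: "homogeneous_of_degree Rdeg (- 2 * int i) (\<mu> i)" for i
    unfolding homogeneous_of_degree_def
  proof (intro allI ballI)
    fix a b r s assume r: "r \<in> Rdeg a" and s: "s \<in> Rdeg b"
    then have c: "r \<in> carrier R" "s \<in> carrier R" "\<sigma> r \<otimes>\<^bsub>B\<^esub> \<sigma> s \<in> B.homog (a + b)" by (auto simp: Rdeg_iff B.homog_mult)
    obtain x where x: "x \<in> carrier Rt" "\<And>i. x i \<in> Rdeg (a + b - 2 * int i)" "cl (mon B 0 (\<sigma> r \<otimes>\<^bsub>B\<^esub> \<sigma> s)) = sec x"
      using normal_form_homog[OF c(3)] by blast
    then show "\<mu> i r s \<in> Rdeg (a + b + - 2 * int i)" using prod[OF c(1,2) x(1) x(3)] x(2)[of i] by (simp add: \<mu>_def)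
  qed
  have "deformation R \<mu> D"
    unfolding deformation_def assoc_algebra_iff
    using D.assoc_alg_axioms bil prod0 by (simp add: DS monom_eq_mon)
  moreover have "sec \<in> algebra_iso (UP Cring) D H"
    unfolding algebra_iso_eq bij_betw_def using secI secS
    by (auto intro!: alg_homI simp: DS sec_simps rec)
  then have "algebra_isomorphic (UP Cring) H D"
    by (intro algebra_isomorphic_sym[OF D.assoc_alg_axioms]) (auto simp: algebra_isomorphic_def)
  ultimately show ?thesis using homog by blast
qed

subsection \<open>From a deformation to the filtered algebra\<close>

text \<open>A homomorphism \<open>\<psi>\<close> from \<open>B[t]\<close> to a deformation \<open>D\<close> of \<open>R\<close> under which the relations hold induces one from
  \<open>H\<close>, and composing this with \<open>sec\<close> gives a \<open>\<complex>[t]\<close>-linear endomorphism of \<open>R[t]\<close>. If \<open>\<psi>\<close> is \<open>\<pi>\<close> modulo \<open>t\<close>,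
  this endomorphism is the identity modulo \<open>t\<close>. Hence it is injective, as \<open>R[t]\<close> has no \<open>t\<close>-torsion and only
  zero is divisible by all powers of \<open>t\<close>. If \<open>\<psi>\<close> is moreover graded, with
  \<open>t\<close> in degree two, it is onto: subtracting the image of the lowest coefficient leaves \<open>t\<close> times an element whose
  degree is smaller by two, and degrees are bounded below.\<close>

lemma sec_inj_if_hom_to_deformation:
  assumes D: "assoc_alg (UP Cring) D"
    and DC: "carrier D = carrier Rt" and D0: "\<zero>\<^bsub>D\<^esub> = \<zero>\<^bsub>Rt\<^esub>"
    and D_add: "\<And>x y. \<lbrakk>x \<in> carrier Rt; y \<in> carrier Rt\<rbrakk> \<Longrightarrow> x \<oplus>\<^bsub>D\<^esub> y = x \<oplus>\<^bsub>Rt\<^esub> y"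
    and D_smult: "\<And>p x. \<lbrakk>p \<in> carrier (UP Cring); x \<in> carrier Rt\<rbrakk> \<Longrightarrow> p \<odot>\<^bsub>D\<^esub> x = p \<odot>\<^bsub>Rt\<^esub> x"
    and \<psi>: "\<psi> \<in> alg_hom (UP Cring) Bt D"
    and rel: "\<And>\<rho> \<kappa>. (\<rho>, \<kappa>) \<in> rels \<Longrightarrow> \<psi> (mon B 0 \<rho>) = \<psi> (mon B 1 \<kappa>)"
    and const: "\<And>z. z \<in> carrier B \<Longrightarrow> \<psi> (mon B 0 z) 0 = \<pi> z"
    and homog: "\<And>m z i. z \<in> B.homog m \<Longrightarrow> \<psi> (mon B 0 z) i \<in> Rdeg (m - 2 * int i)"
  shows "sec_inj \<and> algebra_isomorphic (UP Cring) D H"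
proof -
  interpret D: assoc_alg "UP Cring" D by fact
  interpret h: ring_hom_ring Bt D \<psi>
    using alg_homD(1)[OF \<psi>] by (simp add: ring_hom_ringI2 Bt.ring_axioms D.ring_axioms)
  note \<psi>D = alg_homD[OF \<psi>]
  have ker: "\<psi> z = \<zero>\<^bsub>D\<^esub>" if "z \<in> J" for z
  proof -
    have "J \<subseteq> a_kernel Bt D \<psi>"
      unfolding J_def
    proof (rule Bt.genideal_minimal[OF h.kernel_is_ideal], clarify)
      fix \<rho> \<kappa> assume r: "(\<rho>, \<kappa>) \<in> rels"
      note c = relation_closed[OF r]
      have "\<psi> (mon B 0 \<rho> \<ominus>\<^bsub>Bt\<^esub> mon B 1 \<kappa>) = \<psi> (mon B 0 \<rho>) \<ominus>\<^bsub>D\<^esub> \<psi> (mon B 1 \<kappa>)"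
        using c \<psi>D by (intro additive_map_minus[where \<phi> = \<psi>]) (auto simp: Bt.is_abelian_group D.is_abelian_group)
      then have "\<psi> (mon B 0 \<rho> \<ominus>\<^bsub>Bt\<^esub> mon B 1 \<kappa>) = \<zero>\<^bsub>D\<^esub>"
        unfolding rel[OF r] using \<psi>D(2)[OF conjunct2[OF relation_closed[OF r]]] by simp
      then show "mon B 0 \<rho> \<ominus>\<^bsub>Bt\<^esub> mon B 1 \<kappa> \<in> a_kernel Bt D \<psi>"
        unfolding a_kernel_def' using c by (intro CollectI conjI Bt.minus_closed) simp_all
    qed
    from subsetD[OF this that] show ?thesis unfolding a_kernel_def' by simp
  qed
  have ker_eq: "\<psi> z = \<psi> w" if "z \<in> carrier Bt" "w \<in> carrier Bt" "cl z = cl w" for z w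
  proof -
    have "\<psi> (z \<ominus>\<^bsub>Bt\<^esub> w) = \<zero>\<^bsub>D\<^esub>" using that by (intro ker) (simp add: J.cls_eq_iff)
    moreover have "\<psi> (z \<ominus>\<^bsub>Bt\<^esub> w) = \<psi> z \<ominus>\<^bsub>D\<^esub> \<psi> w"
      using that \<psi>D by (intro additive_map_minus[where \<phi> = \<psi>]) (auto simp: Bt.is_abelian_group D.is_abelian_group)
    ultimately show ?thesis using that \<psi>D(2) by simp
  qed
  have tC: "tt \<odot>\<^bsub>Rt\<^esub> y \<in> carrier Rt" if "y \<in> carrier Rt" for y using that by simp
  have tcoeff: "(tt \<odot>\<^bsub>Rt\<^esub> y) i = (if i = 0 then \<zero>\<^bsub>R\<^esub> else y (i - 1))" if "y \<in> carrier Rt" for y i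
    using that R.smult_poly_mon[of 1 y 1] by (auto simp: Rt_carrier upD)
  have \<psi>C: "\<psi> z \<in> carrier Rt" if "z \<in> carrier Bt" for z using \<psi>D(2)[OF that] DC by simp
  \<comment> \<open>\<open>N\<close> bounds the number of coefficients of \<open>x\<close>; each step removes the lowest one and a factor \<open>t\<close>.\<close>
  have inj0: "x = \<zero>\<^bsub>Rt\<^esub>" if "x \<in> carrier Rt" "\<psi> (\<sigma>t x) = \<zero>\<^bsub>D\<^esub>" "\<And>i. i \<ge> N \<Longrightarrow> x i = \<zero>\<^bsub>R\<^esub>" for x N
    using that
  proof (induction N arbitrary: x)
    case 0
    then show ?case by (simp add: poly_algebra_simps fun_eq_iff)
  next
    case (Suc N)
    let ?y = "\<lambda>i. x (Suc i)"
    have y: "?y \<in> carrier Rt" by (rule Rt_shift[OF Suc.prems(1)])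
    have c: "mon B 0 (\<sigma> (x 0)) \<in> carrier Bt" "\<sigma>t ?y \<in> carrier Bt" using Suc.prems(1) \<sigma>t_closed[OF y] by simp_all
    have x0y: "mon R 0 (x 0) \<in> carrier Rt" "tt \<odot>\<^bsub>Rt\<^esub> ?y \<in> carrier Rt" using Suc.prems(1) tC[OF y] by simp_all
    have "\<sigma>t x = \<sigma>t (mon R 0 (x 0) \<oplus>\<^bsub>Rt\<^esub> tt \<odot>\<^bsub>Rt\<^esub> ?y)"
      by (rule arg_cong[where f = "\<lambda>x. (\<lambda>i. \<sigma> (x i))", OF Rt_uncons[OF Suc.prems(1)]])
    also have "\<dots> = mon B 0 (\<sigma> (x 0)) \<oplus>\<^bsub>Bt\<^esub> tt \<odot>\<^bsub>Bt\<^esub> \<sigma>t ?y"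
      unfolding \<sigma>t_add[OF x0y] \<sigma>t_smult[OF tt_closed y] \<sigma>t_mon ..
    finally have "\<sigma>t x = mon B 0 (\<sigma> (x 0)) \<oplus>\<^bsub>Bt\<^esub> tt \<odot>\<^bsub>Bt\<^esub> \<sigma>t ?y" .
    then have eq: "\<psi> (\<sigma>t x) = \<psi> (mon B 0 (\<sigma> (x 0))) \<oplus>\<^bsub>Rt\<^esub> tt \<odot>\<^bsub>Rt\<^esub> \<psi> (\<sigma>t ?y)"
      using c by (simp add: \<psi>D(4,6) D_add D_smult \<psi>C)
    have "\<psi> (mon B 0 (\<sigma> (x 0))) 0 = (\<psi> (mon B 0 (\<sigma> (x 0))) \<oplus>\<^bsub>Rt\<^esub> tt \<odot>\<^bsub>Rt\<^esub> \<psi> (\<sigma>t ?y)) 0"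
      using \<psi>C[OF c(1)] tC[OF \<psi>C[OF c(2)]] tcoeff[OF \<psi>C[OF c(2)], of 0] by (simp add: poly_algebra_simps(4) Rt_carrier upD)
    also have "\<dots> = \<zero>\<^bsub>R\<^esub>" unfolding eq[symmetric] Suc.prems(2) D0 by (simp add: poly_algebra_simps)
    finally have "\<psi> (mon B 0 (\<sigma> (x 0))) 0 = \<zero>\<^bsub>R\<^esub>" .
    then have x0: "x 0 = \<zero>\<^bsub>R\<^esub>" using const Suc.prems(1) by simp
    have "\<psi> (mon B 0 (\<sigma> (x 0))) = \<zero>\<^bsub>Rt\<^esub>"
    proof -
      have "mon B 0 (\<sigma> (x 0)) = \<zero>\<^bsub>Bt\<^esub>" by (auto simp: x0 mon_def poly_algebra_simps)
      then show ?thesis using h.hom_zero D0 by simp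
    qed
    then have "tt \<odot>\<^bsub>Rt\<^esub> \<psi> (\<sigma>t ?y) = \<zero>\<^bsub>Rt\<^esub>"
      using eq Rt.l_zero[OF tC[OF \<psi>C[OF c(2)]]] unfolding Suc.prems(2) D0 by metis
    then have "\<psi> (\<sigma>t ?y) i = \<zero>\<^bsub>R\<^esub>" for i
      using tcoeff[OF \<psi>C[OF c(2)], of "Suc i"] by (simp add: poly_algebra_simps)
    then have "\<psi> (\<sigma>t ?y) = \<zero>\<^bsub>D\<^esub>" by (simp add: D0 poly_algebra_simps fun_eq_iff)
    moreover have "?y i = \<zero>\<^bsub>R\<^esub>" if "i \<ge> N" for i using that by (intro Suc.prems(3)) simp
    ultimately have "?y = \<zero>\<^bsub>Rt\<^esub>" by (rule Suc.IH[OF y])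
    then have "x i = \<zero>\<^bsub>R\<^esub>" for i using x0 by (cases i) (auto simp: poly_algebra_simps fun_eq_iff)
    then show ?case by (simp add: poly_algebra_simps fun_eq_iff)
  qed
  have inj: "x = \<zero>\<^bsub>Rt\<^esub>" if x: "x \<in> carrier Rt" "\<psi> (\<sigma>t x) = \<zero>\<^bsub>D\<^esub>" for x
  proof -
    obtain N where "\<forall>i>N. x i = \<zero>\<^bsub>R\<^esub>" using x(1) up_bound unfolding Rt_carrier by blast
    then show ?thesis using inj0[OF x, of "Suc N"] by (simp add: Suc_le_eq)
  qed
  have sec_inj
    unfolding sec_inj_def
  proof (intro ballI impI)
    fix x assume x: "x \<in> carrier Rt" "sec x = \<zero>\<^bsub>H\<^esub>"
    then have "\<psi> (\<sigma>t x) = \<psi> \<zero>\<^bsub>Bt\<^esub>" by (intro ker_eq) (simp_all add: sec_def cl_simps)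
    then show "x = \<zero>\<^bsub>Rt\<^esub>" using inj[OF x(1)] h.hom_zero by simp
  qed
  have kernel: "\<psi> z = \<zero>\<^bsub>D\<^esub> \<longleftrightarrow> z \<in> J" if z: "z \<in> carrier Bt" for z
  proof
    assume a: "\<psi> z = \<zero>\<^bsub>D\<^esub>"
    obtain x where x: "x \<in> carrier Rt" "cl z = sec x" using sec_surj[OF cl_simps(1)[OF z]] by blast
    then have "\<psi> (\<sigma>t x) = \<zero>\<^bsub>D\<^esub>" using ker_eq[OF z \<sigma>t_closed[OF x(1)]] a by (simp add: sec_def)
    then have "x = \<zero>\<^bsub>Rt\<^esub>" using inj x(1) by blast
    then have "cl z = cl \<zero>\<^bsub>Bt\<^esub>" using x by (simp add: sec_zero cl_simps)
    then show "z \<in> J" using z by (simp add: J.cls_eq_iff a_minus_def)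
  qed (rule ker)
  define I where "I = \<psi> ` carrier Bt"
  have I_add: "x \<oplus>\<^bsub>Rt\<^esub> y \<in> I" if xy: "x \<in> I" "y \<in> I" for x y
  proof -
    obtain z w where "z \<in> carrier Bt" "w \<in> carrier Bt" "x = \<psi> z" "y = \<psi> w" using xy unfolding I_def by blast
    then have "x \<oplus>\<^bsub>Rt\<^esub> y = \<psi> (z \<oplus>\<^bsub>Bt\<^esub> w)" by (simp add: \<psi>D(4) D_add \<psi>C)
    moreover have "z \<oplus>\<^bsub>Bt\<^esub> w \<in> carrier Bt" using \<open>z \<in> carrier Bt\<close> \<open>w \<in> carrier Bt\<close> by (rule Bt.M.a_closed)
    ultimately show ?thesis unfolding I_def by (rule image_eqI)
  qed
  have I_smult: "p \<odot>\<^bsub>Rt\<^esub> x \<in> I" if px: "p \<in> carrier (UP Cring)" "x \<in> I" for p x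
  proof -
    obtain z where z: "z \<in> carrier Bt" "x = \<psi> z" using px unfolding I_def by blast
    then have "p \<odot>\<^bsub>Rt\<^esub> x = \<psi> (p \<odot>\<^bsub>Bt\<^esub> z)" using px by (simp add: \<psi>D(6) D_smult \<psi>C)
    moreover have "p \<odot>\<^bsub>Bt\<^esub> z \<in> carrier Bt" using px(1) z(1) by (rule Bt.smult_closed)
    ultimately show ?thesis unfolding I_def by (rule image_eqI)
  qed
  have I_zero: "\<zero>\<^bsub>Rt\<^esub> \<in> I" unfolding I_def using h.hom_zero D0 Bt.zero_closed by (metis imageI)
  \<comment> \<open>Below degree zero there is nothing to show; the offset \<open>2\<close> makes the measure drop also at \<open>m = 0\<close>.\<close>
  have homog_I: "y \<in> I" if "y \<in> carrier Rt" "\<And>i. y i \<in> Rdeg (m - 2 * int i)" for y m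
    using that
  proof (induction "nat (m + 2)" arbitrary: m y rule: less_induct)
    case less
    show ?case
    proof (cases "m < 0")
      case True
      have "y i = \<zero>\<^bsub>R\<^esub>" for i
      proof -
        have "\<sigma> (y i) = \<zero>\<^bsub>B\<^esub>" using less.prems(2)[of i] True B.homog_neg[of "\<sigma> (y i)" "m - 2 * int i"] by (simp add: Rdeg_iff)
        then show ?thesis using \<pi>_\<sigma>[of "y i"] less.prems(1) by simp
      qed
      then have "y = \<zero>\<^bsub>Rt\<^esub>" by (simp add: poly_algebra_simps fun_eq_iff)
      then show ?thesis using I_zero by simp
    next
      case False
      let ?u = "\<psi> (mon B 0 (\<sigma> (y 0)))"
      have s: "\<sigma> (y 0) \<in> B.homog m" "\<sigma> (y 0) \<in> carrier B" using less.prems(2)[of 0] by (auto simp: Rdeg_iff)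
      have u: "?u \<in> carrier Rt" using s by (simp add: \<psi>C)
      let ?v = "y \<ominus>\<^bsub>Rt\<^esub> ?u" and ?w = "\<lambda>i. (y \<ominus>\<^bsub>Rt\<^esub> ?u) (Suc i)"
      have v: "?v \<in> carrier Rt" using less.prems(1) u by simp
      have vi: "?v i = y i \<ominus>\<^bsub>R\<^esub> ?u i" for i using less.prems(1) u by (simp add: Rt_carrier R.poly_minus)
      have v0: "?v 0 = \<zero>\<^bsub>R\<^esub>" using vi[of 0] const[OF s(2)] less.prems(1) by simp
      have R_minus: "r \<ominus>\<^bsub>R\<^esub> r' \<in> Rdeg d" if "r \<in> Rdeg d" "r' \<in> Rdeg d" for r r' d
        using that additive_map_minus[OF R.is_abelian_group B.is_abelian_group, of \<sigma>] \<sigma>_add by (simp add: Rdeg_iff)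
      have "?w i \<in> Rdeg (m - 2 - 2 * int i)" for i
        using R_minus[OF less.prems(2)[of "Suc i"] homog[OF s(1), of "Suc i"]] by (simp add: vi diff_diff_eq)
      then have "?w \<in> I" using False by (intro less.hyps[OF _ Rt_shift[OF v], of "m - 2"]) simp_all
      then have tw: "tt \<odot>\<^bsub>Rt\<^esub> ?w \<in> I" by (rule I_smult[OF tt_closed])
      have tv: "tt \<odot>\<^bsub>Rt\<^esub> ?w = ?v"
        using v0 tcoeff[OF Rt_shift[OF v]] by (auto simp: fun_eq_iff)
      have "?v \<in> I" by (rule subst[where P = "\<lambda>u. u \<in> I", OF tv tw])
      moreover have "?u \<in> I" unfolding I_def by (rule imageI[OF mon_in_Bt[OF s(2)]])
      ultimately have "?u \<oplus>\<^bsub>Rt\<^esub> ?v \<in> I" by (intro I_add)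
      then show ?thesis using u less.prems(1) by (simp add: Rt.M.add_minus_cancel)
    qed
  qed
  have const_I: "mon R 0 (\<pi> z) \<in> I" if "z \<in> carrier B" for z
    using that
  proof (induction z rule: B.graded_induct)
    case zero
    have "mon R 0 (\<pi> \<zero>\<^bsub>B\<^esub>) = \<zero>\<^bsub>Rt\<^esub>" by (auto simp: mon_def poly_algebra_simps)
    then show ?case using I_zero by simp
  next
    case (hom e y)
    then show ?case
      using \<sigma>_homog[OF hom] B.homog_carrier[OF hom]
      by (intro homog_I[of _ e]) (auto simp: mon_def Rdeg_iff, auto simp: Rt_carrier intro!: R.mon_closed[unfolded mon_def])
  next
    case (add y z)
    then have "mon R 0 (\<pi> (y \<oplus>\<^bsub>B\<^esub> z)) = mon R 0 (\<pi> y) \<oplus>\<^bsub>Rt\<^esub> mon R 0 (\<pi> z)" by (simp add: R.mon_add)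
    then show ?case using add by (simp add: I_add)
  qed
  have surj: "\<psi> ` carrier Bt = carrier D"
  proof (intro equalityI subsetI)
    fix y assume "y \<in> carrier D"
    then have y: "y \<in> up R" using DC Rt_carrier by simp
    have "y \<in> I"
      using R.is_abelian_group y
    proof (induction y rule: up_induct)
      case zero
      then show ?case using I_zero by (simp add: poly_algebra_simps)
    next
      case (mon i)
      have c: "y i \<in> carrier R" using y by (rule upD)
      have "mon R i (y i) = mon Cring i 1 \<odot>\<^bsub>Rt\<^esub> mon R 0 (y i)"
        using R.smult_mon_mon[of 1 "y i" i 0] c by simp
      then show ?case using const_I[OF \<sigma>_closed[OF c]] c I_smult[OF tt_closed] by simp
    next
      case (add x z)
      then show ?case using I_add by (simp add: poly_algebra_simps(4)[symmetric])
    qed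
    then show "y \<in> \<psi> ` carrier Bt" unfolding I_def .
  qed (use \<psi>D(2) in auto)
  have "algebra_isomorphic (UP Cring) D H"
    by (rule surjective_alg_hom_quotient[OF Bt.assoc_alg_axioms D.assoc_alg_axioms \<psi> surj J.ideal_axioms kernel])
  with \<open>sec_inj\<close> show ?thesis by blast
qed

end

section \<open>Homogeneous ideals and gradings of skew group algebras\<close>

context graded_alg
begin

lemma cmp_homog_mult_left:
  assumes y: "y \<in> homog e" and x: "x \<in> carrier B"
  shows "cmp d (y \<otimes>\<^bsub>B\<^esub> x) = y \<otimes>\<^bsub>B\<^esub> cmp (d - e) x"
proof -
  have yc: "y \<in> carrier B" using y by (rule homog_carrier)
  have "cmp d (y \<otimes>\<^bsub>B\<^esub> x) = (\<Oplus>\<^bsub>B\<^esub>i\<in>{0..d}. if e = i then y \<otimes>\<^bsub>B\<^esub> cmp (d - i) x else \<zero>\<^bsub>B\<^esub>)"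
    unfolding cmp_mult[OF yc x] using y yc x by (intro M.finsum_cong') (auto simp: cmp_homog)
  also have "\<dots> = y \<otimes>\<^bsub>B\<^esub> cmp (d - e) x"
  proof (cases "e \<in> {0..d}")
    case True
    then show ?thesis using yc x by (subst M.finsum_singleton) auto
  next
    case False
    have "(\<Oplus>\<^bsub>B\<^esub>i\<in>{0..d}. if e = i then y \<otimes>\<^bsub>B\<^esub> cmp (d - i) x else \<zero>\<^bsub>B\<^esub>) = \<zero>\<^bsub>B\<^esub>"
      using False by (intro M.add.finprod_one_eqI) auto
    moreover have "y \<otimes>\<^bsub>B\<^esub> cmp (d - e) x = \<zero>\<^bsub>B\<^esub>"
      using False homog_neg[OF y] cmp_neg[OF x, of "d - e"] yc x by (cases "e < 0") auto
    ultimately show ?thesis by simp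
  qed
  finally show ?thesis .
qed

lemma cmp_homog_mult_right:
  assumes y: "y \<in> homog e" and x: "x \<in> carrier B"
  shows "cmp d (x \<otimes>\<^bsub>B\<^esub> y) = cmp (d - e) x \<otimes>\<^bsub>B\<^esub> y"
proof -
  have yc: "y \<in> carrier B" using y by (rule homog_carrier)
  have "cmp d (x \<otimes>\<^bsub>B\<^esub> y) = (\<Oplus>\<^bsub>B\<^esub>i\<in>{0..d}. if d - e = i then cmp i x \<otimes>\<^bsub>B\<^esub> y else \<zero>\<^bsub>B\<^esub>)"
    unfolding cmp_mult[OF x yc] using y yc x by (intro M.finsum_cong') (auto simp: cmp_homog)
  also have "\<dots> = cmp (d - e) x \<otimes>\<^bsub>B\<^esub> y"
  proof (cases "d - e \<in> {0..d}")
    case True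
    then show ?thesis using yc x by (subst M.finsum_singleton) auto
  next
    case False
    have "(\<Oplus>\<^bsub>B\<^esub>i\<in>{0..d}. if d - e = i then cmp i x \<otimes>\<^bsub>B\<^esub> y else \<zero>\<^bsub>B\<^esub>) = \<zero>\<^bsub>B\<^esub>"
      using False by (intro M.add.finprod_one_eqI) auto
    moreover have "cmp (d - e) x \<otimes>\<^bsub>B\<^esub> y = \<zero>\<^bsub>B\<^esub>"
      using False homog_neg[OF y] cmp_neg[OF x, of "d - e"] yc x by (cases "e < 0") auto
    ultimately show ?thesis by simp
  qed
  finally show ?thesis .
qed

text \<open>The degree \<open>d\<close> part of the ideal generated by elements \<open>s \<in> S\<close> of degree two. Describing it by homogeneous
  factors is what makes induction over the kernel of a graded projection possible.\<close>

inductive_set ideal_part :: "'b set \<Rightarrow> int \<Rightarrow> 'b set" for S d where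
  zero: "\<zero>\<^bsub>B\<^esub> \<in> ideal_part S d"
| add: "\<lbrakk>x \<in> ideal_part S d; y \<in> ideal_part S d\<rbrakk> \<Longrightarrow> x \<oplus>\<^bsub>B\<^esub> y \<in> ideal_part S d"
| gen: "\<lbrakk>s \<in> S; a \<in> homog p; b \<in> homog q; p + q + 2 = d\<rbrakk> \<Longrightarrow> a \<otimes>\<^bsub>B\<^esub> s \<otimes>\<^bsub>B\<^esub> b \<in> ideal_part S d"

lemma ideal_part_mult:
  assumes S: "S \<subseteq> carrier B" and x: "x \<in> ideal_part S d"
  shows ideal_part_carrier: "x \<in> carrier B"
    and ideal_part_mult_left: "y \<in> homog e \<Longrightarrow> y \<otimes>\<^bsub>B\<^esub> x \<in> ideal_part S (e + d)"
    and ideal_part_mult_right: "y \<in> homog e \<Longrightarrow> x \<otimes>\<^bsub>B\<^esub> y \<in> ideal_part S (d + e)"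
proof -
  have "x \<in> carrier B \<and> (\<forall>e. \<forall>y\<in>homog e. y \<otimes>\<^bsub>B\<^esub> x \<in> ideal_part S (e + d) \<and> x \<otimes>\<^bsub>B\<^esub> y \<in> ideal_part S (d + e))"
    using x
  proof induction
    case zero
    then show ?case by (auto simp: homog_carrier intro: ideal_part.zero)
  next
    case (add x y)
    then show ?case by (auto simp: homog_carrier l_distr r_distr intro: ideal_part.add)
  next
    case (gen s a p b q)
    have c: "s \<in> carrier B" "a \<in> carrier B" "b \<in> carrier B" using gen S by (auto simp: homog_carrier)
    have "y \<otimes>\<^bsub>B\<^esub> (a \<otimes>\<^bsub>B\<^esub> s \<otimes>\<^bsub>B\<^esub> b) \<in> ideal_part S (e + d)" if y: "y \<in> homog e" for y e
    proof -
      have "(y \<otimes>\<^bsub>B\<^esub> a) \<otimes>\<^bsub>B\<^esub> s \<otimes>\<^bsub>B\<^esub> b \<in> ideal_part S (e + d)"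
        using gen by (intro ideal_part.gen[OF _ homog_mult[OF y gen(2)] gen(3)]) auto
      then show ?thesis using c homog_carrier[OF y] by (simp add: m_assoc)
    qed
    moreover have "a \<otimes>\<^bsub>B\<^esub> s \<otimes>\<^bsub>B\<^esub> b \<otimes>\<^bsub>B\<^esub> y \<in> ideal_part S (d + e)" if y: "y \<in> homog e" for y e
    proof -
      have "a \<otimes>\<^bsub>B\<^esub> s \<otimes>\<^bsub>B\<^esub> (b \<otimes>\<^bsub>B\<^esub> y) \<in> ideal_part S (d + e)"
        using gen by (intro ideal_part.gen[OF _ gen(2) homog_mult[OF gen(3) y]]) auto
      then show ?thesis using c homog_carrier[OF y] by (simp add: m_assoc)
    qed
    ultimately show ?case using c by simp
  qed
  then show "x \<in> carrier B" "y \<in> homog e \<Longrightarrow> y \<otimes>\<^bsub>B\<^esub> x \<in> ideal_part S (e + d)"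
    "y \<in> homog e \<Longrightarrow> x \<otimes>\<^bsub>B\<^esub> y \<in> ideal_part S (d + e)" by auto
qed

lemma ideal_part_subset:
  assumes S: "S \<subseteq> carrier B" and x: "x \<in> ideal_part S d"
  shows "x \<in> genideal B S"
proof -
  interpret I: ideal "genideal B S" B by (rule genideal_ideal[OF S])
  show ?thesis
    using x
  proof induction
    case (gen s a p b q)
    then have "s \<in> genideal B S" using genideal_self[OF S] by blast
    with gen show ?case by (intro I.I_r_closed I.I_l_closed) (auto simp: homog_carrier)
  qed simp_all
qed

text \<open>The elements all of whose components lie in the respective parts form an ideal containing \<open>S\<close>.\<close>

lemma cmp_genideal:
  assumes S: "S \<subseteq> homog 2" and x: "x \<in> genideal B S"
  shows "cmp d x \<in> ideal_part S d"
proof -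
  have Sc: "S \<subseteq> carrier B" using S homog_carrier by blast
  let ?I = "{x \<in> carrier B. \<forall>d. cmp d x \<in> ideal_part S d}"
  have neg: "\<ominus>\<^bsub>B\<^esub> \<one>\<^bsub>B\<^esub> \<in> homog 0" using one_homog by (simp add: homog_def cmp_a_inv)
  have mult: "y \<otimes>\<^bsub>B\<^esub> x \<in> ?I \<and> x \<otimes>\<^bsub>B\<^esub> y \<in> ?I" if x: "x \<in> ?I" and y: "y \<in> carrier B" for x y
    using y
  proof (induction y rule: graded_induct)
    case zero
    then show ?case using x by (simp add: ideal_part.zero)
  next
    case (hom e y)
    have "cmp d (y \<otimes>\<^bsub>B\<^esub> x) \<in> ideal_part S d" "cmp d (x \<otimes>\<^bsub>B\<^esub> y) \<in> ideal_part S d" for d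
      using x ideal_part_mult_left[OF Sc _ hom, of "cmp (d - e) x" "d - e"]
        ideal_part_mult_right[OF Sc _ hom, of "cmp (d - e) x" "d - e"]
      by (simp_all add: cmp_homog_mult_left[OF hom] cmp_homog_mult_right[OF hom])
    then show ?case using x homog_carrier[OF hom] by simp
  next
    case (add y z)
    then show ?case using x by (auto simp: l_distr r_distr cmp_add intro: ideal_part.add)
  qed
  have "ideal ?I B"
  proof (rule idealI[OF ring_axioms])
    show "subgroup ?I (add_monoid B)"
    proof (rule subgroup.intro)
      fix x assume "x \<in> ?I"
      then have "(\<ominus>\<^bsub>B\<^esub> \<one>\<^bsub>B\<^esub>) \<otimes>\<^bsub>B\<^esub> x \<in> ?I" using mult homog_carrier[OF neg] by blast
      then show "inv\<^bsub>add_monoid B\<^esub> x \<in> ?I" using \<open>x \<in> ?I\<close> by (simp add: l_minus a_inv_def[symmetric])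
    qed (auto simp: cmp_add intro: ideal_part.zero ideal_part.add)
  qed (use mult in auto)
  moreover have "S \<subseteq> ?I"
  proof
    fix s assume s: "s \<in> S"
    then have sc: "s \<in> carrier B" using Sc by blast
    have "\<one>\<^bsub>B\<^esub> \<otimes>\<^bsub>B\<^esub> s \<otimes>\<^bsub>B\<^esub> \<one>\<^bsub>B\<^esub> \<in> ideal_part S 2" by (rule ideal_part.gen[OF s one_homog one_homog]) simp
    then have "cmp d s \<in> ideal_part S d" for d
      using s S sc cmp_homog[of s 2 d] by (auto simp: ideal_part.zero)
    then show "s \<in> ?I" using sc by simp
  qed
  ultimately have "genideal B S \<subseteq> ?I" by (rule genideal_minimal)
  then show ?thesis using x by blast
qed

end

lemma skew_graded:
  assumes "skew_algebra K A G act" "graded_alg K A cmp"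
    and act_cmp: "\<And>g d a. \<lbrakk>g \<in> carrier G; a \<in> carrier A\<rbrakk> \<Longrightarrow> act g (cmp d a) = cmp d (act g a)"
  shows "graded_alg K (skew_group_algebra A G act) (\<lambda>d f. \<lambda>k\<in>carrier G. cmp d (f k))"
proof -
  interpret S: skew_algebra K A G act by fact
  interpret A: graded_alg K A cmp by fact
  interpret SA: assoc_alg K S.S by (rule S.skew_assoc_alg)
  let ?c = "\<lambda>d f. \<lambda>k\<in>carrier G. cmp d (f k)"
  have cl: "?c d f \<in> carrier S.S" if "f \<in> carrier S.S" for d f using that by (simp add: S.S_carrier_iff)
  show ?thesis
  proof unfold_locales
    fix x d assume x: "x \<in> carrier S.S"
    then show "?c d x \<in> carrier S.S" by (rule cl)
    show "?c d (?c e x) = (if d = e then ?c d x else \<zero>\<^bsub>S.S\<^esub>)" for e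
      using x by (auto simp: A.cmp_cmp skew_simps(4) fun_eq_iff)
    show "?c d x = \<zero>\<^bsub>S.S\<^esub>" if "d < 0" using x that by (auto simp: A.cmp_neg skew_simps(4) fun_eq_iff)
    show "x = \<zero>\<^bsub>S.S\<^esub>" if "\<And>d. ?c d x = \<zero>\<^bsub>S.S\<^esub>"
    proof (rule S.S_eqI[OF x SA.zero_closed])
      fix g assume g: "g \<in> carrier G"
      have "cmp d (x g) = \<zero>\<^bsub>A\<^esub>" for d using fun_cong[OF that[of d], of g] g by (simp add: skew_simps(4))
      then show "x g = \<zero>\<^bsub>S.S\<^esub> g" using A.cmp_separated[of "x g"] x g by (simp add: S.S_app)
    qed
    have "\<forall>g\<in>carrier G. \<exists>N. \<forall>d>N. cmp d (x g) = \<zero>\<^bsub>A\<^esub>" using A.cmp_bound x by simp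
    then obtain N where N: "\<And>g d. \<lbrakk>g \<in> carrier G; d > N g\<rbrakk> \<Longrightarrow> cmp d (x g) = \<zero>\<^bsub>A\<^esub>" by metis
    have "cmp d (x g) = \<zero>\<^bsub>A\<^esub>" if "g \<in> carrier G" "d > Max (N ` carrier G)" for d g
    proof -
      have "N g \<le> Max (N ` carrier G)" using that S.finite_G by simp
      then have "N g < d" using that by linarith
      then show ?thesis using N that by blast
    qed
    then show "\<exists>N. \<forall>d>N. ?c d x = \<zero>\<^bsub>S.S\<^esub>"
      by (intro exI[of _ "Max (N ` carrier G)"]) (auto simp: skew_simps(4) fun_eq_iff)
    show "?c d (c \<odot>\<^bsub>S.S\<^esub> x) = c \<odot>\<^bsub>S.S\<^esub> ?c d x" if "c \<in> carrier K" for c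
      using x that by (auto simp: skew_simps(6) A.cmp_smult fun_eq_iff)
  next
    fix x y d assume x: "x \<in> carrier S.S" and y: "y \<in> carrier S.S"
    then show "?c d (x \<oplus>\<^bsub>S.S\<^esub> y) = ?c d x \<oplus>\<^bsub>S.S\<^esub> ?c d y" by (auto simp: skew_simps(5) A.cmp_add fun_eq_iff)
    show "?c d (x \<otimes>\<^bsub>S.S\<^esub> y) = (\<Oplus>\<^bsub>S.S\<^esub>i\<in>{0..d}. ?c i x \<otimes>\<^bsub>S.S\<^esub> ?c (d - i) y)"
    proof (rule S.S_eqI)
      fix k assume k: "k \<in> carrier G"
      let ?t = "\<lambda>g i. cmp i (x g) \<otimes>\<^bsub>A\<^esub> act g (cmp (d - i) (y (inv\<^bsub>G\<^esub> g \<otimes>\<^bsub>G\<^esub> k)))"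
      have "?c d (x \<otimes>\<^bsub>S.S\<^esub> y) k = cmp d (\<Oplus>\<^bsub>A\<^esub>g\<in>carrier G. x g \<otimes>\<^bsub>A\<^esub> act g (y (inv\<^bsub>G\<^esub> g \<otimes>\<^bsub>G\<^esub> k)))"
        using k by (simp add: S.S_app)
      also have "\<dots> = (\<Oplus>\<^bsub>A\<^esub>g\<in>carrier G. cmp d (x g \<otimes>\<^bsub>A\<^esub> act g (y (inv\<^bsub>G\<^esub> g \<otimes>\<^bsub>G\<^esub> k))))"
        using x y k by (intro additive_map_finsum[where \<phi> = "cmp d"]) (auto simp: A.cmp_add S.A.is_abelian_group)
      also have "\<dots> = (\<Oplus>\<^bsub>A\<^esub>g\<in>carrier G. \<Oplus>\<^bsub>A\<^esub>i\<in>{0..d}. ?t g i)"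
        using x y k by (intro S.A.M.finsum_cong') (auto simp: A.cmp_mult act_cmp intro!: S.A.M.finsum_closed)
      also have "\<dots> = (\<Oplus>\<^bsub>A\<^esub>i\<in>{0..d}. \<Oplus>\<^bsub>A\<^esub>g\<in>carrier G. ?t g i)"
        using x y k S.finite_G by (intro S.A.M.finsum_swap) auto
      also have "\<dots> = (\<Oplus>\<^bsub>A\<^esub>i\<in>{0..d}. (?c i x \<otimes>\<^bsub>S.S\<^esub> ?c (d - i) y) k)"
        using x y k by (intro S.A.M.finsum_cong') (auto simp: S.S_app intro!: S.A.M.finsum_closed S.A.M.finsum_cong')
      also have "\<dots> = (\<Oplus>\<^bsub>S.S\<^esub>i\<in>{0..d}. ?c i x \<otimes>\<^bsub>S.S\<^esub> ?c (d - i) y) k"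
        using x y k cl
        by (intro additive_map_finsum[where \<phi> = "\<lambda>f. f k", symmetric])
           (auto simp: S.S_app SA.is_abelian_group S.A.is_abelian_group)
      finally show "?c d (x \<otimes>\<^bsub>S.S\<^esub> y) k = (\<Oplus>\<^bsub>S.S\<^esub>i\<in>{0..d}. ?c i x \<otimes>\<^bsub>S.S\<^esub> ?c (d - i) y) k" .
    qed (use x y cl in \<open>auto intro!: SA.M.finsum_closed\<close>)
  next
    show "?c 0 \<one>\<^bsub>S.S\<^esub> = \<one>\<^bsub>S.S\<^esub>" by (auto simp: skew_simps(3) sgl_def A.cmp_one fun_eq_iff)
  qed
qed

text \<open>Take the projection onto a complement of \<open>U\<close>, along \<open>U\<close>.\<close>

lemma (in vector_space) exists_projection_with_kernel:
  assumes U: "subspace U"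
  shows "\<exists>P. Vector_Spaces.linear scale scale P \<and> (\<forall>u\<in>U. P u = 0) \<and> (\<forall>x. P x - x \<in> U)"
proof -
  interpret vector_space_pair scale scale by unfold_locales
  obtain B where B: "B \<subseteq> U" "independent B" "U \<subseteq> span B" using maximal_independent_subset by blast
  define C where "C = extend_basis B"
  have C: "B \<subseteq> C" "independent C" "span C = UNIV"
    unfolding C_def using extend_basis_superset[OF B(2)] independent_extend_basis[OF B(2)] span_extend_basis[OF B(2)] by auto
  define P where "P = construct C (\<lambda>b. if b \<in> B then 0 else b)"
  have lin: "Vector_Spaces.linear scale scale P" unfolding P_def by (rule linear_construct[OF C(2)])
  interpret P: Vector_Spaces.linear scale scale P by (rule lin)
  have PC: "P b = (if b \<in> B then 0 else b)" if "b \<in> C" for b unfolding P_def using construct_basis[OF C(2) that] by simp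
  have "P u = 0" if "u \<in> U" for u
  proof -
    have "u \<in> span B" using B(3) that by blast
    then show ?thesis
      by (induction rule: span_induct_alt) (use C(1) PC in \<open>auto simp: P.add P.scale P.zero\<close>)
  qed
  moreover have "P x - x \<in> U" for x
  proof -
    have "x \<in> span C" using C(3) by simp
    then show ?thesis
    proof (induction rule: span_induct_alt)
      case base
      then show ?case using subspace_0[OF U] by (simp add: P.zero)
    next
      case (step c b y)
      have "P b - b \<in> U" using PC[OF step(1)] B(1) subspace_0[OF U] subspace_neg[OF U] by auto
      then have "scale c (P b - b) + (P y - y) \<in> U" using step(2) U by (intro subspace_add subspace_scale)
      then show ?case by (simp add: P.add P.scale scale_right_diff_distrib algebra_simps)
    qed
  qed
  ultimately show ?thesis using lin by blast
qed

section \<open>The tensor algebra\<close>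

lemma finsum_Cring: "finsum Cring f S = sum f S"
proof -
  interpret C: ring Cring by (rule ring_from_type_algebra)
  show ?thesis
    by (induction S rule: infinite_finite_induct) (simp_all add: C.finsum_insert)
qed

definition sw :: "complex \<Rightarrow> nat list \<Rightarrow> nat list \<Rightarrow> complex" where
  "sw c w = (\<lambda>u. if u = w then c else 0)"

lemma T_simps:
  "carrier (tensor_algebra n) = {x. finite {w. x w \<noteq> 0} \<and> (\<forall>w. x w \<noteq> 0 \<longrightarrow> set w \<subseteq> {..<n})}"
  "x \<otimes>\<^bsub>tensor_algebra n\<^esub> y = (\<lambda>w. \<Sum>k\<le>length w. x (take k w) * y (drop k w))"
  "\<one>\<^bsub>tensor_algebra n\<^esub> = sw 1 []"
  "\<zero>\<^bsub>tensor_algebra n\<^esub> = (\<lambda>w. 0)"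
  "x \<oplus>\<^bsub>tensor_algebra n\<^esub> y = (\<lambda>w. x w + y w)"
  "c \<odot>\<^bsub>tensor_algebra n\<^esub> x = (\<lambda>w. c * x w)"
  by (simp_all add: tensor_algebra_def sw_def)

lemma T_carrierI:
  "\<lbrakk>finite S; \<And>w. x w \<noteq> 0 \<Longrightarrow> w \<in> S; \<And>w. x w \<noteq> 0 \<Longrightarrow> set w \<subseteq> {..<n}\<rbrakk> \<Longrightarrow> x \<in> carrier (tensor_algebra n)"
  unfolding T_simps by (auto intro: finite_subset[of _ S])

lemma T_carrierD:
  assumes "x \<in> carrier (tensor_algebra n)"
  shows "finite {w. x w \<noteq> 0}" "x w \<noteq> 0 \<Longrightarrow> set w \<subseteq> {..<n}"
  using assms unfolding T_simps by auto

lemma sw_closed [simp]: "set w \<subseteq> {..<n} \<Longrightarrow> sw c w \<in> carrier (tensor_algebra n)"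
  by (rule T_carrierI[of "{w}"]) (auto simp: sw_def split: if_splits)

lemma T_zero_closed [simp]: "(\<lambda>w. 0) \<in> carrier (tensor_algebra n)" by (simp add: T_simps)

lemma T_add_closed: "\<lbrakk>x \<in> carrier (tensor_algebra n); y \<in> carrier (tensor_algebra n)\<rbrakk> \<Longrightarrow> (\<lambda>w. x w + y w) \<in> carrier (tensor_algebra n)"
  by (rule T_carrierI[of "{w. x w \<noteq> 0} \<union> {w. y w \<noteq> 0}"]) (auto dest: T_carrierD, metis T_carrierD(2) add_0 lessThan_iff subsetD)

lemma T_smult_closed: "x \<in> carrier (tensor_algebra n) \<Longrightarrow> (\<lambda>w. c * x w) \<in> carrier (tensor_algebra n)"
  by (rule T_carrierI[of "{w. x w \<noteq> 0}"]) (auto dest: T_carrierD)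

lemma T_mult_closed:
  assumes x: "x \<in> carrier (tensor_algebra n)" and y: "y \<in> carrier (tensor_algebra n)"
  shows "x \<otimes>\<^bsub>tensor_algebra n\<^esub> y \<in> carrier (tensor_algebra n)"
proof -
  have split: "\<exists>u w. v = u @ w \<and> x u \<noteq> 0 \<and> y w \<noteq> 0" if "(x \<otimes>\<^bsub>tensor_algebra n\<^esub> y) v \<noteq> 0" for v
  proof -
    obtain k where "x (take k v) * y (drop k v) \<noteq> 0"
      using \<open>(x \<otimes>\<^bsub>tensor_algebra n\<^esub> y) v \<noteq> 0\<close> unfolding T_simps by (meson sum.neutral)
    then show ?thesis by (intro exI[of _ "take k v"] exI[of _ "drop k v"]) auto
  qed
  show ?thesis
  proof (rule T_carrierI[of "(\<lambda>(u, w). u @ w) ` ({w. x w \<noteq> 0} \<times> {w. y w \<noteq> 0})"])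
    show "finite ((\<lambda>(u, w). u @ w) ` ({w. x w \<noteq> 0} \<times> {w. y w \<noteq> 0}))"
      using T_carrierD(1)[OF x] T_carrierD(1)[OF y] by simp
    fix v assume v: "(x \<otimes>\<^bsub>tensor_algebra n\<^esub> y) v \<noteq> 0"
    then obtain u w where uw: "v = u @ w" "x u \<noteq> 0" "y w \<noteq> 0" using split by blast
    then show "v \<in> (\<lambda>(u, w). u @ w) ` ({w. x w \<noteq> 0} \<times> {w. y w \<noteq> 0})" by auto
    show "set v \<subseteq> {..<n}" using T_carrierD(2)[OF x uw(2)] T_carrierD(2)[OF y uw(3)] uw(1) by simp
  qed
qed

lemma T_induct [consumes 1, case_names zero word add]:
  assumes x: "x \<in> carrier (tensor_algebra n)" and zero: "P (\<lambda>w. 0)"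
    and word: "\<And>c w. set w \<subseteq> {..<n} \<Longrightarrow> P (sw c w)"
    and add: "\<And>x y. \<lbrakk>x \<in> carrier (tensor_algebra n); y \<in> carrier (tensor_algebra n); P x; P y\<rbrakk> \<Longrightarrow> P (\<lambda>w. x w + y w)"
  shows "P x"
proof -
  have "P (\<lambda>w. if w \<in> F then x w else 0)" if "finite F" "F \<subseteq> {w. x w \<noteq> 0}" for F
    using that
  proof (induction F)
    case empty
    then show ?case using zero by simp
  next
    case (insert w F)
    have w: "set w \<subseteq> {..<n}" using T_carrierD(2)[OF x] insert.prems by auto
    have "(\<lambda>u. if u \<in> F then x u else 0) \<in> carrier (tensor_algebra n)"
      using insert.hyps T_carrierD(2)[OF x] by (intro T_carrierI[of F]) (auto split: if_splits)
    then have "P (\<lambda>u. (if u \<in> F then x u else 0) + sw (x w) w u)"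
      using w insert by (intro add word) auto
    also have "(\<lambda>u. (if u \<in> F then x u else 0) + sw (x w) w u) = (\<lambda>u. if u \<in> insert w F then x u else 0)"
      using insert.hyps by (auto simp: sw_def fun_eq_iff)
    finally show ?case .
  qed
  from this[OF T_carrierD(1)[OF x]] have "P (\<lambda>w. if x w \<noteq> 0 then x w else 0)" by simp
  moreover have "(\<lambda>w. if x w \<noteq> 0 then x w else 0) = x" by auto
  ultimately show ?thesis by metis
qed

lemma sw_mult: "sw c u \<otimes>\<^bsub>tensor_algebra n\<^esub> sw d w = sw (c * d) (u @ w)"
proof
  fix v
  have "sw c u (take k v) * sw d w (drop k v) = (if k = length u then sw (c * d) (u @ w) v else 0)" if "k \<le> length v" for k
  proof (cases "take k v = u \<and> drop k v = w")
    case True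
    then have "v = u @ w" "length u = k" using append_take_drop_id[of k v] length_take[of k v] that by (metis, metis min.absorb2)
    then show ?thesis by (simp add: sw_def)
  next
    case False
    then have "\<not> (k = length u \<and> v = u @ w)" by auto
    with False show ?thesis by (auto simp: sw_def)
  qed
  then have "(sw c u \<otimes>\<^bsub>tensor_algebra n\<^esub> sw d w) v = (\<Sum>k\<le>length v. if k = length u then sw (c * d) (u @ w) v else 0)"
    unfolding T_simps by (intro sum.cong) auto
  also have "\<dots> = sw (c * d) (u @ w) v" by (auto simp: sw_def)
  finally show "(sw c u \<otimes>\<^bsub>tensor_algebra n\<^esub> sw d w) v = sw (c * d) (u @ w) v" .
qed

lemma T_distr:
  "(\<lambda>w. x w + y w) \<otimes>\<^bsub>tensor_algebra n\<^esub> z = (\<lambda>w. (x \<otimes>\<^bsub>tensor_algebra n\<^esub> z) w + (y \<otimes>\<^bsub>tensor_algebra n\<^esub> z) w)"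
  "z \<otimes>\<^bsub>tensor_algebra n\<^esub> (\<lambda>w. x w + y w) = (\<lambda>w. (z \<otimes>\<^bsub>tensor_algebra n\<^esub> x) w + (z \<otimes>\<^bsub>tensor_algebra n\<^esub> y) w)"
  "(\<lambda>w. 0) \<otimes>\<^bsub>tensor_algebra n\<^esub> z = (\<lambda>w. 0)" "z \<otimes>\<^bsub>tensor_algebra n\<^esub> (\<lambda>w. 0) = (\<lambda>w. 0)"
  by (simp_all add: T_simps algebra_simps sum.distrib)

lemma T_assoc:
  assumes x: "x \<in> carrier (tensor_algebra n)" and y: "y \<in> carrier (tensor_algebra n)" and z: "z \<in> carrier (tensor_algebra n)"
  shows "(x \<otimes>\<^bsub>tensor_algebra n\<^esub> y) \<otimes>\<^bsub>tensor_algebra n\<^esub> z = x \<otimes>\<^bsub>tensor_algebra n\<^esub> (y \<otimes>\<^bsub>tensor_algebra n\<^esub> z)"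
proof -
  have 1: "(sw c u \<otimes>\<^bsub>tensor_algebra n\<^esub> sw d w) \<otimes>\<^bsub>tensor_algebra n\<^esub> z = sw c u \<otimes>\<^bsub>tensor_algebra n\<^esub> (sw d w \<otimes>\<^bsub>tensor_algebra n\<^esub> z)" for c u d w
    using z by (induction z rule: T_induct) (simp_all add: T_distr sw_mult mult.assoc)
  have 2: "(sw c u \<otimes>\<^bsub>tensor_algebra n\<^esub> y) \<otimes>\<^bsub>tensor_algebra n\<^esub> z = sw c u \<otimes>\<^bsub>tensor_algebra n\<^esub> (y \<otimes>\<^bsub>tensor_algebra n\<^esub> z)" for c u
    using y by (induction y rule: T_induct) (simp_all add: T_distr 1)
  show ?thesis using x by (induction x rule: T_induct) (simp_all add: T_distr 2)
qed

lemma T_one: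
  assumes "x \<in> carrier (tensor_algebra n)"
  shows "sw 1 [] \<otimes>\<^bsub>tensor_algebra n\<^esub> x = x" "x \<otimes>\<^bsub>tensor_algebra n\<^esub> sw 1 [] = x"
proof -
  show "sw 1 [] \<otimes>\<^bsub>tensor_algebra n\<^esub> x = x"
    using assms by (induction x rule: T_induct) (simp_all add: T_distr sw_mult)
  show "x \<otimes>\<^bsub>tensor_algebra n\<^esub> sw 1 [] = x"
    using assms by (induction x rule: T_induct) (simp_all add: T_distr sw_mult)
qed

lemma Cring_cring: "cring Cring" by (rule cring_from_type_algebra)

lemma T_assoc_alg: "assoc_alg Cring (tensor_algebra n)"
proof -
  have ab: "abelian_group (tensor_algebra n)"
  proof (rule abelian_groupI)
    fix x assume "x \<in> carrier (tensor_algebra n)"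
    then show "\<exists>y\<in>carrier (tensor_algebra n). y \<oplus>\<^bsub>tensor_algebra n\<^esub> x = \<zero>\<^bsub>tensor_algebra n\<^esub>"
      using T_smult_closed[of x n "-1"] by (intro bexI[of _ "\<lambda>w. - 1 * x w"]) (simp_all add: T_simps(4,5))
  qed (simp_all add: T_simps(4,5) T_add_closed algebra_simps)
  have mo: "Group.monoid (tensor_algebra n)"
    by (rule monoidI) (simp_all add: T_mult_closed T_assoc T_simps(3) T_one)
  have ri: "ring (tensor_algebra n)"
    by (rule ringI[OF ab mo]) (simp_all add: T_simps(5) T_distr)
  have "module Cring (tensor_algebra n)"
    by (rule moduleI[OF Cring_cring ab]) (simp_all add: T_simps(5,6) T_smult_closed algebra_simps)
  then show ?thesis
    by (rule assoc_alg.intro[OF _ ri], unfold_locales) (simp_all add: T_simps(2,6) sum_distrib_left algebra_simps)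
qed

abbreviation tcmp :: "int \<Rightarrow> (nat list \<Rightarrow> complex) \<Rightarrow> nat list \<Rightarrow> complex" where
  "tcmp d x \<equiv> (\<lambda>w. if int (length w) = d then x w else 0)"

lemma tcmp_closed: "x \<in> carrier (tensor_algebra n) \<Longrightarrow> tcmp d x \<in> carrier (tensor_algebra n)"
  by (rule T_carrierI[of "{w. x w \<noteq> 0}"]) (auto dest: T_carrierD split: if_splits)

lemma T_graded: "graded_alg Cring (tensor_algebra n) tcmp"
proof -
  interpret T: assoc_alg Cring "tensor_algebra n" by (rule T_assoc_alg)
  interpret C: ring Cring by (rule ring_from_type_algebra)
  show ?thesis
  proof unfold_locales
    fix x d assume x: "x \<in> carrier (tensor_algebra n)"
    then show "tcmp d x \<in> carrier (tensor_algebra n)" by (rule tcmp_closed)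
    show "tcmp d (tcmp e x) = (if d = e then tcmp d x else \<zero>\<^bsub>tensor_algebra n\<^esub>)" for e
      by (auto simp: T_simps)
    show "d < 0 \<Longrightarrow> tcmp d x = \<zero>\<^bsub>tensor_algebra n\<^esub>" by (auto simp: T_simps)
    show "tcmp d (c \<odot>\<^bsub>tensor_algebra n\<^esub> x) = c \<odot>\<^bsub>tensor_algebra n\<^esub> tcmp d x" for c by (auto simp: T_simps)
    show "(\<And>d. tcmp d x = \<zero>\<^bsub>tensor_algebra n\<^esub>) \<Longrightarrow> x = \<zero>\<^bsub>tensor_algebra n\<^esub>"
      unfolding T_simps fun_eq_iff by metis
    let ?N = "Max (insert 0 ((\<lambda>w. int (length w)) ` {w. x w \<noteq> 0}))"
    have "int (length w) \<le> ?N" if "x w \<noteq> 0" for w using that T_carrierD(1)[OF x] by (intro Max_ge) auto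
    then have "tcmp d x = \<zero>\<^bsub>tensor_algebra n\<^esub>" if "d > ?N" for d using that by (force simp: T_simps)
    then show "\<exists>N. \<forall>d>N. tcmp d x = \<zero>\<^bsub>tensor_algebra n\<^esub>" by blast
  next
    fix x y d assume x: "x \<in> carrier (tensor_algebra n)" and y: "y \<in> carrier (tensor_algebra n)"
    show "tcmp d (x \<oplus>\<^bsub>tensor_algebra n\<^esub> y) = tcmp d x \<oplus>\<^bsub>tensor_algebra n\<^esub> tcmp d y" by (auto simp: T_simps)
    show "tcmp d (x \<otimes>\<^bsub>tensor_algebra n\<^esub> y) = (\<Oplus>\<^bsub>tensor_algebra n\<^esub>i\<in>{0..d}. tcmp i x \<otimes>\<^bsub>tensor_algebra n\<^esub> tcmp (d - i) y)"
    proof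
      fix w
      have "(\<Oplus>\<^bsub>tensor_algebra n\<^esub>i\<in>{0..d}. tcmp i x \<otimes>\<^bsub>tensor_algebra n\<^esub> tcmp (d - i) y) w
        = (\<Oplus>\<^bsub>Cring\<^esub>i\<in>{0..d}. (tcmp i x \<otimes>\<^bsub>tensor_algebra n\<^esub> tcmp (d - i) y) w)"
        using x y by (intro additive_map_finsum[where \<phi> = "\<lambda>x. x w"])
          (auto simp: T.is_abelian_group ring.is_abelian_group[OF ring_from_type_algebra] T_simps(5) intro!: T_mult_closed tcmp_closed)
      also have "\<dots> = (\<Sum>i\<in>{0..d}. \<Sum>k\<le>length w. tcmp i x (take k w) * tcmp (d - i) y (drop k w))"
        by (simp add: finsum_Cring T_simps)
      also have "\<dots> = (\<Sum>k\<le>length w. \<Sum>i\<in>{0..d}. tcmp i x (take k w) * tcmp (d - i) y (drop k w))"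
        by (rule sum.swap)
      also have "\<dots> = (\<Sum>k\<le>length w. if int (length w) = d then x (take k w) * y (drop k w) else 0)"
      proof (rule sum.cong[OF refl])
        fix k assume k: "k \<in> {..length w}"
        have "int (length (take k w)) = int k" "int (length (drop k w)) = int (length w) - int k" using k by auto
        then have "tcmp i x (take k w) * tcmp (d - i) y (drop k w) =
            (if i = int k then (if int (length w) = d then x (take k w) * y (drop k w) else 0) else 0)" for i
          by simp
        then have "(\<Sum>i\<in>{0..d}. tcmp i x (take k w) * tcmp (d - i) y (drop k w)) =
            (\<Sum>i\<in>{0..d}. if i = int k then (if int (length w) = d then x (take k w) * y (drop k w) else 0) else 0)"
          by (intro sum.cong) auto
        also have "\<dots> = (if int (length w) = d then x (take k w) * y (drop k w) else 0)"
          using k by (subst sum.delta) auto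
        finally show "(\<Sum>i\<in>{0..d}. tcmp i x (take k w) * tcmp (d - i) y (drop k w)) =
            (if int (length w) = d then x (take k w) * y (drop k w) else 0)" .
      qed
      finally show "tcmp d (x \<otimes>\<^bsub>tensor_algebra n\<^esub> y) w = (\<Oplus>\<^bsub>tensor_algebra n\<^esub>i\<in>{0..d}. tcmp i x \<otimes>\<^bsub>tensor_algebra n\<^esub> tcmp (d - i) y) w"
        by (simp add: T_simps)
    qed
  next
    show "tcmp 0 \<one>\<^bsub>tensor_algebra n\<^esub> = \<one>\<^bsub>tensor_algebra n\<^esub>" by (auto simp: T_simps sw_def)
  qed
qed

lemma tensor_degree_eq: "tensor_degree n d = graded_alg.homog (tensor_algebra n) tcmp d"
  unfolding tensor_degree_def graded_alg.homog_def[OF T_graded] by (auto simp: fun_eq_iff)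

lemma tensor_filtration_eq: "tensor_filtration n d = graded_alg.below (tensor_algebra n) tcmp d"
proof -
  have "(\<forall>w. x w \<noteq> 0 \<longrightarrow> int (length w) \<le> d) \<longleftrightarrow> (\<forall>e>d. tcmp e x = \<zero>\<^bsub>tensor_algebra n\<^esub>)" for x
  proof (intro iffI allI impI)
    fix w assume a: "\<forall>e>d. tcmp e x = \<zero>\<^bsub>tensor_algebra n\<^esub>" and w: "x w \<noteq> 0"
    have "tcmp (int (length w)) x w \<noteq> 0" using w by simp
    then have "tcmp (int (length w)) x \<noteq> \<zero>\<^bsub>tensor_algebra n\<^esub>" by (simp add: T_simps fun_eq_iff) (metis w)
    then show "int (length w) \<le> d" using a not_le by blast
  next
    fix e assume "\<forall>w. x w \<noteq> 0 \<longrightarrow> int (length w) \<le> d" "e > d"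
    then show "tcmp e x = \<zero>\<^bsub>tensor_algebra n\<^esub>" by (simp add: T_simps fun_eq_iff) force
  qed
  then show ?thesis unfolding tensor_filtration_def graded_alg.below_def[OF T_graded] by auto
qed

lemma gen_eq_sw: "gen i = sw 1 [i]" by (simp add: gen_def sw_def)

text \<open>Every element is a linear combination of products of generators.\<close>

lemma T_hom_unique:
  assumes "ring D" and \<phi>: "\<phi> \<in> alg_hom Cring (tensor_algebra n) D" and \<psi>: "\<psi> \<in> alg_hom Cring (tensor_algebra n) D"
    and gen: "\<And>i. i < n \<Longrightarrow> \<phi> (gen i) = \<psi> (gen i)" and x: "x \<in> carrier (tensor_algebra n)"
  shows "\<phi> x = \<psi> x"
proof -
  interpret T: assoc_alg Cring "tensor_algebra n" by (rule T_assoc_alg)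
  interpret D: ring D by fact
  note \<phi>D = alg_homD[OF \<phi>] and \<psi>D = alg_homD[OF \<psi>]
  have word1: "\<phi> (sw 1 w) = \<psi> (sw 1 w)" if "set w \<subseteq> {..<n}" for w
    using that
  proof (induction w)
    case Nil
    then show ?case using \<phi>D(5) \<psi>D(5) by (simp add: T_simps(3))
  next
    case (Cons i w)
    have "sw 1 (i # w) = gen i \<otimes>\<^bsub>tensor_algebra n\<^esub> sw 1 w" by (simp add: gen_eq_sw sw_mult)
    then show ?case using Cons \<phi>D(3)[of "gen i" "sw 1 w"] \<psi>D(3)[of "gen i" "sw 1 w"] gen[of i]
      by (simp add: gen_eq_sw)
  qed
  show ?thesis
    using x
  proof (induction x rule: T_induct)
    case zero
    then show ?case
      using additive_map_zero[OF T.is_abelian_group D.is_abelian_group, of \<phi>] additive_map_zero[OF T.is_abelian_group D.is_abelian_group, of \<psi>]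
        \<phi>D \<psi>D by (simp add: T_simps(4))
  next
    case (word c w)
    have "sw c w = c \<odot>\<^bsub>tensor_algebra n\<^esub> sw 1 w" by (auto simp: T_simps sw_def)
    then show ?case using word word1[OF word] \<phi>D(6)[of c "sw 1 w"] \<psi>D(6)[of c "sw 1 w"] by simp
  next
    case (add x y)
    then show ?case using \<phi>D(4)[OF add(1,2)] \<psi>D(4)[OF add(1,2)] by (simp add: T_simps(5))
  qed
qed

text \<open>The universal property of the tensor algebra: any values for the generators extend to a homomorphism \<open>tens\<close>.\<close>

locale tensor_extension = D: assoc_alg Cring D for D :: "(complex, 'd) module" +
  fixes n :: nat and V :: "nat \<Rightarrow> 'd"
  assumes V_closed [simp]: "i < n \<Longrightarrow> V i \<in> carrier D"
begin

definition wprod :: "nat list \<Rightarrow> 'd" where "wprod w = foldr (\<lambda>i a. V i \<otimes>\<^bsub>D\<^esub> a) w \<one>\<^bsub>D\<^esub>"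
definition tens :: "(nat list \<Rightarrow> complex) \<Rightarrow> 'd" where
  "tens x = (\<Oplus>\<^bsub>D\<^esub>w\<in>{w. x w \<noteq> 0}. x w \<odot>\<^bsub>D\<^esub> wprod w)"

lemma wprod_closed [simp]: "set w \<subseteq> {..<n} \<Longrightarrow> wprod w \<in> carrier D"
  by (induction w) (auto simp: wprod_def)

lemma wprod_append: "\<lbrakk>set u \<subseteq> {..<n}; set w \<subseteq> {..<n}\<rbrakk> \<Longrightarrow> wprod (u @ w) = wprod u \<otimes>\<^bsub>D\<^esub> wprod w"
proof (induction u)
  case Nil
  then show ?case using wprod_closed[of w] by (simp add: wprod_def)
next
  case (Cons i u)
  then show ?case using wprod_closed[of w] wprod_closed[of u] by (simp add: wprod_def D.m_assoc)
qed

lemma tens_eq: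
  assumes "x \<in> carrier (tensor_algebra n)" "finite S" "{w. x w \<noteq> 0} \<subseteq> S" "\<And>w. w \<in> S \<Longrightarrow> set w \<subseteq> {..<n}"
  shows "tens x = (\<Oplus>\<^bsub>D\<^esub>w\<in>S. x w \<odot>\<^bsub>D\<^esub> wprod w)"
  unfolding tens_def using assms D.smult_l_null
  by (intro D.M.add.finprod_mono_neutral_cong_left) auto

lemma tens_closed: "x \<in> carrier (tensor_algebra n) \<Longrightarrow> tens x \<in> carrier D"
  unfolding tens_def by (intro D.M.finsum_closed) (auto dest: T_carrierD)

lemma tens_word: "set w \<subseteq> {..<n} \<Longrightarrow> tens (sw c w) = c \<odot>\<^bsub>D\<^esub> wprod w"
  by (subst tens_eq[of _ "{w}"], rule sw_closed) (auto simp: sw_def split: if_splits)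

lemma tens_zero: "tens (\<lambda>w. 0) = \<zero>\<^bsub>D\<^esub>" by (simp add: tens_def)

lemma tens_add:
  assumes x: "x \<in> carrier (tensor_algebra n)" and y: "y \<in> carrier (tensor_algebra n)"
  shows "tens (\<lambda>w. x w + y w) = tens x \<oplus>\<^bsub>D\<^esub> tens y"
proof -
  let ?S = "{w. x w \<noteq> 0} \<union> {w. y w \<noteq> 0}"
  have fin: "finite ?S" using T_carrierD(1)[OF x] T_carrierD(1)[OF y] by simp
  have S: "set w \<subseteq> {..<n}" if "w \<in> ?S" for w using that T_carrierD(2)[OF x] T_carrierD(2)[OF y] by auto
  have "tens (\<lambda>w. x w + y w) = (\<Oplus>\<^bsub>D\<^esub>w\<in>?S. (x w + y w) \<odot>\<^bsub>D\<^esub> wprod w)"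
    by (rule tens_eq[OF T_add_closed[OF x y] fin _ S]) auto
  also have "\<dots> = (\<Oplus>\<^bsub>D\<^esub>w\<in>?S. x w \<odot>\<^bsub>D\<^esub> wprod w \<oplus>\<^bsub>D\<^esub> y w \<odot>\<^bsub>D\<^esub> wprod w)"
    using S D.smult_l_distr by (intro D.M.finsum_cong') (auto simp: Pi_iff)
  also have "\<dots> = (\<Oplus>\<^bsub>D\<^esub>w\<in>?S. x w \<odot>\<^bsub>D\<^esub> wprod w) \<oplus>\<^bsub>D\<^esub> (\<Oplus>\<^bsub>D\<^esub>w\<in>?S. y w \<odot>\<^bsub>D\<^esub> wprod w)"
    using S by (intro D.M.finsum_addf) (auto simp: Pi_iff)
  also have "\<dots> = tens x \<oplus>\<^bsub>D\<^esub> tens y"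
    using tens_eq[OF x fin _ S] tens_eq[OF y fin _ S] by simp
  finally show ?thesis .
qed

lemma tens_hom: "tens \<in> alg_hom Cring (tensor_algebra n) D"
proof -
  have cc: "c \<odot>\<^bsub>D\<^esub> (d \<odot>\<^bsub>D\<^esub> a) = (c * d) \<odot>\<^bsub>D\<^esub> a" if "a \<in> carrier D" for c d a
    using that D.smult_assoc1[of c d a] by simp
  have 1: "tens (sw c u \<otimes>\<^bsub>tensor_algebra n\<^esub> y) = tens (sw c u) \<otimes>\<^bsub>D\<^esub> tens y"
    if u: "set u \<subseteq> {..<n}" and y: "y \<in> carrier (tensor_algebra n)" for c u y
    using y
  proof (induction y rule: T_induct)
    case (word d w)
    then show ?case using u by (simp add: sw_mult tens_word wprod_append D.smult_mult_left D.smult_mult_right cc mult.commute)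
  next
    case (add y z)
    then show ?case using u by (simp add: T_distr tens_add T_mult_closed tens_closed D.r_distr)
  qed (simp add: T_distr tens_zero tens_closed u)
  have 2: "tens (x \<otimes>\<^bsub>tensor_algebra n\<^esub> y) = tens x \<otimes>\<^bsub>D\<^esub> tens y"
    if x: "x \<in> carrier (tensor_algebra n)" and y: "y \<in> carrier (tensor_algebra n)" for x y
    using x
  proof (induction x rule: T_induct)
    case (add x z)
    then show ?case using y by (simp add: T_distr tens_add T_mult_closed tens_closed D.l_distr)
  qed (simp_all add: T_distr tens_zero tens_closed y 1)
  have 3: "tens (\<lambda>w. c * x w) = c \<odot>\<^bsub>D\<^esub> tens x" if "x \<in> carrier (tensor_algebra n)" for c x
    using that
  proof (induction x rule: T_induct)
    case zero
    then show ?case by (simp add: tens_zero)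
  next
    case (word d w)
    have "(\<lambda>v. c * sw d w v) = sw (c * d) w" by (auto simp: sw_def)
    then show ?case using word by (simp add: tens_word cc)
  next
    case (add x y)
    then show ?case
      using tens_add[OF T_smult_closed[OF add(1)] T_smult_closed[OF add(2)]]
      by (simp add: tens_add tens_closed D.smult_r_distr algebra_simps)
  qed
  have 4: "tens (sw 1 []) = \<one>\<^bsub>D\<^esub>" using tens_word[of "[]" 1] D.smult_one[of "\<one>\<^bsub>D\<^esub>"] by (simp add: wprod_def)
  show ?thesis
    by (rule alg_homI) (simp_all add: tens_closed 2 tens_add T_simps(3,5,6) 3 4)
qed

lemma tens_gen: "i < n \<Longrightarrow> tens (gen i) = V i"
  using tens_word[of "[i]" 1] D.smult_one[of "V i"] by (simp add: gen_eq_sw wprod_def)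

end

section \<open>Surjective endomorphisms of finite-dimensional spaces\<close>

text \<open>In a spanning family of minimal size no proper subfamily spans, and the image of such a family under a
  surjection is again one. A nontrivial kernel would make one of its members superfluous.\<close>

lemma surjective_endomorphism_injective:
  fixes R :: "(complex, 'r) module" and M :: "'r set" and I\<^sub>0 :: "'i set" and u\<^sub>0 :: "'i \<Rightarrow> 'r"
  assumes "assoc_alg Cring R" and M: "M \<subseteq> carrier R"
    and fin: "finite I\<^sub>0" and u\<^sub>0: "u\<^sub>0 \<in> I\<^sub>0 \<rightarrow> M"
    and span: "\<And>x. x \<in> M \<Longrightarrow> \<exists>c. x = (\<Oplus>\<^bsub>R\<^esub>i\<in>I\<^sub>0. c i \<odot>\<^bsub>R\<^esub> u\<^sub>0 i)"
    and zero: "\<zero>\<^bsub>R\<^esub> \<in> M"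
    and M_add: "\<And>x y. \<lbrakk>x \<in> M; y \<in> M\<rbrakk> \<Longrightarrow> x \<oplus>\<^bsub>R\<^esub> y \<in> M"
    and M_smult: "\<And>c x. x \<in> M \<Longrightarrow> c \<odot>\<^bsub>R\<^esub> x \<in> M"
    and g: "\<And>r. r \<in> M \<Longrightarrow> g r \<in> M"
    and g_add: "\<And>r s. \<lbrakk>r \<in> M; s \<in> M\<rbrakk> \<Longrightarrow> g (r \<oplus>\<^bsub>R\<^esub> s) = g r \<oplus>\<^bsub>R\<^esub> g s"
    and g_smult: "\<And>c r. r \<in> M \<Longrightarrow> g (c \<odot>\<^bsub>R\<^esub> r) = c \<odot>\<^bsub>R\<^esub> g r"
    and surj: "M \<subseteq> g ` M"
  shows "\<forall>r\<in>M. g r = \<zero>\<^bsub>R\<^esub> \<longrightarrow> r = \<zero>\<^bsub>R\<^esub>"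
proof (intro ballI impI)
  fix r assume r: "r \<in> M" "g r = \<zero>\<^bsub>R\<^esub>"
  interpret R: assoc_alg Cring R by fact
  have l_distr: "(a + b) \<odot>\<^bsub>R\<^esub> x = a \<odot>\<^bsub>R\<^esub> x \<oplus>\<^bsub>R\<^esub> b \<odot>\<^bsub>R\<^esub> x" if "x \<in> carrier R" for a b x
    using R.smult_l_distr[of a b x] that by simp
  have assoc: "(a * b) \<odot>\<^bsub>R\<^esub> x = a \<odot>\<^bsub>R\<^esub> (b \<odot>\<^bsub>R\<^esub> x)" if "x \<in> carrier R" for a b x
    using R.smult_assoc1[of a b x] that by simp
  have smult0: "0 \<odot>\<^bsub>R\<^esub> x = \<zero>\<^bsub>R\<^esub>" if "x \<in> carrier R" for x using R.smult_l_null[OF that] by simp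
  let ?spans = "\<lambda>I u. finite I \<and> u \<in> I \<rightarrow> M \<and> (\<forall>x\<in>M. \<exists>c. x = (\<Oplus>\<^bsub>R\<^esub>i\<in>I. c i \<odot>\<^bsub>R\<^esub> u i))"
  let ?Q = "\<lambda>k. \<exists>(I :: 'i set) u. ?spans I u \<and> card I = k"
  have Q0: "?Q (card I\<^sub>0)" using fin u\<^sub>0 span by blast
  obtain I :: "'i set" and u where I: "?spans I u" and card: "card I = (LEAST k. ?Q k)"
    using LeastI[of ?Q, OF Q0] by blast
  have uc: "u i \<in> carrier R" "u i \<in> M" "g (u i) \<in> carrier R" "g (u i) \<in> M" if "i \<in> I" for i using that I M g by auto
  have g0: "g \<zero>\<^bsub>R\<^esub> = \<zero>\<^bsub>R\<^esub>"
  proof -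
    have "\<zero>\<^bsub>R\<^esub> \<in> carrier R" "g \<zero>\<^bsub>R\<^esub> \<in> carrier R" using zero g[OF zero] M by auto
    then show ?thesis using g_smult[OF zero, of 0] smult0 by simp
  qed
  have g_sum: "g (\<Oplus>\<^bsub>R\<^esub>i\<in>F. c i \<odot>\<^bsub>R\<^esub> u i) = (\<Oplus>\<^bsub>R\<^esub>i\<in>F. c i \<odot>\<^bsub>R\<^esub> g (u i)) \<and> (\<Oplus>\<^bsub>R\<^esub>i\<in>F. c i \<odot>\<^bsub>R\<^esub> u i) \<in> M"
    if "finite F" "F \<subseteq> I" for F c
    using that
  proof (induction F)
    case empty
    then show ?case by (simp add: g0 zero)
  next
    case (insert i F)
    have "(\<Oplus>\<^bsub>R\<^esub>i\<in>insert i F. c i \<odot>\<^bsub>R\<^esub> u i) = c i \<odot>\<^bsub>R\<^esub> u i \<oplus>\<^bsub>R\<^esub> (\<Oplus>\<^bsub>R\<^esub>i\<in>F. c i \<odot>\<^bsub>R\<^esub> u i)"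
      using insert uc by (intro R.M.finsum_insert) auto
    moreover have "(\<Oplus>\<^bsub>R\<^esub>i\<in>insert i F. c i \<odot>\<^bsub>R\<^esub> g (u i)) = c i \<odot>\<^bsub>R\<^esub> g (u i) \<oplus>\<^bsub>R\<^esub> (\<Oplus>\<^bsub>R\<^esub>i\<in>F. c i \<odot>\<^bsub>R\<^esub> g (u i))"
      using insert uc by (intro R.M.finsum_insert) auto
    ultimately show ?case using insert uc by (simp add: g_add g_smult M_smult M_add)
  qed
  obtain c where c: "r = (\<Oplus>\<^bsub>R\<^esub>i\<in>I. c i \<odot>\<^bsub>R\<^esub> u i)" using I r(1) by blast
  have rel: "(\<Oplus>\<^bsub>R\<^esub>i\<in>I. c i \<odot>\<^bsub>R\<^esub> g (u i)) = \<zero>\<^bsub>R\<^esub>" using g_sum[of I c] I r(2) unfolding c by simp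
  have "c j = 0" if j: "j \<in> I" for j
  proof (rule ccontr)
    assume cj: "c j \<noteq> 0"
    have "\<exists>e. y = (\<Oplus>\<^bsub>R\<^esub>i\<in>I - {j}. e i \<odot>\<^bsub>R\<^esub> g (u i))" if y: "y \<in> M" for y
    proof -
      obtain x where x: "x \<in> M" "y = g x" using surj y by blast
      obtain d where "x = (\<Oplus>\<^bsub>R\<^esub>i\<in>I. d i \<odot>\<^bsub>R\<^esub> u i)" using I x(1) by blast
      then have yd: "y = (\<Oplus>\<^bsub>R\<^esub>i\<in>I. d i \<odot>\<^bsub>R\<^esub> g (u i))" using g_sum[of I d] I x(2) by simp
      \<comment> \<open>Subtracting a multiple of the relation \<open>rel\<close> removes the coefficient at \<open>j\<close>.\<close>
      define e where "e i = d i + (- d j / c j) * c i" for i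
      have "(\<Oplus>\<^bsub>R\<^esub>i\<in>I. e i \<odot>\<^bsub>R\<^esub> g (u i)) = (\<Oplus>\<^bsub>R\<^esub>i\<in>I. d i \<odot>\<^bsub>R\<^esub> g (u i) \<oplus>\<^bsub>R\<^esub> (- d j / c j) \<odot>\<^bsub>R\<^esub> (c i \<odot>\<^bsub>R\<^esub> g (u i)))"
        using uc by (intro R.M.finsum_cong' refl) (simp_all only: e_def l_distr assoc Pi_iff, auto)
      also have "\<dots> = (\<Oplus>\<^bsub>R\<^esub>i\<in>I. d i \<odot>\<^bsub>R\<^esub> g (u i)) \<oplus>\<^bsub>R\<^esub> (\<Oplus>\<^bsub>R\<^esub>i\<in>I. (- d j / c j) \<odot>\<^bsub>R\<^esub> (c i \<odot>\<^bsub>R\<^esub> g (u i)))"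
        using uc by (intro R.M.finsum_addf) auto
      also have "(\<Oplus>\<^bsub>R\<^esub>i\<in>I. (- d j / c j) \<odot>\<^bsub>R\<^esub> (c i \<odot>\<^bsub>R\<^esub> g (u i))) = (- d j / c j) \<odot>\<^bsub>R\<^esub> (\<Oplus>\<^bsub>R\<^esub>i\<in>I. c i \<odot>\<^bsub>R\<^esub> g (u i))"
        using uc I by (intro R.finsum_smult_ldistr[symmetric]) auto
      also have "\<dots> = \<zero>\<^bsub>R\<^esub>" by (simp add: rel)
      finally have "y = (\<Oplus>\<^bsub>R\<^esub>i\<in>I. e i \<odot>\<^bsub>R\<^esub> g (u i))" using y M by (auto simp: yd[symmetric])
      also have "\<dots> = (\<Oplus>\<^bsub>R\<^esub>i\<in>I - {j}. e i \<odot>\<^bsub>R\<^esub> g (u i))"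
        using I uc cj j smult0 by (intro R.M.add.finprod_mono_neutral_cong_right) (auto simp: e_def)
      finally show ?thesis by blast
    qed
    then have "?spans (I - {j}) (\<lambda>i. g (u i))" using I uc by auto
    then have "(LEAST k. ?Q k) \<le> card (I - {j})" by (intro Least_le) blast
    moreover have "card (I - {j}) < card I" using I j by (intro psubset_card_mono) auto
    ultimately show False using card by simp
  qed
  then show "r = \<zero>\<^bsub>R\<^esub>" unfolding c using uc smult0 by (intro R.M.add.finprod_one_eqI) auto
qed

section \<open>Graded deformations\<close>

text \<open>A deformation with \<open>deg \<mu>\<^sub>i = - 2i\<close> is a graded algebra once \<open>t\<close> is put in degree two. This grading
  forces products of small degree to be undeformed.\<close>

locale graded_deformation = R: assoc_alg Cring R for R :: "(complex, 'r) module" +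
  fixes Rd :: "int \<Rightarrow> 'r set" and \<mu> and D :: "(nat \<Rightarrow> complex, nat \<Rightarrow> 'r) module"
  assumes deform: "deformation R \<mu> D"
    and \<mu>_degree: "i \<ge> 1 \<Longrightarrow> homogeneous_of_degree Rd (- 2 * int i) (\<mu> i)"
    and Rd_carrier: "r \<in> Rd d \<Longrightarrow> r \<in> carrier R"
    and Rd_zero: "\<zero>\<^bsub>R\<^esub> \<in> Rd d"
    and Rd_add: "\<lbrakk>r \<in> Rd d; s \<in> Rd d\<rbrakk> \<Longrightarrow> r \<oplus>\<^bsub>R\<^esub> s \<in> Rd d"
    and Rd_smult: "r \<in> Rd d \<Longrightarrow> c \<odot>\<^bsub>R\<^esub> r \<in> Rd d"
    and Rd_neg: "\<lbrakk>r \<in> Rd d; d < 0\<rbrakk> \<Longrightarrow> r = \<zero>\<^bsub>R\<^esub>"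
    and Rd_mult: "\<lbrakk>r \<in> Rd a; s \<in> Rd b\<rbrakk> \<Longrightarrow> r \<otimes>\<^bsub>R\<^esub> s \<in> Rd (a + b)"
    and Rd_one: "\<one>\<^bsub>R\<^esub> \<in> Rd 0"
begin

abbreviation "Rt \<equiv> poly_algebra R"

sublocale Rt: assoc_alg "UP Cring" Rt by (rule R.poly_assoc_alg)
sublocale D: assoc_alg "UP Cring" D
  using deform unfolding deformation_def assoc_algebra_iff by blast

lemma Rt_carrier: "carrier Rt = up R" by (simp add: poly_algebra_simps)

lemma D_simps:
  "carrier D = carrier Rt" "\<zero>\<^bsub>D\<^esub> = \<zero>\<^bsub>Rt\<^esub>"
  "\<lbrakk>x \<in> carrier Rt; y \<in> carrier Rt\<rbrakk> \<Longrightarrow> x \<oplus>\<^bsub>D\<^esub> y = x \<oplus>\<^bsub>Rt\<^esub> y"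
  "\<lbrakk>p \<in> carrier (UP Cring); x \<in> carrier Rt\<rbrakk> \<Longrightarrow> p \<odot>\<^bsub>D\<^esub> x = p \<odot>\<^bsub>Rt\<^esub> x"
  using deform unfolding deformation_def by auto

lemma mon_closed [simp]: "r \<in> carrier R \<Longrightarrow> mon R i r \<in> carrier Rt"
  by (simp add: Rt_carrier R.mon_closed)

lemma coeff_closed [simp]: "x \<in> carrier Rt \<Longrightarrow> x i \<in> carrier R"
  by (simp add: Rt_carrier upD)

lemma mult_closed [simp]: "\<lbrakk>x \<in> carrier Rt; y \<in> carrier Rt\<rbrakk> \<Longrightarrow> x \<otimes>\<^bsub>D\<^esub> y \<in> carrier Rt"
  using D.m_closed[of x y] by (simp add: D_simps)

lemma const_mult:
  "\<lbrakk>r \<in> carrier R; s \<in> carrier R\<rbrakk> \<Longrightarrow> mon R 0 r \<otimes>\<^bsub>D\<^esub> mon R 0 s = (\<lambda>i. if i = 0 then r \<otimes>\<^bsub>R\<^esub> s else \<mu> i r s)"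
  using deform unfolding deformation_def by (simp add: monom_eq_mon)

lemma add_coeff: "\<lbrakk>x \<in> carrier Rt; y \<in> carrier Rt\<rbrakk> \<Longrightarrow> (x \<oplus>\<^bsub>D\<^esub> y) i = x i \<oplus>\<^bsub>R\<^esub> y i"
  by (simp add: D_simps Rt_carrier poly_algebra_simps(4))

lemma smult_const_coeff: "x \<in> carrier Rt \<Longrightarrow> (mon Cring 0 c \<odot>\<^bsub>D\<^esub> x) i = c \<odot>\<^bsub>R\<^esub> x i"
  using R.smult_poly_mon[of c x 0] by (simp add: D_simps Rt_carrier)

lemma t_coeff_1: "x \<in> carrier Rt \<Longrightarrow> (tt \<odot>\<^bsub>D\<^esub> x) i = (if i = 0 then \<zero>\<^bsub>R\<^esub> else x (i - 1))"
  using R.smult_poly_mon[of 1 x 1] R.smult_one[of "x (i - 1)"] by (auto simp: D_simps Rt_carrier upD)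

lemmas t_coeff = t_coeff_1 t_coeff_1[unfolded One_nat_def]

lemma t_closed_1: "x \<in> carrier Rt \<Longrightarrow> tt \<odot>\<^bsub>D\<^esub> x \<in> carrier Rt"
  using D.smult_closed[of tt x] by (simp add: D_simps(1))

lemmas t_closed [simp] = t_closed_1 t_closed_1[unfolded One_nat_def]

lemma shift_closed: "x \<in> carrier Rt \<Longrightarrow> (\<lambda>i. x (Suc i)) \<in> carrier Rt"
  unfolding Rt_carrier by (rule up_shift)

lemma uncons: "x \<in> carrier Rt \<Longrightarrow> x = mon R 0 (x 0) \<oplus>\<^bsub>D\<^esub> tt \<odot>\<^bsub>D\<^esub> (\<lambda>i. x (Suc i))"
proof
  fix i assume x: "x \<in> carrier Rt"
  have "(mon R 0 (x 0) \<oplus>\<^bsub>D\<^esub> tt \<odot>\<^bsub>D\<^esub> (\<lambda>i. x (Suc i))) i = mon R 0 (x 0) i \<oplus>\<^bsub>R\<^esub> (tt \<odot>\<^bsub>D\<^esub> (\<lambda>i. x (Suc i))) i"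
    using x shift_closed[OF x] by (intro add_coeff mon_closed t_closed_1) simp_all
  then show "x i = (mon R 0 (x 0) \<oplus>\<^bsub>D\<^esub> tt \<odot>\<^bsub>D\<^esub> (\<lambda>i. x (Suc i))) i"
    using x t_coeff_1[OF shift_closed[OF x], of i] by (cases i) (simp_all add: mon_def)
qed

lemma t_cancel:
  assumes x: "x \<in> carrier Rt" and t: "tt \<odot>\<^bsub>D\<^esub> x = \<zero>\<^bsub>D\<^esub>"
  shows "x = \<zero>\<^bsub>D\<^esub>"
proof
  fix i
  show "x i = \<zero>\<^bsub>D\<^esub> i" using t_coeff[OF x, of "Suc i"] unfolding t by (simp add: D_simps(2) poly_algebra_simps)
qed

lemma lowest_coeff_mult:
  assumes x: "x \<in> carrier Rt" and y: "y \<in> carrier Rt"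
  shows "(x \<otimes>\<^bsub>D\<^esub> y) 0 = x 0 \<otimes>\<^bsub>R\<^esub> y 0"
proof -
  let ?x = "\<lambda>i. x (Suc i)" and ?y = "\<lambda>i. y (Suc i)"
  have c: "mon R 0 (x 0) \<in> carrier Rt" "mon R 0 (y 0) \<in> carrier Rt" "?x \<in> carrier Rt" "?y \<in> carrier Rt"
    using x y shift_closed by auto
  have "x \<otimes>\<^bsub>D\<^esub> y = (mon R 0 (x 0) \<oplus>\<^bsub>D\<^esub> tt \<odot>\<^bsub>D\<^esub> ?x) \<otimes>\<^bsub>D\<^esub> y" by (rule arg_cong[where f = "\<lambda>u. u \<otimes>\<^bsub>D\<^esub> y", OF uncons[OF x]])
  also have "\<dots> = mon R 0 (x 0) \<otimes>\<^bsub>D\<^esub> y \<oplus>\<^bsub>D\<^esub> tt \<odot>\<^bsub>D\<^esub> (?x \<otimes>\<^bsub>D\<^esub> y)"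
    using c y t_closed[OF c(3)] by (simp add: D.l_distr D_simps(1) D.smult_mult_left)
  finally have 1: "(x \<otimes>\<^bsub>D\<^esub> y) 0 = (mon R 0 (x 0) \<otimes>\<^bsub>D\<^esub> y) 0"
    using c y by (simp add: add_coeff t_coeff)
  have "mon R 0 (x 0) \<otimes>\<^bsub>D\<^esub> y = mon R 0 (x 0) \<otimes>\<^bsub>D\<^esub> (mon R 0 (y 0) \<oplus>\<^bsub>D\<^esub> tt \<odot>\<^bsub>D\<^esub> ?y)"
    by (rule arg_cong[where f = "\<lambda>u. mon R 0 (x 0) \<otimes>\<^bsub>D\<^esub> u", OF uncons[OF y]])
  also have "\<dots> = mon R 0 (x 0) \<otimes>\<^bsub>D\<^esub> mon R 0 (y 0) \<oplus>\<^bsub>D\<^esub> tt \<odot>\<^bsub>D\<^esub> (mon R 0 (x 0) \<otimes>\<^bsub>D\<^esub> ?y)"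
    using c t_closed[OF c(4)] by (simp add: D.r_distr D_simps(1) D.smult_mult_right)
  finally have "(mon R 0 (x 0) \<otimes>\<^bsub>D\<^esub> y) 0 = (mon R 0 (x 0) \<otimes>\<^bsub>D\<^esub> mon R 0 (y 0)) 0"
    using c by (simp add: add_coeff t_coeff)
  then show ?thesis using 1 x y by (simp add: const_mult)
qed

text \<open>The grading of \<open>D\<close> with \<open>t\<close> in degree two.\<close>

definition "Dd m = {x \<in> carrier Rt. \<forall>i. x i \<in> Rd (m - 2 * int i)}"

lemma Dd_carrier: "x \<in> Dd m \<Longrightarrow> x \<in> carrier Rt" by (simp add: Dd_def)
lemma Dd_zero: "\<zero>\<^bsub>D\<^esub> \<in> Dd m" by (simp add: Dd_def D_simps(2) Rd_zero poly_algebra_simps) (simp add: up_iff)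
lemma Dd_add: "\<lbrakk>x \<in> Dd m; y \<in> Dd m\<rbrakk> \<Longrightarrow> x \<oplus>\<^bsub>D\<^esub> y \<in> Dd m"
  using D.M.a_closed[of x y] by (simp add: Dd_def add_coeff Rd_add D_simps(1))
lemma Dd_smult: "x \<in> Dd m \<Longrightarrow> mon Cring 0 c \<odot>\<^bsub>D\<^esub> x \<in> Dd m"
  using D.smult_closed[of "mon Cring 0 c" x] by (simp add: Dd_def smult_const_coeff Rd_smult D_simps(1))
lemma Dd_const: "r \<in> Rd m \<Longrightarrow> mon R 0 r \<in> Dd m"
  by (auto simp: Dd_def Rd_carrier) (simp add: mon_def Rd_zero)
lemma Dd_t: "x \<in> Dd (m - 2) \<Longrightarrow> tt \<odot>\<^bsub>D\<^esub> x \<in> Dd m"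
proof -
  assume x: "x \<in> Dd (m - 2)"
  have "(tt \<odot>\<^bsub>D\<^esub> x) i \<in> Rd (m - 2 * int i)" for i
  proof (cases i)
    case 0
    then show ?thesis by (simp add: t_coeff[OF Dd_carrier[OF x]] Rd_zero)
  next
    case (Suc j)
    have "x j \<in> Rd (m - 2 - 2 * int j)" using x unfolding Dd_def by blast
    then show ?thesis by (simp add: Suc t_coeff[OF Dd_carrier[OF x]] diff_diff_eq)
  qed
  then show ?thesis using Dd_carrier[OF x] by (simp add: Dd_def)
qed

lemma Dd_neg: "\<lbrakk>x \<in> Dd m; m < 0\<rbrakk> \<Longrightarrow> x = \<zero>\<^bsub>D\<^esub>"
  using Rd_neg[of "x i" "m - 2 * int i" for i] by (auto simp: Dd_def D_simps(2) poly_algebra_simps fun_eq_iff)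

lemma Dd_shift: "x \<in> Dd m \<Longrightarrow> (\<lambda>i. x (Suc i)) \<in> Dd (m - 2)"
proof -
  assume x: "x \<in> Dd m"
  have "x (Suc i) \<in> Rd (m - 2 - 2 * int i)" for i
  proof -
    have "x (Suc i) \<in> Rd (m - 2 * int (Suc i))" using x unfolding Dd_def by blast
    then show ?thesis by (simp add: diff_diff_eq)
  qed
  then show ?thesis using shift_closed[OF Dd_carrier[OF x]] by (simp add: Dd_def)
qed

lemma const_mult_Dd: "\<lbrakk>r \<in> Rd a; s \<in> Rd b\<rbrakk> \<Longrightarrow> mon R 0 r \<otimes>\<^bsub>D\<^esub> mon R 0 s \<in> Dd (a + b)"
proof -
  assume r: "r \<in> Rd a" and s: "s \<in> Rd b"
  have "\<mu> i r s \<in> Rd (a + b - 2 * int i)" if "i \<noteq> 0" for i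
  proof -
    have "homogeneous_of_degree Rd (- 2 * int i) (\<mu> i)" using that by (intro \<mu>_degree) simp
    then have "\<mu> i r s \<in> Rd (a + b + (- 2 * int i))" using r s unfolding homogeneous_of_degree_def by blast
    then show ?thesis by simp
  qed
  then show ?thesis
    using r s Rd_mult[OF r s] mult_closed[of "mon R 0 r" "mon R 0 s"] by (auto simp: Dd_def const_mult Rd_carrier)
qed

lemma Dd_mult:
  assumes "x \<in> Dd a" "y \<in> Dd b"
  shows "x \<otimes>\<^bsub>D\<^esub> y \<in> Dd (a + b)"
proof -
  have const: "mon R 0 r \<otimes>\<^bsub>D\<^esub> y \<in> Dd (a + b)" if r: "r \<in> Rd a" and "y \<in> Dd b" for r a b y
    using that(2)
  proof (induction "nat (b + 2)" arbitrary: b y rule: less_induct)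
    case less
    have rc: "mon R 0 r \<in> carrier D" using r by (simp add: Rd_carrier D_simps(1))
    show ?case
    proof (cases "b < 0")
      case True
      then show ?thesis using Dd_neg[OF less.prems] rc Dd_zero by simp
    next
      case False
      let ?y = "\<lambda>i. y (Suc i)"
      have y0: "y 0 \<in> Rd b" using less.prems by (auto simp: Dd_def dest: spec[of _ 0])
      have yS: "?y \<in> Dd (b - 2)" by (rule Dd_shift[OF less.prems])
      have c: "mon R 0 (y 0) \<in> carrier D" "?y \<in> carrier D" using y0 Dd_carrier[OF yS] by (simp_all add: Rd_carrier D_simps(1))
      have "mon R 0 r \<otimes>\<^bsub>D\<^esub> ?y \<in> Dd (a + (b - 2))" using False by (intro less.hyps yS) simp
      then have "tt \<odot>\<^bsub>D\<^esub> (mon R 0 r \<otimes>\<^bsub>D\<^esub> ?y) \<in> Dd (a + b)" by (intro Dd_t) (simp add: algebra_simps)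
      moreover have "mon R 0 r \<otimes>\<^bsub>D\<^esub> (mon R 0 (y 0) \<oplus>\<^bsub>D\<^esub> tt \<odot>\<^bsub>D\<^esub> ?y)
          = mon R 0 r \<otimes>\<^bsub>D\<^esub> mon R 0 (y 0) \<oplus>\<^bsub>D\<^esub> tt \<odot>\<^bsub>D\<^esub> (mon R 0 r \<otimes>\<^bsub>D\<^esub> ?y)"
        using rc c by (simp add: D.r_distr D.smult_mult_right)
      ultimately show ?thesis
        using uncons[OF Dd_carrier[OF less.prems]] Dd_add[OF const_mult_Dd[OF r y0]] by metis
    qed
  qed
  show ?thesis
    using assms(1)
  proof (induction "nat (a + 2)" arbitrary: a x rule: less_induct)
    case less
    have yc: "y \<in> carrier D" using Dd_carrier[OF assms(2)] by (simp add: D_simps(1))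
    show ?case
    proof (cases "a < 0")
      case True
      then show ?thesis using Dd_neg[OF less.prems] yc Dd_zero by simp
    next
      case False
      let ?x = "\<lambda>i. x (Suc i)"
      have x0: "x 0 \<in> Rd a" using less.prems by (auto simp: Dd_def dest: spec[of _ 0])
      have xS: "?x \<in> Dd (a - 2)" by (rule Dd_shift[OF less.prems])
      have c: "mon R 0 (x 0) \<in> carrier D" "?x \<in> carrier D" using x0 Dd_carrier[OF xS] by (simp_all add: Rd_carrier D_simps(1))
      have "?x \<otimes>\<^bsub>D\<^esub> y \<in> Dd (a - 2 + b)" using False by (intro less.hyps xS) simp
      then have "tt \<odot>\<^bsub>D\<^esub> (?x \<otimes>\<^bsub>D\<^esub> y) \<in> Dd (a + b)" by (intro Dd_t) (simp add: algebra_simps)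
      moreover have "(mon R 0 (x 0) \<oplus>\<^bsub>D\<^esub> tt \<odot>\<^bsub>D\<^esub> ?x) \<otimes>\<^bsub>D\<^esub> y = mon R 0 (x 0) \<otimes>\<^bsub>D\<^esub> y \<oplus>\<^bsub>D\<^esub> tt \<odot>\<^bsub>D\<^esub> (?x \<otimes>\<^bsub>D\<^esub> y)"
        using yc c by (simp add: D.l_distr D.smult_mult_left)
      ultimately show ?thesis
        using uncons[OF Dd_carrier[OF less.prems]] Dd_add[OF const[OF x0 assms(2)]] by metis
    qed
  qed
qed

text \<open>In total degree below two the coefficients of \<open>t, t\<^sup>2, \<dots>\<close> have negative degree.\<close>

lemma const_mult_low:
  assumes r: "r \<in> Rd a" and s: "s \<in> Rd b" and "a + b < 2"
  shows "mon R 0 r \<otimes>\<^bsub>D\<^esub> mon R 0 s = mon R 0 (r \<otimes>\<^bsub>R\<^esub> s)"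
proof
  fix i
  have "(mon R 0 r \<otimes>\<^bsub>D\<^esub> mon R 0 s) i \<in> Rd (a + b - 2 * int i)" using const_mult_Dd[OF r s] by (simp add: Dd_def)
  then have "(mon R 0 r \<otimes>\<^bsub>D\<^esub> mon R 0 s) i = \<zero>\<^bsub>R\<^esub>" if "i \<noteq> 0"
    using Rd_neg[of _ "a + b - 2 * int i"] assms(3) that by simp
  moreover have "(mon R 0 r \<otimes>\<^bsub>D\<^esub> mon R 0 s) 0 = r \<otimes>\<^bsub>R\<^esub> s" using r s by (simp add: const_mult Rd_carrier)
  ultimately show "(mon R 0 r \<otimes>\<^bsub>D\<^esub> mon R 0 s) i = mon R 0 (r \<otimes>\<^bsub>R\<^esub> s) i"
    by (cases "i = 0") (simp_all add: mon_def[of R 0 "r \<otimes>\<^bsub>R\<^esub> s"])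
qed

text \<open>The unit of \<open>R\<close> is idempotent in \<open>D\<close>, and multiplication by it preserves lowest coefficients, so it
  annihilates nothing.\<close>

lemma one_eq: "\<one>\<^bsub>D\<^esub> = mon R 0 \<one>\<^bsub>R\<^esub>"
proof -
  let ?u = "mon R 0 \<one>\<^bsub>R\<^esub>"
  have uc: "?u \<in> carrier D" by (simp add: D_simps(1))
  have uu: "?u \<otimes>\<^bsub>D\<^esub> ?u = ?u" using const_mult_low[OF Rd_one Rd_one] by simp
  have ann: "x = \<zero>\<^bsub>D\<^esub>" if "x \<in> carrier Rt" "?u \<otimes>\<^bsub>D\<^esub> x = \<zero>\<^bsub>D\<^esub>" "\<And>i. i \<ge> N \<Longrightarrow> x i = \<zero>\<^bsub>R\<^esub>" for x N
    using that
  proof (induction N arbitrary: x)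
    case 0
    then show ?case by (simp add: D_simps(2) poly_algebra_simps fun_eq_iff)
  next
    case (Suc N)
    let ?x = "\<lambda>i. x (Suc i)"
    have xS: "?x \<in> carrier Rt" by (rule shift_closed[OF Suc.prems(1)])
    have x0: "x 0 = \<zero>\<^bsub>R\<^esub>"
      using lowest_coeff_mult[of ?u x] Suc.prems(1,2) by (simp add: D_simps(2) poly_algebra_simps(2)) (simp add: mon_def)
    have m0: "mon R 0 (x 0) = \<zero>\<^bsub>D\<^esub>" by (auto simp: x0 mon_def D_simps(2) poly_algebra_simps)
    have tc: "tt \<odot>\<^bsub>D\<^esub> ?x \<in> carrier D" using t_closed[OF xS] by (simp add: D_simps(1))
    have "x = tt \<odot>\<^bsub>D\<^esub> ?x" using uncons[OF Suc.prems(1)] D.l_zero[OF tc] unfolding m0 by metis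
    then have "?u \<otimes>\<^bsub>D\<^esub> (tt \<odot>\<^bsub>D\<^esub> ?x) = \<zero>\<^bsub>D\<^esub>" using Suc.prems(2) by metis
    then have "tt \<odot>\<^bsub>D\<^esub> (?u \<otimes>\<^bsub>D\<^esub> ?x) = \<zero>\<^bsub>D\<^esub>" using uc xS by (simp add: D.smult_mult_right D_simps(1))
    then have "?u \<otimes>\<^bsub>D\<^esub> ?x = \<zero>\<^bsub>D\<^esub>" by (rule t_cancel[OF mult_closed[OF mon_closed[OF R.one_closed] xS]])
    moreover have "?x i = \<zero>\<^bsub>R\<^esub>" if "i \<ge> N" for i using that by (intro Suc.prems(3)) simp
    ultimately have "?x = \<zero>\<^bsub>D\<^esub>" by (rule Suc.IH[OF xS])
    then have "x i = \<zero>\<^bsub>R\<^esub>" for i using x0 by (cases i) (auto simp: D_simps(2) poly_algebra_simps fun_eq_iff)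
    then show ?case by (simp add: D_simps(2) poly_algebra_simps fun_eq_iff)
  qed
  define x where "x = \<one>\<^bsub>D\<^esub> \<ominus>\<^bsub>D\<^esub> ?u"
  have xc: "x \<in> carrier Rt" unfolding x_def D_simps(1)[symmetric] using uc by simp
  have "?u \<otimes>\<^bsub>D\<^esub> x = \<zero>\<^bsub>D\<^esub>"
    unfolding x_def a_minus_def using uc uu by (simp add: D.r_distr D.r_minus D.M.r_neg)
  moreover obtain N where "\<forall>i>N. x i = \<zero>\<^bsub>R\<^esub>" using xc up_bound unfolding Rt_carrier by blast
  ultimately have "x = \<zero>\<^bsub>D\<^esub>" using ann[OF xc, of "Suc N"] by (simp add: Suc_le_eq)
  then show ?thesis unfolding x_def using uc by simp
qed

end

section \<open>Quantum symmetric algebras with a group action\<close>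

lemma prod_lessThan_add: "(\<Prod>k<a + b. f k) = (\<Prod>k<a. f k) * (\<Prod>k<b. f (a + k :: nat) :: complex)"
  by (induction b) (simp_all add: mult.assoc)

locale quantum_data = vector_space scale + grp: group G
  for G :: "('g, 'm) monoid_scheme" and scale :: "complex \<Rightarrow> 'v \<Rightarrow> 'v :: ab_group_add" +
  fixes v :: "nat \<Rightarrow> 'v" and n :: nat and act :: "'g \<Rightarrow> 'v \<Rightarrow> 'v" and q :: "nat \<Rightarrow> nat \<Rightarrow> complex"
    and \<alpha> :: "'g \<Rightarrow> (nat list \<Rightarrow> complex) set \<Rightarrow> (nat list \<Rightarrow> complex) set"
  assumes finite_G: "finite (carrier G)"
    and basis: "is_basis scale v n"
    and act_linear: "linear_action G scale act"
    and q_nonzero: "\<lbrakk>i < n; j < n\<rbrakk> \<Longrightarrow> q i j \<noteq> 0"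
    and q_inverse: "\<lbrakk>i < n; j < n\<rbrakk> \<Longrightarrow> q j i = inverse (q i j)"
    and induced: "induced_action G scale v n act q \<alpha>"
begin

abbreviation "T \<equiv> tensor_algebra n"
abbreviation "co \<equiv> coord scale v n"
abbreviation "tov \<equiv> tensor_of_vec scale v n"
abbreviation "tm \<equiv> tensor_map scale v n"
abbreviation "qc \<equiv> quantum_commutator n q"
abbreviation "I \<equiv> quantum_ideal n q"
abbreviation "A \<equiv> quantum_sym n q"
abbreviation "qcl \<equiv> quantum_class n q"

sublocale T: graded_alg Cring T tcmp by (rule T_graded)

lemma T_minus: "\<lbrakk>x \<in> carrier T; y \<in> carrier T\<rbrakk> \<Longrightarrow> x \<ominus>\<^bsub>T\<^esub> y = (\<lambda>w. x w - y w)"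
proof -
  assume "x \<in> carrier T" "y \<in> carrier T"
  then have "\<ominus>\<^bsub>T\<^esub> y = (\<lambda>w. - 1 * y w)"
    using T_smult_closed[of y n "- 1"] by (intro T.minus_equality) (simp_all add: T_simps(4,5))
  then show ?thesis by (simp add: a_minus_def T_simps(5))
qed

subsection \<open>Coordinates and the action on the tensor algebra\<close>

lemma basis_facts: "independent (v ` {..<n})" "span (v ` {..<n}) = UNIV" "inj_on v {..<n}"
  using basis unfolding is_basis_def by auto

lemma co_add: "co (x + y) i = co x i + co y i"
  unfolding coord_def using basis_facts by (simp add: representation_add)

lemma co_scale: "co (scale c x) i = c * co x i"
  unfolding coord_def using basis_facts by (simp add: representation_scale)

lemma co_zero: "co 0 i = 0"
  unfolding coord_def by (simp add: representation_zero)

lemma co_v: "i < n \<Longrightarrow> co (v i) j = (if j = i then 1 else 0)"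
  unfolding coord_def using basis_facts by (auto simp: representation_basis inj_on_def)

lemma vector_induct [case_names zero add]:
  assumes "P 0" and "\<And>c i y. \<lbrakk>i < n; P y\<rbrakk> \<Longrightarrow> P (scale c (v i) + y)"
  shows "P x"
proof -
  have "x \<in> span (v ` {..<n})" using basis_facts by simp
  then show ?thesis by (induction rule: span_induct_alt) (use assms in auto)
qed

lemma tov_closed: "tov x \<in> carrier T"
proof (rule T_carrierI[of "(\<lambda>i. [i]) ` {..<n}"])
  fix w assume "tov x w \<noteq> 0"
  then obtain i where "w = [i]" "i < n"
    unfolding tensor_of_vec_def coord_def by (cases w) (auto split: if_splits)
  then show "w \<in> (\<lambda>i. [i]) ` {..<n}" "set w \<subseteq> {..<n}" by auto
qed simp

lemma tov_v: "i < n \<Longrightarrow> tov (v i) = gen i"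
  unfolding tensor_of_vec_def gen_def by (auto simp: fun_eq_iff co_v length_Suc_conv)

lemma tov_step: "tov (scale c x + y) = (\<lambda>w. (c \<odot>\<^bsub>T\<^esub> tov x) w + tov y w)"
  unfolding tensor_of_vec_def T_simps by (auto simp: co_add co_scale)

lemma tov_zero: "tov 0 = (\<lambda>w. 0)"
  unfolding tensor_of_vec_def by (auto simp: co_zero)

lemma tov_homog: "tov x \<in> T.homog 1"
  using tov_closed unfolding T.homog_def by (auto simp: tensor_of_vec_def fun_eq_iff)

lemma finite_words: "finite {w :: nat list. set w \<subseteq> {..<n} \<and> length w = k}"
  by (rule finite_lists_length_eq) simp

lemma tm_sw:
  assumes "set w \<subseteq> {..<n}"
  shows "tm f (sw c w) = (\<lambda>u. if length u = length w then c * (\<Prod>k<length u. co (f (v (w ! k))) (u ! k)) else 0)"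
proof
  fix u
  have "tm f (sw c w) u = (\<Sum>w' | set w' \<subseteq> {..<n} \<and> length w' = length u.
      if w' = w then c * (\<Prod>k<length u. co (f (v (w ! k))) (u ! k)) else 0)"
    unfolding tensor_map_def by (intro sum.cong) (auto simp: sw_def)
  also have "\<dots> = (if length u = length w then c * (\<Prod>k<length u. co (f (v (w ! k))) (u ! k)) else 0)"
    using assms finite_words by (subst sum.delta) auto
  finally show "tm f (sw c w) u = (if length u = length w then c * (\<Prod>k<length u. co (f (v (w ! k))) (u ! k)) else 0)" .
qed

lemma tm_add: "tm f (\<lambda>w. x w + y w) = (\<lambda>w. tm f x w + tm f y w)"
  unfolding tensor_map_def by (simp add: algebra_simps sum.distrib)

lemma tm_smult: "tm f (\<lambda>w. c * x w) = (\<lambda>w. c * tm f x w)"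
  unfolding tensor_map_def by (simp add: sum_distrib_left mult.assoc)

lemma tm_zero: "tm f (\<lambda>w. 0) = (\<lambda>w. 0)"
  unfolding tensor_map_def by simp

lemma tm_tcmp: "tm f (tcmp d x) = tcmp d (tm f x)"
  unfolding tensor_map_def by (auto simp: fun_eq_iff)

lemma tm_closed: "x \<in> carrier T \<Longrightarrow> tm f x \<in> carrier T"
proof (induction x rule: T_induct)
  case (word c w)
  have nz: "set u \<subseteq> {..<n} \<and> length u = length w" if "tm f (sw c w) u \<noteq> 0" for u
  proof -
    have u: "length u = length w" "(\<Prod>k<length u. co (f (v (w ! k))) (u ! k)) \<noteq> 0"
      using that unfolding tm_sw[OF word] by (auto split: if_splits)
    have "u ! k < n" if "k < length u" for k
    proof -
      have "co (f (v (w ! k))) (u ! k) \<noteq> 0" using u(2) that by (simp add: prod_zero_iff)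
      then show ?thesis by (simp add: coord_def split: if_splits)
    qed
    then show ?thesis using u(1) by (auto simp: in_set_conv_nth)
  qed
  then show ?case using finite_words[of "length w"] by (intro T_carrierI) auto
qed (simp_all add: tm_zero tm_add T_add_closed)

text \<open>On words both sides are products of coordinates over the positions; the general case follows by biadditivity.\<close>

lemma tm_hom: "tm f \<in> alg_hom Cring T T"
proof -
  have words: "tm f (sw c u \<otimes>\<^bsub>T\<^esub> sw d w) = tm f (sw c u) \<otimes>\<^bsub>T\<^esub> tm f (sw d w)"
    if u: "set u \<subseteq> {..<n}" and w: "set w \<subseteq> {..<n}" for c d u w
  proof
    fix z
    let ?a = "length u" and ?b = "length w"
    have "(tm f (sw c u) \<otimes>\<^bsub>T\<^esub> tm f (sw d w)) z =
      (\<Sum>k\<le>length z. if k = ?a then (if length z = ?a + ?b then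
          c * d * ((\<Prod>k<?a. co (f (v (u ! k))) (z ! k)) * (\<Prod>k<?b. co (f (v (w ! k))) (z ! (?a + k)))) else 0) else 0)"
      unfolding T_simps(2)
    proof (rule sum.cong[OF refl])
      fix k assume k: "k \<in> {..length z}"
      show "tm f (sw c u) (take k z) * tm f (sw d w) (drop k z) = (if k = ?a then (if length z = ?a + ?b then
          c * d * ((\<Prod>k<?a. co (f (v (u ! k))) (z ! k)) * (\<Prod>k<?b. co (f (v (w ! k))) (z ! (?a + k)))) else 0) else 0)"
      proof (cases "k = ?a \<and> length z = ?a + ?b")
        case True
        then have "(\<Prod>k'<?a. co (f (v (u ! k'))) (take k z ! k')) = (\<Prod>k<?a. co (f (v (u ! k))) (z ! k))"
          "(\<Prod>k'<?b. co (f (v (w ! k'))) (drop k z ! k')) = (\<Prod>k<?b. co (f (v (w ! k))) (z ! (?a + k)))"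
          by (auto intro!: prod.cong)
        then show ?thesis using True by (simp add: tm_sw[OF u] tm_sw[OF w])
      next
        case False
        then show ?thesis using k by (auto simp: tm_sw[OF u] tm_sw[OF w])
      qed
    qed
    also have "\<dots> = (if length z = ?a + ?b then
          c * d * ((\<Prod>k<?a. co (f (v (u ! k))) (z ! k)) * (\<Prod>k<?b. co (f (v (w ! k))) (z ! (?a + k)))) else 0)"
      by (subst sum.delta) auto
    also have "\<dots> = tm f (sw (c * d) (u @ w)) z"
    proof -
      have "(\<Prod>k<?a + ?b. co (f (v ((u @ w) ! k))) (z ! k)) =
          (\<Prod>k<?a. co (f (v (u ! k))) (z ! k)) * (\<Prod>k<?b. co (f (v (w ! k))) (z ! (?a + k)))"
        unfolding prod_lessThan_add by (simp add: nth_append)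
      then show ?thesis using u w by (simp add: tm_sw[of "u @ w"])
    qed
    finally show "tm f (sw c u \<otimes>\<^bsub>T\<^esub> sw d w) z = (tm f (sw c u) \<otimes>\<^bsub>T\<^esub> tm f (sw d w)) z"
      by (simp add: sw_mult)
  qed
  have 1: "tm f (sw c u \<otimes>\<^bsub>T\<^esub> y) = tm f (sw c u) \<otimes>\<^bsub>T\<^esub> tm f y" if u: "set u \<subseteq> {..<n}" and y: "y \<in> carrier T" for c u y
    using y
  proof (induction y rule: T_induct)
    case (word d w)
    then show ?case by (rule words[OF u])
  qed (simp_all add: T_distr tm_zero tm_add)
  have 2: "tm f (x \<otimes>\<^bsub>T\<^esub> y) = tm f x \<otimes>\<^bsub>T\<^esub> tm f y" if x: "x \<in> carrier T" and y: "y \<in> carrier T" for x y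
    using x
  proof (induction x rule: T_induct)
    case (word d w)
    then show ?case by (rule 1[OF _ y])
  qed (simp_all add: T_distr tm_zero tm_add)
  have 3: "tm f (sw 1 []) = sw 1 []" by (subst tm_sw) (auto simp: sw_def)
  show ?thesis
    by (rule alg_homI) (simp_all add: tm_closed 2 3 T_simps(3,5,6) tm_add tm_smult)
qed

lemma tm_gen: "i < n \<Longrightarrow> tm f (gen i) = tov (f (v i))"
proof
  fix u assume i: "i < n"
  have "tm f (gen i) u = (if length u = 1 then 1 * (\<Prod>k<length u. co (f (v ([i] ! k))) (u ! k)) else 0)"
    unfolding gen_eq_sw by (subst tm_sw) (use i in auto)
  also have "\<dots> = tov (f (v i)) u"
    by (cases u) (auto simp: tensor_of_vec_def)
  finally show "tm f (gen i) u = tov (f (v i)) u" .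
qed

lemma tm_tov:
  assumes "Vector_Spaces.linear scale scale f"
  shows "tm f (tov x) = tov (f x)"
proof -
  interpret f: Vector_Spaces.linear scale scale f by fact
  show ?thesis
  proof (induction x rule: vector_induct)
    case zero
    then show ?case by (simp add: tov_zero tm_zero f.zero)
  next
    case (add c i y)
    then show ?case
      by (simp add: tov_step tm_add T_simps(6) tm_smult f.add f.scale tov_v tm_gen)
  qed
qed

lemma act_group_action: "group_action G UNIV act"
  and act_lin: "g \<in> carrier G \<Longrightarrow> Vector_Spaces.linear scale scale (act g)"
  using act_linear unfolding linear_action_def by auto

lemma tm_skew: "skew_algebra Cring T G (\<lambda>g. tm (act g))"
proof (unfold skew_algebra_def skew_algebra_axioms_def, intro conjI allI impI)
  show "assoc_alg Cring T" by (rule T_assoc_alg)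
  show "Group.group G" by (rule grp.is_group)
  show "finite (carrier G)" by (rule finite_G)
  show "tm (act g) \<in> alg_hom Cring T T" for g by (rule tm_hom)
  fix a assume a: "a \<in> carrier T"
  have id: "(\<lambda>x. x) \<in> alg_hom Cring T T" by (rule alg_homI) simp_all
  have "act \<one>\<^bsub>G\<^esub> x = x" for x
    using fun_cong[OF group_action.id_eq_one[OF act_group_action], of x] by simp
  then show "tm (act \<one>\<^bsub>G\<^esub>) a = a"
    using T_hom_unique[OF T.ring_axioms tm_hom id _ a, of "act \<one>\<^bsub>G\<^esub>"] by (simp add: tm_gen tov_v)
  fix g h assume g: "g \<in> carrier G" and h: "h \<in> carrier G"
  have comp: "(\<lambda>x. tm (act g) (tm (act h) x)) \<in> alg_hom Cring T T"
    using alg_homD[OF tm_hom[of "act g"]] alg_homD[OF tm_hom[of "act h"]] by (intro alg_homI) simp_all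
  have "tm (act (g \<otimes>\<^bsub>G\<^esub> h)) (gen i) = tm (act g) (tm (act h) (gen i))" if "i < n" for i
    using that group_action.composition_rule[OF act_group_action, of "v i" g h] g h
    by (simp add: tm_gen tm_tov[OF act_lin[OF g]])
  then show "tm (act (g \<otimes>\<^bsub>G\<^esub> h)) a = tm (act g) (tm (act h) a)"
    using T_hom_unique[OF T.ring_axioms tm_hom comp _ a] by simp
qed

sublocale TS: skew_algebra Cring T G "\<lambda>g. tm (act g)" by (rule tm_skew)

subsection \<open>The quantum symmetric algebra as a graded quotient\<close>

lemma gen_homog: "i < n \<Longrightarrow> gen i \<in> T.homog 1"
  using tov_homog[of "v i"] by (simp add: tov_v)

lemma qc_eq: "qc i j = (gen i \<otimes>\<^bsub>T\<^esub> gen j) \<ominus>\<^bsub>T\<^esub> q i j \<odot>\<^bsub>T\<^esub> (gen j \<otimes>\<^bsub>T\<^esub> gen i)"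
  unfolding quantum_commutator_def ..

lemma qc_homog: "\<lbrakk>i < n; j < n\<rbrakk> \<Longrightarrow> qc i j \<in> T.homog 2"
  unfolding qc_eq using T.homog_mult[OF gen_homog[of i] gen_homog[of j]] T.homog_mult[OF gen_homog[of j] gen_homog[of i]]
  by (intro T.homog_minus T.homog_smult) simp_all

abbreviation "Q \<equiv> {qc i j | i j. i < n \<and> j < n}"

lemma Q_homog: "Q \<subseteq> T.homog 2" using qc_homog by auto
lemma Q_carrier: "Q \<subseteq> carrier T" using Q_homog T.homog_carrier by blast

lemma I_eq: "I = genideal T Q" unfolding quantum_ideal_def ..

sublocale I: alg_ideal Cring T I
  unfolding alg_ideal_def using T.genideal_ideal[OF Q_carrier] T.assoc_alg_axioms by (simp add: I_eq)

lemma A_eq: "A = quotient_algebra T I" unfolding quantum_sym_def ..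
lemma qcl_eq: "qcl x = I.cls x" unfolding quantum_class_def ..

sublocale A: assoc_alg Cring A unfolding A_eq by (rule I.quotient_assoc_alg)

lemma qcl_hom: "qcl \<in> alg_hom Cring T A"
  using I.cls_alg_hom unfolding A_eq qcl_eq[abs_def] .

lemma qcl_zero_iff: "x \<in> carrier T \<Longrightarrow> qcl x = \<zero>\<^bsub>A\<^esub> \<longleftrightarrow> x \<in> I"
  unfolding qcl_eq A_eq I.cls_zero[symmetric] by (simp add: I.cls_eq_iff T.minus_eq)

lemma qcl_surj: "U \<in> carrier A \<Longrightarrow> \<exists>x\<in>carrier T. U = qcl x"
  unfolding A_eq qcl_eq by (rule I.cls_surj)

lemma I_part: "x \<in> I \<Longrightarrow> tcmp d x \<in> T.ideal_part Q d"
  unfolding I_eq by (rule T.cmp_genideal[OF Q_homog])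

lemma ideal_part_I: "x \<in> T.ideal_part Q d \<Longrightarrow> x \<in> I"
  unfolding I_eq by (rule T.ideal_part_subset[OF Q_carrier])

lemma I_tcmp: "x \<in> I \<Longrightarrow> tcmp d x \<in> I"
  using I_part ideal_part_I by blast

text \<open>The ideal starts in degree two, so the scalars embed in the quantum symmetric algebra.\<close>

lemma I_degree_zero: "x \<in> I \<Longrightarrow> x [] = 0"
proof -
  assume "x \<in> I"
  then have "tcmp 0 x \<in> T.ideal_part Q 0" by (rule I_part)
  then have "tcmp 0 x = \<zero>\<^bsub>T\<^esub>"
  proof induction
    case (gen s a p b q)
    then have "a = \<zero>\<^bsub>T\<^esub> \<or> b = \<zero>\<^bsub>T\<^esub>" using T.homog_neg[of a p] T.homog_neg[of b q] by linarith
    moreover have "s \<in> carrier T" "a \<in> carrier T" "b \<in> carrier T"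
      using gen(1) Q_carrier T.homog_carrier[OF gen(2)] T.homog_carrier[OF gen(3)] by auto
    ultimately show ?case by auto
  qed simp_all
  from fun_cong[OF this, of "[]"] show "x [] = 0" by (simp add: T_simps)
qed

lemma \<alpha>_facts:
  "group_action G (carrier A) \<alpha>"
  "g \<in> carrier G \<Longrightarrow> \<alpha> g \<in> alg_hom Cring A A"
  "g \<in> carrier G \<Longrightarrow> \<alpha> g (qcl (tov x)) = qcl (tov (act g x))"
  using induced unfolding induced_action_def by (auto simp: algebra_iso_eq)

lemma \<alpha>_skew: "skew_algebra Cring A G \<alpha>"
proof (unfold skew_algebra_def skew_algebra_axioms_def, intro conjI allI impI)
  show "assoc_alg Cring A" by (rule A.assoc_alg_axioms)
  show "Group.group G" by (rule grp.is_group)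
  show "finite (carrier G)" by (rule finite_G)
  show "\<And>g. g \<in> carrier G \<Longrightarrow> \<alpha> g \<in> alg_hom Cring A A" by (rule \<alpha>_facts)
  fix a assume a: "a \<in> carrier A"
  show "\<alpha> \<one>\<^bsub>G\<^esub> a = a"
    using fun_cong[OF group_action.id_eq_one[OF \<alpha>_facts(1)], of a] a by simp
  show "\<And>g h. g \<in> carrier G \<Longrightarrow> h \<in> carrier G \<Longrightarrow> \<alpha> (g \<otimes>\<^bsub>G\<^esub> h) a = \<alpha> g (\<alpha> h a)"
    using group_action.composition_rule[OF \<alpha>_facts(1) a] by blast
qed

sublocale AS: skew_algebra Cring A G \<alpha> by (rule \<alpha>_skew)

lemma qcl_equivariant:
  assumes g: "g \<in> carrier G" and a: "a \<in> carrier T"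
  shows "qcl (tm (act g) a) = \<alpha> g (qcl a)"
proof -
  note qD = alg_homD[OF qcl_hom] and tD = alg_homD[OF tm_hom[of "act g"]] and \<alpha>D = alg_homD[OF \<alpha>_facts(2)[OF g]]
  have 1: "(\<lambda>a. qcl (tm (act g) a)) \<in> alg_hom Cring T A" by (rule alg_homI) (simp_all add: qD tD)
  have 2: "(\<lambda>a. \<alpha> g (qcl a)) \<in> alg_hom Cring T A" by (rule alg_homI) (simp_all add: qD \<alpha>D)
  have "qcl (tm (act g) (gen i)) = \<alpha> g (qcl (gen i))" if "i < n" for i
    using that \<alpha>_facts(3)[OF g, of "v i"] by (simp add: tm_gen tov_v)
  then show ?thesis by (rule T_hom_unique[OF A.ring_axioms 1 2 _ a])
qed

abbreviation "B \<equiv> tensor_skew G scale v n act"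
abbreviation "R \<equiv> quantum_skew G n q \<alpha>"
abbreviation "bcmp \<equiv> (\<lambda>d f. \<lambda>k\<in>carrier G. tcmp d (f k))"
definition "\<pi> f = (\<lambda>k\<in>carrier G. qcl (f k))"

lemma B_eq: "B = TS.S" unfolding tensor_skew_def ..
lemma R_eq: "R = AS.S" unfolding quantum_skew_def ..

sublocale B: graded_alg Cring B bcmp
  unfolding B_eq by (rule skew_graded[OF tm_skew T_graded]) (rule tm_tcmp)

sublocale R: assoc_alg Cring R
  unfolding R_eq by (rule AS.skew_assoc_alg)

lemma \<pi>_hom: "\<pi> \<in> alg_hom Cring B R"
proof -
  have "(\<lambda>f. \<lambda>g\<in>carrier G. qcl (f g)) \<in> alg_hom Cring TS.S AS.S"
    by (rule skew_map_hom[OF tm_skew \<alpha>_skew qcl_hom]) (rule qcl_equivariant)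
  then show ?thesis unfolding B_eq R_eq \<pi>_def[abs_def] .
qed

lemma B_carrier_iff: "f \<in> carrier B \<longleftrightarrow> f \<in> extensional (carrier G) \<and> (\<forall>g\<in>carrier G. f g \<in> carrier T)"
  unfolding B_eq by (rule TS.S_carrier_iff)

lemma B_homog_iff: "f \<in> B.homog d \<longleftrightarrow> f \<in> carrier B \<and> (\<forall>g\<in>carrier G. f g \<in> T.homog d)"
proof -
  have "bcmp d f = f \<longleftrightarrow> (\<forall>g\<in>carrier G. tcmp d (f g) = f g)" if "f \<in> carrier B"
  proof
    assume e: "bcmp d f = f"
    show "\<forall>g\<in>carrier G. tcmp d (f g) = f g"
    proof
      fix g assume "g \<in> carrier G"
      then show "tcmp d (f g) = f g" using fun_cong[OF e, of g] by (simp only: restrict_apply if_True)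
    qed
  next
    assume e: "\<forall>g\<in>carrier G. tcmp d (f g) = f g"
    have "f \<in> extensional (carrier G)" using that unfolding B_carrier_iff by (rule conjunct1)
    then show "bcmp d f = f" by (rule extensionalityI[OF restrict_extensional]) (use e in \<open>simp only: restrict_apply if_True\<close>)
  qed
  then show ?thesis unfolding B.homog_def T.homog_def by (auto simp: B_carrier_iff)
qed

lemma B_below_eq: "B.below d = skew_part G (tensor_filtration n d)"
proof -
  have "(\<forall>e>d. bcmp e f = \<zero>\<^bsub>B\<^esub>) \<longleftrightarrow> (\<forall>g\<in>carrier G. \<forall>e>d. tcmp e (f g) = \<zero>\<^bsub>T\<^esub>)" for f
    unfolding B_eq skew_simps(4) by (auto simp: fun_eq_iff)
  then have "f \<in> B.below d \<longleftrightarrow> f \<in> skew_part G (tensor_filtration n d)" for f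
    unfolding B.below_def skew_part_def tensor_filtration_eq T.below_def PiE_iff mem_Collect_eq B_carrier_iff by blast
  then show ?thesis by (simp add: set_eq_iff)
qed

lemma quantum_skew_degree_eq: "quantum_skew_degree G n q d = \<pi> ` B.homog d"
proof (intro equalityI subsetI)
  fix r assume r: "r \<in> quantum_skew_degree G n q d"
  then have ext: "r \<in> extensional (carrier G)" and ex: "\<forall>g\<in>carrier G. \<exists>x. x \<in> T.homog d \<and> r g = qcl x"
    unfolding quantum_skew_degree_def skew_part_def quantum_degree_def tensor_degree_eq PiE_iff by auto
  from bchoice[OF ex] obtain x where x: "\<forall>g\<in>carrier G. x g \<in> T.homog d \<and> r g = qcl (x g)" ..
  have "(\<lambda>g\<in>carrier G. x g) \<in> B.homog d" using x T.homog_carrier by (auto simp: B_homog_iff B_carrier_iff)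
  moreover have "r = \<pi> (\<lambda>g\<in>carrier G. x g)" unfolding \<pi>_def using x ext by (auto simp: extensional_def fun_eq_iff)
  ultimately show "r \<in> \<pi> ` B.homog d" by blast
next
  fix r assume "r \<in> \<pi> ` B.homog d"
  then show "r \<in> quantum_skew_degree G n q d"
    unfolding quantum_skew_degree_def skew_part_def quantum_degree_def tensor_degree_eq \<pi>_def by (auto simp: B_homog_iff)
qed

subsection \<open>A graded linear section\<close>

text \<open>In each degree take a linear projection whose kernel is that part of the ideal. Its image is a
  homogeneous system of normal forms modulo the ideal.\<close>

lemma exists_normal_form_map:
  "\<exists>P. (\<forall>x\<in>carrier T. P x \<in> carrier T \<and> P x \<ominus>\<^bsub>T\<^esub> x \<in> I) \<and> (\<forall>x\<in>I. P x = \<zero>\<^bsub>T\<^esub>) \<and>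
     (\<forall>d. \<forall>x\<in>T.homog d. P x \<in> T.homog d) \<and>
     (\<forall>x y. P (\<lambda>w. x w + y w) = (\<lambda>w. P x w + P y w)) \<and> (\<forall>c x. P (\<lambda>w. c * x w) = (\<lambda>w. c * P x w))"
proof -
  let ?s = "\<lambda>(c :: complex) (f :: nat list \<Rightarrow> complex). (\<lambda>w. c * f w)"
  interpret F: vector_space ?s
    by unfold_locales (auto simp: fun_eq_iff algebra_simps plus_fun_def)
  have ex: "\<exists>P. Vector_Spaces.linear ?s ?s P \<and> (\<forall>u\<in>I \<inter> T.homog d. P u = 0) \<and> (\<forall>x. P x - x \<in> I \<inter> T.homog d)" for d
  proof (rule F.exists_projection_with_kernel)
    have "0 \<in> I \<inter> T.homog d" using I.zero_closed T.homog_zero[of d] by (simp add: T_simps(4) zero_fun_def)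
    moreover have "x + y \<in> I \<inter> T.homog d" if "x \<in> I \<inter> T.homog d" "y \<in> I \<inter> T.homog d" for x y
      using that I.a_closed[of x y] T.homog_add[of x d y] by (simp add: T_simps(5) plus_fun_def)
    moreover have "(\<lambda>w. c * x w) \<in> I \<inter> T.homog d" if "x \<in> I \<inter> T.homog d" for c x
      using that T.ideal_smult_closed[OF I.ideal_axioms, of c x] T.homog_smult[of c x d] by (simp add: T_simps(6))
    ultimately show "F.subspace (I \<inter> T.homog d)" by (rule F.subspaceI)
  qed
  from choice[OF allI, OF ex] obtain P where P': "\<forall>d. Vector_Spaces.linear ?s ?s (P d) \<and>
    (\<forall>u\<in>I \<inter> T.homog d. P d u = 0) \<and> (\<forall>x. P d x - x \<in> I \<inter> T.homog d)" ..
  have P: "Vector_Spaces.linear ?s ?s (P d)" "\<And>u. u \<in> I \<inter> T.homog d \<Longrightarrow> P d u = 0"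
    "P d x - x \<in> I \<inter> T.homog d" for d x
    by (rule conjunct1[OF spec[OF P']], erule bspec[OF conjunct1[OF conjunct2[OF spec[OF P']]]],
        rule spec[OF conjunct2[OF conjunct2[OF spec[OF P']]]])
  define N where "N x = (\<lambda>w. P (int (length w)) (tcmp (int (length w)) x) w)" for x :: "nat list \<Rightarrow> complex"
  have P_add: "P d (\<lambda>w. x w + y w) = (\<lambda>w. P d x w + P d y w)" for d x y
    using Vector_Spaces.linear.axioms(1)[OF P(1)[of d]] module_hom.add[OF Vector_Spaces.linear.axioms(3)[OF P(1)[of d]], of x y]
    by (simp add: plus_fun_def)
  have P_smult: "P d (\<lambda>w. c * x w) = (\<lambda>w. c * P d x w)" for d c x
    using module_hom.scale[OF Vector_Spaces.linear.axioms(3)[OF P(1)[of d]], of c x] by simp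
  have P0: "P d (\<lambda>w. 0) = (\<lambda>w. 0)" for d using P_smult[of d 0 "\<lambda>w. 0"] by simp
  have N_add: "N (\<lambda>w. x w + y w) = (\<lambda>w. N x w + N y w)" for x y
  proof -
    have "tcmp d (\<lambda>w. x w + y w) = (\<lambda>w. tcmp d x w + tcmp d y w)" for d by auto
    then show ?thesis by (simp only: N_def P_add)
  qed
  have N_smult: "N (\<lambda>w. c * x w) = (\<lambda>w. c * N x w)" for c x
  proof -
    have "tcmp d (\<lambda>w. c * x w) = (\<lambda>w. c * tcmp d x w)" for d by auto
    then show ?thesis by (simp only: N_def P_smult)
  qed
  have P_homog: "P d x \<in> T.homog d" if x: "x \<in> T.homog d" for d x
  proof -
    have "P d x = (\<lambda>w. (P d x - x) w + x w)" by (simp add: fun_eq_iff)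
    moreover have "(\<lambda>w. (P d x - x) w + x w) \<in> T.homog d"
      using T.homog_add[of "P d x - x" d x] P(3)[of d x] x by (simp add: T_simps(5))
    ultimately show ?thesis by metis
  qed
  have N_homog: "N x = P d x" if x: "x \<in> T.homog d" for d x
  proof
    fix w
    show "N x w = P d x w"
    proof (cases "int (length w) = d")
      case True
      then show ?thesis unfolding N_def using T.cmp_homog[OF x, of d] by simp
    next
      case False
      have "tcmp (int (length w)) x = (\<lambda>w. 0)" using T.cmp_homog[OF x, of "int (length w)"] False by (simp add: T_simps(4))
      then have "N x w = 0" unfolding N_def using P0 by metis
      moreover have "P d x w = 0" using fun_cong[OF T.cmp_homog[OF P_homog[OF x], of d], of w] False by simp
      ultimately show ?thesis by simp
    qed
  qed
  have N_I: "N x \<in> carrier T \<and> N x \<ominus>\<^bsub>T\<^esub> x \<in> I" if "x \<in> carrier T" for x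
    using that
  proof (induction x rule: T.graded_induct)
    case zero
    have "N (\<lambda>w. 0) = (\<lambda>w. 0)" using N_smult[of 0 "\<lambda>w. 0"] by simp
    then show ?case using I.zero_closed[unfolded T_simps(4)] by (simp add: T_simps(4) T_minus)
  next
    case (hom d x)
    have c: "P d x \<in> carrier T" "x \<in> carrier T" using P_homog[OF hom] hom T.homog_carrier by blast+
    then show ?case using P(3)[of d x] by (simp add: N_homog[OF hom] T_minus fun_diff_def)
  next
    case (add x y)
    have "N (x \<oplus>\<^bsub>T\<^esub> y) = N x \<oplus>\<^bsub>T\<^esub> N y" by (simp add: T_simps(5) N_add)
    moreover have "(N x \<oplus>\<^bsub>T\<^esub> N y) \<ominus>\<^bsub>T\<^esub> (x \<oplus>\<^bsub>T\<^esub> y) = (N x \<ominus>\<^bsub>T\<^esub> x) \<oplus>\<^bsub>T\<^esub> (N y \<ominus>\<^bsub>T\<^esub> y)"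
      using add by (intro T.M.add_diff_add) auto
    ultimately show ?case using add by simp
  qed
  have N_kernel: "N x = \<zero>\<^bsub>T\<^esub>" if x: "x \<in> I" for x
  proof -
    have "tcmp d x \<in> I \<inter> T.homog d" for d using I_tcmp[OF x] T.cmp_in_homog[of x d] I.Icarr[OF x] by blast
    then have "P d (tcmp d x) = 0" for d by (rule P(2))
    then show ?thesis unfolding N_def by (simp only: N_def T_simps(4) zero_fun_def)
  qed
  show ?thesis
    using N_I N_kernel N_add N_smult P_homog N_homog by (intro exI[of _ N]) simp
qed

text \<open>The map \<open>rep\<close> is the section that the projection \<open>nf\<close> induces on classes, and \<open>\<sigma>\<close> applies it at each
  group element.\<close>

definition "nf = (SOME P. (\<forall>x\<in>carrier T. P x \<in> carrier T \<and> P x \<ominus>\<^bsub>T\<^esub> x \<in> I) \<and> (\<forall>x\<in>I. P x = \<zero>\<^bsub>T\<^esub>) \<and>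
     (\<forall>d. \<forall>x\<in>T.homog d. P x \<in> T.homog d) \<and>
     (\<forall>x y. P (\<lambda>w. x w + y w) = (\<lambda>w. P x w + P y w)) \<and> (\<forall>c x. P (\<lambda>w. c * x w) = (\<lambda>w. c * P x w)))"

lemma nf_facts:
  "x \<in> carrier T \<Longrightarrow> nf x \<in> carrier T" "x \<in> carrier T \<Longrightarrow> nf x \<ominus>\<^bsub>T\<^esub> x \<in> I" "x \<in> I \<Longrightarrow> nf x = \<zero>\<^bsub>T\<^esub>"
  "x \<in> T.homog d \<Longrightarrow> nf x \<in> T.homog d"
  "nf (x \<oplus>\<^bsub>T\<^esub> y) = nf x \<oplus>\<^bsub>T\<^esub> nf y" "nf (c \<odot>\<^bsub>T\<^esub> x) = c \<odot>\<^bsub>T\<^esub> nf x"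
  using someI_ex[OF exists_normal_form_map, folded nf_def] unfolding T_simps(5,6) by blast+

lemma nf_class: "x \<in> carrier T \<Longrightarrow> qcl (nf x) = qcl x"
  unfolding qcl_eq using nf_facts(1,2) by (simp add: I.cls_eq_iff)

lemma nf_cong:
  assumes "x \<in> carrier T" "y \<in> carrier T" "qcl x = qcl y"
  shows "nf x = nf y"
proof -
  have "nf (x \<ominus>\<^bsub>T\<^esub> y) = nf x \<ominus>\<^bsub>T\<^esub> nf y"
    using assms nf_facts(1,5) by (intro additive_map_minus[where \<phi> = nf]) (auto simp: T.is_abelian_group)
  moreover have "nf (x \<ominus>\<^bsub>T\<^esub> y) = \<zero>\<^bsub>T\<^esub>" using assms by (intro nf_facts(3)) (simp add: qcl_eq I.cls_eq_iff)
  ultimately have "nf x \<ominus>\<^bsub>T\<^esub> nf y = \<zero>\<^bsub>T\<^esub>" by simp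
  then show ?thesis using ring.r_right_minus_eq[OF T.ring_axioms nf_facts(1)[OF assms(1)] nf_facts(1)[OF assms(2)]] by (rule iffD1[rotated])
qed

definition "rep U = nf (SOME x. x \<in> carrier T \<and> U = qcl x)"

lemma rep_class: "x \<in> carrier T \<Longrightarrow> rep (qcl x) = nf x"
proof -
  assume x: "x \<in> carrier T"
  then have "\<exists>y. y \<in> carrier T \<and> qcl x = qcl y" by blast
  from someI_ex[OF this] show ?thesis unfolding rep_def using x by (intro nf_cong) auto
qed

definition "\<sigma> r = (\<lambda>k\<in>carrier G. rep (r k))"

lemma R_carrier_iff: "r \<in> carrier R \<longleftrightarrow> r \<in> extensional (carrier G) \<and> (\<forall>g\<in>carrier G. r g \<in> carrier A)"
  unfolding R_eq by (rule AS.S_carrier_iff)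

lemma R_rep: "r \<in> carrier R \<Longrightarrow> \<exists>f\<in>carrier B. r = \<pi> f"
proof -
  assume r: "r \<in> carrier R"
  then have ex: "\<forall>g\<in>carrier G. \<exists>x. x \<in> carrier T \<and> r g = qcl x"
    using qcl_surj unfolding R_carrier_iff Bex_def by blast
  from bchoice[OF ex] obtain x where x: "\<forall>g\<in>carrier G. x g \<in> carrier T \<and> r g = qcl (x g)" ..
  have "(\<lambda>g\<in>carrier G. x g) \<in> carrier B" using x by (auto simp: B_carrier_iff)
  moreover have "r = \<pi> (\<lambda>g\<in>carrier G. x g)" unfolding \<pi>_def using x r by (auto simp: R_carrier_iff extensional_def fun_eq_iff)
  ultimately show ?thesis by blast
qed

lemma \<sigma>_\<pi>: "f \<in> carrier B \<Longrightarrow> \<sigma> (\<pi> f) = (\<lambda>k\<in>carrier G. nf (f k))"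
  unfolding \<sigma>_def \<pi>_def by (auto simp: B_carrier_iff rep_class)

lemma \<pi>_zero_iff: "f \<in> carrier B \<Longrightarrow> \<pi> f = \<zero>\<^bsub>R\<^esub> \<longleftrightarrow> (\<forall>g\<in>carrier G. f g \<in> I)"
proof -
  assume f: "f \<in> carrier B"
  have "\<pi> f = \<zero>\<^bsub>R\<^esub> \<longleftrightarrow> (\<forall>g\<in>carrier G. qcl (f g) = \<zero>\<^bsub>A\<^esub>)"
    unfolding R_eq skew_simps(4) \<pi>_def by (auto simp: fun_eq_iff restrict_def)
  then show ?thesis using f by (simp add: B_carrier_iff qcl_zero_iff)
qed

subsection \<open>The presentation of the family\<close>

definition "rels \<kappa> = {(skew_of_base T G (qc i j), skew_of_group_algebra T G (\<kappa> (v i) (v j))) | i j. i < n \<and> j < n}"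
  for \<kappa> :: "'v \<Rightarrow> 'v \<Rightarrow> 'g \<Rightarrow> complex"

lemma skew_of_base_eq: "skew_of_base T G a = TS.\<delta> \<one>\<^bsub>G\<^esub> a"
  unfolding skew_of_base_def sgl_def ..

lemma \<delta>_homog: "a \<in> T.homog d \<Longrightarrow> TS.\<delta> g a \<in> B.homog d"
  by (auto simp: B_homog_iff B_carrier_iff sgl_def T.homog_carrier)

lemma scalar_homog: "skew_of_group_algebra T G c \<in> B.homog 0"
  using T.homog_smult[OF _ T.one_homog] T.homog_carrier[OF T.homog_smult[OF _ T.one_homog]]
  by (auto simp: B_homog_iff B_carrier_iff skew_of_group_algebra_def)

text \<open>An element \<open>y g\<close> with \<open>y\<close> in the ideal of the tensor algebra is a sum of terms \<open>a s b g\<close>, in which \<open>g\<close> is absorbed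
  by the right factor.\<close>

lemma kernel_spanned:
  assumes x: "x \<in> B.homog m" "\<pi> x = \<zero>\<^bsub>R\<^esub>" and zero: "P \<zero>\<^bsub>B\<^esub>"
    and add: "\<And>u w. \<lbrakk>u \<in> carrier B; w \<in> carrier B; P u; P w\<rbrakk> \<Longrightarrow> P (u \<oplus>\<^bsub>B\<^esub> w)"
    and gen: "\<And>i j a b p q. \<lbrakk>i < n; j < n; a \<in> B.homog p; b \<in> B.homog q; p + q + 2 = m\<rbrakk> \<Longrightarrow>
      P (a \<otimes>\<^bsub>B\<^esub> skew_of_base T G (qc i j) \<otimes>\<^bsub>B\<^esub> b)"
  shows "P x"
proof -
  have xB: "x \<in> carrier TS.S" using B.homog_carrier[OF x(1)] unfolding B_eq .
  have single: "P (TS.\<delta> g y)" if g: "g \<in> carrier G" and y: "y \<in> T.ideal_part Q m" for g y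
    using y
  proof induction
    case zero
    have "TS.\<delta> g \<zero>\<^bsub>T\<^esub> = \<zero>\<^bsub>B\<^esub>" unfolding B_eq skew_simps(4) sgl_def by auto
    then show ?case using \<open>P \<zero>\<^bsub>B\<^esub>\<close> by simp
  next
    case (add y z)
    have c: "y \<in> carrier T" "z \<in> carrier T" using add T.ideal_part_carrier[OF Q_carrier] by blast+
    then have "P (TS.\<delta> g y \<oplus>\<^bsub>B\<^esub> TS.\<delta> g z)" using add assms(4) by (simp add: B_eq)
    then show ?case using c by (simp add: B_eq TS.\<delta>_add)
  next
    case (gen s a p b q)
    then obtain i j where s: "s = qc i j" "i < n" "j < n" by blast
    have c: "s \<in> carrier T" "a \<in> carrier T" "b \<in> carrier T"
      using gen Q_carrier T.homog_carrier by blast+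
    have "TS.\<delta> \<one>\<^bsub>G\<^esub> a \<otimes>\<^bsub>B\<^esub> TS.\<delta> \<one>\<^bsub>G\<^esub> s \<otimes>\<^bsub>B\<^esub> TS.\<delta> g b = TS.\<delta> g (a \<otimes>\<^bsub>T\<^esub> s \<otimes>\<^bsub>T\<^esub> b)"
      using c g by (simp add: B_eq TS.\<delta>_mult TS.act_one)
    then show ?case
      using assms(5)[OF s(2,3) \<delta>_homog[OF gen(2), of "\<one>\<^bsub>G\<^esub>"] \<delta>_homog[OF gen(3), of g] gen(4)]
      by (simp add: skew_of_base_eq s(1))
  qed
  show ?thesis
    using xB
  proof (induction x rule: TS.skew_induct)
    case zero
    then show ?case using \<open>P \<zero>\<^bsub>B\<^esub>\<close> by (simp add: B_eq)
  next
    case (single g)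
    have "x g \<in> I" using \<pi>_zero_iff[OF B.homog_carrier[OF x(1)]] x(2) single by blast
    moreover have "tcmp m (x g) = x g" using x(1) single unfolding B_homog_iff T.homog_def by blast
    ultimately have "x g \<in> T.ideal_part Q m" using I_part[of "x g" m] by simp
    then show ?case using \<open>g \<in> carrier G\<close> by (intro \<open>\<And>g y. _ \<Longrightarrow> _ \<Longrightarrow> P (TS.\<delta> g y)\<close>)
  next
    case (add y z)
    then show ?case using assms(4) by (simp add: B_eq)
  qed
qed

lemma presentation: "presentation B bcmp R \<pi> \<sigma> (rels \<kappa>)"
proof (unfold presentation_def presentation_axioms_def, intro conjI allI impI)
  show "graded_alg Cring B bcmp" by (rule B.graded_alg_axioms)
  show "assoc_alg Cring R" by (rule R.assoc_alg_axioms)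
  show "\<pi> \<in> alg_hom Cring B R" by (rule \<pi>_hom)
  note \<pi>D = alg_homD[OF \<pi>_hom]
  fix r assume r: "r \<in> carrier R"
  then obtain f where f: "f \<in> carrier B" "r = \<pi> f" using R_rep by blast
  then show "\<sigma> r \<in> carrier B" by (auto simp: \<sigma>_\<pi> B_carrier_iff nf_facts)
  show "\<pi> (\<sigma> r) = r" using f by (auto simp: \<sigma>_\<pi>) (auto simp: \<pi>_def B_carrier_iff nf_class fun_eq_iff)
  show "\<sigma> (c \<odot>\<^bsub>R\<^esub> r) = c \<odot>\<^bsub>B\<^esub> \<sigma> r" for c
    using f B.smult_closed[of c f]
    by (simp add: \<pi>D(6)[symmetric] \<sigma>_\<pi>) (auto simp: B_eq skew_simps(6) nf_facts fun_eq_iff)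
  fix s assume s: "s \<in> carrier R"
  then obtain h where h: "h \<in> carrier B" "s = \<pi> h" using R_rep by blast
  show "\<sigma> (r \<oplus>\<^bsub>R\<^esub> s) = \<sigma> r \<oplus>\<^bsub>B\<^esub> \<sigma> s"
    using f h B.M.a_closed[of f h]
    by (simp add: \<pi>D(4)[symmetric] \<sigma>_\<pi>) (auto simp: B_eq skew_simps(5) nf_facts fun_eq_iff)
next
  fix x d assume x: "x \<in> carrier B" "\<pi> x = \<zero>\<^bsub>R\<^esub>"
  then show "\<pi> (bcmp d x) = \<zero>\<^bsub>R\<^esub>" using I_tcmp by (simp add: \<pi>_zero_iff B.cmp_closed[of x d])
next
  fix x d assume x: "x \<in> B.homog d"
  then show "\<sigma> (\<pi> x) \<in> B.homog d"
    using B.homog_carrier[OF x] nf_facts(1,4) by (auto simp: \<sigma>_\<pi> B_homog_iff B_carrier_iff)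
next
  fix \<rho> k assume "(\<rho>, k) \<in> rels \<kappa>"
  then obtain i j where ij: "i < n" "j < n" and \<rho>: "\<rho> = TS.\<delta> \<one>\<^bsub>G\<^esub> (qc i j)"
    and k: "k = skew_of_group_algebra T G (\<kappa> (v i) (v j))" unfolding rels_def skew_of_base_eq by blast
  show h: "\<rho> \<in> B.homog 2" unfolding \<rho> by (rule \<delta>_homog[OF qc_homog[OF ij]])
  show "k \<in> B.homog 0" unfolding k by (rule scalar_homog)
  have "qc i j \<in> I" unfolding I_eq using T.genideal_self[OF Q_carrier] ij by blast
  then show "\<pi> \<rho> = \<zero>\<^bsub>R\<^esub>"
    using \<pi>_zero_iff[OF B.homog_carrier[OF h]] I.zero_closed by (auto simp: \<rho> sgl_def)
next
  fix x m and P :: "('g \<Rightarrow> nat list \<Rightarrow> complex) \<Rightarrow> bool"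
  assume x: "x \<in> B.homog m" "\<pi> x = \<zero>\<^bsub>R\<^esub>" and P: "P \<zero>\<^bsub>B\<^esub>"
    "\<forall>u w. u \<in> carrier B \<longrightarrow> w \<in> carrier B \<longrightarrow> P u \<longrightarrow> P w \<longrightarrow> P (u \<oplus>\<^bsub>B\<^esub> w)"
    "\<forall>a \<rho> k b p q. (\<rho>, k) \<in> rels \<kappa> \<longrightarrow> a \<in> B.homog p \<longrightarrow> b \<in> B.homog q \<longrightarrow> p + q + 2 = m \<longrightarrow> P (a \<otimes>\<^bsub>B\<^esub> \<rho> \<otimes>\<^bsub>B\<^esub> b)"
  show "P x"
  proof (rule kernel_spanned[of x m P, OF x P(1)])
    fix i j a b p q assume "i < n" "j < n" "a \<in> B.homog p" "b \<in> B.homog q" "p + q + 2 = m"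
    then show "P (a \<otimes>\<^bsub>B\<^esub> skew_of_base T G (qc i j) \<otimes>\<^bsub>B\<^esub> b)"
      using P(3) unfolding rels_def by blast
  qed (use P(2) in blast)
qed

end

section \<open>The Hecke algebras and their deformations\<close>

lemma family_span_closed:
  fixes R :: "(complex, 'r) module" and u :: "'i \<Rightarrow> 'r"
  assumes "assoc_alg Cring R" and fin: "finite I" and u: "u \<in> I \<rightarrow> carrier R"
  defines "Sp \<equiv> {x. \<exists>c. x = (\<Oplus>\<^bsub>R\<^esub>i\<in>I. c i \<odot>\<^bsub>R\<^esub> u i)}"
  shows "\<zero>\<^bsub>R\<^esub> \<in> Sp" and "\<lbrakk>x \<in> Sp; y \<in> Sp\<rbrakk> \<Longrightarrow> x \<oplus>\<^bsub>R\<^esub> y \<in> Sp" and "j \<in> I \<Longrightarrow> c \<odot>\<^bsub>R\<^esub> u j \<in> Sp"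
proof -
  interpret R: assoc_alg Cring R by fact
  have uc: "u i \<in> carrier R" if "i \<in> I" for i using u that by auto
  have s0: "0 \<odot>\<^bsub>R\<^esub> x = \<zero>\<^bsub>R\<^esub>" if "x \<in> carrier R" for x using R.smult_l_null[OF that] by simp
  have "(\<Oplus>\<^bsub>R\<^esub>i\<in>I. 0 \<odot>\<^bsub>R\<^esub> u i) = \<zero>\<^bsub>R\<^esub>" using uc s0 by (intro R.M.add.finprod_one_eqI) auto
  then show "\<zero>\<^bsub>R\<^esub> \<in> Sp" unfolding Sp_def by (intro CollectI exI[of _ "\<lambda>_. 0"]) simp
  show "x \<oplus>\<^bsub>R\<^esub> y \<in> Sp" if "x \<in> Sp" "y \<in> Sp"
  proof -
    from that obtain a b where ab: "x = (\<Oplus>\<^bsub>R\<^esub>i\<in>I. a i \<odot>\<^bsub>R\<^esub> u i)" "y = (\<Oplus>\<^bsub>R\<^esub>i\<in>I. b i \<odot>\<^bsub>R\<^esub> u i)"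
      unfolding Sp_def by blast
    have "(\<Oplus>\<^bsub>R\<^esub>i\<in>I. (a i + b i) \<odot>\<^bsub>R\<^esub> u i) = (\<Oplus>\<^bsub>R\<^esub>i\<in>I. a i \<odot>\<^bsub>R\<^esub> u i \<oplus>\<^bsub>R\<^esub> b i \<odot>\<^bsub>R\<^esub> u i)"
      using uc R.smult_l_distr by (intro R.M.finsum_cong') auto
    also have "\<dots> = x \<oplus>\<^bsub>R\<^esub> y" unfolding ab by (intro R.M.finsum_addf) (use uc in auto)
    finally show ?thesis unfolding Sp_def by (intro CollectI exI[of _ "\<lambda>i. a i + b i"]) simp
  qed
  show "c \<odot>\<^bsub>R\<^esub> u j \<in> Sp" if j: "j \<in> I"
  proof -
    have "(\<Oplus>\<^bsub>R\<^esub>i\<in>I. (if j = i then c else 0) \<odot>\<^bsub>R\<^esub> u i) = (\<Oplus>\<^bsub>R\<^esub>i\<in>I. if j = i then c \<odot>\<^bsub>R\<^esub> u i else \<zero>\<^bsub>R\<^esub>)"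
      using uc s0 by (intro R.M.finsum_cong') auto
    also have "\<dots> = c \<odot>\<^bsub>R\<^esub> u j"
      using R.M.finsum_singleton[OF j fin, of "\<lambda>i. c \<odot>\<^bsub>R\<^esub> u i"] uc by auto
    finally show ?thesis unfolding Sp_def by (intro CollectI exI[of _ "\<lambda>i. if j = i then c else 0"]) simp
  qed
qed

context quantum_data
begin

lemma \<delta>_B:
  "a \<in> carrier T \<Longrightarrow> TS.\<delta> g a \<in> carrier B"
  "\<lbrakk>a \<in> carrier T; b \<in> carrier T\<rbrakk> \<Longrightarrow> TS.\<delta> g (a \<oplus>\<^bsub>T\<^esub> b) = TS.\<delta> g a \<oplus>\<^bsub>B\<^esub> TS.\<delta> g b"
  "a \<in> carrier T \<Longrightarrow> TS.\<delta> g (c \<odot>\<^bsub>T\<^esub> a) = c \<odot>\<^bsub>B\<^esub> TS.\<delta> g a"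
  "TS.\<delta> g \<zero>\<^bsub>T\<^esub> = \<zero>\<^bsub>B\<^esub>"
  "\<lbrakk>g \<in> carrier G; h \<in> carrier G; a \<in> carrier T; b \<in> carrier T\<rbrakk> \<Longrightarrow>
    TS.\<delta> g a \<otimes>\<^bsub>B\<^esub> TS.\<delta> h b = TS.\<delta> (g \<otimes>\<^bsub>G\<^esub> h) (a \<otimes>\<^bsub>T\<^esub> tm (act g) b)"
  "TS.\<delta> \<one>\<^bsub>G\<^esub> \<one>\<^bsub>T\<^esub> = \<one>\<^bsub>B\<^esub>"
  unfolding B_eq by (simp_all add: TS.\<delta>_add TS.\<delta>_smult TS.\<delta>_mult) (simp_all add: skew_simps sgl_def)

lemma \<pi>_facts:
  "f \<in> carrier B \<Longrightarrow> \<pi> f \<in> carrier R"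
  "\<lbrakk>f \<in> carrier B; h \<in> carrier B\<rbrakk> \<Longrightarrow> \<pi> (f \<otimes>\<^bsub>B\<^esub> h) = \<pi> f \<otimes>\<^bsub>R\<^esub> \<pi> h"
  "\<lbrakk>f \<in> carrier B; h \<in> carrier B\<rbrakk> \<Longrightarrow> \<pi> (f \<oplus>\<^bsub>B\<^esub> h) = \<pi> f \<oplus>\<^bsub>R\<^esub> \<pi> h"
  "f \<in> carrier B \<Longrightarrow> \<pi> (c \<odot>\<^bsub>B\<^esub> f) = c \<odot>\<^bsub>R\<^esub> \<pi> f"
  "\<pi> \<one>\<^bsub>B\<^esub> = \<one>\<^bsub>R\<^esub>" "\<pi> \<zero>\<^bsub>B\<^esub> = \<zero>\<^bsub>R\<^esub>"
  using alg_homD[OF \<pi>_hom] additive_map_zero[OF B.is_abelian_group R.is_abelian_group, of \<pi>] by simp_all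

subsection \<open>The Hecke algebra of a form\<close>

lemma hecke_relation_eq:
  assumes "i < n" "j < n"
  shows "hecke_relation G scale v n act q \<kappa> i j =
    mon B 0 (skew_of_base T G (qc i j)) \<ominus>\<^bsub>poly_algebra B\<^esub> mon B 1 (skew_of_group_algebra T G (\<kappa> (v i) (v j)))"
proof -
  have "skew_of_base T G (qc i j) \<in> carrier B"
    using B.homog_carrier[OF \<delta>_homog[OF qc_homog[OF assms], of "\<one>\<^bsub>G\<^esub>"]] by (simp add: skew_of_base_eq)
  moreover have "skew_of_group_algebra T G c \<in> carrier B" for c by (rule B.homog_carrier[OF scalar_homog])
  ultimately show ?thesis unfolding hecke_relation_def by (simp add: monom_eq_mon)
qed

lemma hecke_ideal_eq: "hecke_ideal G scale v n act q \<kappa> = presentation.J B (rels \<kappa>)"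
proof -
  have "{hecke_relation G scale v n act q \<kappa> i j | i j. i < n \<and> j < n} =
    {mon B 0 \<rho> \<ominus>\<^bsub>poly_algebra B\<^esub> mon B 1 k | \<rho> k. (\<rho>, k) \<in> rels \<kappa>}" (is "?L = ?R")
  proof (intro equalityI subsetI)
    fix x assume "x \<in> ?L"
    then obtain i j where "i < n" "j < n" "x = hecke_relation G scale v n act q \<kappa> i j" by blast
    then show "x \<in> ?R" unfolding rels_def using hecke_relation_eq by blast
  next
    fix x assume "x \<in> ?R"
    then obtain i j where ij: "i < n" "j < n" and
      "x = mon B 0 (skew_of_base T G (qc i j)) \<ominus>\<^bsub>poly_algebra B\<^esub> mon B 1 (skew_of_group_algebra T G (\<kappa> (v i) (v j)))"
      unfolding rels_def by blast
    then have "x = hecke_relation G scale v n act q \<kappa> i j" by (simp only: hecke_relation_eq[OF ij])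
    then show "x \<in> ?L" using ij by blast
  qed
  then show ?thesis unfolding hecke_ideal_def presentation.J_def[OF presentation] by (rule arg_cong)
qed

lemma hecke_algebra_eq:
  "hecke_algebra G scale v n act q \<kappa> = quotient_algebra (poly_algebra B) (presentation.J B (rels \<kappa>))"
  unfolding hecke_algebra_def hecke_ideal_eq ..

lemma hecke_filtration_eq: "hecke_filtration G scale v n act q \<kappa> = presentation.Fil B bcmp (rels \<kappa>)"
proof
  fix d
  interpret P: presentation B bcmp R \<pi> \<sigma> "rels \<kappa>" by (rule presentation)
  show "hecke_filtration G scale v n act q \<kappa> d = presentation.Fil B bcmp (rels \<kappa>) d"
    unfolding hecke_filtration_def hecke_ideal_eq B_below_eq[symmetric] P.poly_part_below P.Fil_def ..
qed

lemma quantum_skew_degree_Rdeg: "quantum_skew_degree G n q = presentation.Rdeg B bcmp \<pi>"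
  by (rule ext) (simp only: quantum_skew_degree_eq presentation.Rdeg_def[OF presentation[of "\<lambda>_ _ _. 0"]])

lemma quantum_Drinfeld_Hecke_iff:
  "quantum_Drinfeld_Hecke G scale v n act q \<alpha> \<kappa> \<longleftrightarrow>
   quantum_skew_form G scale v n q \<kappa> \<and> presentation.PBW B bcmp R \<pi> (rels \<kappa>)"
  unfolding quantum_Drinfeld_Hecke_def presentation.PBW_def[OF presentation] hecke_algebra_eq hecke_filtration_eq
    quantum_skew_degree_Rdeg ..

subsection \<open>Finite-dimensional components\<close>

text \<open>The images of the \<open>w g\<close> with \<open>g \<in> G\<close> and \<open>w\<close> a word of length \<open>d\<close> span degree \<open>d\<close>. Finiteness of \<open>G\<close> and of the
  basis of \<open>V\<close> enters here.\<close>

lemma Rdeg_spanned: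
  assumes r: "r \<in> \<pi> ` B.homog d"
  shows "\<exists>c. r = (\<Oplus>\<^bsub>R\<^esub>p\<in>carrier G \<times> {w. set w \<subseteq> {..<n} \<and> length w = nat d}.
    c p \<odot>\<^bsub>R\<^esub> \<pi> (TS.\<delta> (fst p) (sw 1 (snd p))))"
proof -
  let ?W = "{w. set w \<subseteq> {..<n} \<and> length w = nat d}"
  let ?u = "\<lambda>p. \<pi> (TS.\<delta> (fst p) (sw 1 (snd p)))"
  let ?S = "{x. \<exists>c. x = (\<Oplus>\<^bsub>R\<^esub>p\<in>carrier G \<times> ?W. c p \<odot>\<^bsub>R\<^esub> ?u p)}"
  have fin: "finite (carrier G \<times> ?W)" using finite_G finite_words by simp
  have uc: "?u \<in> carrier G \<times> ?W \<rightarrow> carrier R" by (auto simp: \<pi>_facts \<delta>_B)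
  note span = family_span_closed[OF R.assoc_alg_axioms fin uc]
  have single: "\<pi> (TS.\<delta> g (tcmp d x)) \<in> ?S" if g: "g \<in> carrier G" and x: "x \<in> carrier T" for g x
    using x
  proof (induction x rule: T_induct)
    case zero
    have "tcmp d (\<lambda>w. 0) = \<zero>\<^bsub>T\<^esub>" by (simp add: T_simps)
    then have "\<pi> (TS.\<delta> g (tcmp d (\<lambda>w. 0))) = \<zero>\<^bsub>R\<^esub>" by (simp only: \<delta>_B \<pi>_facts)
    then show ?case using span(1) by simp
  next
    case (word c w)
    show ?case
    proof (cases "int (length w) = d")
      case True
      have "tcmp d (sw c w) = c \<odot>\<^bsub>T\<^esub> sw 1 w" using True by (auto simp: sw_def T_simps)
      moreover have "TS.\<delta> g (c \<odot>\<^bsub>T\<^esub> sw 1 w) = c \<odot>\<^bsub>B\<^esub> TS.\<delta> g (sw 1 w)" using word by (intro \<delta>_B(3)) simp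
      ultimately have "\<pi> (TS.\<delta> g (tcmp d (sw c w))) = c \<odot>\<^bsub>R\<^esub> ?u (g, w)"
        using \<pi>_facts(4)[of "TS.\<delta> g (sw 1 w)" c] word by (simp add: \<delta>_B(1))
      moreover have "(g, w) \<in> carrier G \<times> ?W" using g word True by auto
      ultimately show ?thesis using span(3)[of "(g, w)" c] by simp
    next
      case False
      have "tcmp d (sw c w) = \<zero>\<^bsub>T\<^esub>" using False by (auto simp: sw_def T_simps)
      then have "\<pi> (TS.\<delta> g (tcmp d (sw c w))) = \<zero>\<^bsub>R\<^esub>" by (simp only: \<delta>_B \<pi>_facts)
      then show ?thesis using span(1) by simp
    qed
  next
    case (add x y)
    have e: "tcmp d (\<lambda>w. x w + y w) = tcmp d x \<oplus>\<^bsub>T\<^esub> tcmp d y" by (auto simp: T_simps(5))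
    have c: "tcmp d x \<in> carrier T" "tcmp d y \<in> carrier T" using T.cmp_closed add(1,2) by blast+
    have "\<pi> (TS.\<delta> g (tcmp d (\<lambda>w. x w + y w))) = \<pi> (TS.\<delta> g (tcmp d x)) \<oplus>\<^bsub>R\<^esub> \<pi> (TS.\<delta> g (tcmp d y))"
      unfolding e using c by (simp only: \<delta>_B(1,2) \<pi>_facts(3))
    then show ?case using span(2)[OF add(3,4)] by simp
  qed
  obtain f where f: "f \<in> B.homog d" "r = \<pi> f" using r by blast
  have fB: "f \<in> carrier TS.S" using B.homog_carrier[OF f(1)] unfolding B_eq .
  have "\<pi> f \<in> ?S"
    using fB
  proof (induction f rule: TS.skew_induct)
    case zero
    have "\<pi> \<zero>\<^bsub>TS.S\<^esub> = \<zero>\<^bsub>R\<^esub>" using \<pi>_facts(6) unfolding B_eq .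
    then show ?case using span(1) by simp
  next
    case (single g)
    have fg: "f g \<in> carrier T" "tcmp d (f g) = f g" using f(1) single unfolding B_homog_iff T.homog_def by blast+
    show ?case using \<open>\<And>g x. _ \<Longrightarrow> _ \<Longrightarrow> \<pi> (TS.\<delta> g (tcmp d x)) \<in> ?S\<close>[OF single fg(1)] unfolding fg(2) .
  next
    case (add y z)
    have "\<pi> (y \<oplus>\<^bsub>TS.S\<^esub> z) = \<pi> y \<oplus>\<^bsub>R\<^esub> \<pi> z" using \<pi>_facts(3)[of y z] add(1,2) unfolding B_eq by blast
    then show ?case using span(2)[OF add(3,4)] by simp
  qed
  then show ?thesis unfolding f(2) by (rule CollectD)
qed

lemma Rdeg_closed:
  "r \<in> \<pi> ` B.homog d \<Longrightarrow> r \<in> carrier R"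
  "\<zero>\<^bsub>R\<^esub> \<in> \<pi> ` B.homog d"
  "\<lbrakk>r \<in> \<pi> ` B.homog d; s \<in> \<pi> ` B.homog d\<rbrakk> \<Longrightarrow> r \<oplus>\<^bsub>R\<^esub> s \<in> \<pi> ` B.homog d"
  "r \<in> \<pi> ` B.homog d \<Longrightarrow> c \<odot>\<^bsub>R\<^esub> r \<in> \<pi> ` B.homog d"
proof -
  show "r \<in> \<pi> ` B.homog d \<Longrightarrow> r \<in> carrier R" using \<pi>_facts(1) B.homog_carrier by blast
  show "\<zero>\<^bsub>R\<^esub> \<in> \<pi> ` B.homog d" using \<pi>_facts(6) B.homog_zero by (rule image_eqI[OF sym])
  assume "r \<in> \<pi> ` B.homog d"
  then obtain f where f: "f \<in> B.homog d" "r = \<pi> f" by blast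
  note fc = B.homog_carrier[OF f(1)]
  have "c \<odot>\<^bsub>R\<^esub> r = \<pi> (c \<odot>\<^bsub>B\<^esub> f)" unfolding f(2) by (rule \<pi>_facts(4)[OF fc, symmetric])
  then show "c \<odot>\<^bsub>R\<^esub> r \<in> \<pi> ` B.homog d" using B.homog_smult[OF _ f(1), of c] by simp
  assume "s \<in> \<pi> ` B.homog d"
  then obtain h where h: "h \<in> B.homog d" "s = \<pi> h" by blast
  note hc = B.homog_carrier[OF h(1)]
  have "r \<oplus>\<^bsub>R\<^esub> s = \<pi> (f \<oplus>\<^bsub>B\<^esub> h)" unfolding f(2) h(2) by (rule \<pi>_facts(3)[OF fc hc, symmetric])
  then show "r \<oplus>\<^bsub>R\<^esub> s \<in> \<pi> ` B.homog d" using B.homog_add[OF f(1) h(1)] by simp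
qed

lemma Rdeg_surjective_injective:
  assumes "\<And>r. r \<in> \<pi> ` B.homog d \<Longrightarrow> f r \<in> \<pi> ` B.homog d"
    and "\<And>r s. \<lbrakk>r \<in> \<pi> ` B.homog d; s \<in> \<pi> ` B.homog d\<rbrakk> \<Longrightarrow> f (r \<oplus>\<^bsub>R\<^esub> s) = f r \<oplus>\<^bsub>R\<^esub> f s"
    and "\<And>c r. r \<in> \<pi> ` B.homog d \<Longrightarrow> f (c \<odot>\<^bsub>R\<^esub> r) = c \<odot>\<^bsub>R\<^esub> f r"
    and "\<pi> ` B.homog d \<subseteq> f ` \<pi> ` B.homog d"
  shows "\<forall>r\<in>\<pi> ` B.homog d. f r = \<zero>\<^bsub>R\<^esub> \<longrightarrow> r = \<zero>\<^bsub>R\<^esub>"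
proof (cases "d < 0")
  case True
  then have "B.homog d \<subseteq> {\<zero>\<^bsub>B\<^esub>}" using B.homog_neg by blast
  then show ?thesis using \<pi>_facts(6) by blast
next
  case False
  let ?W = "{w. set w \<subseteq> {..<n} \<and> length w = nat d}"
  have fin: "finite (carrier G \<times> ?W)" using finite_G finite_words by simp
  have sub: "\<pi> ` B.homog d \<subseteq> carrier R" using Rdeg_closed(1) by blast
  have "\<pi> (TS.\<delta> g (sw 1 w)) \<in> \<pi> ` B.homog d" if "w \<in> ?W" for g w
  proof -
    have "sw 1 w \<in> carrier T" using that by simp
    moreover have "tcmp d (sw 1 w) = sw 1 w" using that False by (auto simp: sw_def)
    ultimately have "sw 1 w \<in> T.homog d" unfolding T.homog_def by blast
    then show ?thesis by (intro imageI \<delta>_homog)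
  qed
  then have u: "(\<lambda>p. \<pi> (TS.\<delta> (fst p) (sw 1 (snd p)))) \<in> carrier G \<times> ?W \<rightarrow> \<pi> ` B.homog d" by auto
  show ?thesis
    by (rule surjective_endomorphism_injective[OF R.assoc_alg_axioms sub fin u Rdeg_spanned Rdeg_closed(2) Rdeg_closed(3)
      Rdeg_closed(4) assms])
qed

subsection \<open>Hecke algebras are deformations\<close>

text \<open>Finite dimension turns the abstract isomorphism in the definition of a quantum Drinfeld Hecke algebra into
  injectivity of the concrete map \<open>sec\<close>, along which the multiplication is transported.\<close>

lemma hecke_algebra_is_deformation:
  assumes "quantum_Drinfeld_Hecke G scale v n act q \<alpha> \<kappa>"
  shows "\<exists>\<mu> D. deformation R \<mu> D \<and>
    (\<forall>i\<ge>1. homogeneous_of_degree (quantum_skew_degree G n q) (- 2 * int i) (\<mu> i)) \<and>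
    algebra_isomorphic (UP Cring) (hecke_algebra G scale v n act q \<kappa>) D"
proof -
  interpret P: presentation B bcmp R \<pi> \<sigma> "rels \<kappa>" by (rule presentation)
  have PBW: "P.PBW" using assms unfolding quantum_Drinfeld_Hecke_iff by (rule conjunct2)
  have "P.sec_inj"
  proof (rule P.sec_inj_if_leading_term_inj)
    fix d x assume x: "x \<in> carrier P.Rt" "P.\<sigma>t x \<in> P.Bt.homog d" "P.sec x \<in> P.Fil (d - 1)"
    show "x = \<zero>\<^bsub>P.Rt\<^esub>"
      by (rule P.PBW_imp_leading_term_inj[OF PBW _ x]) (unfold P.Rdeg_def, rule Rdeg_surjective_injective)
  qed
  from P.deformation_if_sec_inj[OF this] show ?thesis unfolding hecke_algebra_eq quantum_skew_degree_Rdeg .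
qed

end

section \<open>Every graded deformation is a Hecke algebra\<close>

text \<open>Restriction of scalars from \<open>\<complex>[t]\<close> to \<open>\<complex>\<close>.\<close>

definition const_scalars :: "(nat \<Rightarrow> complex, 'd) module \<Rightarrow> (complex, 'd) module" where
  "const_scalars D = \<lparr>carrier = carrier D, monoid.mult = monoid.mult D, monoid.one = monoid.one D,
     ring.zero = ring.zero D, ring.add = ring.add D, module.smult = (\<lambda>c x. mon Cring 0 c \<odot>\<^bsub>D\<^esub> x)\<rparr>"

lemma const_scalars_simps [simp]:
  "carrier (const_scalars D) = carrier D" "(\<otimes>\<^bsub>const_scalars D\<^esub>) = (\<otimes>\<^bsub>D\<^esub>)" "\<one>\<^bsub>const_scalars D\<^esub> = \<one>\<^bsub>D\<^esub>"
  "\<zero>\<^bsub>const_scalars D\<^esub> = \<zero>\<^bsub>D\<^esub>" "(\<oplus>\<^bsub>const_scalars D\<^esub>) = (\<oplus>\<^bsub>D\<^esub>)"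
  "c \<odot>\<^bsub>const_scalars D\<^esub> x = mon Cring 0 c \<odot>\<^bsub>D\<^esub> x"
  by (simp_all add: const_scalars_def)

lemma const_scalars_assoc_alg:
  assumes "assoc_alg (UP Cring) D"
  shows "assoc_alg Cring (const_scalars D)"
proof -
  interpret D: assoc_alg "UP Cring" D by fact
  have C: "cring Cring" by (rule assoc_alg.axioms(1)[OF T_assoc_alg, THEN module.axioms(1)])
  interpret UPC: UP_cring Cring "UP Cring" by (rule UP_cring.intro[OF C])
  have ring: "ring (const_scalars D)" by (rule ring_same_operations[OF D.ring_axioms]) simp_all
  have add: "mon Cring 0 (a + b) = mon Cring 0 a \<oplus>\<^bsub>UP Cring\<^esub> mon Cring 0 b" for a b
    using UPC.monom_add[of a b 0] by (simp add: monom_eq_mon)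
  have mult: "mon Cring 0 (a * b) = mon Cring 0 a \<otimes>\<^bsub>UP Cring\<^esub> mon Cring 0 b" for a b
    using UPC.monom_mult[of a b 0 0] by (simp add: monom_eq_mon)
  have one: "mon Cring 0 1 = \<one>\<^bsub>UP Cring\<^esub>"
    using UPC.monom_one by (simp add: monom_eq_mon)
  have "module Cring (const_scalars D)"
    by (rule moduleI[OF C ring.is_abelian_group[OF ring]])
      (simp_all add: add mult one D.smult_l_distr D.smult_r_distr D.smult_assoc1)
  then show ?thesis
    unfolding assoc_alg_def assoc_alg_axioms_def using ring by (simp add: D.smult_mult_left D.smult_mult_right)
qed

lemma T_generated_induct [consumes 1, case_names zero one gen mult smult add]:
  assumes x: "x \<in> carrier (tensor_algebra n)" and zero: "P \<zero>\<^bsub>tensor_algebra n\<^esub>" and one: "P \<one>\<^bsub>tensor_algebra n\<^esub>"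
    and gen: "\<And>i. i < n \<Longrightarrow> P (gen i)"
    and mult: "\<And>x y. \<lbrakk>x \<in> carrier (tensor_algebra n); y \<in> carrier (tensor_algebra n); P x; P y\<rbrakk> \<Longrightarrow> P (x \<otimes>\<^bsub>tensor_algebra n\<^esub> y)"
    and smult: "\<And>c x. \<lbrakk>x \<in> carrier (tensor_algebra n); P x\<rbrakk> \<Longrightarrow> P (c \<odot>\<^bsub>tensor_algebra n\<^esub> x)"
    and add: "\<And>x y. \<lbrakk>x \<in> carrier (tensor_algebra n); y \<in> carrier (tensor_algebra n); P x; P y\<rbrakk> \<Longrightarrow> P (x \<oplus>\<^bsub>tensor_algebra n\<^esub> y)"
  shows "P x"
  using x
proof (induction x rule: T_induct)
  case zero
  then show ?case using assms(2) by (simp add: T_simps(4))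
next
  case (word c w)
  have "P (sw 1 w)"
    using word
  proof (induction w)
    case Nil
    then show ?case using one by (simp add: T_simps(3))
  next
    case (Cons i w)
    then have "P (gen i \<otimes>\<^bsub>tensor_algebra n\<^esub> sw 1 w)" by (intro mult gen) (simp_all add: gen_eq_sw)
    then show ?case by (simp add: gen_eq_sw sw_mult)
  qed
  then have "P (c \<odot>\<^bsub>tensor_algebra n\<^esub> sw 1 w)" using word by (intro smult) simp_all
  moreover have "c \<odot>\<^bsub>tensor_algebra n\<^esub> sw 1 w = sw c w" by (auto simp: T_simps sw_def)
  ultimately show ?case by simp
next
  case (add x y)
  then show ?case using assms(7)[of x y] by (simp add: T_simps(5))
qed

locale quantum_deformation = quantum_data G scale v n act q \<alpha>
  for G :: "('g, 'm) monoid_scheme" and scale :: "complex \<Rightarrow> 'v \<Rightarrow> 'v :: ab_group_add"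
    and v n act q \<alpha> +
  fixes \<mu> and D :: "(nat \<Rightarrow> complex, nat \<Rightarrow> 'g \<Rightarrow> (nat list \<Rightarrow> complex) set) module"
  assumes deform_D: "deformation R \<mu> D"
    and degree_\<mu>: "i \<ge> 1 \<Longrightarrow> homogeneous_of_degree (quantum_skew_degree G n q) (- 2 * int i) (\<mu> i)"
begin

abbreviation "Rd d \<equiv> \<pi> ` B.homog d"

lemma Rd_more:
  "\<lbrakk>r \<in> Rd d; d < 0\<rbrakk> \<Longrightarrow> r = \<zero>\<^bsub>R\<^esub>"
  "\<lbrakk>r \<in> Rd a; s \<in> Rd b\<rbrakk> \<Longrightarrow> r \<otimes>\<^bsub>R\<^esub> s \<in> Rd (a + b)"
  "\<one>\<^bsub>R\<^esub> \<in> Rd 0"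
proof -
  show "\<one>\<^bsub>R\<^esub> \<in> Rd 0" using \<pi>_facts(5) B.one_homog by (rule image_eqI[OF sym])
  show "\<lbrakk>r \<in> Rd d; d < 0\<rbrakk> \<Longrightarrow> r = \<zero>\<^bsub>R\<^esub>" using B.homog_neg \<pi>_facts(6) by blast
  assume "r \<in> Rd a" "s \<in> Rd b"
  then obtain f h where f: "f \<in> B.homog a" "r = \<pi> f" and h: "h \<in> B.homog b" "s = \<pi> h" by blast
  have "r \<otimes>\<^bsub>R\<^esub> s = \<pi> (f \<otimes>\<^bsub>B\<^esub> h)"
    unfolding f(2) h(2) by (rule \<pi>_facts(2)[OF B.homog_carrier[OF f(1)] B.homog_carrier[OF h(1)], symmetric])
  then show "r \<otimes>\<^bsub>R\<^esub> s \<in> Rd (a + b)" using B.homog_mult[OF f(1) h(1)] by simp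
qed

sublocale GD: graded_deformation R "\<lambda>d. \<pi> ` B.homog d" \<mu> D
proof (unfold graded_deformation_def graded_deformation_axioms_def, intro conjI allI impI)
  show "assoc_alg Cring R" by (rule R.assoc_alg_axioms)
  show "deformation R \<mu> D" by (rule deform_D)
  have e: "(\<lambda>d. \<pi> ` B.homog d) = quantum_skew_degree G n q" by (rule ext) (rule quantum_skew_degree_eq[symmetric])
  show "homogeneous_of_degree (\<lambda>d. \<pi> ` B.homog d) (- 2 * int i) (\<mu> i)" if "1 \<le> i" for i
    unfolding e by (rule degree_\<mu>[OF that])
qed (erule Rdeg_closed Rd_more | rule Rdeg_closed Rd_more | assumption)+

abbreviation "D0 \<equiv> const_scalars D"

sublocale D0: assoc_alg Cring D0 by (rule const_scalars_assoc_alg[OF GD.D.assoc_alg_axioms])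

lemma Dd_below_two: "\<lbrakk>x \<in> GD.Dd m; m < 2\<rbrakk> \<Longrightarrow> x = mon R 0 (x 0)"
proof
  fix k assume x: "x \<in> GD.Dd m" and "m < 2"
  have "x k = \<zero>\<^bsub>R\<^esub>" if "k \<noteq> 0"
    by (rule Rd_more(1)[of _ "m - 2 * int k"]) (use x that \<open>m < 2\<close> in \<open>simp_all add: GD.Dd_def\<close>)
  then show "x k = mon R 0 (x 0) k" by (simp add: mon_def)
qed

lemma Dd_two: "\<lbrakk>x \<in> GD.Dd 2; x 0 = \<zero>\<^bsub>R\<^esub>\<rbrakk> \<Longrightarrow> x = mon R 1 (x 1)"
proof
  fix k assume x: "x \<in> GD.Dd 2" and x0: "x 0 = \<zero>\<^bsub>R\<^esub>"
  have "x k = \<zero>\<^bsub>R\<^esub>" if "k \<noteq> 1"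
  proof (cases "k = 0")
    case False
    with that have "2 - 2 * int k < 0" by simp
    then show ?thesis using x by (intro Rd_more(1)[of _ "2 - 2 * int k"]) (simp_all add: GD.Dd_def)
  qed (simp add: x0)
  then show "x k = mon R 1 (x 1) k" by (simp add: mon_def)
qed

text \<open>The constant polynomial \<open>a g\<close>. In \<open>D\<close> it is a substitute for the product only if the degree of \<open>a\<close> is at most one.\<close>

definition "lift g a = mon R 0 (\<pi> (TS.\<delta> g a))"

lemma lift_closed [simp]: "a \<in> carrier T \<Longrightarrow> lift g a \<in> carrier D"
  unfolding lift_def by (simp add: GD.D_simps(1) \<pi>_facts \<delta>_B)

lemma lift_Dd: "a \<in> T.homog d \<Longrightarrow> lift g a \<in> GD.Dd d"
  unfolding lift_def by (intro GD.Dd_const imageI \<delta>_homog)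

lemma lift_add: "\<lbrakk>a \<in> carrier T; b \<in> carrier T\<rbrakk> \<Longrightarrow> lift g (a \<oplus>\<^bsub>T\<^esub> b) = lift g a \<oplus>\<^bsub>D\<^esub> lift g b"
  unfolding lift_def by (simp add: GD.D_simps(3) \<pi>_facts \<delta>_B R.mon_add)

lemma lift_smult: "a \<in> carrier T \<Longrightarrow> lift g (c \<odot>\<^bsub>T\<^esub> a) = mon Cring 0 c \<odot>\<^bsub>D\<^esub> lift g a"
  unfolding lift_def by (simp add: GD.D_simps(4) \<pi>_facts \<delta>_B R.smult_mon_mon)

lemma lift_zero: "lift g \<zero>\<^bsub>T\<^esub> = \<zero>\<^bsub>D\<^esub>"
  unfolding lift_def \<delta>_B(4) \<pi>_facts(6) by (auto simp: GD.D_simps(2) poly_algebra_simps mon_def)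

text \<open>In total degree below two products are those of \<open>R\<close>. In particular the group algebra, and its products with \<open>V\<close>, sit undeformed
  inside \<open>D\<close>.\<close>

lemma lift_mult:
  assumes "g \<in> carrier G" "h \<in> carrier G" "a \<in> T.homog d" "b \<in> T.homog e" "d + e < 2"
  shows "lift g a \<otimes>\<^bsub>D\<^esub> lift h b = lift (g \<otimes>\<^bsub>G\<^esub> h) (a \<otimes>\<^bsub>T\<^esub> tm (act g) b)"
proof -
  have c: "a \<in> carrier T" "b \<in> carrier T" using assms T.homog_carrier by blast+
  have "lift g a \<otimes>\<^bsub>D\<^esub> lift h b = mon R 0 (\<pi> (TS.\<delta> g a) \<otimes>\<^bsub>R\<^esub> \<pi> (TS.\<delta> h b))"
    unfolding lift_def by (rule GD.const_mult_low[OF _ _ assms(5)]) (intro imageI \<delta>_homog assms)+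
  also have "\<pi> (TS.\<delta> g a) \<otimes>\<^bsub>R\<^esub> \<pi> (TS.\<delta> h b) = \<pi> (TS.\<delta> (g \<otimes>\<^bsub>G\<^esub> h) (a \<otimes>\<^bsub>T\<^esub> tm (act g) b))"
    using \<delta>_B(5)[OF assms(1,2) c] \<pi>_facts(2)[OF \<delta>_B(1)[OF c(1)] \<delta>_B(1)[OF c(2)], of g h] by simp
  finally show ?thesis unfolding lift_def .
qed

lemma lift_one: "lift \<one>\<^bsub>G\<^esub> \<one>\<^bsub>T\<^esub> = \<one>\<^bsub>D\<^esub>"
  unfolding lift_def \<delta>_B(6) \<pi>_facts(5) GD.one_eq ..

subsection \<open>The homomorphism from the free algebra\<close>

lemma gen_closed: "i < n \<Longrightarrow> gen i \<in> carrier T" by (rule T.homog_carrier[OF gen_homog])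

sublocale TE: tensor_extension D0 n "\<lambda>i. lift \<one>\<^bsub>G\<^esub> (gen i)"
  by unfold_locales (simp add: gen_closed)

lemma tens_facts:
  "x \<in> carrier T \<Longrightarrow> TE.tens x \<in> carrier D"
  "\<lbrakk>x \<in> carrier T; y \<in> carrier T\<rbrakk> \<Longrightarrow> TE.tens (x \<otimes>\<^bsub>T\<^esub> y) = TE.tens x \<otimes>\<^bsub>D\<^esub> TE.tens y"
  "\<lbrakk>x \<in> carrier T; y \<in> carrier T\<rbrakk> \<Longrightarrow> TE.tens (x \<oplus>\<^bsub>T\<^esub> y) = TE.tens x \<oplus>\<^bsub>D\<^esub> TE.tens y"
  "x \<in> carrier T \<Longrightarrow> TE.tens (c \<odot>\<^bsub>T\<^esub> x) = mon Cring 0 c \<odot>\<^bsub>D\<^esub> TE.tens x"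
  "TE.tens \<one>\<^bsub>T\<^esub> = \<one>\<^bsub>D\<^esub>" "TE.tens \<zero>\<^bsub>T\<^esub> = \<zero>\<^bsub>D\<^esub>"
  using alg_homD[OF TE.tens_hom] TE.tens_zero by (simp_all add: T_simps(4))

text \<open>In degree one the homomorphism and \<open>lift\<close> agree on generators, hence everywhere; this is needed because the
  group sends a generator to a linear combination of generators.\<close>

lemma tens_linear: "x \<in> T.homog 1 \<Longrightarrow> TE.tens x = lift \<one>\<^bsub>G\<^esub> x"
proof -
  assume x: "x \<in> T.homog 1"
  have "TE.tens (tcmp 1 y) = lift \<one>\<^bsub>G\<^esub> (tcmp 1 y)" if "y \<in> carrier T" for y
    using that
  proof (induction y rule: T_induct)
    case zero
    have "tcmp 1 (\<lambda>w. 0) = \<zero>\<^bsub>T\<^esub>" by (simp add: T_simps)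
    then show ?case by (simp only: tens_facts lift_zero)
  next
    case (word c w)
    show ?case
    proof (cases "length w = 1")
      case True
      then obtain i where w: "w = [i]" by (auto simp: length_Suc_conv)
      have i: "i < n" using word w by simp
      have "tcmp 1 (sw c w) = c \<odot>\<^bsub>T\<^esub> gen i" by (auto simp: w sw_def gen_def T_simps)
      then show ?thesis using TE.tens_gen[OF i] by (simp only: tens_facts(4) lift_smult gen_closed[OF i])
    next
      case False
      then have "tcmp 1 (sw c w) = \<zero>\<^bsub>T\<^esub>" by (auto simp: sw_def T_simps)
      then show ?thesis by (simp only: tens_facts lift_zero)
    qed
  next
    case (add y z)
    have e: "tcmp 1 (\<lambda>w. y w + z w) = tcmp 1 y \<oplus>\<^bsub>T\<^esub> tcmp 1 z" by (auto simp: T_simps(5))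
    have c: "tcmp 1 y \<in> carrier T" "tcmp 1 z \<in> carrier T" using T.cmp_closed add(1,2) by blast+
    show ?case unfolding e using c add(3,4) by (simp only: tens_facts(3) lift_add)
  qed
  from this[of x] show ?thesis using x unfolding T.homog_def by simp
qed

lemma tens_Dd: "x \<in> T.homog m \<Longrightarrow> TE.tens x \<in> GD.Dd m"
proof -
  assume x: "x \<in> T.homog m"
  have word: "TE.tens (sw 1 w) \<in> GD.Dd (int (length w))" if "set w \<subseteq> {..<n}" for w
    using that
  proof (induction w)
    case Nil
    have "TE.tens \<one>\<^bsub>T\<^esub> \<in> GD.Dd 0" unfolding tens_facts(5) GD.one_eq by (rule GD.Dd_const[OF Rd_more(3)])
    then show ?case unfolding T_simps(3) list.size(3) of_nat_0 .
  next
    case (Cons i w)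
    then have i: "i < n" and w: "sw 1 w \<in> carrier T" and sub: "set w \<subseteq> {..<n}" by simp_all
    have "lift \<one>\<^bsub>G\<^esub> (gen i) \<otimes>\<^bsub>D\<^esub> TE.tens (sw 1 w) \<in> GD.Dd (1 + int (length w))"
      by (rule GD.Dd_mult[OF lift_Dd[OF gen_homog[OF i]] Cons(1)[OF sub]])
    moreover have "TE.tens (sw 1 (i # w)) = lift \<one>\<^bsub>G\<^esub> (gen i) \<otimes>\<^bsub>D\<^esub> TE.tens (sw 1 w)"
      using tens_facts(2)[OF gen_closed[OF i] w] TE.tens_gen[OF i] by (simp add: gen_eq_sw sw_mult)
    moreover have "int (length (i # w)) = 1 + int (length w)" by simp
    ultimately show ?case by (simp only:)
  qed
  have "TE.tens (tcmp m y) \<in> GD.Dd m" if "y \<in> carrier T" for y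
    using that
  proof (induction y rule: T_induct)
    case zero
    have "tcmp m (\<lambda>w. 0) = \<zero>\<^bsub>T\<^esub>" by (simp add: T_simps)
    then show ?case by (simp only: tens_facts GD.Dd_zero)
  next
    case (word c w)
    show ?case
    proof (cases "int (length w) = m")
      case True
      have "tcmp m (sw c w) = c \<odot>\<^bsub>T\<^esub> sw 1 w" using True by (auto simp: sw_def T_simps)
      moreover have "sw 1 w \<in> carrier T" using word by simp
      ultimately show ?thesis
        using GD.Dd_smult[OF \<open>\<And>w. _ \<Longrightarrow> TE.tens (sw 1 w) \<in> _\<close>[OF word], of c] True by (simp only: tens_facts(4))
    next
      case False
      then have "tcmp m (sw c w) = \<zero>\<^bsub>T\<^esub>" by (auto simp: sw_def T_simps)
      then show ?thesis by (simp only: tens_facts GD.Dd_zero)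
    qed
  next
    case (add y z)
    have e: "tcmp m (\<lambda>w. y w + z w) = tcmp m y \<oplus>\<^bsub>T\<^esub> tcmp m z" by (auto simp: T_simps(5))
    have c: "tcmp m y \<in> carrier T" "tcmp m z \<in> carrier T" using T.cmp_closed add(1,2) by blast+
    show ?case unfolding e tens_facts(3)[OF c] by (rule GD.Dd_add[OF add(3,4)])
  qed
  from this[of x] show ?thesis using x unfolding T.homog_def by simp
qed

text \<open>Only the case of a generator has content, and there all products have degree one and are undeformed.\<close>

lemma tens_intertwine:
  assumes g: "g \<in> carrier G" and a: "a \<in> carrier T"
  shows "lift g \<one>\<^bsub>T\<^esub> \<otimes>\<^bsub>D\<^esub> TE.tens a = TE.tens (tm (act g) a) \<otimes>\<^bsub>D\<^esub> lift g \<one>\<^bsub>T\<^esub>"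
  using a
proof (induction a rule: T_generated_induct)
  note tD = alg_homD[OF tm_hom[of "act g"]]
  have u: "lift g \<one>\<^bsub>T\<^esub> \<in> carrier D" by simp
  {
    case zero
    have "tm (act g) \<zero>\<^bsub>T\<^esub> = \<zero>\<^bsub>T\<^esub>" by (simp add: T_simps(4) tm_zero)
    then show ?case by (simp add: tens_facts)
  next
    case one
    then show ?case using tD(5) by (simp add: tens_facts)
  next
    case (gen i)
    let ?y = "tov (act g (v i))"
    have y: "?y \<in> T.homog 1" "?y \<in> carrier T" using tov_homog tov_closed by blast+
    have "lift g \<one>\<^bsub>T\<^esub> \<otimes>\<^bsub>D\<^esub> lift \<one>\<^bsub>G\<^esub> (gen i) = lift (g \<otimes>\<^bsub>G\<^esub> \<one>\<^bsub>G\<^esub>) (\<one>\<^bsub>T\<^esub> \<otimes>\<^bsub>T\<^esub> tm (act g) (gen i))"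
      by (rule lift_mult[OF g _ T.one_homog gen_homog[OF gen]]) simp_all
    also have "\<dots> = lift g ?y" using g y gen by (simp add: tm_gen)
    also have "\<dots> = lift (\<one>\<^bsub>G\<^esub> \<otimes>\<^bsub>G\<^esub> g) (?y \<otimes>\<^bsub>T\<^esub> tm (act \<one>\<^bsub>G\<^esub>) \<one>\<^bsub>T\<^esub>)"
      using g y alg_homD(5)[OF tm_hom[of "act \<one>\<^bsub>G\<^esub>"]] by simp
    also have "\<dots> = lift \<one>\<^bsub>G\<^esub> ?y \<otimes>\<^bsub>D\<^esub> lift g \<one>\<^bsub>T\<^esub>"
      by (rule lift_mult[OF _ g y(1) T.one_homog, symmetric]) simp_all
    finally show ?case using gen TE.tens_gen[OF gen] tens_linear[OF y(1)] by (simp add: tm_gen)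
  next
    case (mult x y)
    have c: "TE.tens x \<in> carrier D" "TE.tens y \<in> carrier D" "tm (act g) x \<in> carrier T" "tm (act g) y \<in> carrier T"
      "TE.tens (tm (act g) x) \<in> carrier D" "TE.tens (tm (act g) y) \<in> carrier D"
      using mult(1,2) tD(2) tens_facts(1) by blast+
    have "lift g \<one>\<^bsub>T\<^esub> \<otimes>\<^bsub>D\<^esub> (TE.tens x \<otimes>\<^bsub>D\<^esub> TE.tens y) = (lift g \<one>\<^bsub>T\<^esub> \<otimes>\<^bsub>D\<^esub> TE.tens x) \<otimes>\<^bsub>D\<^esub> TE.tens y"
      using u c by (simp add: GD.D.m_assoc)
    also have "\<dots> = TE.tens (tm (act g) x) \<otimes>\<^bsub>D\<^esub> (lift g \<one>\<^bsub>T\<^esub> \<otimes>\<^bsub>D\<^esub> TE.tens y)"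
      unfolding mult(3) using u c by (simp add: GD.D.m_assoc)
    also have "\<dots> = (TE.tens (tm (act g) x) \<otimes>\<^bsub>D\<^esub> TE.tens (tm (act g) y)) \<otimes>\<^bsub>D\<^esub> lift g \<one>\<^bsub>T\<^esub>"
      unfolding mult(4) using u c by (simp add: GD.D.m_assoc)
    finally show ?case using mult(1,2) c by (simp add: tens_facts tD(3))
  next
    case (smult c x)
    have "TE.tens x \<in> carrier D" "tm (act g) x \<in> carrier T" "TE.tens (tm (act g) x) \<in> carrier D"
      using smult(1) tD(2) tens_facts(1) by blast+
    then show ?case using smult u by (simp add: tens_facts tD(6) GD.D.smult_mult_left GD.D.smult_mult_right)
  next
    case (add x y)
    have "TE.tens x \<in> carrier D" "TE.tens y \<in> carrier D" "tm (act g) x \<in> carrier T" "tm (act g) y \<in> carrier T"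
      "TE.tens (tm (act g) x) \<in> carrier D" "TE.tens (tm (act g) y) \<in> carrier D"
      using add(1,2) tD(2) tens_facts(1) by blast+
    then show ?case using add u by (simp add: tens_facts tD(4) GD.D.l_distr GD.D.r_distr)
  }
qed

sublocale SE: skew_extension Cring T G "\<lambda>g. tm (act g)" D0 TE.tens "\<lambda>g. lift g \<one>\<^bsub>T\<^esub>"
proof (unfold skew_extension_def skew_extension_axioms_def, intro conjI allI impI)
  show "skew_algebra Cring T G (\<lambda>g. tm (act g))" by (rule tm_skew)
  show "assoc_alg Cring D0" by (rule D0.assoc_alg_axioms)
  show "TE.tens \<in> alg_hom Cring T D0" by (rule TE.tens_hom)
  show "lift g \<one>\<^bsub>T\<^esub> \<in> carrier D0" for g by simp
  show "lift \<one>\<^bsub>G\<^esub> \<one>\<^bsub>T\<^esub> = \<one>\<^bsub>D0\<^esub>" by (simp add: lift_one)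
  show "lift (g \<otimes>\<^bsub>G\<^esub> h) \<one>\<^bsub>T\<^esub> = lift g \<one>\<^bsub>T\<^esub> \<otimes>\<^bsub>D0\<^esub> lift h \<one>\<^bsub>T\<^esub>"
    if "g \<in> carrier G" "h \<in> carrier G" for g h
    using lift_mult[OF that T.one_homog T.one_homog] alg_homD(5)[OF tm_hom[of "act g"]] by simp
  show "lift g \<one>\<^bsub>T\<^esub> \<otimes>\<^bsub>D0\<^esub> TE.tens a = TE.tens (tm (act g) a) \<otimes>\<^bsub>D0\<^esub> lift g \<one>\<^bsub>T\<^esub>"
    if "g \<in> carrier G" "a \<in> carrier T" for g a
    using tens_intertwine[OF that] by simp
qed

abbreviation "\<psi> \<equiv> SE.ext"

lemma \<psi>_facts:
  "x \<in> carrier B \<Longrightarrow> \<psi> x \<in> carrier D"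
  "\<lbrakk>x \<in> carrier B; y \<in> carrier B\<rbrakk> \<Longrightarrow> \<psi> (x \<otimes>\<^bsub>B\<^esub> y) = \<psi> x \<otimes>\<^bsub>D\<^esub> \<psi> y"
  "\<lbrakk>x \<in> carrier B; y \<in> carrier B\<rbrakk> \<Longrightarrow> \<psi> (x \<oplus>\<^bsub>B\<^esub> y) = \<psi> x \<oplus>\<^bsub>D\<^esub> \<psi> y"
  "\<psi> \<one>\<^bsub>B\<^esub> = \<one>\<^bsub>D\<^esub>"
  "x \<in> carrier B \<Longrightarrow> \<psi> (c \<odot>\<^bsub>B\<^esub> x) = mon Cring 0 c \<odot>\<^bsub>D\<^esub> \<psi> x"
  "\<psi> \<zero>\<^bsub>B\<^esub> = \<zero>\<^bsub>D\<^esub>"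
  using alg_homD[OF SE.ext_hom] SE.ext_zero unfolding B_eq by simp_all

lemma \<psi>_single: "\<lbrakk>g \<in> carrier G; a \<in> carrier T\<rbrakk> \<Longrightarrow> \<psi> (TS.\<delta> g a) = TE.tens a \<otimes>\<^bsub>D\<^esub> lift g \<one>\<^bsub>T\<^esub>"
  using SE.ext_single by simp

lemma \<psi>_Dd:
  assumes z: "z \<in> B.homog m"
  shows "\<psi> z \<in> GD.Dd m"
proof -
  have "z \<in> carrier TS.S" using B.homog_carrier[OF z] unfolding B_eq .
  then show ?thesis
  proof (induction z rule: TS.skew_induct)
    case zero
    have "\<psi> \<zero>\<^bsub>B\<^esub> \<in> GD.Dd m" unfolding \<psi>_facts(6) by (rule GD.Dd_zero)
    then show ?case unfolding B_eq .
  next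
    case (single g)
    then have zg: "z g \<in> T.homog m" using z unfolding B_homog_iff by blast
    have "TE.tens (z g) \<otimes>\<^bsub>D\<^esub> lift g \<one>\<^bsub>T\<^esub> \<in> GD.Dd (m + 0)"
      by (intro GD.Dd_mult tens_Dd zg lift_Dd T.one_homog)
    then show ?case by (simp only: \<psi>_single[OF single T.homog_carrier[OF zg]] add_0_right)
  next
    case (add y z)
    have "\<psi> (y \<oplus>\<^bsub>TS.S\<^esub> z) = \<psi> y \<oplus>\<^bsub>D\<^esub> \<psi> z" using \<psi>_facts(3)[of y z] add(1,2) unfolding B_eq .
    then show ?case using GD.Dd_add[OF add(3,4)] by (simp only:)
  qed
qed

lemma tens_constant: "a \<in> carrier T \<Longrightarrow> TE.tens a 0 = \<pi> (TS.\<delta> \<one>\<^bsub>G\<^esub> a)"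
proof -
  have "(\<lambda>a. TE.tens a 0) \<in> alg_hom Cring T R"
  proof (rule alg_homI)
    fix x y assume x: "x \<in> carrier T" and y: "y \<in> carrier T"
    have c: "TE.tens x \<in> carrier GD.Rt" "TE.tens y \<in> carrier GD.Rt"
      using tens_facts(1)[OF x] tens_facts(1)[OF y] by (simp_all add: GD.D_simps(1))
    show "TE.tens x 0 \<in> carrier R" using c by simp
    show "TE.tens (x \<otimes>\<^bsub>T\<^esub> y) 0 = TE.tens x 0 \<otimes>\<^bsub>R\<^esub> TE.tens y 0"
      using GD.lowest_coeff_mult[OF c] x y by (simp add: tens_facts)
    show "TE.tens (x \<oplus>\<^bsub>T\<^esub> y) 0 = TE.tens x 0 \<oplus>\<^bsub>R\<^esub> TE.tens y 0"
      using GD.add_coeff[OF c] x y by (simp add: tens_facts)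
    show "TE.tens (c \<odot>\<^bsub>T\<^esub> x) 0 = c \<odot>\<^bsub>R\<^esub> TE.tens x 0" for c
      using GD.smult_const_coeff[OF c(1)] x by (simp add: tens_facts)
  next
    show "TE.tens \<one>\<^bsub>T\<^esub> 0 = \<one>\<^bsub>R\<^esub>" by (simp add: tens_facts GD.one_eq mon_def)
  qed
  moreover have "(\<lambda>a. \<pi> (TS.\<delta> \<one>\<^bsub>G\<^esub> a)) \<in> alg_hom Cring T R"
  proof (rule alg_homI)
    fix x y assume x: "x \<in> carrier T" and y: "y \<in> carrier T"
    show "\<pi> (TS.\<delta> \<one>\<^bsub>G\<^esub> x) \<in> carrier R" using x by (simp add: \<pi>_facts \<delta>_B)
    show "\<pi> (TS.\<delta> \<one>\<^bsub>G\<^esub> (x \<otimes>\<^bsub>T\<^esub> y)) = \<pi> (TS.\<delta> \<one>\<^bsub>G\<^esub> x) \<otimes>\<^bsub>R\<^esub> \<pi> (TS.\<delta> \<one>\<^bsub>G\<^esub> y)"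
    proof -
      have "TS.\<delta> \<one>\<^bsub>G\<^esub> (x \<otimes>\<^bsub>T\<^esub> y) = TS.\<delta> \<one>\<^bsub>G\<^esub> x \<otimes>\<^bsub>B\<^esub> TS.\<delta> \<one>\<^bsub>G\<^esub> y"
        using x y \<delta>_B(5)[of "\<one>\<^bsub>G\<^esub>" "\<one>\<^bsub>G\<^esub>" x y] by (simp add: TS.act_one)
      then show ?thesis by (simp only: \<pi>_facts(2) \<delta>_B(1) x y)
    qed
    show "\<pi> (TS.\<delta> \<one>\<^bsub>G\<^esub> (x \<oplus>\<^bsub>T\<^esub> y)) = \<pi> (TS.\<delta> \<one>\<^bsub>G\<^esub> x) \<oplus>\<^bsub>R\<^esub> \<pi> (TS.\<delta> \<one>\<^bsub>G\<^esub> y)"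
      using x y by (simp add: \<pi>_facts \<delta>_B)
    show "\<pi> (TS.\<delta> \<one>\<^bsub>G\<^esub> (c \<odot>\<^bsub>T\<^esub> x)) = c \<odot>\<^bsub>R\<^esub> \<pi> (TS.\<delta> \<one>\<^bsub>G\<^esub> x)" for c
      using x by (simp add: \<pi>_facts \<delta>_B)
  next
    show "\<pi> (TS.\<delta> \<one>\<^bsub>G\<^esub> \<one>\<^bsub>T\<^esub>) = \<one>\<^bsub>R\<^esub>" by (simp add: \<pi>_facts \<delta>_B)
  qed
  moreover have "TE.tens (gen i) 0 = \<pi> (TS.\<delta> \<one>\<^bsub>G\<^esub> (gen i))" if "i < n" for i
    using TE.tens_gen[OF that] by (simp add: lift_def mon_def)
  ultimately show "TE.tens a 0 = \<pi> (TS.\<delta> \<one>\<^bsub>G\<^esub> a)" if "a \<in> carrier T"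
    by (rule T_hom_unique[OF R.ring_axioms _ _ _ that])
qed

text \<open>Taking lowest coefficients is a homomorphism from \<open>D\<close> to \<open>R\<close>, so modulo \<open>t\<close> the homomorphism \<open>\<psi>\<close> is \<open>\<pi>\<close>.\<close>

lemma \<psi>_constant:
  assumes z: "z \<in> carrier B"
  shows "\<psi> z 0 = \<pi> z"
proof -
  have "z \<in> carrier TS.S" using z unfolding B_eq .
  then show ?thesis
  proof (induction z rule: TS.skew_induct)
    case zero
    have "\<psi> \<zero>\<^bsub>B\<^esub> 0 = \<pi> \<zero>\<^bsub>B\<^esub>" unfolding \<psi>_facts(6) \<pi>_facts(6) by (simp add: GD.D_simps(2) poly_algebra_simps)
    then show ?case unfolding B_eq .
  next
    case (single g)
    then have zg: "z g \<in> carrier T" using z unfolding B_carrier_iff by blast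
    have c: "TE.tens (z g) \<in> carrier GD.Rt" "lift g \<one>\<^bsub>T\<^esub> \<in> carrier GD.Rt"
      using tens_facts(1)[OF zg] lift_closed[of "\<one>\<^bsub>T\<^esub>" g] by (simp_all add: GD.D_simps(1))
    have "\<psi> (TS.\<delta> g (z g)) 0 = TE.tens (z g) 0 \<otimes>\<^bsub>R\<^esub> lift g \<one>\<^bsub>T\<^esub> 0"
      using single zg GD.lowest_coeff_mult[OF c] by (simp add: \<psi>_single)
    also have "\<dots> = \<pi> (TS.\<delta> \<one>\<^bsub>G\<^esub> (z g)) \<otimes>\<^bsub>R\<^esub> \<pi> (TS.\<delta> g \<one>\<^bsub>T\<^esub>)"
      using tens_constant[OF zg] by (simp add: lift_def mon_def)
    also have "\<dots> = \<pi> (TS.\<delta> \<one>\<^bsub>G\<^esub> (z g) \<otimes>\<^bsub>B\<^esub> TS.\<delta> g \<one>\<^bsub>T\<^esub>)"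
      by (rule \<pi>_facts(2)[symmetric]) (simp_all add: \<delta>_B zg)
    also have "\<dots> = \<pi> (TS.\<delta> g (z g))"
      using single zg by (simp add: \<delta>_B TS.act_one)
    finally show ?case .
  next
    case (add y z)
    then have yz: "y \<in> carrier B" "z \<in> carrier B" unfolding B_eq by blast+
    have c: "\<psi> y \<in> carrier GD.Rt" "\<psi> z \<in> carrier GD.Rt"
      using \<psi>_facts(1)[OF yz(1)] \<psi>_facts(1)[OF yz(2)] by (simp_all add: GD.D_simps(1))
    have "\<psi> (y \<oplus>\<^bsub>B\<^esub> z) 0 = \<pi> (y \<oplus>\<^bsub>B\<^esub> z)"
      using GD.add_coeff[OF c] add(3,4) yz by (simp add: \<psi>_facts \<pi>_facts)
    then show ?case unfolding B_eq .
  qed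
qed

subsection \<open>The form\<close>

lemma scalar_injective:
  assumes e: "\<pi> (skew_of_group_algebra T G c) = \<pi> (skew_of_group_algebra T G c')" and g: "g \<in> carrier G"
  shows "c g = c' g"
proof -
  let ?a = "\<lambda>c. c g \<odot>\<^bsub>T\<^esub> \<one>\<^bsub>T\<^esub>"
  have cl: "?a c \<in> carrier T" for c by simp
  have "qcl (?a c) = qcl (?a c')"
    using fun_cong[OF e, of g] g by (simp add: \<pi>_def skew_of_group_algebra_def)
  then have "?a c \<ominus>\<^bsub>T\<^esub> ?a c' \<in> I" using I.cls_eq_iff[OF cl cl] unfolding qcl_eq by blast
  then have "(?a c \<ominus>\<^bsub>T\<^esub> ?a c') [] = 0" by (rule I_degree_zero)
  then have "?a c [] = ?a c' []" unfolding T_minus[OF cl cl] by simp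
  then show ?thesis by (simp add: T_simps sw_def)
qed

lemma scalar_surjective:
  assumes "r \<in> Rd 0"
  shows "\<exists>c. r = \<pi> (skew_of_group_algebra T G c)"
proof -
  obtain f where f: "f \<in> B.homog 0" "r = \<pi> f" using assms by blast
  have "f = skew_of_group_algebra T G (\<lambda>g. f g [])"
  proof
    fix g
    show "f g = skew_of_group_algebra T G (\<lambda>g. f g []) g"
    proof (cases "g \<in> carrier G")
      case True
      then have "tcmp 0 (f g) = f g" using f(1) unfolding B_homog_iff T.homog_def by blast
      note e = fun_cong[OF this]
      have nz: "f g w = 0" if "w \<noteq> []" for w using e[of w] that by simp
      show ?thesis
      proof
        fix w
        show "f g w = skew_of_group_algebra T G (\<lambda>g. f g []) g w"
          using True nz[of w] by (cases "w = []") (simp_all add: skew_of_group_algebra_def T_simps(3,6) sw_def)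
      qed
    next
      case False
      then show ?thesis using B.homog_carrier[OF f(1)] unfolding B_carrier_iff
        by (auto simp: skew_of_group_algebra_def extensional_def)
    qed
  qed
  from arg_cong[OF this, of \<pi>] show ?thesis unfolding f(2) by (intro exI[of _ "\<lambda>g. f g []"])
qed

abbreviation "\<rho> i j \<equiv> TS.\<delta> \<one>\<^bsub>G\<^esub> (qc i j)"

lemma \<rho>_homog: "\<lbrakk>i < n; j < n\<rbrakk> \<Longrightarrow> \<rho> i j \<in> B.homog 2" by (rule \<delta>_homog[OF qc_homog])

text \<open>The image of a relation has degree two and no constant term. So it is \<open>t\<close> times an element of degree zero, that
  is, of the group algebra: this element is the value of the form.\<close>

lemma \<psi>_\<rho>_exists:
  assumes ij: "i < n" "j < n"
  shows "\<exists>c. \<psi> (\<rho> i j) = mon R 1 (\<pi> (skew_of_group_algebra T G c))"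
proof -
  have x: "\<psi> (\<rho> i j) \<in> GD.Dd 2" by (rule \<psi>_Dd[OF \<rho>_homog[OF ij]])
  have "\<rho> i j g \<in> I" if "g \<in> carrier G" for g
    using that ij T.genideal_self[OF Q_carrier] I.zero_closed unfolding I_eq[symmetric] by (auto simp: sgl_def)
  then have "\<pi> (\<rho> i j) = \<zero>\<^bsub>R\<^esub>" using \<pi>_zero_iff[OF B.homog_carrier[OF \<rho>_homog[OF ij]]] by blast
  then have "\<psi> (\<rho> i j) 0 = \<zero>\<^bsub>R\<^esub>" using \<psi>_constant[OF B.homog_carrier[OF \<rho>_homog[OF ij]]] by simp
  then have e: "\<psi> (\<rho> i j) = mon R 1 (\<psi> (\<rho> i j) 1)" by (rule Dd_two[OF x])
  have "\<psi> (\<rho> i j) 1 \<in> Rd (2 - 2 * int 1)" using x unfolding GD.Dd_def by blast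
  then have "\<psi> (\<rho> i j) 1 \<in> Rd 0" by simp
  then obtain c where "\<psi> (\<rho> i j) 1 = \<pi> (skew_of_group_algebra T G c)" using scalar_surjective by blast
  with e show ?thesis by (intro exI[of _ c]) simp
qed

definition "kc i j = (SOME c. \<psi> (\<rho> i j) = mon R 1 (\<pi> (skew_of_group_algebra T G c)))"
text \<open>The bilinear extension of the values \<open>kc i j\<close> at the basis vectors.\<close>

definition "form x y g = (\<Sum>i<n. \<Sum>j<n. co x i * co y j * kc i j g)"

lemma \<psi>_\<rho>: "\<lbrakk>i < n; j < n\<rbrakk> \<Longrightarrow> \<psi> (\<rho> i j) = mon R 1 (\<pi> (skew_of_group_algebra T G (kc i j)))"
  unfolding kc_def by (rule someI_ex[OF \<psi>_\<rho>_exists])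

lemma form_v: "\<lbrakk>i < n; j < n\<rbrakk> \<Longrightarrow> form (v i) (v j) = kc i j"
proof
  fix g assume i: "i < n" and j: "j < n"
  have d: "(\<Sum>k<n. co (v l) k * f k) = f l" if "l < n" for l and f :: "nat \<Rightarrow> complex"
  proof -
    have "(\<Sum>k<n. co (v l) k * f k) = (\<Sum>k<n. if k = l then f k else 0)" using that by (intro sum.cong) (auto simp: co_v)
    then show ?thesis using that by (simp add: sum.delta)
  qed
  have "form (v i) (v j) g = (\<Sum>i'<n. co (v i) i' * (\<Sum>j'<n. co (v j) j' * kc i' j' g))"
    unfolding form_def by (simp only: sum_distrib_left mult.assoc)
  then show "form (v i) (v j) g = kc i j g" by (simp only: d[OF i] d[OF j])
qed

text \<open>This uses \<open>q\<^sub>i\<^sub>j q\<^sub>j\<^sub>i = 1\<close>, and is the source of the skew symmetry of the form.\<close>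

lemma qc_swap: "\<lbrakk>i < n; j < n\<rbrakk> \<Longrightarrow> qc i j = (- q i j) \<odot>\<^bsub>T\<^esub> qc j i"
proof -
  assume ij: "i < n" "j < n"
  let ?a = "gen i \<otimes>\<^bsub>T\<^esub> gen j" and ?b = "gen j \<otimes>\<^bsub>T\<^esub> gen i"
  have c: "?a \<in> carrier T" "?b \<in> carrier T" using ij gen_closed by simp_all
  have "q j i * q i j = 1" using q_inverse[OF ij] q_nonzero[OF ij] by simp
  then have "a - q i j * b = - q i j * (b - q j i * a)" for a b by (simp add: algebra_simps)
  moreover have "qc i j = (\<lambda>w. ?a w - q i j * ?b w)"
    unfolding qc_eq by (subst T_minus[OF c(1) T.smult_closed[OF _ c(2)]]) (simp_all only: T_simps(6) Cring_simps UNIV_I)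
  moreover have "qc j i = (\<lambda>w. ?b w - q j i * ?a w)"
    unfolding qc_eq by (subst T_minus[OF c(2) T.smult_closed[OF _ c(1)]]) (simp_all only: T_simps(6) Cring_simps UNIV_I)
  ultimately show ?thesis by (simp only: T_simps(6))
qed

lemma scalar_closed: "skew_of_group_algebra T G c \<in> carrier B" by (rule B.homog_carrier[OF scalar_homog])

lemma kc_swap:
  assumes ij: "i < n" "j < n" and g: "g \<in> carrier G"
  shows "kc i j g = - q i j * kc j i g"
proof -
  have qc: "qc j i \<in> carrier T" by (rule T.homog_carrier[OF qc_homog[OF ij(2,1)]])
  have e: "(- q i j) \<odot>\<^bsub>B\<^esub> skew_of_group_algebra T G (kc j i) = skew_of_group_algebra T G (\<lambda>g. - q i j * kc j i g)"
    unfolding B_eq skew_simps(6) skew_of_group_algebra_def by (auto simp: T_simps fun_eq_iff)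
  have "\<psi> (\<rho> i j) = mon Cring 0 (- q i j) \<odot>\<^bsub>D\<^esub> \<psi> (\<rho> j i)"
    unfolding qc_swap[OF ij] \<delta>_B(3)[OF qc] by (rule \<psi>_facts(5)[OF \<delta>_B(1)[OF qc]])
  also have "\<dots> = mon Cring 0 (- q i j) \<odot>\<^bsub>D\<^esub> mon R 1 (\<pi> (skew_of_group_algebra T G (kc j i)))"
    unfolding \<psi>_\<rho>[OF ij(2,1)] ..
  also have "\<dots> = mon R 1 (\<pi> (skew_of_group_algebra T G (\<lambda>g. - q i j * kc j i g)))"
    unfolding e[symmetric] \<pi>_facts(4)[OF scalar_closed]
    using R.smult_mon_mon[of "- q i j" "\<pi> (skew_of_group_algebra T G (kc j i))" 0 1]
    by (simp add: GD.D_simps(4) \<pi>_facts scalar_closed)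
  finally have "mon R 1 (\<pi> (skew_of_group_algebra T G (kc i j))) = mon R 1 (\<pi> (skew_of_group_algebra T G (\<lambda>g. - q i j * kc j i g)))"
    unfolding \<psi>_\<rho>[OF ij] .
  from fun_cong[OF this, of 1] have "\<pi> (skew_of_group_algebra T G (kc i j)) = \<pi> (skew_of_group_algebra T G (\<lambda>g. - q i j * kc j i g))"
    by (simp add: mon_def)
  from scalar_injective[OF this g] show ?thesis .
qed

lemma form_skew: "quantum_skew_form G scale v n q form"
proof (unfold quantum_skew_form_def Vector_Spaces.linear_iff, intro ballI conjI allI impI)
  show "vector_space scale" by (rule vector_space_axioms)
  show "vector_space scale" by (rule vector_space_axioms)
  show "vector_space ((*) :: complex \<Rightarrow> complex \<Rightarrow> complex)" by unfold_locales (simp_all add: algebra_simps)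
  show "vector_space ((*) :: complex \<Rightarrow> complex \<Rightarrow> complex)" by unfold_locales (simp_all add: algebra_simps)
next
  fix g i j assume "g \<in> carrier G" "i < n" "j < n"
  then show "form (v i) (v j) g = - q i j * form (v j) (v i) g" using kc_swap[of i j g] by (simp only: form_v)
qed (simp_all add: form_def co_add co_scale algebra_simps sum.distrib sum_distrib_left)

subsection \<open>The isomorphism\<close>

lemma \<psi>_scalar: "\<psi> (skew_of_group_algebra T G c) = mon R 0 (\<pi> (skew_of_group_algebra T G c))"
  using Dd_below_two[OF \<psi>_Dd[OF scalar_homog]] \<psi>_constant[OF scalar_closed] by simp

lemma poly_extension_\<psi>: "poly_extension Cring B D \<psi>"
proof (unfold poly_extension_def poly_extension_axioms_def, intro conjI allI impI)
  show "assoc_alg Cring B" by (rule B.assoc_alg_axioms)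
  show "assoc_alg (UP Cring) D" by (rule GD.D.assoc_alg_axioms)
  show "\<psi> \<in> ring_hom B D" by (rule ring_hom_memI) (simp_all add: \<psi>_facts)
qed (simp add: \<psi>_facts)

text \<open>By the choice of the form the relations of its Hecke algebra hold in \<open>D\<close>.\<close>

lemma deformation_is_hecke_algebra:
  "quantum_Drinfeld_Hecke G scale v n act q \<alpha> form \<and> algebra_isomorphic (UP Cring) D (hecke_algebra G scale v n act q form)"
proof -
  interpret E: poly_extension Cring B D \<psi> by (rule poly_extension_\<psi>)
  interpret P: presentation B bcmp R \<pi> \<sigma> "rels form" by (rule presentation)
  have const: "E.ext (mon B 0 z) = \<psi> z" if z: "z \<in> carrier B" for z
  proof -
    have zD: "\<psi> z \<in> carrier GD.Rt" using \<psi>_facts(1)[OF z] unfolding GD.D_simps(1) .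
    have "mon Cring 0 1 \<odot>\<^bsub>D\<^esub> \<psi> z = \<psi> z"
      using GD.smult_const_coeff[OF zD, of 1] GD.coeff_closed[OF zD] R.smult_one by (auto simp: fun_eq_iff)
    then show ?thesis using E.ext_mon[OF z, of 0] by simp
  qed
  have res: "P.sec_inj \<and> algebra_isomorphic (UP Cring) D P.H"
  proof (rule P.sec_inj_if_hom_to_deformation[where \<psi> = E.ext])
    show "assoc_alg (UP Cring) D" by (rule GD.D.assoc_alg_axioms)
    show "E.ext \<in> alg_hom (UP Cring) P.Bt D" by (rule E.ext_hom)
    fix \<rho>' k assume "(\<rho>', k) \<in> rels form"
    then obtain i j where ij: "i < n" "j < n" and \<rho>': "\<rho>' = \<rho> i j" and "k = skew_of_group_algebra T G (form (v i) (v j))"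
      unfolding rels_def skew_of_base_eq by blast
    then have k: "k = skew_of_group_algebra T G (kc i j)" by (simp only: form_v)
    have \<pi>k: "\<pi> k \<in> carrier R" unfolding k by (rule \<pi>_facts(1)[OF scalar_closed])
    have "E.ext (mon B 1 k) = tt \<odot>\<^bsub>D\<^esub> mon R 0 (\<pi> k)"
      using E.ext_mon[of k 1] \<psi>_scalar[of "kc i j"] scalar_closed[of "kc i j"] unfolding k by simp
    also have "\<dots> = mon R 1 (\<pi> k)"
      using R.smult_mon_mon[of 1 "\<pi> k" 1 0] R.smult_one[OF \<pi>k] \<pi>k by (simp add: GD.D_simps(4))
    also have "\<dots> = \<psi> \<rho>'" unfolding \<rho>' k \<psi>_\<rho>[OF ij] ..
    also have "\<dots> = E.ext (mon B 0 \<rho>')" unfolding \<rho>' by (rule const[OF B.homog_carrier[OF \<rho>_homog[OF ij]], symmetric])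
    finally show "E.ext (mon B 0 \<rho>') = E.ext (mon B 1 k)" by (rule sym)
  next
    fix z assume "z \<in> carrier B"
    then show "E.ext (mon B 0 z) 0 = \<pi> z" by (simp only: const \<psi>_constant)
  next
    fix m z i assume z: "z \<in> B.homog m"
    have "E.ext (mon B 0 z) = \<psi> z" by (rule const[OF B.homog_carrier[OF z]])
    then show "E.ext (mon B 0 z) i \<in> P.Rdeg (m - 2 * int i)"
      using \<psi>_Dd[OF z] unfolding GD.Dd_def P.Rdeg_def by simp
  qed (simp_all only: GD.D_simps)
  have "P.PBW" by (rule P.PBW_if_sec_inj[OF conjunct1[OF res]])
  then show ?thesis
    unfolding quantum_Drinfeld_Hecke_iff hecke_algebra_eq by (intro conjI form_skew conjunct2[OF res])
qed

end

theorem theorem2p2: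
  fixes G :: "('g, 'm) monoid_scheme"
    and scale :: "complex \<Rightarrow> 'v \<Rightarrow> 'v :: ab_group_add"
    and v :: "nat \<Rightarrow> 'v"
    and n :: nat
    and act :: "'g \<Rightarrow> 'v \<Rightarrow> 'v"
    and q :: "nat \<Rightarrow> nat \<Rightarrow> complex"
    and \<alpha> :: "'g \<Rightarrow> (nat list \<Rightarrow> complex) set \<Rightarrow> (nat list \<Rightarrow> complex) set"
  assumes "group G" and "finite (carrier G)"
    and "vector_space scale" and "is_basis scale v n"
    and "linear_action G scale act"
    and "\<And>i j. i < n \<Longrightarrow> j < n \<Longrightarrow> q i j \<noteq> 0"
    and "\<And>i. i < n \<Longrightarrow> q i i = 1"
    and "\<And>i j. i < n \<Longrightarrow> j < n \<Longrightarrow> q j i = inverse (q i j)"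
    and "induced_action G scale v n act q \<alpha>"
  shows "(\<forall>\<kappa>. quantum_Drinfeld_Hecke G scale v n act q \<alpha> \<kappa> \<longrightarrow>
           (\<exists>\<mu> D. deformation (quantum_skew G n q \<alpha>) \<mu> D \<and>
              (\<forall>i\<ge>1. homogeneous_of_degree (quantum_skew_degree G n q) (- 2 * int i) (\<mu> i)) \<and>
              algebra_isomorphic Ct (hecke_algebra G scale v n act q \<kappa>) D)) \<and>
         (\<forall>\<mu> D. deformation (quantum_skew G n q \<alpha>) \<mu> D \<and>
              (\<forall>i\<ge>1. homogeneous_of_degree (quantum_skew_degree G n q) (- 2 * int i) (\<mu> i)) \<longrightarrow>
           (\<exists>\<kappa>. quantum_Drinfeld_Hecke G scale v n act q \<alpha> \<kappa> \<and>
              algebra_isomorphic Ct D (hecke_algebra G scale v n act q \<kappa>)))"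
proof -
  have data: "quantum_data G scale v n act q \<alpha>"
    unfolding quantum_data_def quantum_data_axioms_def using assms by blast
  show ?thesis
  proof (intro conjI allI impI)
    fix \<kappa> assume "quantum_Drinfeld_Hecke G scale v n act q \<alpha> \<kappa>"
    then show "\<exists>\<mu> D. deformation (quantum_skew G n q \<alpha>) \<mu> D \<and>
        (\<forall>i\<ge>1. homogeneous_of_degree (quantum_skew_degree G n q) (- 2 * int i) (\<mu> i)) \<and>
        algebra_isomorphic Ct (hecke_algebra G scale v n act q \<kappa>) D"
      by (rule quantum_data.hecke_algebra_is_deformation[OF data])
  next
    fix \<mu> D assume D: "deformation (quantum_skew G n q \<alpha>) \<mu> D \<and>
      (\<forall>i\<ge>1. homogeneous_of_degree (quantum_skew_degree G n q) (- 2 * int i) (\<mu> i))"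
    then have QD: "quantum_deformation G scale v n act q \<alpha> \<mu> D"
      using data unfolding quantum_deformation_def quantum_deformation_axioms_def by blast
    show "\<exists>\<kappa>. quantum_Drinfeld_Hecke G scale v n act q \<alpha> \<kappa> \<and>
        algebra_isomorphic Ct D (hecke_algebra G scale v n act q \<kappa>)"
      by (intro exI) (rule quantum_deformation.deformation_is_hecke_algebra[OF QD])
  qed
qed

end
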